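(* Let $\mathscr{K}_{jk,p}^s$ be the $2n$-dimensional Yetter-Drinfeld module over $A_{N\,2n}^{\mu\lambda}$ defined in the context, with $j\in\{2,4\}$ if $\lambda=1$, $j\in\{1,3\}$ if $\lambda=-1$, $p\in\{0,1\}$, $1\le s\le N$, $0\le k\le N-1$. Let $q=(-1)^p\bar\mu^s\omega^{8kns}$. (1) If $n=1$, then $\dim\mathfrak{B}(\mathscr{K}_{jk,p}^s)<\infty$ if and only if $\lambda q^2=1\ne q$ (Cartan type $A_1\times A_1$) or $\lambda q^3=1\ne q$ (Cartan type $A_2$). (2) If $n=2$, then $\dim\mathfrak{B}(\mathscr{K}_{jk,p}^s)<\infty$ implies $q=-1$ or $q^3=1\ne q$. In particular, if (in addition to $n=2$) $\lambda=1$, then $\dim\mathfrak{B}(\mathscr{K}_{jk,p}^s)=64$ if $q=-1$, and $\dim\mathfrak{B}(\mathscr{K}_{jk,p}^s)=\infty$ otherwise.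
   Context: $\Bbbk$ is an algebraically closed field of characteristic $0$; $N,n\ge1$ are integers and $\mu,\lambda\in\{1,-1\}$. The Suzuki algebra $A=A_{N\,2n}^{\mu\lambda}$ is the Hopf algebra over $\Bbbk$ generated by $x_{11},x_{12},x_{21},x_{22}$ with relations $x_{11}^2=x_{22}^2$, $x_{12}^2=x_{21}^2$, $\chi_{21}^{2n}=\lambda\chi_{12}^{2n}$, $\chi_{11}^{2n}=\chi_{22}^{2n}$, $x_{11}^{2N}+\mu x_{12}^{2N}=1$, and $x_{ij}x_{kl}=0$ whenever $i+j+k+l$ is odd. Here $\chi_{11}^m=x_{11}x_{22}x_{11}\cdots$, $\chi_{22}^m=x_{22}x_{11}x_{22}\cdots$, $\chi_{12}^m=x_{12}x_{21}x_{12}\cdots$, $\chi_{21}^m=x_{21}x_{12}x_{21}\cdots$ are alternating products with $m$ factors ($\chi^0=1$). $\Delta(x_{ij})=x_{i1}\otimes x_{1j}+x_{i2}\otimes x_{2j}$, $\varepsilon(x_{ij})=\delta_{ij}$, $S(x_{ij})=x_{ji}^{4N-1}$. Fix a primitive $8nN$-th root of unity $\omega$. Put $\bar\mu=1$ if $\mu=1$ and $\bar\mu=\omega^{4n}$ if $\mu=-1$. For $j$ even if $\lambda=1$, $j$ odd if $\lambda=-1$, $V_{jk}'=\Bbbk v_1'\oplus\Bbbk v_2'$ is the left $A$-module (not necessarily simple) with $x_{11},x_{22}$ acting by $0$, $x_{21}v_1'=\omega^{2jN}v_2'$, $x_{21}v_2'=\bar\mu\omega^{2(4kn-jN)}v_1'$,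 $x_{12}v_1'=v_2'$, $x_{12}v_2'=\bar\mu\omega^{8kn}v_1'$. For a left $A$-module $V$, $V\boxtimes A$ is the vector space $V\otimes A$ (elements $\ell\boxtimes g$) with the left-left Yetter-Drinfeld structure $h\cdot(\ell\boxtimes g)=(h_{(2)}\cdot\ell)\boxtimes h_{(1)}gS(h_{(3)})$, $\rho(\ell\boxtimes g)=g_{(1)}\otimes(\ell\boxtimes g_{(2)})$. $\mathscr{K}_{jk,p}^s=\bigoplus_{r=1}^{2n}\Bbbk w_r\subset V_{jk}'\boxtimes A$ is the Yetter-Drinfeld submodule with $w_1=v_1'\boxtimes[x_{11}^{2s}+(-1)^px_{12}^{2s}]$, $w_r=\chi_{12}^{r-1}\cdot w_1$ for $r$ even, $w_r=\chi_{21}^{r-1}\cdot w_1$ for $r$ odd. The braiding of a Yetter-Drinfeld module $M$ is $c(x\otimes y)=x_{(-1)}\cdot y\otimes x_{(0)}$; $\mathfrak{B}(M)$ is the Nichols algebra of $(M,c)$. It is of diagonal type if $M$ has a basis $(v_i)$ with $c(v_i\otimes v_j)=q_{ij}v_j\otimes v_i$, $q_{ij}\in\Bbbk^\times$; its Dynkin diagram has vertices labelled $q_{ii}$ and, when $q_{ij}q_{ji}\ne1$, an edge labelled $q_{ij}q_{ji}$. Cartan type $A_1\times A_1$: two vertices with no edge; $A_2$: two vertices labelled by the same scalar $x$ with an edge labelled $x^{-1}$. *)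

theory Defs
  imports
    "HOL-Library.Poly_Mapping"
    "HOL-Library.Product_Plus"
    "HOL-Library.Extended_Nat"
    "HOL-Computational_Algebra.Computational_Algebra"
begin

text \<open>
  The vector space with basis a type \<open>'s\<close> is \<open>'s \<Rightarrow>\<^sub>0 'k\<close>, and the tensor product of the spaces with
  bases \<open>'s\<close> and \<open>'t\<close> is \<open>'s \<times> 't \<Rightarrow>\<^sub>0 'k\<close>. If \<open>'s\<close> is a monoid (written additively), then
  \<open>'s \<Rightarrow>\<^sub>0 'k\<close> with the convolution product of Poly_Mapping is its monoid algebra. For words
  (\<open>'a list\<close> with concatenation) this is the free algebra on \<open>'a\<close>, i.e. the tensor algebra of
  the vector space with basis \<open>'a\<close>; for pairs of words it is the tensor square of that algebra.

  Quotient spaces are represented by a space together with the subspace \<open>U\<close> that is divided out: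
  vectors stand for their classes modulo \<open>U\<close>, and equations are congruences modulo \<open>U\<close>.
\<close>

section \<open>Linear algebra on free vector spaces\<close>

instantiation list :: (type) monoid_add
begin
definition zero_list :: "'a list" where "zero_list = []"
definition plus_list :: "'a list \<Rightarrow> 'a list \<Rightarrow> 'a list" where "plus_list = (@)"
instance by standard (simp_all add: zero_list_def plus_list_def)
end

definition fscale :: "'k::field \<Rightarrow> ('s \<Rightarrow>\<^sub>0 'k) \<Rightarrow> ('s \<Rightarrow>\<^sub>0 'k)" where
  "fscale a p = Poly_Mapping.map ((*) a) p"

lemma lookup_fscale [simp]: "Poly_Mapping.lookup (fscale a p) s = a * Poly_Mapping.lookup p s"
  by (simp add: fscale_def Poly_Mapping.map.rep_eq when_def)

interpretation fv: vector_space fscale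
  by unfold_locales (auto intro!: poly_mapping_eqI simp: lookup_add algebra_simps)

abbreviation bas :: "'s \<Rightarrow> ('s \<Rightarrow>\<^sub>0 'k::field)" where
  "bas s \<equiv> Poly_Mapping.single s 1"

text \<open>Linear extension of a map given on basis vectors.\<close>

definition lext :: "('s \<Rightarrow> ('t \<Rightarrow>\<^sub>0 'k)) \<Rightarrow> ('s \<Rightarrow>\<^sub>0 'k) \<Rightarrow> ('t \<Rightarrow>\<^sub>0 'k::field)" where
  "lext f p = (\<Sum>s\<in>Poly_Mapping.keys p. fscale (Poly_Mapping.lookup p s) (f s))"

definition tens :: "('s \<Rightarrow>\<^sub>0 'k) \<Rightarrow> ('t \<Rightarrow>\<^sub>0 'k) \<Rightarrow> ('s \<times> 't \<Rightarrow>\<^sub>0 'k::field)" where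
  "tens p r = lext (\<lambda>s. lext (\<lambda>t. bas (s, t)) r) p"

text \<open>
  For subspaces \<open>Q \<subseteq> P\<close>: the dimension of \<open>P / Q\<close>, which is \<open>\<infinity>\<close> (the infimum of the empty set)
  if no finite set spans \<open>P\<close> modulo \<open>Q\<close>.
\<close>

definition quot_dim :: "('s \<Rightarrow>\<^sub>0 'k::field) set \<Rightarrow> ('s \<Rightarrow>\<^sub>0 'k) set \<Rightarrow> enat" where
  "quot_dim P Q = (INF B \<in> {B. finite B \<and> B \<subseteq> P \<and> P \<subseteq> fv.span (B \<union> Q)}. enat (card B))"

definition ideal_gen :: "('m::monoid_add \<Rightarrow>\<^sub>0 'k::field) set \<Rightarrow> ('m \<Rightarrow>\<^sub>0 'k) set" where
  "ideal_gen R = fv.span {a * r * b | a r b. r \<in> R}"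

definition subalg_gen :: "('m::monoid_add \<Rightarrow>\<^sub>0 'k::field) set \<Rightarrow> ('m \<Rightarrow>\<^sub>0 'k) set" where
  "subalg_gen R = fv.span {prod_list rs | rs. set rs \<subseteq> R}"

definition primitive_root_of_one :: "nat \<Rightarrow> 'k::field \<Rightarrow> bool" where
  "primitive_root_of_one m w \<longleftrightarrow> w ^ m = 1 \<and> (\<forall>i. 0 < i \<and> i < m \<longrightarrow> w ^ i \<noteq> 1)"


section \<open>Nichols algebras of braided vector spaces\<close>

text \<open>
  In this section \<open>c\<close> is an endomorphism of \<open>X \<otimes> X\<close>, where \<open>X = ('s \<Rightarrow>\<^sub>0 'k)\<close>, given on the basis.
  The braided vector space under consideration is the image \<open>M = W / (W \<inter> U)\<close> of a subspace \<open>W\<close>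
  of \<open>X\<close> in \<open>X / U\<close>. The tensor algebra \<open>T(X)\<close> is \<open>'s list \<Rightarrow>\<^sub>0 'k\<close>, and
  \<open>T(X / U) = T(X) / (U)\<close>; \<open>T(M)\<close> is the image of the subalgebra generated by \<open>W\<close>.
\<close>

definition deg1 :: "('s \<Rightarrow>\<^sub>0 'k) \<Rightarrow> ('s list \<Rightarrow>\<^sub>0 'k::field)" where
  "deg1 = lext (\<lambda>s. bas [s])"

text \<open>The braiding applied to the tensor factors number \<open>i\<close> and \<open>i + 1\<close> (counted from \<open>0\<close>).\<close>

definition braid_at ::
  "('s \<times> 's \<Rightarrow> ('s \<times> 's \<Rightarrow>\<^sub>0 'k)) \<Rightarrow> nat \<Rightarrow> ('s list \<Rightarrow>\<^sub>0 'k) \<Rightarrow> ('s list \<Rightarrow>\<^sub>0 'k::field)" where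
  "braid_at c i = lext (\<lambda>xs.
     lext (\<lambda>(s, t). bas (take i xs @ [s, t] @ drop (i + 2) xs)) (c (xs ! i, xs ! Suc i)))"

text \<open>
  \<open>braid_sum c m = 1 + c_{m-1} + c_{m-1} c_{m-2} + \<dots> + c_{m-1} \<cdots> c_0\<close>. These are the lifts of the
  minimal coset representatives of \<open>S_m\<close> in \<open>S_{m+1}\<close>, hence \<open>qsymm c m\<close> is on \<open>T^m(X)\<close> the quantum
  symmetrizer, i.e. the sum over all permutations in \<open>S_m\<close> of their Matsumoto lifts.
\<close>

fun braid_sum ::
  "('s \<times> 's \<Rightarrow> ('s \<times> 's \<Rightarrow>\<^sub>0 'k)) \<Rightarrow> nat \<Rightarrow> ('s list \<Rightarrow>\<^sub>0 'k) \<Rightarrow> ('s list \<Rightarrow>\<^sub>0 'k::field)" where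
  "braid_sum c 0 t = t"
| "braid_sum c (Suc m) t = t + braid_at c m (braid_sum c m t)"

fun qsymm ::
  "('s \<times> 's \<Rightarrow> ('s \<times> 's \<Rightarrow>\<^sub>0 'k)) \<Rightarrow> nat \<Rightarrow> ('s list \<Rightarrow>\<^sub>0 'k) \<Rightarrow> ('s list \<Rightarrow>\<^sub>0 'k::field)" where
  "qsymm c 0 t = t"
| "qsymm c (Suc m) t = qsymm c m (braid_sum c m t)"

definition quantum_symmetrizer ::
  "('s \<times> 's \<Rightarrow> ('s \<times> 's \<Rightarrow>\<^sub>0 'k)) \<Rightarrow> ('s list \<Rightarrow>\<^sub>0 'k) \<Rightarrow> ('s list \<Rightarrow>\<^sub>0 'k::field)" where
  "quantum_symmetrizer c = lext (\<lambda>xs. qsymm c (length xs) (bas xs))"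

text \<open>
  The Nichols algebra of \<open>M\<close> is \<open>T(M)\<close> modulo the direct sum of the kernels of the quantum
  symmetrizers; both are represented by their preimages in \<open>T(X)\<close>.
\<close>

definition tensor_alg :: "('s \<Rightarrow>\<^sub>0 'k::field) set \<Rightarrow> ('s list \<Rightarrow>\<^sub>0 'k) set" where
  "tensor_alg W = subalg_gen (deg1 ` W)"

definition nichols_ideal ::
  "('s \<times> 's \<Rightarrow> ('s \<times> 's \<Rightarrow>\<^sub>0 'k::field)) \<Rightarrow> ('s \<Rightarrow>\<^sub>0 'k) set \<Rightarrow> ('s \<Rightarrow>\<^sub>0 'k) set \<Rightarrow> ('s list \<Rightarrow>\<^sub>0 'k) set" where
  "nichols_ideal c W U = {t \<in> tensor_alg W. quantum_symmetrizer c t \<in> ideal_gen (deg1 ` U)}"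

definition nichols_dim ::
  "('s \<times> 's \<Rightarrow> ('s \<times> 's \<Rightarrow>\<^sub>0 'k::field)) \<Rightarrow> ('s \<Rightarrow>\<^sub>0 'k) set \<Rightarrow> ('s \<Rightarrow>\<^sub>0 'k) set \<Rightarrow> enat" where
  "nichols_dim c W U = quot_dim (tensor_alg W) (nichols_ideal c W U)"

text \<open>
  \<open>v 0, \<dots>, v (d - 1)\<close> represent a basis of \<open>M\<close> on which the braiding is diagonal with matrix \<open>q\<close>.
\<close>

definition diagonal_braiding ::
  "('s \<times> 's \<Rightarrow> ('s \<times> 's \<Rightarrow>\<^sub>0 'k::field)) \<Rightarrow> ('s \<Rightarrow>\<^sub>0 'k) set \<Rightarrow> ('s \<Rightarrow>\<^sub>0 'k) set \<Rightarrow> nat \<Rightarrow>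
   (nat \<Rightarrow> ('s \<Rightarrow>\<^sub>0 'k)) \<Rightarrow> (nat \<Rightarrow> nat \<Rightarrow> 'k) \<Rightarrow> bool" where
  "diagonal_braiding c W U d v q \<longleftrightarrow>
     (\<forall>i<d. v i \<in> W) \<and>
     (\<forall>x\<in>W. \<exists>!a. (\<forall>i\<ge>d. a i = 0) \<and> x - (\<Sum>i<d. fscale (a i) (v i)) \<in> U) \<and>
     (\<forall>i<d. \<forall>j<d. q i j \<noteq> 0 \<and>
        lext c (tens (v i) (v j)) - fscale (q i j) (tens (v j) (v i))
          \<in> fv.span ({tens u x | u x. u \<in> U} \<union> {tens x u | u x. u \<in> U}))"

definition cartan_type_A1xA1 ::
  "('s \<times> 's \<Rightarrow> ('s \<times> 's \<Rightarrow>\<^sub>0 'k::field)) \<Rightarrow> ('s \<Rightarrow>\<^sub>0 'k) set \<Rightarrow> ('s \<Rightarrow>\<^sub>0 'k) set \<Rightarrow> bool" where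
  "cartan_type_A1xA1 c W U \<longleftrightarrow>
     (\<exists>v q. diagonal_braiding c W U 2 v q \<and> q 0 1 * q 1 0 = 1)"

definition cartan_type_A2 ::
  "('s \<times> 's \<Rightarrow> ('s \<times> 's \<Rightarrow>\<^sub>0 'k::field)) \<Rightarrow> ('s \<Rightarrow>\<^sub>0 'k) set \<Rightarrow> ('s \<Rightarrow>\<^sub>0 'k) set \<Rightarrow> bool" where
  "cartan_type_A2 c W U \<longleftrightarrow>
     (\<exists>v q x. diagonal_braiding c W U 2 v q \<and> q 0 0 = x \<and> q 1 1 = x \<and>
        q 0 1 * q 1 0 \<noteq> 1 \<and> q 0 1 * q 1 0 = inverse x)"


section \<open>The Suzuki algebras\<close>

datatype ind = I1 | I2

fun ind_val :: "ind \<Rightarrow> nat" where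
  "ind_val I1 = 1"
| "ind_val I2 = 2"

type_synonym word = "(ind \<times> ind) list"

text \<open>The free algebra on the four generators; the Suzuki algebra is its quotient by \<open>suzuki_ideal\<close>.\<close>

type_synonym 'k free_alg = "word \<Rightarrow>\<^sub>0 'k"

definition xg :: "ind \<Rightarrow> ind \<Rightarrow> 'k::field free_alg" where
  "xg i j = bas [(i, j)]"

fun alt_prod :: "'r::monoid_mult \<Rightarrow> 'r \<Rightarrow> nat \<Rightarrow> 'r" where
  "alt_prod a b 0 = 1"
| "alt_prod a b (Suc m) = a * alt_prod b a m"

abbreviation chi11 :: "nat \<Rightarrow> 'k::field free_alg" where
  "chi11 \<equiv> alt_prod (xg I1 I1) (xg I2 I2)"
abbreviation chi22 :: "nat \<Rightarrow> 'k::field free_alg" where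
  "chi22 \<equiv> alt_prod (xg I2 I2) (xg I1 I1)"
abbreviation chi12 :: "nat \<Rightarrow> 'k::field free_alg" where
  "chi12 \<equiv> alt_prod (xg I1 I2) (xg I2 I1)"
abbreviation chi21 :: "nat \<Rightarrow> 'k::field free_alg" where
  "chi21 \<equiv> alt_prod (xg I2 I1) (xg I1 I2)"

text \<open>A relation \<open>a = b\<close> is listed as the element \<open>a - b\<close>.\<close>

definition suzuki_relations :: "nat \<Rightarrow> nat \<Rightarrow> 'k::field \<Rightarrow> 'k \<Rightarrow> 'k free_alg set" where
  "suzuki_relations N n \<mu> lam =
     {xg I1 I1 ^ 2 - xg I2 I2 ^ 2,
      xg I1 I2 ^ 2 - xg I2 I1 ^ 2,
      chi21 (2 * n) - fscale lam (chi12 (2 * n)),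
      chi11 (2 * n) - chi22 (2 * n),
      xg I1 I1 ^ (2 * N) + fscale \<mu> (xg I1 I2 ^ (2 * N)) - 1} \<union>
     {xg i j * xg k l | i j k l. odd (ind_val i + ind_val j + ind_val k + ind_val l)}"

definition suzuki_ideal :: "nat \<Rightarrow> nat \<Rightarrow> 'k::field \<Rightarrow> 'k \<Rightarrow> 'k free_alg set" where
  "suzuki_ideal N n \<mu> lam = ideal_gen (suzuki_relations N n \<mu> lam)"

text \<open>
  Comultiplication and antipode on words, as an algebra map and an algebra antimap respectively.
  Their linear extensions are lifts to the free algebra of the structure maps of the Suzuki algebra.
\<close>

fun comult :: "word \<Rightarrow> (word \<times> word \<Rightarrow>\<^sub>0 'k::field)" where
  "comult [] = 1"
| "comult ((i, j) # w) = (\<Sum>k\<in>{I1, I2}. tens (xg i k) (xg k j)) * comult w"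

definition comult2 :: "word \<Rightarrow> (word \<times> word \<times> word \<Rightarrow>\<^sub>0 'k::field)" where
  "comult2 w = lext (\<lambda>(u, v). tens (bas u) (comult v)) (comult w)"

fun antipode :: "nat \<Rightarrow> word \<Rightarrow> 'k::field free_alg" where
  "antipode N [] = 1"
| "antipode N ((i, j) # w) = antipode N w * xg j i ^ (4 * N - 1)"


section \<open>The Yetter-Drinfeld modules\<close>

definition mu_bar :: "nat \<Rightarrow> 'k::field \<Rightarrow> 'k \<Rightarrow> 'k" where
  "mu_bar n \<mu> \<omega> = (if \<mu> = 1 then 1 else \<omega> ^ (4 * n))"

text \<open>
  The module \<open>V'_{jk}\<close> with basis \<open>v'_1, v'_2\<close> indexed by \<open>ind\<close>: action of a generator on a basis
  vector. One exponent of \<open>\<omega>\<close> may be negative.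
\<close>

definition V_gen ::
  "nat \<Rightarrow> nat \<Rightarrow> 'k::field \<Rightarrow> 'k \<Rightarrow> nat \<Rightarrow> nat \<Rightarrow> ind \<times> ind \<Rightarrow> ind \<Rightarrow> (ind \<Rightarrow>\<^sub>0 'k)" where
  "V_gen N n \<mu> \<omega> j k g b = (case (g, b) of
      ((I2, I1), I1) \<Rightarrow> fscale (\<omega> ^ (2 * j * N)) (bas I2)
    | ((I2, I1), I2) \<Rightarrow>
        fscale (mu_bar n \<mu> \<omega> * \<omega> powi (2 * (4 * int k * int n - int j * int N))) (bas I1)
    | ((I1, I2), I1) \<Rightarrow> bas I2
    | ((I1, I2), I2) \<Rightarrow> fscale (mu_bar n \<mu> \<omega> * \<omega> ^ (8 * k * n)) (bas I1)
    | _ \<Rightarrow> 0)"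

text \<open>
  Below, \<open>a\<close> gives the action of the generators on a module with basis \<open>'b\<close>; \<open>V \<boxtimes> A\<close> is represented
  by the space with basis \<open>'b \<times> word\<close> modulo \<open>box_null\<close>.
\<close>

fun mod_act :: "(ind \<times> ind \<Rightarrow> 'b \<Rightarrow> ('b \<Rightarrow>\<^sub>0 'k)) \<Rightarrow> word \<Rightarrow> ('b \<Rightarrow>\<^sub>0 'k) \<Rightarrow> ('b \<Rightarrow>\<^sub>0 'k::field)" where
  "mod_act a [] v = v"
| "mod_act a (g # w) v = lext (a g) (mod_act a w v)"

definition box_null :: "'k::field free_alg set \<Rightarrow> ('b \<times> word \<Rightarrow>\<^sub>0 'k) set" where
  "box_null I = fv.span {tens l g | l g. g \<in> I}"

text \<open>\<open>h \<cdot> (l \<boxtimes> g) = (h_2 \<cdot> l) \<boxtimes> h_1 g S(h_3)\<close> and \<open>\<rho>(l \<boxtimes> g) = g_1 \<otimes> (l \<boxtimes> g_2)\<close> on basis vectors.\<close>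

definition box_act ::
  "nat \<Rightarrow> (ind \<times> ind \<Rightarrow> 'b \<Rightarrow> ('b \<Rightarrow>\<^sub>0 'k)) \<Rightarrow> word \<Rightarrow> 'b \<times> word \<Rightarrow> ('b \<times> word \<Rightarrow>\<^sub>0 'k::field)" where
  "box_act N a h = (\<lambda>(l, g).
     lext (\<lambda>(h1, h2, h3). tens (mod_act a h2 (bas l)) (bas h1 * bas g * antipode N h3)) (comult2 h))"

definition box_coact :: "'b \<times> word \<Rightarrow> (word \<times> ('b \<times> word) \<Rightarrow>\<^sub>0 'k::field)" where
  "box_coact = (\<lambda>(l, g). lext (\<lambda>(g1, g2). bas (g1, (l, g2))) (comult g))"

text \<open>\<open>c(x \<otimes> y) = x_{-1} \<cdot> y \<otimes> x_0\<close>.\<close>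

definition box_braiding ::
  "nat \<Rightarrow> (ind \<times> ind \<Rightarrow> 'b \<Rightarrow> ('b \<Rightarrow>\<^sub>0 'k)) \<Rightarrow>
   ('b \<times> word) \<times> ('b \<times> word) \<Rightarrow> (('b \<times> word) \<times> ('b \<times> word) \<Rightarrow>\<^sub>0 'k::field)" where
  "box_braiding N a = (\<lambda>(x, y). lext (\<lambda>(h, x0). tens (box_act N a h y) (bas x0)) (box_coact x))"

definition box_mult ::
  "nat \<Rightarrow> (ind \<times> ind \<Rightarrow> 'b \<Rightarrow> ('b \<Rightarrow>\<^sub>0 'k)) \<Rightarrow> 'k free_alg \<Rightarrow> ('b \<times> word \<Rightarrow>\<^sub>0 'k) \<Rightarrow> ('b \<times> word \<Rightarrow>\<^sub>0 'k::field)" where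
  "box_mult N a h x = lext (\<lambda>w. lext (box_act N a w) x) h"

definition K_vec ::
  "nat \<Rightarrow> nat \<Rightarrow> 'k::field \<Rightarrow> 'k \<Rightarrow> nat \<Rightarrow> nat \<Rightarrow> nat \<Rightarrow> nat \<Rightarrow> nat \<Rightarrow> (ind \<times> word \<Rightarrow>\<^sub>0 'k)" where
  "K_vec N n \<mu> \<omega> j k p s r =
     box_mult N (V_gen N n \<mu> \<omega> j k)
       (if even r then chi12 (r - 1) else chi21 (r - 1))
       (tens (bas I1) (xg I1 I1 ^ (2 * s) + fscale ((- 1) ^ p) (xg I1 I2 ^ (2 * s))))"

definition K_space ::
  "nat \<Rightarrow> nat \<Rightarrow> 'k::field \<Rightarrow> 'k \<Rightarrow> nat \<Rightarrow> nat \<Rightarrow> nat \<Rightarrow> nat \<Rightarrow> (ind \<times> word \<Rightarrow>\<^sub>0 'k) set" where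
  "K_space N n \<mu> \<omega> j k p s = fv.span (K_vec N n \<mu> \<omega> j k p s ` {1..2 * n})"

abbreviation K_braiding ::
  "nat \<Rightarrow> nat \<Rightarrow> 'k::field \<Rightarrow> 'k \<Rightarrow> nat \<Rightarrow> nat \<Rightarrow>
   (ind \<times> word) \<times> (ind \<times> word) \<Rightarrow> ((ind \<times> word) \<times> (ind \<times> word) \<Rightarrow>\<^sub>0 'k)" where
  "K_braiding N n \<mu> \<omega> j k \<equiv> box_braiding N (V_gen N n \<mu> \<omega> j k)"

abbreviation K_null :: "nat \<Rightarrow> nat \<Rightarrow> 'k::field \<Rightarrow> 'k \<Rightarrow> (ind \<times> word \<Rightarrow>\<^sub>0 'k) set" where
  "K_null N n \<mu> lam \<equiv> box_null (suzuki_ideal N n \<mu> lam)"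

end

theory Submission
  imports Defs
begin

text \<open>
  Modulo the null space, the vectors \<open>w\<^sub>1, w\<^sub>2\<close> for \<open>n = 1\<close>, the vectors \<open>w\<^sub>1 \<plusminus> a w\<^sub>3, w\<^sub>2 \<plusminus> a w\<^sub>4\<close> for
  \<open>n = 2\<close> and \<open>\<lambda> = 1\<close>, and \<open>w\<^sub>1 \<plusminus> a w\<^sub>3\<close> for \<open>n = 2\<close> and \<open>\<lambda> = - 1\<close> span braided subspaces of diagonal
  type, where \<open>a\<close> is a scalar. All vertices are labelled \<open>q\<close> and all \<open>q\<^sub>i\<^sub>j q\<^sub>j\<^sub>i\<close> are \<open>\<plusminus> q\<^sup>2\<close>.
  It follows from Rosso's skew derivations, which detect the elements of the Nichols
  ideal, that the Nichols algebra of a pair of vertices labelled \<open>q\<close> with edge \<open>l q\<^sup>2\<close>, where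
  \<open>l = \<plusminus> 1\<close>, is finite-dimensional only if \<open>l q\<^sup>2 = 1 \<noteq> q\<close> or \<open>l q\<^sup>3 = 1 \<noteq> q\<close>: in the other cases the pair
  is of Cartan type with Cartan integers at most \<open>- 2\<close>, and reflections produce nonzero elements of
  arbitrarily high degree, or some root vector has self-braiding \<open>1\<close>. In the exceptional cases PBW
  monomials span. For \<open>n = 2\<close>, \<open>\<lambda> = 1\<close> and \<open>q = - 1\<close> the diagram consists of two components of type
  \<open>A\<^sub>2\<close> at \<open>- 1\<close>, so that the dimension is \<open>8 \<cdot> 8\<close>.
\<close>

section \<open>Linear maps between free vector spaces\<close>

text \<open>Nothing is proved about the size of the Suzuki algebra, although the null space is given
  only by generators of an ideal. Two facts replace a basis. The ideal is stable under
  comultiplication and antipode and annihilates V', so action and braiding descend modulo the null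
  space. Matrix coefficients of V' vanish on the ideal and hence separate the vectors w_r; for n = 2
  a second module of the same shape is required, since one coefficient cannot tell w_1 from a
  multiple of w_3.

  The scalar q arises because x_11^2 acts on the box product by 0 and x_12^2 by \<beta> =
  \<open>mu_bar\<close> times \<omega>^(8kn): the algebra factor of w_1 is group-like, and its
  second summand acts by (-1)^p \<beta>^s = q. With c = \<omega>^(2jN), the scalar a is c / \<beta>.

  For n = 2 and \<lambda> = -1 the vectors w_2 \<plusminus> a w_4 do not braid diagonally with w_1
  \<plusminus> a w_3, because c^4 = \<lambda>. A braided subspace still bounds the dimension from
  below, so necessary conditions remain accessible.\<close>

definition lin :: "(('s \<Rightarrow>\<^sub>0 'k) \<Rightarrow> ('t \<Rightarrow>\<^sub>0 'k::field)) \<Rightarrow> bool" where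
  "lin f \<longleftrightarrow> (\<forall>x y. f (x + y) = f x + f y) \<and> (\<forall>a x. f (fscale a x) = fscale a (f x))"

lemma linI: "(\<And>x y. f (x + y) = f x + f y) \<Longrightarrow> (\<And>a x. f (fscale a x) = fscale a (f x)) \<Longrightarrow> lin f"
  by (simp add: lin_def)

lemma lin_add: "lin f \<Longrightarrow> f (x + y) = f x + f y"
  and lin_scale: "lin f \<Longrightarrow> f (fscale a x) = fscale a (f x)"
  by (simp_all add: lin_def)

lemma lin_0: "lin f \<Longrightarrow> f 0 = 0"
  using lin_scale[of f 0 0] by simp

lemma lin_diff: "lin f \<Longrightarrow> f (x - y) = f x - f y"
  using lin_add[of f "x - y" y] by simp

lemma lin_sum: "lin f \<Longrightarrow> f (\<Sum>i\<in>A. g i) = (\<Sum>i\<in>A. f (g i))"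
  by (induction A rule: infinite_finite_induct) (auto simp: lin_0 lin_add)

lemma sum_fscale_bas: "(\<Sum>s\<in>Poly_Mapping.keys x. fscale (Poly_Mapping.lookup x s) (bas s)) = x"
proof (rule poly_mapping_eqI)
  fix t
  have "Poly_Mapping.lookup (\<Sum>s\<in>Poly_Mapping.keys x. fscale (Poly_Mapping.lookup x s) (bas s)) t
    = (\<Sum>s\<in>Poly_Mapping.keys x. if s = t then Poly_Mapping.lookup x s else 0)"
    unfolding lookup_sum by (rule sum.cong) (auto simp: lookup_single)
  also have "\<dots> = Poly_Mapping.lookup x t"
    by (auto simp: sum.delta in_keys_iff)
  finally show "Poly_Mapping.lookup (\<Sum>s\<in>Poly_Mapping.keys x. fscale (Poly_Mapping.lookup x s) (bas s)) t
    = Poly_Mapping.lookup x t" .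
qed

lemma lext_eq_sum:
  "finite A \<Longrightarrow> Poly_Mapping.keys x \<subseteq> A \<Longrightarrow> lext f x = (\<Sum>s\<in>A. fscale (Poly_Mapping.lookup x s) (f s))"
  unfolding lext_def by (rule sum.mono_neutral_left) (auto simp: in_keys_iff)

lemma lin_lext: "lin (lext f)"
proof (rule linI)
  fix x y :: "'a \<Rightarrow>\<^sub>0 'b"
  let ?A = "Poly_Mapping.keys x \<union> Poly_Mapping.keys y"
  have "lext f z = (\<Sum>s\<in>?A. fscale (Poly_Mapping.lookup z s) (f s))" if "z \<in> {x, y, x + y}" for z
    using that Poly_Mapping.keys_add[of x y] by (intro lext_eq_sum) auto
  then show "lext f (x + y) = lext f x + lext f y"
    by (simp add: lookup_add fv.scale_left_distrib sum.distrib)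
next
  fix a and x :: "'a \<Rightarrow>\<^sub>0 'b"
  have "lext f (fscale a x) = (\<Sum>s\<in>Poly_Mapping.keys x. fscale (Poly_Mapping.lookup (fscale a x) s) (f s))"
    by (intro lext_eq_sum) (auto simp: in_keys_iff)
  then show "lext f (fscale a x) = fscale a (lext f x)"
    by (simp add: lext_def fv.scale_sum_right)
qed

lemma lext_bas [simp]: "lext f (bas s) = f s"
  by (simp add: lext_def)

lemma lin_eqI: "lin f \<Longrightarrow> lin g \<Longrightarrow> (\<And>s. f (bas s) = g (bas s)) \<Longrightarrow> f x = g x"
  by (subst (1 2) sum_fscale_bas[symmetric]) (simp add: lin_sum lin_scale)

lemma lin_eqI_keys:
  "lin f \<Longrightarrow> lin g \<Longrightarrow> (\<And>s. s \<in> Poly_Mapping.keys x \<Longrightarrow> f (bas s) = g (bas s)) \<Longrightarrow> f x = g x"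
  by (subst (1 2) sum_fscale_bas[symmetric]) (simp add: lin_sum lin_scale)

lemma lin_into_subspace:
  assumes "lin f" "fv.subspace V" "\<And>s. s \<in> Poly_Mapping.keys x \<Longrightarrow> f (bas s) \<in> V"
  shows "f x \<in> V"
proof -
  have "f x = (\<Sum>s\<in>Poly_Mapping.keys x. fscale (Poly_Mapping.lookup x s) (f (bas s)))"
    by (subst sum_fscale_bas[symmetric]) (simp only: lin_sum[OF assms(1)] lin_scale[OF assms(1)])
  then show ?thesis
    using assms(2,3) by (auto intro!: fv.subspace_sum fv.subspace_scale)
qed

lemma lin_span_into:
  assumes "lin f" "fv.subspace V" "\<And>x. x \<in> S \<Longrightarrow> f x \<in> V" "x \<in> fv.span S"
  shows "f x \<in> V"
  using assms(4)
proof (induction rule: fv.span_induct_alt)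
  case base
  then show ?case using assms by (simp add: lin_0 fv.subspace_0)
next
  case (step c x y)
  then show ?case
    using assms by (simp add: lin_add lin_scale fv.subspace_add fv.subspace_scale)
qed

lemma lin_id: "lin (\<lambda>x. x)"
  and lin_zero: "lin (\<lambda>x. 0)"
  by (simp_all add: lin_def)

lemma lin_plus: "lin f \<Longrightarrow> lin g \<Longrightarrow> lin (\<lambda>x. f x + g x)"
  and lin_sub: "lin f \<Longrightarrow> lin g \<Longrightarrow> lin (\<lambda>x. f x - g x)"
  and lin_smul: "lin f \<Longrightarrow> lin (\<lambda>x. fscale a (f x))"
  by (simp_all add: lin_def fv.scale_right_distrib fv.scale_right_diff_distrib mult.commute)

lemma lin_comp: "lin f \<Longrightarrow> lin g \<Longrightarrow> lin (\<lambda>x. f (g x))"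
  by (simp add: lin_def)

lemma lin_lext_comp: "lin g \<Longrightarrow> lin (\<lambda>x. lext f (g x))"
  by (rule lin_comp[OF lin_lext])

lemma lin_sumI: "(\<And>i. i \<in> A \<Longrightarrow> lin (f i)) \<Longrightarrow> lin (\<lambda>x. \<Sum>i\<in>A. f i x)"
  by (auto simp: lin_def sum.distrib fv.scale_sum_right)

text \<open>Scalars become multiples of the unit of the monoid algebra; once these are central,
  compatibility of \<open>fscale\<close> with convolution is a matter of ring laws.\<close>

lemma fscale_eq_mult: "fscale a x = Poly_Mapping.single 0 a * (x :: 'm::monoid_add \<Rightarrow>\<^sub>0 'k::field)"
  by (rule poly_mapping_eqI) (simp add: lookup_mult prod_fun_def[abs_def] lookup_single when_mult Sum_any_when_equal')

lemma fscale_commutes_mult: "Poly_Mapping.single 0 a * (x :: 'm::monoid_add \<Rightarrow>\<^sub>0 'k::field) = x * Poly_Mapping.single 0 a"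
proof -
  have "lin (\<lambda>x :: 'm \<Rightarrow>\<^sub>0 'k. Poly_Mapping.single 0 a * x)"
    by (simp add: lin_def fscale_eq_mult distrib_left flip: mult.assoc)
      (simp add: mult_single mult.commute)
  moreover have "lin (\<lambda>x :: 'm \<Rightarrow>\<^sub>0 'k. x * Poly_Mapping.single 0 a)"
    by (simp add: lin_def fscale_eq_mult distrib_right mult.assoc)
  ultimately show ?thesis
    by (rule lin_eqI) (simp add: mult_single)
qed

lemma fscale_mult_left: "fscale a x * y = fscale a (x * (y :: 'm::monoid_add \<Rightarrow>\<^sub>0 'k::field))"
  by (simp add: fscale_eq_mult mult.assoc)

lemma fscale_mult_right: "x * fscale a y = fscale a (x * (y :: 'm::monoid_add \<Rightarrow>\<^sub>0 'k::field))"
  by (simp add: fscale_eq_mult) (metis fscale_commutes_mult mult.assoc)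

lemmas fscale_mult = fscale_mult_left fscale_mult_right

lemma lin_multL: "lin f \<Longrightarrow> lin (\<lambda>x. a * (f x :: 'm::monoid_add \<Rightarrow>\<^sub>0 'k::field))"
  and lin_multR: "lin f \<Longrightarrow> lin (\<lambda>x. (f x :: 'm::monoid_add \<Rightarrow>\<^sub>0 'k::field) * a)"
  by (simp_all add: lin_def distrib_left distrib_right fscale_mult)

lemma bas_mult_list: "bas u * bas v = (bas (u @ v) :: _ \<Rightarrow>\<^sub>0 'k::field)"
  by (simp add: mult_single plus_list_def)

lemma bas_Nil: "bas [] = (1 :: _ \<Rightarrow>\<^sub>0 'k::field)"
  by (metis single_one zero_list_def)

lemma bas_Cons: "bas (x # u) = (bas [x] * bas u :: _ \<Rightarrow>\<^sub>0 'k::field)"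
  by (simp add: bas_mult_list)

lemma lin_tensL: "lin f \<Longrightarrow> lin (\<lambda>x. tens (f x) b)"
  by (simp add: tens_def lin_lext_comp)

lemma lin_tens_right: "lin (tens a)"
proof (rule linI)
  fix x y
  show "tens a (x + y) = tens a x + tens a y"
    unfolding tens_def lext_def[of _ a] by (simp add: lin_add[OF lin_lext] fv.scale_right_distrib sum.distrib)
  fix c
  show "tens a (fscale c x) = fscale c (tens a x)"
    unfolding tens_def lext_def[of _ a]
    by (simp add: lin_scale[OF lin_lext] fv.scale_sum_right mult.commute)
qed

lemma lin_tensR: "lin f \<Longrightarrow> lin (\<lambda>x. tens a (f x))"
  by (rule lin_comp[OF lin_tens_right])

lemma tens_bas [simp]: "tens (bas s) (bas t) = bas (s, t)"
  by (simp add: tens_def)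

lemmas lin_intros = lin_id lin_zero lin_plus lin_sub lin_smul lin_lext lin_lext_comp lin_sumI lin_multL lin_multR
  lin_tensL lin_tensR

lemma tens_add_left: "tens (a + b) c = tens a c + tens b c"
  and tens_diff_left: "tens (a - b) c = tens a c - tens b c"
  and tens_scale_left: "tens (fscale k a) c = fscale k (tens a c)"
  and tens_0_left: "tens 0 c = 0"
  using lin_add[OF lin_tensL[OF lin_id]] lin_diff[OF lin_tensL[OF lin_id]]
    lin_scale[OF lin_tensL[OF lin_id]] lin_0[OF lin_tensL[OF lin_id]] by blast+

lemma tens_add_right: "tens c (a + b) = tens c a + tens c b"
  and tens_diff_right: "tens c (a - b) = tens c a - tens c b"
  and tens_scale_right: "tens c (fscale k a) = fscale k (tens c a)"
  and tens_0_right: "tens c 0 = 0"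
  by (simp_all add: lin_add lin_diff lin_scale lin_0 lin_tens_right)

lemmas tens_simps = tens_add_left tens_add_right tens_diff_left tens_diff_right tens_scale_left tens_scale_right
  tens_0_left tens_0_right

lemma bilin_eqI:
  assumes "\<And>b. lin (\<lambda>a. f a b)" "\<And>b. lin (\<lambda>a. g a b)" "\<And>a. lin (f a)" "\<And>a. lin (g a)"
    and "\<And>s t. f (bas s) (bas t) = g (bas s) (bas t)"
  shows "f a b = g a b"
proof -
  have "f (bas s) b = g (bas s) b" for s
    by (rule lin_eqI[where f = "f (bas s)"]) (use assms in auto)
  then show ?thesis
    by (rule lin_eqI[where f = "\<lambda>a. f a b", OF assms(1,2)])
qed

lemma tens_mult:
  fixes a a' :: "'m::monoid_add \<Rightarrow>\<^sub>0 'k::field" and b b' :: "'n::monoid_add \<Rightarrow>\<^sub>0 'k"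
  shows "tens a b * tens a' b' = tens (a * a') (b * b')"
proof -
  have *: "tens (bas s) (bas t) * tens a' b' = tens (bas s * a') (bas t * b')"
    for s :: 'm and t :: 'n
    by (rule bilin_eqI[where f = "\<lambda>a' b'. tens (bas s) (bas t) * tens a' b'"
          and g = "\<lambda>a' b'. tens (bas s * a') (bas t * b')"])
      (intro lin_intros | simp add: mult_single plus_prod_def)+
  show ?thesis
    by (rule bilin_eqI[where f = "\<lambda>a b. tens a b * tens a' b'"
          and g = "\<lambda>a b. tens (a * a') (b * b')"]) (intro lin_intros | fact *)+
qed

lemma tens_1_1: "tens 1 1 = (1 :: 'm::monoid_add \<times> 'n::monoid_add \<Rightarrow>\<^sub>0 'k::field)"
proof -
  have "tens (bas (0::'m)) (bas (0::'n)) = (bas 0 :: _ \<Rightarrow>\<^sub>0 'k)"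
    by (simp only: tens_bas zero_prod_def)
  then show ?thesis by (simp only: single_one)
qed

lemma range_tens_span: "x \<in> fv.span (range (\<lambda>(a, b). tens a b))"
proof -
  have "x = (\<Sum>s\<in>Poly_Mapping.keys x. fscale (Poly_Mapping.lookup x s) (bas s))"
    by (simp add: sum_fscale_bas)
  also have "\<dots> \<in> fv.span (range (\<lambda>(a, b). tens a b))"
    by (intro fv.span_sum fv.span_scale fv.span_base)
      (metis (mono_tags, lifting) case_prod_conv rangeI surj_pair tens_bas)
  finally show ?thesis .
qed

section \<open>Algebra maps out of free algebras\<close>

definition freehom :: "('a \<Rightarrow> ('m \<Rightarrow>\<^sub>0 'k)) \<Rightarrow> ('a list \<Rightarrow>\<^sub>0 'k) \<Rightarrow> ('m::monoid_add \<Rightarrow>\<^sub>0 'k::field)" where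
  "freehom g = lext (\<lambda>w. prod_list (map g w))"

lemma lin_freehom: "lin (freehom g)"
  by (simp add: freehom_def lin_lext)

lemma lin_freehom_comp: "lin f \<Longrightarrow> lin (\<lambda>x. freehom g (f x))"
  by (rule lin_comp[OF lin_freehom])

lemma freehom_bas: "freehom g (bas w) = prod_list (map g w)"
  by (simp add: freehom_def)

lemma freehom_mult: "freehom g (x * y) = freehom g x * freehom g y"
  by (rule bilin_eqI[where f = "\<lambda>x y. freehom g (x * y)" and g = "\<lambda>x y. freehom g x * freehom g y"])
    (intro lin_intros lin_freehom_comp lin_freehom | simp add: bas_mult_list freehom_bas)+

lemma freehom_1: "freehom g 1 = 1"
  using freehom_bas[of g "[]"] by (simp add: bas_Nil)

lemma freehom_comp:
  "freehom g (freehom h x) = freehom (\<lambda>a. freehom g (h a)) x"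
proof -
  have "freehom g (prod_list (map h w)) = prod_list (map (\<lambda>a. freehom g (h a)) w)" for w
    by (induction w) (simp_all add: freehom_1 freehom_mult)
  then show ?thesis
    by - (rule lin_eqI[where f = "\<lambda>x. freehom g (freehom h x)" and g = "freehom (\<lambda>a. freehom g (h a))"],
      simp_all add: lin_freehom_comp lin_freehom freehom_bas)
qed

lemma freehom_bas_singletons: "freehom (\<lambda>a. bas [a]) x = x"
proof -
  have "prod_list (map (\<lambda>a. bas [a]) w) = (bas w :: _ \<Rightarrow>\<^sub>0 'b)" for w :: "'a list"
    by (induction w) (simp_all add: bas_Nil bas_mult_list)
  then show ?thesis
    by - (rule lin_eqI[where f = "freehom (\<lambda>a. bas [a])" and g = "\<lambda>x. x"], simp_all add: lin_freehom lin_id freehom_bas)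
qed

section \<open>Words of a fixed length\<close>

definition homog :: "nat \<Rightarrow> ('a list \<Rightarrow>\<^sub>0 'k::field) set" where
  "homog n = {t. \<forall>w\<in>Poly_Mapping.keys t. length w = n}"

lemma subspace_homog: "fv.subspace (homog n :: ('a list \<Rightarrow>\<^sub>0 'k::field) set)"
proof (rule fv.subspaceI)
  fix x y :: "'a list \<Rightarrow>\<^sub>0 'k" and c :: 'k
  assume x: "x \<in> homog n"
  then show "fscale c x \<in> homog n"
    by (simp add: homog_def in_keys_iff)
  assume "y \<in> homog n"
  then show "x + y \<in> homog n"
    using x Poly_Mapping.keys_add[of x y] by (auto simp: homog_def)
qed (simp add: homog_def)

lemma bas_in_homog: "length w = n \<Longrightarrow> bas w \<in> homog n"
  by (simp add: homog_def)

lemma lin_into_homog: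
  "lin f \<Longrightarrow> x \<in> homog n \<Longrightarrow> (\<And>w. length w = n \<Longrightarrow> f (bas w) \<in> V) \<Longrightarrow> fv.subspace V \<Longrightarrow> f x \<in> V"
  using lin_into_subspace[of f V x] by (simp add: homog_def)

lemma homog_mult: "x \<in> homog n \<Longrightarrow> y \<in> homog m \<Longrightarrow> x * y \<in> homog (n + m)"
proof -
  assume x: "x \<in> homog n" and y: "y \<in> homog m"
  have "bas u * y \<in> homog (n + m)" if "length u = n" for u
    by (rule lin_into_homog[OF lin_multL[OF lin_id, of "bas u"] y])
      (simp_all add: bas_mult_list that subspace_homog bas_in_homog)
  then show ?thesis
    using lin_into_homog[OF lin_multR[OF lin_id, of y] x _ subspace_homog] by blast
qed

section \<open>Skew derivations and the Nichols ideal of a diagonal braiding\<close>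

locale diag_braid =
  fixes Q :: "'i::finite \<Rightarrow> 'i \<Rightarrow> 'k::field"
begin

definition qw :: "'i \<Rightarrow> 'i list \<Rightarrow> 'k" where "qw i w = (\<Prod>k\<leftarrow>w. Q i k)"
definition qw' :: "'i \<Rightarrow> 'i list \<Rightarrow> 'k" where "qw' i w = (\<Prod>k\<leftarrow>w. Q k i)"

text \<open>\<open>sg i\<close> and \<open>tu i\<close> are the diagonal algebra automorphisms that
  scale each letter k by \<open>Q i k\<close> and by \<open>Q k i\<close>, the scalars for braiding
  i past k from either side.\<close>

definition sg :: "'i \<Rightarrow> ('i list \<Rightarrow>\<^sub>0 'k) \<Rightarrow> ('i list \<Rightarrow>\<^sub>0 'k)" where
  "sg i = lext (\<lambda>w. fscale (qw i w) (bas w))"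
definition tu :: "'i \<Rightarrow> ('i list \<Rightarrow>\<^sub>0 'k) \<Rightarrow> ('i list \<Rightarrow>\<^sub>0 'k)" where
  "tu i = lext (\<lambda>w. fscale (qw' i w) (bas w))"

text \<open>
  The skew derivations satisfy \<open>\<partial>\<^sup>R(x y) = x \<partial>\<^sup>R y + (\<partial>\<^sup>R x) \<sigma>(y)\<close> and
  \<open>\<partial>\<^sup>L(x y) = (\<partial>\<^sup>L x) y + \<tau>(x) \<partial>\<^sup>L y\<close>, where \<open>\<sigma>\<close> is \<open>sg\<close> and \<open>\<tau>\<close> is \<open>tu\<close>; with these twists
  all left ones commute with all right ones, without any scalar.
\<close>

fun dRw :: "'i \<Rightarrow> 'i list \<Rightarrow> ('i list \<Rightarrow>\<^sub>0 'k)" where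
  "dRw i [] = 0"
| "dRw i (j # u) = bas [j] * dRw i u + (if i = j then fscale (qw i u) (bas u) else 0)"

fun dLw :: "'i \<Rightarrow> 'i list \<Rightarrow> ('i list \<Rightarrow>\<^sub>0 'k)" where
  "dLw i [] = 0"
| "dLw i (j # u) = (if i = j then bas u else 0) + fscale (Q j i) (bas [j] * dLw i u)"

definition dR :: "'i \<Rightarrow> ('i list \<Rightarrow>\<^sub>0 'k) \<Rightarrow> ('i list \<Rightarrow>\<^sub>0 'k)" where "dR i = lext (dRw i)"
definition dL :: "'i \<Rightarrow> ('i list \<Rightarrow>\<^sub>0 'k) \<Rightarrow> ('i list \<Rightarrow>\<^sub>0 'k)" where "dL i = lext (dLw i)"

lemma lin_dR: "lin (dR i)" and lin_dL: "lin (dL i)" and lin_sg: "lin (sg i)" and lin_tu: "lin (tu i)"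
  by (simp_all add: dR_def dL_def sg_def tu_def lin_lext)

lemma lin_dR_comp: "lin f \<Longrightarrow> lin (\<lambda>x. dR i (f x))" and lin_dL_comp: "lin f \<Longrightarrow> lin (\<lambda>x. dL i (f x))"
  and lin_sg_comp: "lin f \<Longrightarrow> lin (\<lambda>x. sg i (f x))" and lin_tu_comp: "lin f \<Longrightarrow> lin (\<lambda>x. tu i (f x))"
  by (rule lin_comp, rule lin_dR lin_dL lin_sg lin_tu, assumption)+

lemmas lins = lin_intros lin_dR lin_dL lin_sg lin_tu lin_dR_comp lin_dL_comp lin_sg_comp lin_tu_comp

lemma dR_bas [simp]: "dR i (bas w) = dRw i w" and dL_bas [simp]: "dL i (bas w) = dLw i w"
  and sg_bas [simp]: "sg i (bas w) = fscale (qw i w) (bas w)"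
  and tu_bas [simp]: "tu i (bas w) = fscale (qw' i w) (bas w)"
  by (simp_all add: dR_def dL_def sg_def tu_def)

lemma qw_simps [simp]: "qw i [] = 1" "qw i (j # w) = Q i j * qw i w" "qw i (u @ w) = qw i u * qw i w"
  "qw' i [] = 1" "qw' i (j # w) = Q j i * qw' i w" "qw' i (u @ w) = qw' i u * qw' i w"
  by (simp_all add: qw_def qw'_def)

lemma dR_1 [simp]: "dR i 1 = 0" and dL_1 [simp]: "dL i 1 = 0" and sg_1 [simp]: "sg i 1 = 1" and tu_1 [simp]: "tu i 1 = 1"
  using dR_bas[of i "[]"] dL_bas[of i "[]"] sg_bas[of i "[]"] tu_bas[of i "[]"] by (simp_all add: bas_Nil)

lemma sg_mult: "sg i (x * y) = sg i x * sg i y"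
  by (rule bilin_eqI[where f = "\<lambda>x y. sg i (x * y)" and g = "\<lambda>x y. sg i x * sg i y"])
    (intro lins | simp add: bas_mult_list fscale_mult mult.commute)+

lemma tu_mult: "tu i (x * y) = tu i x * tu i y"
  by (rule bilin_eqI[where f = "\<lambda>x y. tu i (x * y)" and g = "\<lambda>x y. tu i x * tu i y"])
    (intro lins | simp add: bas_mult_list fscale_mult mult.commute)+

lemma dRw_append: "dRw i (u @ v) = bas u * dRw i v + dRw i u * fscale (qw i v) (bas v)"
  by (induction u)
    (auto simp: bas_Nil bas_Cons[of _ "_ @ _"] bas_mult_list distrib_left distrib_right fscale_mult mult.assoc mult.commute
      fv.scale_right_distrib simp flip: mult.assoc)

lemma dR_mult: "dR i (x * y) = x * dR i y + dR i x * sg i y"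
  by (rule bilin_eqI[where f = "\<lambda>x y. dR i (x * y)" and g = "\<lambda>x y. x * dR i y + dR i x * sg i y"])
    (intro lins | simp add: bas_mult_list dRw_append)+

lemma dLw_append: "dLw i (u @ v) = dLw i u * bas v + fscale (qw' i u) (bas u * dLw i v)"
  by (induction u)
    (auto simp: bas_Nil bas_Cons[of _ "_ @ _"] bas_mult_list distrib_left distrib_right fscale_mult mult.assoc mult.commute
      fv.scale_right_distrib simp flip: mult.assoc)

lemma dL_mult: "dL i (x * y) = dL i x * y + tu i x * dL i y"
  by (rule bilin_eqI[where f = "\<lambda>x y. dL i (x * y)" and g = "\<lambda>x y. dL i x * y + tu i x * dL i y"])
    (intro lins | simp add: bas_mult_list dLw_append fscale_mult)+

lemma dR_scale [simp]: "dR i (fscale a x) = fscale a (dR i x)"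
  and dL_scale [simp]: "dL i (fscale a x) = fscale a (dL i x)"
  and sg_scale [simp]: "sg i (fscale a x) = fscale a (sg i x)"
  and tu_scale [simp]: "tu i (fscale a x) = fscale a (tu i x)"
  by (simp_all add: lin_scale lin_dR lin_dL lin_sg lin_tu)

lemma dR_diff [simp]: "dR i (x - y) = dR i x - dR i y" and dL_diff [simp]: "dL i (x - y) = dL i x - dL i y"
  and sg_diff [simp]: "sg i (x - y) = sg i x - sg i y" and tu_diff [simp]: "tu i (x - y) = tu i x - tu i y"
  and dR_add [simp]: "dR i (x + y) = dR i x + dR i y" and dL_add [simp]: "dL i (x + y) = dL i x + dL i y"
  and sg_add [simp]: "sg i (x + y) = sg i x + sg i y" and tu_add [simp]: "tu i (x + y) = tu i x + tu i y"
  and dR_0 [simp]: "dR i 0 = 0" and dL_0 [simp]: "dL i 0 = 0" and sg_0 [simp]: "sg i 0 = 0" and tu_0 [simp]: "tu i 0 = 0"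
  by (simp_all add: lin_add lin_diff lin_0 lin_dR lin_dL lin_sg lin_tu)

text \<open>The derivation removes one letter i, so a factor \<open>Q j i\<close> is missing after
  scaling. It stands on the left because entries of \<open>Q\<close> may be 0 in this locale and
  cannot be divided by.\<close>

lemma sg_dLw: "fscale (Q j i) (sg j (dLw i u)) = fscale (qw j u) (dLw i u)"
proof (induction u)
  case (Cons a u)
  have "fscale (Q j i) (sg j (dLw i (a # u)))
    = (if i = a then fscale (Q j i * qw j u) (bas u) else 0)
      + fscale (Q a i * Q j a) (bas [a] * fscale (Q j i) (sg j (dLw i u)))"
    by (auto simp: sg_mult fscale_mult fv.scale_right_distrib mult_ac)
  also have "\<dots> = fscale (qw j (a # u)) (dLw i (a # u))"
    by (auto simp: Cons fscale_mult fv.scale_right_distrib mult_ac)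
  finally show ?case .
qed simp

lemma sg_dRw: "fscale (Q j i) (sg j (dRw i u)) = fscale (qw j u) (dRw i u)"
proof (induction u)
  case (Cons a u)
  have "fscale (Q j i) (sg j (dRw i (a # u)))
    = (if i = a then fscale (Q j i * qw j u * qw i u) (bas u) else 0)
      + fscale (Q j a) (bas [a] * fscale (Q j i) (sg j (dRw i u)))"
    by (auto simp: sg_mult fscale_mult fv.scale_right_distrib mult_ac)
  also have "\<dots> = fscale (qw j (a # u)) (dRw i (a # u))"
    by (auto simp: Cons fscale_mult fv.scale_right_distrib mult_ac)
  finally show ?case .
qed simp

lemma dR_sg: "dR i (sg j x) = fscale (Q j i) (sg j (dR i x))"
  by (rule lin_eqI[where f = "\<lambda>x. dR i (sg j x)" and g = "\<lambda>x. fscale (Q j i) (sg j (dR i x))"])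
    (intro lins | simp add: sg_dRw)+

text \<open>Formal except where the right derivation removes the first letter; there
  \<open>sg_dLw\<close> accounts for the twist of \<open>dR_mult\<close>. Because of this
  commutation the ideal, defined by right derivations, can also be tested from the left.\<close>

lemma dL_dR_commute: "dL i (dR j x) = dR j (dL i x)"
proof -
  have "dL i (dRw j u) = dR j (dLw i u)" for u
  proof (induction u)
    case (Cons a u)
    then show ?case
      using sg_dLw[of j i u] by (auto simp: dL_mult dR_mult fv.scale_right_distrib fscale_mult bas_Nil)
  qed simp
  then show ?thesis
    by - (rule lin_eqI[where f = "\<lambda>x. dL i (dR j x)" and g = "\<lambda>x. dR j (dL i x)"], (intro lins | simp)+)
qed

definition eps :: "('i list \<Rightarrow>\<^sub>0 'k) \<Rightarrow> 'k" where "eps x = Poly_Mapping.lookup x []"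

lemma eps_simps [simp]: "eps (x + y) = eps x + eps y" "eps (x - y) = eps x - eps y" "eps (fscale a x) = a * eps x"
  "eps 0 = 0" "eps 1 = 1"
  by (simp_all add: eps_def lookup_add lookup_minus) (simp only: lookup_single bas_Nil[symmetric], simp)

lemma eps_bas: "eps (bas w) = (if w = [] then 1 else 0)"
  by (simp add: eps_def lookup_single when_def)

lemma lin_fun_eqI:
  fixes f g :: "('s \<Rightarrow>\<^sub>0 'k) \<Rightarrow> 'k"
  assumes "\<And>x y. f (x + y) = f x + f y" "\<And>a x. f (fscale a x) = a * f x"
    "\<And>x y. g (x + y) = g x + g y" "\<And>a x. g (fscale a x) = a * g x" "\<And>s. f (bas s) = g (bas s)"
  shows "f x = g x"
proof -
  have 0: "f 0 = 0" "g 0 = 0" using assms(2)[of 0 0] assms(4)[of 0 0] by simp_all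
  have s: "f (\<Sum>i\<in>A. h i) = (\<Sum>i\<in>A. f (h i))" "g (\<Sum>i\<in>A. h i) = (\<Sum>i\<in>A. g (h i))" for A and h :: "'s \<Rightarrow> _"
    by (induction A rule: infinite_finite_induct) (simp_all add: assms 0)
  show ?thesis
    by (subst (1 2) sum_fscale_bas[symmetric]) (simp add: s assms)
qed

lemma eps_mult: "eps (x * y) = eps x * eps y"
proof -
  have *: "eps (bas u * y) = eps (bas u) * eps y" for u
    by (rule lin_fun_eqI[where f = "\<lambda>y. eps (bas u * y)" and g = "\<lambda>y. eps (bas u) * eps y"])
      (simp_all add: distrib_left fscale_mult bas_mult_list eps_bas)
  show ?thesis
    by (rule lin_fun_eqI[where f = "\<lambda>x. eps (x * y)" and g = "\<lambda>x. eps x * eps y"])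
      (simp_all add: distrib_right fscale_mult *)
qed

lemma eps_sg: "eps (sg i x) = eps x"
  by (rule lin_fun_eqI[where f = "\<lambda>x. eps (sg i x)" and g = eps]) (simp_all add: eps_bas)

text \<open>Both sides are the coefficient of the one-letter word i, where no twist is left.\<close>

lemma eps_dL_eq_dR: "eps (dL i x) = eps (dR i x)"
proof -
  have "eps (dLw i u) = eps (dRw i u)" for u
    by (induction u) (auto simp: eps_mult eps_bas)
  then show ?thesis
    by - (rule lin_fun_eqI[where f = "\<lambda>x. eps (dL i x)" and g = "\<lambda>x. eps (dR i x)"], simp_all)
qed

definition dRs :: "'i list \<Rightarrow> ('i list \<Rightarrow>\<^sub>0 'k) \<Rightarrow> ('i list \<Rightarrow>\<^sub>0 'k)" where "dRs w x = fold dR w x"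

lemma dRs_simps [simp]: "dRs [] x = x" "dRs (i # w) x = dRs w (dR i x)" "dRs (w @ v) x = dRs v (dRs w x)"
  by (simp_all add: dRs_def)

lemma lin_dRs: "lin (dRs w)"
proof (induction w)
  case (Cons i w)
  then show ?case using lin_comp[OF Cons lin_dR] by (simp add: dRs_def)
qed (simp add: lin_def)

text \<open>
  This turns out to be the sum of the kernels of the quantum symmetrizers.
\<close>

definition nich :: "('i list \<Rightarrow>\<^sub>0 'k) set" where
  "nich = {x. \<forall>w. eps (dRs w x) = 0}"

lemma subspace_nich: "fv.subspace nich"
  by (rule fv.subspaceI) (simp_all add: nich_def lin_0[OF lin_dRs] lin_add[OF lin_dRs] lin_scale[OF lin_dRs])

lemmas nich_0 = fv.subspace_0[OF subspace_nich]
  and nich_add = fv.subspace_add[OF subspace_nich]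
  and nich_diff = fv.subspace_diff[OF subspace_nich]
  and nich_scale = fv.subspace_scale[OF subspace_nich]

lemma nich_dR: "x \<in> nich \<Longrightarrow> dR i x \<in> nich"
  by (auto simp: nich_def simp flip: dRs_simps(2))

lemma nich_eps: "x \<in> nich \<Longrightarrow> eps x = 0"
  using dRs_simps(1)[of x] by (auto simp: nich_def dest: spec[of _ "[]"])

lemma nichI: "eps x = 0 \<Longrightarrow> (\<And>i. dR i x \<in> nich) \<Longrightarrow> x \<in> nich"
proof -
  assume e: "eps x = 0" and d: "\<And>i. dR i x \<in> nich"
  have "eps (dRs w x) = 0" for w
    using e d by (cases w) (auto simp: nich_def)
  then show ?thesis by (simp add: nich_def)
qed

lemma nich_sg: "x \<in> nich \<Longrightarrow> sg i x \<in> nich"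
proof -
  have "\<exists>a. dRs w (sg i y) = fscale a (sg i (dRs w y))" for w y
  proof (induction w arbitrary: y)
    case Nil
    then show ?case by (auto intro: exI[of _ 1])
  next
    case (Cons j w)
    obtain a where "dRs w (sg i (dR j y)) = fscale a (sg i (dRs w (dR j y)))"
      using Cons by blast
    then show ?case
      by (auto simp: dR_sg lin_scale[OF lin_dRs] intro: exI[of _ "Q i j * a"])
  qed
  then show "x \<in> nich \<Longrightarrow> sg i x \<in> nich"
    unfolding nich_def mem_Collect_eq by (metis eps_sg eps_simps(3) mult_zero_right)
qed

text \<open>After the last derivation of a word only the constant term matters, so that derivation
  may be replaced by a left one, which commutes with the others and can be applied to x
  first.\<close>

lemma nichI_left: "eps x = 0 \<Longrightarrow> (\<And>i. dL i x \<in> nich) \<Longrightarrow> x \<in> nich"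
proof -
  assume e: "eps x = 0" and d: "\<And>i. dL i x \<in> nich"
  have c: "dRs w (dL i y) = dL i (dRs w y)" for w y i
    by (induction w arbitrary: y) (simp_all add: dL_dR_commute[symmetric])
  have "eps (dRs w x) = 0" for w
  proof (cases w rule: rev_cases)
    case (snoc u i)
    have "eps (dRs u (dL i x)) = 0" using d[of i] by (simp add: nich_def)
    then show ?thesis by (simp add: snoc c eps_dL_eq_dR)
  qed (simp add: e)
  then show ?thesis by (simp add: nich_def)
qed

lemma nich_mult_left: "x \<in> nich \<Longrightarrow> y * x \<in> nich"
proof -
  have "eps (dRs w (y * x)) = 0" if "x \<in> nich" for w x y
    using that
  proof (induction w arbitrary: x y)
    case (Cons i w)
    then show ?case
      by (simp add: dR_mult lin_add[OF lin_dRs] nich_dR nich_sg)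
  qed (simp add: eps_mult nich_eps)
  then show "x \<in> nich \<Longrightarrow> y * x \<in> nich" by (simp add: nich_def)
qed

lemma nich_mult_right: "x \<in> nich \<Longrightarrow> x * y \<in> nich"
proof -
  have "eps (dRs w (x * y)) = 0" if "x \<in> nich" for w x y
    using that
  proof (induction w arbitrary: x y)
    case (Cons i w)
    then show ?case
      by (simp add: dR_mult lin_add[OF lin_dRs] nich_dR nich_sg)
  qed (simp add: eps_mult nich_eps)
  then show "x \<in> nich \<Longrightarrow> x * y \<in> nich" by (simp add: nich_def)
qed

lemma one_notin_nich: "1 \<notin> nich"
  using nich_eps by fastforce

end

section \<open>Quantum symmetrizers\<close>

definition two :: "('s \<times> 's \<Rightarrow>\<^sub>0 'k) \<Rightarrow> ('s list \<Rightarrow>\<^sub>0 'k::field)" where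
  "two = lext (\<lambda>(s, t). bas [s, t])"

lemma lin_two: "lin two" by (simp add: two_def lin_lext)

lemma lin_two_comp: "lin f \<Longrightarrow> lin (\<lambda>x. two (f x))" by (rule lin_comp[OF lin_two])

lemma two_bas [simp]: "two (bas (s, t)) = bas [s, t]" by (simp add: two_def)

lemma lin_deg1: "lin deg1" by (simp add: deg1_def lin_lext)

lemma lin_deg1_comp: "lin f \<Longrightarrow> lin (\<lambda>x. deg1 (f x))" by (rule lin_comp[OF lin_deg1])

lemma deg1_bas [simp]: "deg1 (bas s) = bas [s]" by (simp add: deg1_def)

lemma two_tens: "two (tens x y) = deg1 x * deg1 y"
  by (rule bilin_eqI[where f = "\<lambda>x y. two (tens x y)" and g = "\<lambda>x y. deg1 x * deg1 y"])
    (intro lin_intros lin_two_comp lin_deg1_comp lin_deg1 | simp add: bas_mult_list)+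

lemma two_in_homog: "two x \<in> homog 2"
  by (rule lin_into_subspace[OF lin_two subspace_homog]) (auto simp: bas_in_homog)

lemma deg1_in_homog: "deg1 x \<in> homog 1"
  by (rule lin_into_subspace[OF lin_deg1 subspace_homog]) (auto simp: bas_in_homog)

lemma lin_braid_at: "lin (braid_at c i)"
  by (simp add: braid_at_def lin_lext)

lemma lin_braid_sum: "lin (braid_sum c m)"
proof (induction m)
  case (Suc m)
  have "lin (\<lambda>t. t + braid_at c m (braid_sum c m t))"
    by (intro lin_plus lin_id lin_comp[OF lin_braid_at Suc])
  moreover have "braid_sum c (Suc m) = (\<lambda>t. t + braid_at c m (braid_sum c m t))"
    by (rule ext) simp
  ultimately show ?case by simp
qed (simp add: lin_def)

lemma lin_qsymm: "lin (qsymm c m)"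
proof (induction m)
  case (Suc m)
  have "lin (\<lambda>t. qsymm c m (braid_sum c m t))"
    by (intro lin_comp[OF Suc] lin_braid_sum)
  moreover have "qsymm c (Suc m) = (\<lambda>t. qsymm c m (braid_sum c m t))"
    by (rule ext) simp
  ultimately show ?case by simp
qed (simp add: lin_def)

lemma lin_quantum_symmetrizer: "lin (quantum_symmetrizer c)"
  by (simp add: quantum_symmetrizer_def lin_lext)

lemma quantum_symmetrizer_homog: "x \<in> homog n \<Longrightarrow> quantum_symmetrizer c x = qsymm c n x"
  by (rule lin_eqI_keys[OF lin_quantum_symmetrizer lin_qsymm]) (auto simp: homog_def quantum_symmetrizer_def)

lemma two_mid: "lext (\<lambda>(s, t). bas (u @ [s, t] @ r)) x = bas u * two x * bas r"
  by (rule lin_eqI[where f = "lext (\<lambda>(s, t). bas (u @ [s, t] @ r))" and g = "\<lambda>x. bas u * two x * bas r"])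
    (auto intro!: lin_intros lin_two simp: bas_mult_list)

lemma braid_at_mid:
  assumes "length u = i"
  shows "braid_at c i (bas u * two x * bas r) = bas u * two (lext c x) * bas r"
proof (rule lin_eqI[where f = "\<lambda>x. braid_at c i (bas u * two x * bas r)"
      and g = "\<lambda>x. bas u * two (lext c x) * bas r"])
  fix st :: "'a \<times> 'a"
  obtain s t where st: "st = (s, t)" by force
  have "braid_at c i (bas (u @ [s, t] @ r)) = bas u * two (c (s, t)) * bas r"
    using assms by (auto simp: braid_at_def nth_append two_mid[symmetric])
  then show "braid_at c i (bas u * two (bas st) * bas r) = bas u * two (lext c (bas st)) * bas r"
    by (simp add: st bas_mult_list)
qed (intro lin_intros lin_two_comp lin_comp[OF lin_braid_at] lin_two)+

lemma braid_at_mid_homog: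
  assumes "x \<in> homog i"
  shows "braid_at c i (x * two y * z) = x * two (lext c y) * z"
proof -
  have *: "braid_at c i (bas u * two y * z) = bas u * two (lext c y) * z" if "length u = i" for u
    by (rule lin_eqI[where f = "\<lambda>z. braid_at c i (bas u * two y * z)" and g = "\<lambda>z. bas u * two (lext c y) * z"])
      (intro lin_intros lin_comp[OF lin_braid_at] | simp add: braid_at_mid that)+
  show ?thesis
    by (rule lin_eqI_keys[where f = "\<lambda>x. braid_at c i (x * two y * z)" and g = "\<lambda>x. x * two (lext c y) * z"])
      (use assms in \<open>(intro lin_intros lin_comp[OF lin_braid_at] | simp add: * homog_def)+\<close>)
qed

lemma split_word_at:
  assumes "Suc i < length w"
  obtains u s t r where "w = u @ [s, t] @ r" "length u = i"
proof
  show "w = take i w @ [w ! i, w ! Suc i] @ drop (i + 2) w"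
    using assms by (simp add: Cons_nth_drop_Suc)
  show "length (take i w) = i"
    using assms by simp
qed

lemma braid_at_word: "length u = i \<Longrightarrow> braid_at c i (bas (u @ [s, t] @ r)) = bas u * two (c (s, t)) * bas r"
  using braid_at_mid[of u i c "bas (s, t)" r] by (simp add: bas_mult_list)

lemma braid_at_in_homog:
  assumes "x \<in> homog n" "Suc i < n"
  shows "braid_at c i x \<in> homog n"
proof (rule lin_into_homog[OF lin_braid_at assms(1) _ subspace_homog])
  fix w :: "'a list" assume w: "length w = n"
  then obtain u s t r where wu: "w = u @ [s, t] @ r" "length u = i"
    using split_word_at assms(2) by metis
  have "bas u * two (c (s, t)) * bas r \<in> homog ((i + 2) + length r)"
    by (intro homog_mult two_in_homog bas_in_homog wu refl)
  moreover have "(i + 2) + length r = n"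
    using w wu by simp
  ultimately show "braid_at c i (bas w) \<in> homog n"
    using braid_at_word wu by metis
qed

lemma braid_at_mult_right:
  assumes "x \<in> homog n" "Suc i < n"
  shows "braid_at c i (x * bas r') = braid_at c i x * bas r'"
proof (rule lin_eqI_keys[where f = "\<lambda>x. braid_at c i (x * bas r')" and g = "\<lambda>x. braid_at c i x * bas r'"])
  fix w assume "w \<in> Poly_Mapping.keys x"
  then have w: "length w = n" using assms by (simp add: homog_def)
  then obtain u s t r where wu: "w = u @ [s, t] @ r" "length u = i"
    using split_word_at assms(2) by metis
  have "bas w * bas r' = (bas (u @ [s, t] @ (r @ r')) :: _ \<Rightarrow>\<^sub>0 'b)"
    by (simp add: wu bas_mult_list)
  then show "braid_at c i (bas w * bas r') = braid_at c i (bas w) * bas r'"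
    using wu(2) by (simp only: braid_at_word) (simp only: wu braid_at_word mult.assoc bas_mult_list)
qed (intro lin_intros lin_comp[OF lin_braid_at] lin_braid_at)+

lemma braid_sum_in_homog: "x \<in> homog n \<Longrightarrow> m < n \<Longrightarrow> braid_sum c m x \<in> homog n"
  by (induction m) (auto intro!: fv.subspace_add[OF subspace_homog] braid_at_in_homog)

lemma braid_sum_mult_right: "x \<in> homog n \<Longrightarrow> m < n \<Longrightarrow> braid_sum c m (x * bas r) = braid_sum c m x * bas r"
  by (induction m) (simp_all add: distrib_right braid_at_mult_right[OF braid_sum_in_homog])

lemma qsymm_mult_right: "x \<in> homog n \<Longrightarrow> m \<le> n \<Longrightarrow> qsymm c m (x * bas r) = qsymm c m x * bas r"
  by (induction m arbitrary: x) (simp_all add: braid_sum_mult_right braid_sum_in_homog)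

lemma lookup_mult_bas_snoc:
  "Poly_Mapping.lookup (x * bas [i]) (w @ [j]) = (if i = j then Poly_Mapping.lookup x w else (0 :: 'k::field))"
proof -
  have "x * bas [i] = (\<Sum>s\<in>Poly_Mapping.keys x. fscale (Poly_Mapping.lookup x s) (bas (s @ [i])))"
    by (subst (1) sum_fscale_bas[symmetric]) (simp add: sum_distrib_right fscale_mult bas_mult_list)
  then have "Poly_Mapping.lookup (x * bas [i]) (w @ [j])
    = (\<Sum>s\<in>Poly_Mapping.keys x. Poly_Mapping.lookup (fscale (Poly_Mapping.lookup x s) (bas (s @ [i]))) (w @ [j]))"
    by (simp only: lookup_sum)
  also have "\<dots> = (\<Sum>s\<in>Poly_Mapping.keys x. if s = w then (if i = j then Poly_Mapping.lookup x s else 0) else 0)"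
    by (rule sum.cong) (auto simp: lookup_single when_def)
  finally show ?thesis
    by (auto simp: sum.delta in_keys_iff)
qed

lemma lookup_mult_bas_Nil: "Poly_Mapping.lookup (x * bas [i]) [] = (0 :: 'k::field)"
proof -
  have "x * bas [i] = (\<Sum>s\<in>Poly_Mapping.keys x. fscale (Poly_Mapping.lookup x s) (bas (s @ [i])))"
    by (subst (1) sum_fscale_bas[symmetric]) (simp add: sum_distrib_right fscale_mult bas_mult_list)
  then show ?thesis
    by (simp add: lookup_sum lookup_single)
qed

context diag_braid
begin

definition dbr :: "'i \<times> 'i \<Rightarrow> ('i \<times> 'i \<Rightarrow>\<^sub>0 'k)" where
  "dbr = (\<lambda>(s, t). fscale (Q s t) (bas (t, s)))"

lemma dRw_in_homog: "dRw i u \<in> homog (length u - 1)"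
proof (induction u)
  case (Cons j u)
  show ?case
  proof (cases u)
    case Nil
    then show ?thesis
      by (auto simp: fv.subspace_0[OF subspace_homog] bas_in_homog)
  next
    case (Cons k v)
    have "bas [j] * dRw i u \<in> homog (1 + (length u - 1))"
      by (intro homog_mult Cons.IH bas_in_homog) simp
    then have 1: "bas [j] * dRw i u \<in> homog (length (j # u) - 1)"
      by (simp add: Cons)
    have 2: "(if i = j then fscale (qw i u) (bas u) else 0) \<in> homog (length (j # u) - 1)"
      by (auto intro!: fv.subspace_scale[OF subspace_homog] bas_in_homog fv.subspace_0[OF subspace_homog])
    show ?thesis
      unfolding dRw.simps(2)[of i j u] by (rule fv.subspace_add[OF subspace_homog 1 2])
  qed
qed (simp add: fv.subspace_0[OF subspace_homog])

text \<open>The braid sum moves each letter of \<open>u\<close> in turn to the end, and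
  \<open>dRw\<close> records the scalar for passing the letters behind it. The spectator
  \<open>r\<close> makes the induction work: the last letter of \<open>u\<close> is shifted into
  it.\<close>

lemma braid_sum_dbr:
  "length u = Suc m \<Longrightarrow> braid_sum dbr m (bas (u @ r)) = (\<Sum>i\<in>UNIV. dRw i u * bas (i # r))"
proof (induction m arbitrary: u r)
  case 0
  then obtain k where "u = [k]" by (metis length_0_conv length_Suc_conv)
  then show ?case
    by (auto simp: if_distrib[of "\<lambda>x. x * _"] bas_Nil cong: if_cong)
next
  case (Suc m)
  then obtain v k where u: "u = v @ [k]" "length v = Suc m"
    by (metis append_butlast_last_id length_0_conv length_butlast diff_Suc_1 nat.distinct(1))
  have swap: "braid_at dbr m (dRw i v * bas (i # k # r)) = fscale (Q i k) (dRw i v * bas (k # i # r))" for i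
    using braid_at_mid_homog[of "dRw i v" m dbr "bas (i, k)" "bas r"] dRw_in_homog[of i v] u
    by (simp add: dbr_def mult.assoc bas_mult_list lin_scale[OF lin_two] fscale_mult)
  have "braid_sum dbr (Suc m) (bas (u @ r)) = bas (v @ k # r)
      + (\<Sum>i\<in>UNIV. fscale (Q i k) (dRw i v * bas (k # i # r)))"
    by (simp add: u Suc.IH lin_sum[OF lin_braid_at] swap)
  also have "\<dots> = (\<Sum>i\<in>UNIV. dRw i u * bas (i # r))"
    by (auto simp: u dRw_append distrib_right sum.distrib fscale_mult mult.assoc bas_mult_list bas_Nil
        if_distrib[of "\<lambda>x. x * _"] if_distrib[of "\<lambda>x. _ * x"] cong: if_cong)
  finally show ?case .
qed

lemma quantum_symmetrizer_dbr:
  "quantum_symmetrizer dbr x = fscale (eps x) 1 + (\<Sum>i\<in>UNIV. quantum_symmetrizer dbr (dR i x) * bas [i])"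
proof (rule lin_eqI[where f = "quantum_symmetrizer dbr"
      and g = "\<lambda>x. fscale (eps x) 1 + (\<Sum>i\<in>UNIV. quantum_symmetrizer dbr (dR i x) * bas [i])"])
  fix w
  show "quantum_symmetrizer dbr (bas w)
    = fscale (eps (bas w)) 1 + (\<Sum>i\<in>UNIV. quantum_symmetrizer dbr (dR i (bas w)) * bas [i])"
  proof (cases w)
    case Nil
    have "quantum_symmetrizer dbr (bas []) = bas []"
      by (simp add: quantum_symmetrizer_def)
    then show ?thesis
      by (simp add: eps_bas bas_Nil Nil lin_0[OF lin_quantum_symmetrizer])
  next
    case (Cons a v)
    then obtain m where w: "length w = Suc m" by simp
    then have h: "dRw i w \<in> homog m" for i
      using dRw_in_homog[of i w] by simp
    have "quantum_symmetrizer dbr (bas w) = qsymm dbr m (braid_sum dbr m (bas (w @ [])))"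
      using quantum_symmetrizer_homog[OF bas_in_homog[OF w]] by simp
    also have "\<dots> = (\<Sum>i\<in>UNIV. quantum_symmetrizer dbr (dRw i w) * bas [i])"
      using braid_sum_dbr[OF w, of "[]"]
      by (simp add: lin_sum[OF lin_qsymm] qsymm_mult_right[OF h order_refl] quantum_symmetrizer_homog[OF h])
    finally show ?thesis
      by (simp add: eps_bas Cons)
  qed
next
  show "lin (\<lambda>x. fscale (eps x) 1 + (\<Sum>i\<in>UNIV. quantum_symmetrizer dbr (dR i x) * bas [i]))"
    by (intro lin_plus lin_sumI lin_multR lin_comp[OF lin_quantum_symmetrizer] lin_dR)
      (simp add: lin_def fv.scale_left_distrib)
qed (rule lin_quantum_symmetrizer)

text \<open>Every coefficient of the symmetrized element is an iterated derivative, which identifies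
  the kernel with \<open>nich\<close>. The word is reversed because its last letter is split off
  first.\<close>

lemma lookup_quantum_symmetrizer: "Poly_Mapping.lookup (quantum_symmetrizer dbr x) w = eps (dRs (rev w) x)"
proof (induction w arbitrary: x rule: rev_induct)
  case Nil
  show ?case
    by (subst quantum_symmetrizer_dbr)
      (simp add: lookup_add lookup_sum lookup_mult_bas_Nil lookup_single flip: bas_Nil)
next
  case (snoc i w)
  show ?case
    by (subst quantum_symmetrizer_dbr)
      (simp add: lookup_add lookup_sum lookup_mult_bas_snoc snoc lookup_single flip: bas_Nil cong: if_cong)
qed

lemma nich_iff_quantum_symmetrizer: "x \<in> nich \<longleftrightarrow> quantum_symmetrizer dbr x = 0"
  unfolding nich_def poly_mapping_eq_iff fun_eq_iff lookup_quantum_symmetrizer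
  by simp (metis rev_rev_ident)

end

section \<open>Infinite-dimensional Nichols algebras of rank two\<close>

locale letter_pair = diag_braid Q for Q :: "'i::finite \<Rightarrow> 'i \<Rightarrow> 'k::field" +
  fixes e f :: 'i
  assumes ef: "e \<noteq> f"
begin

abbreviation "q \<equiv> Q e e"
abbreviation "p \<equiv> Q e f * Q f e"
abbreviation "xe \<equiv> bas [e] :: 'i list \<Rightarrow>\<^sub>0 'k"
abbreviation "xf \<equiv> bas [f] :: 'i list \<Rightarrow>\<^sub>0 'k"

text \<open>
  The elements \<open>z j = (ad x\<^sub>e)\<^sup>j x\<^sub>f\<close> are killed by \<open>dR e\<close>, and \<open>dL e\<close> lowers \<open>z j\<close> to
  \<open>cz j\<close> times \<open>z (j - 1)\<close>.
\<close>

definition adx :: "('i list \<Rightarrow>\<^sub>0 'k) \<Rightarrow> ('i list \<Rightarrow>\<^sub>0 'k)" where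
  "adx x = xe * x - sg e x * xe"

primrec z :: "nat \<Rightarrow> ('i list \<Rightarrow>\<^sub>0 'k)" where
  "z 0 = xf"
| "z (Suc j) = adx (z j)"

text \<open>The quantum integer (j)_q. The scalars \<open>cz\<close> and \<open>Cz\<close> govern
  how \<open>dL e\<close> lowers \<open>z j\<close> and how \<open>dR f\<close> sends it to a power
  of \<open>xe\<close>; the first zero of \<open>cz\<close> marks the end of the root
  string.\<close>

definition qint :: "nat \<Rightarrow> 'k" where "qint j = (\<Sum>i<j. q ^ i)"
definition cz :: "nat \<Rightarrow> 'k" where "cz j = qint j * (1 - q ^ (j - 1) * p)"
definition Cz :: "nat \<Rightarrow> 'k" where "Cz j = (\<Prod>l<j. 1 - q ^ l * p)"

lemma lin_adx: "lin adx"
  unfolding adx_def by (intro lins)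

lemma adx_mult: "adx (x * y) = adx x * y + sg e x * adx y"
  by (simp add: adx_def sg_mult algebra_simps)

lemma adx_nich: "x \<in> nich \<Longrightarrow> adx x \<in> nich"
  by (simp add: adx_def nich_diff nich_mult_left nich_mult_right nich_sg)

lemma sg_z: "sg e (z j) = fscale (q ^ j * Q e f) (z j)"
  and sg_f_z: "sg f (z j) = fscale (Q f e ^ j * Q f f) (z j)"
  and tu_z: "tu e (z j) = fscale (q ^ j * Q f e) (z j)"
  and tu_f_z: "tu f (z j) = fscale (Q e f ^ j * Q f f) (z j)"
  by (induction j) (simp_all add: adx_def sg_mult tu_mult fscale_mult fv.scale_right_diff_distrib mult_ac)

lemma dR_e_z: "dR e (z j) = 0"
  by (induction j) (simp_all add: adx_def ef dR_mult sg_z fscale_mult bas_Nil)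

lemma dR_f_z: "dR f (z j) = fscale (Cz j) (xe ^ j)"
proof (induction j)
  case 0
  then show ?case by (simp add: Cz_def bas_Nil)
next
  case (Suc j)
  then show ?case
    using ef by (simp add: adx_def dR_mult sg_z fscale_mult power_commutes Cz_def algebra_simps
      flip: fv.scale_left_diff_distrib)
qed

lemma dR_other_z: "i \<noteq> e \<Longrightarrow> i \<noteq> f \<Longrightarrow> dR i (z j) = 0"
  by (induction j) (simp_all add: adx_def dR_mult sg_z fscale_mult bas_Nil)

lemma qint_Suc: "qint (Suc j) = 1 + q * qint j"
  unfolding qint_def by (subst sum.lessThan_Suc_shift) (simp add: sum_distrib_left)

lemma qint_Suc': "qint (Suc j) = qint j + q ^ j"
  by (simp add: qint_def)

text \<open>The two summands of \<open>cz\<close> use the two different recursions for quantum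
  integers. The result is the coefficient that appears when \<open>dL e\<close> is applied to
  \<open>adx (z j)\<close>.\<close>

lemma cz_Suc: "cz (Suc j) = 1 - q ^ j * (q ^ j * p) + q * cz j"
proof (cases j)
  case 0
  then show ?thesis by (simp add: cz_def qint_def)
next
  case (Suc i)
  have "cz (Suc j) = qint (Suc j) - q ^ j * p * qint (Suc j)"
    by (simp add: cz_def algebra_simps)
  also have "\<dots> = (1 + q * qint j) - q ^ j * p * (qint j + q ^ j)"
    by (simp only: qint_Suc[symmetric] qint_Suc'[symmetric])
  also have "\<dots> = 1 - q ^ j * (q ^ j * p) + q * cz j"
    by (simp add: cz_def Suc algebra_simps)
  finally show ?thesis .
qed

lemma dL_e_z: "dL e (z j) = fscale (cz j) (z (j - 1))"
proof (induction j)
  case 0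
  then show ?case using ef by (simp add: cz_def qint_def)
next
  case (Suc j)
  have "dL e (z (Suc j)) = fscale (1 - q ^ j * (q ^ j * p)) (z j)
      + fscale (cz j) (fscale q (xe * z (j - 1)) - fscale (q ^ j * Q e f) (z (j - 1) * xe))"
    by (simp add: adx_def dL_mult sg_z tu_z Suc fscale_mult bas_Nil fv.scale_right_diff_distrib
        fv.scale_right_distrib fv.scale_left_diff_distrib mult_ac)
  also have "fscale (cz j) (fscale q (xe * z (j - 1)) - fscale (q ^ j * Q e f) (z (j - 1) * xe)) = fscale (q * cz j) (z j)"
    by (cases j) (simp_all add: cz_def qint_def adx_def sg_z fscale_mult fv.scale_right_diff_distrib mult_ac)
  finally show ?case
    by (simp add: cz_Suc fv.scale_left_distrib)
qed

lemma dL_f_z: "dL f (z j) = (if j = 0 then 1 else 0)"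
proof (induction j)
  case (Suc j)
  then show ?case
    using ef by (cases "j = 0") (simp_all add: adx_def dL_mult sg_z fscale_mult bas_Nil)
qed (simp add: bas_Nil)

lemma dL_other_z: "i \<noteq> e \<Longrightarrow> i \<noteq> f \<Longrightarrow> dL i (z j) = 0"
  by (induction j) (simp_all add: adx_def dL_mult sg_z fscale_mult bas_Nil)

lemma eps_z: "eps (z j) = 0"
  by (induction j) (simp_all add: adx_def eps_mult eps_bas)

text \<open>The vanishing coefficient makes \<open>dL e\<close> kill \<open>z (Suc m)\<close>, and
  the other left derivations kill it anyway; all later root vectors follow because
  \<open>adx\<close> preserves the ideal.\<close>

lemma z_nich:
  assumes "cz (Suc m) = 0" "j > m"
  shows "z j \<in> nich"
proof -
  have "z (Suc m) \<in> nich"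
  proof (rule nichI_left)
    fix i
    show "dL i (z (Suc m)) \<in> nich"
      by (metis dL_e_z dL_f_z dL_other_z assms(1) fv.scale_zero_left nich_0 nat.distinct(1))
  qed (rule eps_z)
  moreover have "z (Suc m + d) \<in> nich" if "z (Suc m) \<in> nich" for d
    by (induction d) (use that in \<open>simp_all add: adx_nich\<close>)
  moreover obtain d where "j = Suc m + d"
    using assms(2) less_iff_Suc_add by auto
  ultimately show ?thesis by blast
qed

subsection \<open>Words in the root vectors\<close>

definition phi :: "(nat list \<Rightarrow>\<^sub>0 'k) \<Rightarrow> ('i list \<Rightarrow>\<^sub>0 'k)" where "phi = freehom z"

lemma lin_phi: "lin phi" by (simp add: phi_def lin_freehom)
lemma lin_phi_comp: "lin g \<Longrightarrow> lin (\<lambda>x. phi (g x))" by (rule lin_comp[OF lin_phi])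
lemma phi_mult: "phi (x * y) = phi x * phi y" by (simp add: phi_def freehom_mult)
lemma phi_Nil [simp]: "phi (bas []) = 1" by (simp add: phi_def freehom_bas)
lemma phi_1 [simp]: "phi 1 = 1" by (simp add: phi_def freehom_1)
lemma phi_Cons [simp]: "phi (bas (j # u)) = z j * phi (bas u)" by (simp add: phi_def freehom_bas)
lemma phi_simps [simp]: "phi (x + y) = phi x + phi y" "phi (fscale a x) = fscale a (phi x)" "phi 0 = 0"
  by (simp_all add: lin_add lin_scale lin_0 lin_phi)
lemma phi_single: "phi (bas [j]) = z j" by (simp add: bas_Nil)

lemma eps_phi: "eps (phi x) = Poly_Mapping.lookup x []"
proof -
  have "eps (phi (bas u)) = Poly_Mapping.lookup (bas u) []" for u
    by (cases u) (simp_all add: eps_mult eps_z lookup_single)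
  then show ?thesis
    by - (rule lin_fun_eqI[where f = "\<lambda>x. eps (phi x)" and g = "\<lambda>x. Poly_Mapping.lookup x []"],
        simp_all add: lookup_add)
qed

text \<open>
  On words in the \<open>z j\<close>, the operators \<open>dL e\<close> and \<open>dL f\<close> become \<open>Y\<close> and \<open>D\<^sub>0\<close>, and, if \<open>z (m + 1)\<close>
  vanishes, \<open>ad x\<^sub>e\<close> and (up to a scalar) \<open>(dR e)\<^sup>m dR f\<close> become \<open>X\<close> and \<open>D\<close>. Hence an element of the
  Nichols ideal is detected both by iterating \<open>Y, D\<^sub>0\<close> and by iterating \<open>X, D\<close>.
\<close>

fun Yw :: "nat list \<Rightarrow> (nat list \<Rightarrow>\<^sub>0 'k)" where
  "Yw [] = 0"
| "Yw (j # u) = fscale (cz j) (bas ((j - 1) # u)) + fscale (q ^ j * Q f e) (bas [j] * Yw u)"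

fun D0w :: "nat list \<Rightarrow> (nat list \<Rightarrow>\<^sub>0 'k)" where
  "D0w [] = 0"
| "D0w (j # u) = (if j = 0 then bas u else 0) + fscale (Q e f ^ j * Q f f) (bas [j] * D0w u)"

fun Xw :: "nat \<Rightarrow> nat list \<Rightarrow> (nat list \<Rightarrow>\<^sub>0 'k)" where
  "Xw m [] = 0"
| "Xw m (j # u) = (if j < m then bas (Suc j # u) else 0) + fscale (q ^ j * Q e f) (bas [j] * Xw m u)"

text \<open>The twist that the operator (dR e)^m dR f picks up on a word of root vectors: one factor
  from \<open>sg f\<close> and m factors from \<open>sg e\<close> for each letter.\<close>

definition sw :: "nat \<Rightarrow> nat list \<Rightarrow> 'k" where
  "sw m u = (\<Prod>j\<leftarrow>u. Q f e ^ j * Q f f * (q ^ j * Q e f) ^ m)"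

fun Dw :: "nat \<Rightarrow> nat list \<Rightarrow> (nat list \<Rightarrow>\<^sub>0 'k)" where
  "Dw m [] = 0"
| "Dw m (j # u) = bas [j] * Dw m u + (if j = m then fscale (sw m u) (bas u) else 0)"

definition "opY = lext Yw"
definition "opD0 = lext D0w"
definition "opX m = lext (Xw m)"
definition "opD m = lext (Dw m)"

lemma op_bas [simp]: "opY (bas u) = Yw u" "opD0 (bas u) = D0w u" "opX m (bas u) = Xw m u" "opD m (bas u) = Dw m u"
  by (simp_all add: opY_def opD0_def opX_def opD_def)

lemma lin_op: "lin opY" "lin opD0" "lin (opX m)" "lin (opD m)"
  by (simp_all add: opY_def opD0_def opX_def opD_def lin_lext)

lemma phi_opY: "phi (opY x) = dL e (phi x)"
proof -
  have "phi (Yw u) = dL e (phi (bas u))" for u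
    by (induction u) (simp_all add: dL_mult dL_e_z tu_z fscale_mult phi_mult bas_Nil)
  then show ?thesis
    by - (rule lin_eqI[where f = "\<lambda>x. phi (opY x)" and g = "\<lambda>x. dL e (phi x)"],
        simp_all add: lin_phi_comp lin_dL_comp lin_phi lin_op)
qed

lemma phi_opD0: "phi (opD0 x) = dL f (phi x)"
proof -
  have "phi (D0w u) = dL f (phi (bas u))" for u
    by (induction u) (simp_all add: dL_mult dL_f_z tu_f_z fscale_mult phi_mult bas_Nil)
  then show ?thesis
    by - (rule lin_eqI[where f = "\<lambda>x. phi (opD0 x)" and g = "\<lambda>x. dL f (phi x)"],
        simp_all add: lin_phi_comp lin_dL_comp lin_phi lin_op)
qed

lemma dL_other_phi: "i \<noteq> e \<Longrightarrow> i \<noteq> f \<Longrightarrow> dL i (phi x) = 0"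
proof -
  assume i: "i \<noteq> e" "i \<noteq> f"
  have "dL i (phi (bas u)) = 0" for u
    by (induction u) (simp_all add: dL_mult dL_other_z i)
  then show ?thesis
    by - (rule lin_eqI[where f = "\<lambda>x. dL i (phi x)" and g = "\<lambda>x. 0"], simp_all add: lin_dL_comp lin_phi lin_zero)
qed

definition opL :: "bool list \<Rightarrow> (nat list \<Rightarrow>\<^sub>0 'k) \<Rightarrow> (nat list \<Rightarrow>\<^sub>0 'k)" where
  "opL W x = fold (\<lambda>b. if b then opY else opD0) W x"

definition opR :: "nat \<Rightarrow> bool list \<Rightarrow> (nat list \<Rightarrow>\<^sub>0 'k) \<Rightarrow> (nat list \<Rightarrow>\<^sub>0 'k)" where
  "opR m W x = fold (\<lambda>b. if b then opX m else opD m) W x"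

text \<open>As in \<open>nichI_left\<close>, right derivations are exchanged one at a time for left
  ones; on the image of \<open>phi\<close> these are \<open>opY\<close>, \<open>opD0\<close> or
  zero.\<close>

lemma phi_nich_left:
  assumes "\<And>W. Poly_Mapping.lookup (opL W x) [] = 0"
  shows "phi x \<in> nich"
proof -
  have "eps (dRs (rev w) (phi x)) = 0" if "\<And>W. Poly_Mapping.lookup (opL W x) [] = 0" for w x
    using that
  proof (induction w arbitrary: x)
    case Nil
    show ?case using Nil[of "[]"] by (simp add: eps_phi opL_def)
  next
    case (Cons i w)
    have c: "dRs w (dL i y) = dL i (dRs w y)" for w y
      by (induction w arbitrary: y) (simp_all add: dL_dR_commute[symmetric])
    have "eps (dRs (rev (i # w)) (phi x)) = eps (dRs (rev w) (dL i (phi x)))"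
      by (simp add: c eps_dL_eq_dR)
    moreover have "eps (dRs (rev w) (phi (opY x))) = 0"
      by (rule Cons.IH) (use Cons.prems[of "True # W" for W] in \<open>simp add: opL_def\<close>)
    moreover have "eps (dRs (rev w) (phi (opD0 x))) = 0"
      by (rule Cons.IH) (use Cons.prems[of "False # W" for W] in \<open>simp add: opL_def\<close>)
    ultimately show ?case
      by (metis phi_opY phi_opD0 dL_other_phi lin_0[OF lin_dRs] eps_simps(4))
  qed
  from this[OF assms, of "rev w" for w] show ?thesis
    by (simp add: nich_def)
qed

definition small :: "nat \<Rightarrow> (nat list \<Rightarrow>\<^sub>0 'k) set" where
  "small m = {x. \<forall>u\<in>Poly_Mapping.keys x. \<forall>j\<in>set u. j \<le> m}"

lemma subspace_small: "fv.subspace (small m)"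
proof (rule fv.subspaceI)
  fix x y :: "nat list \<Rightarrow>\<^sub>0 'k" and c :: 'k
  assume x: "x \<in> small m"
  then show "fscale c x \<in> small m"
    by (auto simp: small_def in_keys_iff)
  assume "y \<in> small m"
  then show "x + y \<in> small m"
    using x Poly_Mapping.keys_add[of x y] by (fastforce simp: small_def)
qed (simp add: small_def)

lemmas small_rules = fv.subspace_0[OF subspace_small] fv.subspace_add[OF subspace_small] fv.subspace_scale[OF subspace_small]

lemma bas_small: "bas u \<in> small m \<longleftrightarrow> (\<forall>j\<in>set u. j \<le> m)"
  by (simp add: small_def)

lemma bas_mult_small:
  assumes "j \<le> m" "x \<in> small m"
  shows "bas [j] * x \<in> small m"
  by (rule lin_into_subspace[OF lin_multL[OF lin_id] subspace_small])
    (use assms in \<open>auto simp: bas_mult_list small_def\<close>)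

lemma opX_small: "x \<in> small m \<Longrightarrow> opX m x \<in> small m"
proof (rule lin_into_subspace[OF lin_op(3) subspace_small])
  have "Xw m u \<in> small m" if "\<forall>j\<in>set u. j \<le> m" for u
    using that by (induction u) (auto intro!: small_rules bas_mult_small simp: bas_small)
  then show "x \<in> small m \<Longrightarrow> u \<in> Poly_Mapping.keys x \<Longrightarrow> opX m (bas u) \<in> small m" for u
    unfolding op_bas by (metis (no_types, lifting) small_def mem_Collect_eq)
qed

lemma opD_small: "x \<in> small m \<Longrightarrow> opD m x \<in> small m"
proof (rule lin_into_subspace[OF lin_op(4) subspace_small])
  have "Dw m u \<in> small m" if "\<forall>j\<in>set u. j \<le> m" for u
    using that by (induction u) (auto intro!: small_rules bas_mult_small simp: bas_small)
  then show "x \<in> small m \<Longrightarrow> u \<in> Poly_Mapping.keys x \<Longrightarrow> opD m (bas u) \<in> small m" for u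
    unfolding op_bas by (metis (no_types, lifting) small_def mem_Collect_eq)
qed

text \<open>Unlike \<open>phi_opY\<close>, this holds only modulo the ideal: where \<open>Xw\<close>
  drops a letter m, the operator \<open>adx\<close> produces the factor
  \<open>z (Suc m)\<close>.\<close>

lemma phi_opX:
  assumes "z (Suc m) \<in> nich" "x \<in> small m"
  shows "adx (phi x) - phi (opX m x) \<in> nich"
proof (rule lin_into_subspace[where f = "\<lambda>x. adx (phi x) - phi (opX m x)"])
  have w: "adx (phi (bas u)) - phi (Xw m u) \<in> nich" if "\<forall>j\<in>set u. j \<le> m" for u
    using that
  proof (induction u)
    case Nil
    then show ?case by (simp add: adx_def nich_0)
  next
    case (Cons j u)
    have "adx (phi (bas (j # u))) - phi (Xw m (j # u))
      = (if j < m then 0 else z (Suc j) * phi (bas u))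
        + fscale (q ^ j * Q e f) (z j * (adx (phi (bas u)) - phi (Xw m u)))"
      by (simp add: adx_mult sg_z fscale_mult phi_mult phi_single algebra_simps fv.scale_right_diff_distrib)
    moreover have "(if j < m then 0 else z (Suc j) * phi (bas u)) \<in> nich"
      using Cons.prems assms(1) by (auto simp: nich_0 le_less intro!: nich_mult_right simp del: z.simps)
    ultimately show ?case
      using Cons by (simp add: nich_add nich_scale nich_mult_left)
  qed
  show "adx (phi (bas u)) - phi (opX m (bas u)) \<in> nich" if "u \<in> Poly_Mapping.keys x" for u
    using that w assms by (simp add: small_def)
qed (intro lin_sub lin_comp[OF lin_adx] lin_phi lin_phi_comp lin_op subspace_nich)+

definition DD :: "nat \<Rightarrow> ('i list \<Rightarrow>\<^sub>0 'k) \<Rightarrow> ('i list \<Rightarrow>\<^sub>0 'k)" where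
  "DD m x = (dR e ^^ m) (dR f x)"

lemma lin_dR_pow: "lin (dR i ^^ m)"
  by (induction m) (simp_all add: lin_def lin_add[OF lin_dR] lin_scale[OF lin_dR])

lemma lin_DD: "lin (DD m)"
  unfolding DD_def by (intro lin_comp[OF lin_dR_pow] lin_dR)

lemma nich_DD: "x \<in> nich \<Longrightarrow> DD m x \<in> nich"
proof -
  have "y \<in> nich \<Longrightarrow> (dR e ^^ m) y \<in> nich" for y
    by (induction m) (simp_all add: nich_dR)
  then show "x \<in> nich \<Longrightarrow> DD m x \<in> nich"
    by (simp add: DD_def nich_dR)
qed

lemma dR_xe_pow: "dR e (xe ^ Suc j) = fscale (qint (Suc j)) (xe ^ j)"
proof (induction j)
  case (Suc j)
  have "dR e (xe ^ Suc (Suc j)) = dR e (xe ^ Suc j * xe)"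
    by (simp only: power_Suc2)
  also have "\<dots> = xe ^ Suc j + fscale (q * qint (Suc j)) (xe ^ Suc j)"
    by (simp only: dR_mult Suc) (simp add: bas_Nil fscale_mult power_commutes)
  also have "\<dots> = fscale (qint (Suc (Suc j))) (xe ^ Suc j)"
    by (simp add: qint_Suc[of "Suc j"] fv.scale_left_distrib)
  finally show ?case .
qed (simp add: bas_Nil qint_def)

definition qfact :: "nat \<Rightarrow> 'k" where "qfact m = (\<Prod>i<m. qint (Suc i))"

lemma dR_pow_xe: "j \<le> m \<Longrightarrow> (dR e ^^ m) (xe ^ j) = (if j = m then fscale (qfact m) 1 else 0)"
proof (induction m arbitrary: j)
  case (Suc m)
  show ?case
  proof (cases j)
    case 0
    have "(dR e ^^ m) 0 = 0" using lin_0[OF lin_dR_pow] .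
    then show ?thesis by (simp add: 0 funpow_swap1)
  next
    case (Suc i)
    have "(dR e ^^ Suc m) (xe ^ j) = fscale (qint (Suc i)) ((dR e ^^ m) (xe ^ i))"
      unfolding funpow_Suc_right comp_def Suc dR_xe_pow by (simp add: lin_scale[OF lin_dR_pow])
    then show ?thesis
      using Suc.IH[of i] Suc.prems Suc by (auto simp: qfact_def mult_ac)
  qed
qed (simp add: qfact_def)

text \<open>\<open>dR f\<close> turns \<open>z j\<close> into a multiple of the j-th power of
  \<open>xe\<close>, and m further derivations kill every power below the m-th. So among the indices
  up to m only the top root vector survives.\<close>

lemma DD_z: "j \<le> m \<Longrightarrow> DD m (z j) = (if j = m then fscale (Cz m * qfact m) 1 else 0)"
  by (simp add: DD_def dR_f_z lin_scale[OF lin_dR_pow] dR_pow_xe)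

lemma dR_e_phi: "dR e (phi (bas u)) = 0"
  by (induction u) (simp_all add: dR_mult dR_e_z)

lemma DD_mult:
  assumes x: "dR e x = 0" and y: "dR e y = 0" and s: "sg f y = fscale a y" "sg e y = fscale b y"
  shows "DD m (x * y) = x * DD m y + fscale (a * b ^ m) (DD m x * y)"
proof -
  have 1: "(dR e ^^ m) (x * w) = x * (dR e ^^ m) w" for w
    by (induction m) (simp_all add: dR_mult x)
  have 2: "(dR e ^^ m) (w * y) = fscale (b ^ m) ((dR e ^^ m) w * y)" for w
    by (induction m) (simp_all add: dR_mult y s fscale_mult mult_ac)
  show ?thesis
    by (simp add: DD_def dR_mult lin_add[OF lin_dR_pow] 1 s fscale_mult lin_scale[OF lin_dR_pow] 2)
qed

lemma sg_phi:
  "sg f (phi (bas u)) = fscale (\<Prod>j\<leftarrow>u. Q f e ^ j * Q f f) (phi (bas u))"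
  "sg e (phi (bas u)) = fscale (\<Prod>j\<leftarrow>u. q ^ j * Q e f) (phi (bas u))"
  by (induction u) (simp_all add: sg_mult sg_z sg_f_z fscale_mult mult_ac)

lemma sw_eq: "sw m u = (\<Prod>j\<leftarrow>u. Q f e ^ j * Q f f) * (\<Prod>j\<leftarrow>u. q ^ j * Q e f) ^ m"
  unfolding sw_def by (induction u) (simp_all add: power_mult_distrib mult_ac)

lemma phi_opD:
  assumes "x \<in> small m"
  shows "fscale (Cz m * qfact m) (phi (opD m x)) = DD m (phi x)"
proof (rule lin_eqI_keys[where f = "\<lambda>x. fscale (Cz m * qfact m) (phi (opD m x))" and g = "\<lambda>x. DD m (phi x)"])
  have w: "fscale (Cz m * qfact m) (phi (Dw m u)) = DD m (phi (bas u))" if "\<forall>j\<in>set u. j \<le> m" for u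
    using that
  proof (induction u)
    case Nil
    have "DD m 1 = 0" by (simp add: DD_def lin_0[OF lin_dR_pow])
    then show ?case by simp
  next
    case (Cons j u)
    have "DD m (phi (bas (j # u))) = z j * DD m (phi (bas u)) + fscale (sw m u) (DD m (z j) * phi (bas u))"
      by (simp add: DD_mult[OF dR_e_z dR_e_phi sg_phi] sw_eq)
    also have "\<dots> = fscale (Cz m * qfact m) (phi (Dw m (j # u)))"
      using Cons by (auto simp: DD_z phi_mult phi_single fscale_mult fv.scale_right_distrib mult_ac simp flip: Cons.IH)
    finally show ?case by simp
  qed
  show "fscale (Cz m * qfact m) (phi (opD m (bas u))) = DD m (phi (bas u))" if "u \<in> Poly_Mapping.keys x" for u
    using that w assms by (simp add: small_def)
qed (intro lin_smul lin_phi_comp lin_op lin_comp[OF lin_DD] lin_phi)+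

text \<open>Both operators come from maps that preserve the ideal, so iterating them from an element
  of the ideal never reaches a nonzero constant term.\<close>

lemma phi_nich_right:
  assumes "z (Suc m) \<in> nich" "Cz m * qfact m \<noteq> 0" "x \<in> small m" "phi x \<in> nich"
  shows "Poly_Mapping.lookup (opR m W x) [] = 0"
  using assms(3,4)
proof (induction W arbitrary: x)
  case Nil
  then show ?case
    using nich_eps[of "phi x"] by (simp add: opR_def eps_phi)
next
  case (Cons b W)
  have "phi (opX m x) \<in> nich"
    using nich_diff[OF adx_nich[OF Cons.prems(2)] phi_opX[OF assms(1) Cons.prems(1)]] by simp
  moreover have "phi (opD m x) \<in> nich"
  proof -
    have "fscale (inverse (Cz m * qfact m) * (Cz m * qfact m)) (phi (opD m x)) \<in> nich"
      using nich_scale[OF nich_DD[OF Cons.prems(2), of m], of "inverse (Cz m * qfact m)"]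
      by (simp flip: phi_opD[OF Cons.prems(1)])
    then show ?thesis using assms(2) by (metis fv.scale_one left_inverse)
  qed
  ultimately show ?case
    using Cons.IH[of "opX m x"] Cons.IH[of "opD m x"] Cons.prems opX_small opD_small
    by (simp add: opR_def)
qed

end

subsection \<open>The reflection of words in the root vectors\<close>

text \<open>
  An elementary form of the reflection of a Nichols algebra at \<open>e\<close>: reversing a word and replacing
  each \<open>z j\<close> by \<open>z (m - j)\<close> exchanges \<open>(Y, D\<^sub>0)\<close> with \<open>(X, D)\<close> up to scalars, hence it preserves
  nonvanishing. For a word of length \<open>b\<close>, the sum \<open>a\<close> of the indices changes to \<open>m b - a\<close>, so that
  few letters \<open>e\<close> are turned into many. For \<open>m, m' \<ge> 2\<close>, alternating the reflections at \<open>e\<close> and \<open>f\<close>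
  yields arbitrarily long nonvanishing words.
\<close>

locale cartan_pair = letter_pair Q e f for Q :: "'i::finite \<Rightarrow> 'i \<Rightarrow> 'k::field" and e f +
  fixes m :: nat
  assumes cartan: "q ^ m * p = 1" and cz_nz: "\<And>j. 1 \<le> j \<Longrightarrow> j \<le> m \<Longrightarrow> cz j \<noteq> 0" and m_pos: "m \<ge> 1"
begin

lemma nonzero: "q \<noteq> 0" "Q e f \<noteq> 0" "Q f e \<noteq> 0"
  using cartan m_pos by (auto simp: power_0_left)

lemma cz_top: "cz (Suc m) = 0"
  using cartan by (simp add: cz_def)

lemma Cz_qfact: "Cz m * qfact m \<noteq> 0"
proof -
  have "Cz m * qfact m = (\<Prod>j<m. cz (Suc j))"
    by (simp add: Cz_def qfact_def cz_def prod.distrib mult.commute)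
  then show ?thesis
    using cz_nz by simp
qed

definition rv :: "nat list \<Rightarrow> nat list" where "rv u = rev (map (\<lambda>j. m - j) u)"

text \<open>Normalising scalars, chosen so that lowering a letter before the reversal matches
  raising it afterwards; see their use in \<open>opX_RR_word\<close>.\<close>

primrec ff :: "nat \<Rightarrow> 'k" where
  "ff 0 = 1"
| "ff (Suc j) = cz (Suc j) * ff j / (q ^ Suc j * Q f e)"

definition ffw :: "nat list \<Rightarrow> 'k" where "ffw u = (\<Prod>j\<leftarrow>u. ff j)"

definition RR :: "(nat list \<Rightarrow>\<^sub>0 'k) \<Rightarrow> (nat list \<Rightarrow>\<^sub>0 'k)" where
  "RR = lext (\<lambda>u. fscale (ffw u) (bas (rv u)))"

lemma lin_RR: "lin RR" by (simp add: RR_def lin_lext)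

lemma RR_simps [simp]: "RR (x + y) = RR x + RR y" "RR (fscale a x) = fscale a (RR x)" "RR 0 = 0"
  by (simp_all add: lin_add lin_scale lin_0 lin_RR)

lemma RR_bas [simp]: "RR (bas u) = fscale (ffw u) (bas (rv u))"
  by (simp add: RR_def)

lemma rv_simps [simp]: "rv [] = []" "rv (j # u) = rv u @ [m - j]"
  by (simp_all add: rv_def)

lemma ffw_simps [simp]: "ffw [] = 1" "ffw (j # u) = ff j * ffw u"
  by (simp_all add: ffw_def)

lemma RR_letter_mult: "RR (bas [j] * x) = fscale (ff j) (RR x * bas [m - j])"
  by (rule lin_eqI[where f = "\<lambda>x. RR (bas [j] * x)" and g = "\<lambda>x. fscale (ff j) (RR x * bas [m - j])"])
    (auto intro!: lin_intros lin_comp[OF lin_RR] lin_RR simp: bas_mult_list fscale_mult)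

lemma Xw_append: "Xw m (u @ v) = Xw m u * bas v + fscale (\<Prod>j\<leftarrow>u. q ^ j * Q e f) (bas u * Xw m v)"
proof (induction u)
  case (Cons j u)
  have "bas (j # u) * x = bas [j] * (bas u * x)" for x :: "nat list \<Rightarrow>\<^sub>0 'k"
    by (simp add: bas_mult_list flip: mult.assoc)
  then show ?case
    by (simp add: Cons bas_mult_list distrib_left distrib_right fscale_mult mult.assoc fv.scale_right_distrib)
qed (simp add: bas_Nil)

lemma Dw_append: "Dw m (u @ v) = bas u * Dw m v + fscale (sw m v) (Dw m u * bas v)"
proof (induction u)
  case (Cons j u)
  have "bas (j # u) * x = bas [j] * (bas u * x)" for x :: "nat list \<Rightarrow>\<^sub>0 'k"
    by (simp add: bas_mult_list flip: mult.assoc)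
  then show ?case
    by (simp add: Cons bas_mult_list distrib_left distrib_right fscale_mult mult.assoc fv.scale_right_distrib
        sw_def mult.commute)
qed (simp add: bas_Nil)

lemma opD_snoc: "opD m (x * bas [j]) = (if j = m then x else 0) + fscale (sw m [j]) (opD m x * bas [j])"
proof (rule lin_eqI[where f = "\<lambda>x. opD m (x * bas [j])"
        and g = "\<lambda>x. (if j = m then x else 0) + fscale (sw m [j]) (opD m x * bas [j])"])
  have "lin (\<lambda>x :: nat list \<Rightarrow>\<^sub>0 'k. if j = m then x else 0)"
    by (simp add: lin_def)
  then show "lin (\<lambda>x. (if j = m then x else 0) + fscale (sw m [j]) (opD m x * bas [j]))"
    by (intro lin_intros lin_op)
qed (auto intro!: lin_intros lin_comp[OF lin_op(4)] lin_op simp: bas_mult_list Dw_append sw_def bas_Nil)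

text \<open>The reversal turns the twist of \<open>opD\<close> into that of \<open>opD0\<close>. The
  computation splits off a power of q^m \<open>Q e f\<close> \<open>Q f e\<close>, which is 1; this
  is why the Cartan integer must come from this equation and not from a vanishing quantum
  integer.\<close>

lemma sw_reflect:
  assumes "j \<le> m"
  shows "sw m [m - j] = Q e f ^ j * Q f f"
proof -
  obtain i where m: "m = i + j" using assms by (metis le_add_diff_inverse2)
  have "Q f e ^ i * (q ^ i * Q e f) ^ m = (q ^ m * Q e f * Q f e) ^ i * Q e f ^ j"
    by (simp add: m power_add power_mult_distrib power_mult[symmetric] mult_ac add_mult_distrib2)
  then show ?thesis
    using cartan by (simp add: sw_def m mult_ac)
qed

lemma opD_RR:
  assumes "x \<in> small m"
  shows "opD m (RR x) = RR (opD0 x)"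
proof (rule lin_eqI_keys[where f = "\<lambda>x. opD m (RR x)" and g = "\<lambda>x. RR (opD0 x)"])
  have w: "opD m (RR (bas u)) = RR (D0w u)" if "\<forall>j\<in>set u. j \<le> m" for u
    using that
  proof (induction u)
    case Nil
    then show ?case by (simp add: bas_Nil[symmetric])
  next
    case (Cons j u)
    have "opD m (RR (bas (j # u))) = fscale (ff j) (opD m (RR (bas u) * bas [m - j]))"
      using RR_letter_mult[of j "bas u"] by (simp add: bas_mult_list lin_scale[OF lin_op(4)])
    also have "\<dots> = fscale (ff j) ((if m - j = m then RR (bas u) else 0)
        + fscale (Q e f ^ j * Q f f) (RR (D0w u) * bas [m - j]))"
      using Cons sw_reflect[of j] by (simp only: opD_snoc) simp
    also have "\<dots> = RR (D0w (j # u))"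
      using m_pos Cons.prems by (auto simp: RR_letter_mult fv.scale_right_distrib mult_ac)
    finally show ?case .
  qed
  show "opD m (RR (bas u)) = RR (opD0 (bas u))" if "u \<in> Poly_Mapping.keys x" for u
    using that w assms by (simp add: small_def)
qed (intro lin_comp[OF lin_op(4)] lin_comp[OF lin_RR] lin_RR lin_op)+

definition th :: "nat list \<Rightarrow> 'k" where "th u = (\<Prod>j\<leftarrow>u. inverse (q ^ j * Q f e))"

lemma th_simps [simp]: "th [] = 1" "th (j # u) = inverse (q ^ j * Q f e) * th u"
  by (simp_all add: th_def)

lemma chi_rv: "\<forall>j\<in>set u. j \<le> m \<Longrightarrow> (\<Prod>j\<leftarrow>rv u. q ^ j * Q e f) = th u"
proof (induction u)
  case (Cons j u)
  then obtain i where m: "m = i + j" by (metis le_add_diff_inverse2 list.set_intros(1))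
  have "q ^ (m - j) * Q e f * (q ^ j * Q f e) = 1"
    using cartan by (simp add: m power_add mult_ac)
  then have "q ^ (m - j) * Q e f = inverse (q ^ j * Q f e)"
    by (metis inverse_unique mult.commute)
  then show ?case
    using Cons by (simp add: mult_ac)
qed simp

text \<open>The discrepancy \<open>th u\<close> depends only on the sum and the length of u
  (\<open>th_eq\<close>). Iteration therefore works on elements homogeneous in both, which is the
  purpose of \<open>hom2\<close>.\<close>

lemma opX_RR_word:
  "\<forall>j\<in>set u. j \<le> m \<Longrightarrow> opX m (RR (bas u)) = fscale (th u) (RR (Yw u))"
proof (induction u)
  case Nil
  then show ?case by (simp add: bas_Nil[symmetric])
next
  case (Cons j u)
  have X1: "Xw m [m - j] = (if j = 0 then 0 else bas [m - (j - 1)])"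
    using Cons.prems m_pos by (auto simp: Suc_diff_le)
  have ff: "j > 0 \<Longrightarrow> ff j = inverse (q ^ j * Q f e) * (cz j * ff (j - 1))"
    by (cases j) (simp_all add: divide_inverse mult_ac)
  have "opX m (RR (bas (j # u))) = fscale (ff j) (opX m (RR (bas u)) * bas [m - j])
      + fscale (ff j * ffw u * th u) (bas (rv u) * Xw m [m - j])"
    using Cons.prems
    by (simp add: lin_scale[OF lin_op(3)] Xw_append chi_rv fv.scale_right_distrib fscale_mult del: Xw.simps)
  also have "\<dots> = fscale (ff j * th u) (RR (Yw u) * bas [m - j])
      + (if j = 0 then 0 else fscale (ff j * ffw u * th u) (bas (rv u @ [m - (j - 1)])))"
    using Cons by (simp add: X1 fscale_mult bas_mult_list del: Xw.simps)
  also have "\<dots> = fscale (th (j # u)) (RR (Yw (j # u)))"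
    using ff by (auto simp: RR_letter_mult fv.scale_right_distrib mult_ac nonzero cz_def qint_def)
  finally show ?case .
qed

definition hom2 :: "nat \<Rightarrow> nat \<Rightarrow> (nat list \<Rightarrow>\<^sub>0 'k) set" where
  "hom2 a b = {x. \<forall>u\<in>Poly_Mapping.keys x. sum_list u = a \<and> length u = b \<and> (\<forall>j\<in>set u. j \<le> m)}"

lemma subspace_hom2: "fv.subspace (hom2 a b)"
proof (rule fv.subspaceI)
  fix x y :: "nat list \<Rightarrow>\<^sub>0 'k" and c :: 'k
  assume x: "x \<in> hom2 a b"
  then show "fscale c x \<in> hom2 a b"
    by (auto simp: hom2_def in_keys_iff)
  assume "y \<in> hom2 a b"
  then show "x + y \<in> hom2 a b"
    using x Poly_Mapping.keys_add[of x y] by (fastforce simp: hom2_def)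
qed (simp add: hom2_def)

lemmas hom2_rules = fv.subspace_0[OF subspace_hom2] fv.subspace_add[OF subspace_hom2] fv.subspace_scale[OF subspace_hom2]

lemma bas_hom2: "bas u \<in> hom2 a b \<longleftrightarrow> sum_list u = a \<and> length u = b \<and> (\<forall>j\<in>set u. j \<le> m)"
  by (simp add: hom2_def)

lemma letter_hom2:
  assumes "x \<in> hom2 a b" "j \<le> m"
  shows "bas [j] * x \<in> hom2 (j + a) (Suc b)"
  by (rule lin_into_subspace[OF lin_multL[OF lin_id] subspace_hom2])
    (use assms in \<open>auto simp: bas_mult_list hom2_def\<close>)

lemma hom2_into:
  assumes "lin g" "x \<in> hom2 a b" "fv.subspace V"
    and "\<And>u. sum_list u = a \<Longrightarrow> length u = b \<Longrightarrow> \<forall>j\<in>set u. j \<le> m \<Longrightarrow> g (bas u) \<in> V"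
  shows "g x \<in> V"
  by (rule lin_into_subspace[OF assms(1,3)]) (use assms(2,4) in \<open>auto simp: hom2_def\<close>)

lemma Yw_hom2: "\<forall>j\<in>set u. j \<le> m \<Longrightarrow> Yw u \<in> hom2 (sum_list u - 1) (length u)"
proof (induction u)
  case (Cons j u)
  have 1: "fscale (cz j) (bas ((j - 1) # u)) \<in> hom2 (sum_list (j # u) - 1) (length (j # u))"
    using Cons.prems by (cases j) (auto intro!: hom2_rules simp: bas_hom2 cz_def qint_def)
  have "bas [j] * Yw u \<in> hom2 (j + (sum_list u - 1)) (Suc (length u))"
    using Cons by (intro letter_hom2) auto
  moreover have "sum_list u = 0 \<Longrightarrow> Yw u = 0"
    by (induction u) (auto simp: cz_def qint_def)
  ultimately have 2: "fscale (q ^ j * Q f e) (bas [j] * Yw u) \<in> hom2 (sum_list (j # u) - 1) (length (j # u))"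
    by (cases "sum_list u = 0") (auto intro!: hom2_rules)
  show ?case
    unfolding Yw.simps by (rule hom2_rules(2)[OF 1 2])
qed (simp add: hom2_rules)

lemma D0w_hom2: "\<forall>j\<in>set u. j \<le> m \<Longrightarrow> D0w u \<in> hom2 (sum_list u) (length u - 1)"
proof (induction u)
  case (Cons j u)
  have 1: "(if j = 0 then bas u else 0) \<in> hom2 (sum_list (j # u)) (length (j # u) - 1)"
    using Cons.prems by (auto intro!: hom2_rules simp: bas_hom2)
  have "bas [j] * D0w u \<in> hom2 (j + sum_list u) (Suc (length u - 1))"
    using Cons by (intro letter_hom2) auto
  then have 2: "fscale (Q e f ^ j * Q f f) (bas [j] * D0w u) \<in> hom2 (sum_list (j # u)) (length (j # u) - 1)"
    by (cases u) (auto intro!: hom2_rules)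
  show ?case
    unfolding D0w.simps by (rule hom2_rules(2)[OF 1 2])
qed (simp add: hom2_rules)

lemma th_eq: "th u = inverse (q ^ sum_list u * Q f e ^ length u)"
  by (induction u) (simp_all add: power_add mult_ac)

lemma opX_RR:
  assumes "x \<in> hom2 a b"
  shows "opX m (RR x) = fscale (inverse (q ^ a * Q f e ^ b)) (RR (opY x))"
  by (rule lin_eqI_keys[where f = "\<lambda>x. opX m (RR x)" and g = "\<lambda>x. fscale (inverse (q ^ a * Q f e ^ b)) (RR (opY x))"])
    (use assms in \<open>auto intro!: lin_comp[OF lin_op(3)] lin_comp[OF lin_RR] lin_RR lin_op lin_smul
        simp: hom2_def opX_RR_word th_eq simp del: RR_bas\<close>)

lemma opR_scale: "opR m W (fscale a x) = fscale a (opR m W x)"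
  by (induction W arbitrary: x) (simp_all add: opR_def lin_scale[OF lin_op(3)] lin_scale[OF lin_op(4)])

lemma opR_RR:
  "x \<in> hom2 a b \<Longrightarrow> \<exists>s. s \<noteq> 0 \<and> opR m W (RR x) = fscale s (RR (opL W x))"
proof (induction W arbitrary: x a b)
  case Nil
  show ?case by (auto simp: opR_def opL_def intro!: exI[of _ 1])
next
  case (Cons B W)
  show ?case
  proof (cases B)
    case True
    have "opY x \<in> hom2 (a - 1) b"
      by (rule hom2_into[OF lin_op(1) Cons.prems subspace_hom2]) (metis Yw_hom2 op_bas(1))
    then obtain s where "s \<noteq> 0" "opR m W (RR (opY x)) = fscale s (RR (opL W (opY x)))"
      using Cons.IH by blast
    then show ?thesis
      using opX_RR[OF Cons.prems] True opR_scale[of W] nonzero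
      by (intro exI[of _ "inverse (q ^ a * Q f e ^ b) * s"]) (simp add: opR_def opL_def)
  next
    case False
    have "opD0 x \<in> hom2 a (b - 1)"
      by (rule hom2_into[OF lin_op(2) Cons.prems subspace_hom2]) (metis D0w_hom2 op_bas(2))
    then obtain s where "s \<noteq> 0" "opR m W (RR (opD0 x)) = fscale s (RR (opL W (opD0 x)))"
      using Cons.IH by blast
    moreover have "x \<in> small m"
      using Cons.prems by (auto simp: hom2_def small_def)
    ultimately show ?thesis
      using opD_RR[of x] False by (auto simp: opR_def opL_def)
  qed
qed

lemma lookup_RR_Nil: "Poly_Mapping.lookup (RR x) [] = Poly_Mapping.lookup x []"
proof (rule lin_fun_eqI[where f = "\<lambda>x. Poly_Mapping.lookup (RR x) []" and g = "\<lambda>x. Poly_Mapping.lookup x []"])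
  show "Poly_Mapping.lookup (RR (bas s)) [] = Poly_Mapping.lookup (bas s) []" for s
    by (cases s) (simp_all add: lookup_single)
qed (simp_all add: lookup_add)

text \<open>Some operator word W detects \<open>u\<close> from the left. \<open>opR_RR\<close>
  carries W to the right-hand operators acting on the reversed word, where an element of the ideal
  would give no constant term.\<close>

lemma reflect:
  assumes "\<forall>j\<in>set u. j \<le> m" "phi (bas u) \<notin> nich"
  shows "phi (bas (rv u)) \<notin> nich"
proof
  assume n: "phi (bas (rv u)) \<in> nich"
  obtain W where W: "Poly_Mapping.lookup (opL W (bas u)) [] \<noteq> 0"
    using phi_nich_left assms(2) by blast
  have "bas u \<in> hom2 (sum_list u) (length u)"
    using assms(1) by (simp add: bas_hom2)
  then obtain s where s: "s \<noteq> 0" "opR m W (RR (bas u)) = fscale s (RR (opL W (bas u)))"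
    using opR_RR by blast
  have "RR (bas u) \<in> small m"
    by (auto intro!: small_rules simp: bas_small rv_def)
  moreover have "phi (RR (bas u)) \<in> nich"
    using n by (simp add: nich_scale)
  ultimately have "Poly_Mapping.lookup (opR m W (RR (bas u))) [] = 0"
    by (intro phi_nich_right z_nich[OF cz_top] Cz_qfact) simp_all
  then show False
    using W s by (simp add: lookup_RR_Nil)
qed

end

section \<open>Bidegrees, and passing between words in the letters and words in the root
  vectors\<close>

context letter_pair
begin

definition wdeg :: "nat \<Rightarrow> nat \<Rightarrow> ('i list \<Rightarrow>\<^sub>0 'k) set" where
  "wdeg a b = fv.span {bas w | w. set w \<subseteq> {e, f} \<and> count_list w e = a \<and> count_list w f = b}"

lemma bas_wdeg: "set w \<subseteq> {e, f} \<Longrightarrow> bas w \<in> wdeg (count_list w e) (count_list w f)"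
  unfolding wdeg_def by (rule fv.span_base) blast

lemma wdeg_mult: "x \<in> wdeg a b \<Longrightarrow> y \<in> wdeg c d \<Longrightarrow> x * y \<in> wdeg (a + c) (b + d)"
proof -
  assume x: "x \<in> wdeg a b" and y: "y \<in> wdeg c d"
  have s: "fv.subspace (wdeg (a + c) (b + d))" by (simp add: wdeg_def)
  have "bas w * y \<in> wdeg (a + c) (b + d)" if "set w \<subseteq> {e, f}" "count_list w e = a" "count_list w f = b" for w
  proof (rule lin_span_into[OF lin_multL[OF lin_id] s _ y[unfolded wdeg_def]])
    fix x :: "'i list \<Rightarrow>\<^sub>0 'k"
    assume "x \<in> {bas w | w. set w \<subseteq> {e, f} \<and> count_list w e = c \<and> count_list w f = d}"
    then obtain v where "x = bas v" "set v \<subseteq> {e, f}" "count_list v e = c" "count_list v f = d" by blast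
    then show "bas w * x \<in> wdeg (a + c) (b + d)"
      using bas_wdeg[of "w @ v"] that by (simp add: bas_mult_list)
  qed
  then show ?thesis
    by - (rule lin_span_into[OF lin_multR[OF lin_id] s _ x[unfolded wdeg_def]], auto)
qed

lemma wdeg_letters: "xe \<in> wdeg 1 0" "xf \<in> wdeg 0 1" "1 \<in> wdeg 0 0"
  using ef ef[symmetric] bas_wdeg[of "[e]"] bas_wdeg[of "[f]"] bas_wdeg[of "[]"] by (simp_all add: bas_Nil)

lemma z_wdeg: "z j \<in> wdeg j 1"
proof (induction j)
  case (Suc j)
  have "xe * z j \<in> wdeg (1 + j) (0 + 1)" "z j * xe \<in> wdeg (j + 1) (1 + 0)"
    by (intro wdeg_mult Suc wdeg_letters)+
  then show ?case
    by (simp add: adx_def sg_z fscale_mult wdeg_def fv.span_diff fv.span_scale)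
qed (simp add: wdeg_letters[simplified])

lemma phi_wdeg: "phi (bas u) \<in> wdeg (sum_list u) (length u)"
proof (induction u)
  case (Cons j u)
  then show ?case using wdeg_mult[OF z_wdeg[of j] Cons] by simp
qed (simp add: wdeg_letters[simplified])

lemma wdeg_notin_nich:
  assumes "x \<in> wdeg a b" "x \<notin> nich"
  obtains w where "set w \<subseteq> {e, f}" "count_list w e = a" "count_list w f = b" "bas w \<notin> nich"
proof -
  have "wdeg a b \<subseteq> nich" if "\<And>w. set w \<subseteq> {e, f} \<Longrightarrow> count_list w e = a \<Longrightarrow> count_list w f = b \<Longrightarrow> bas w \<in> nich"
    unfolding wdeg_def by (rule fv.span_minimal[OF _ subspace_nich]) (use that in blast)
  then show ?thesis
    using assms that by blast
qed

text \<open>A PBW normal form for the pair: moving \<open>xe\<close> to the right past root vectors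
  only raises an index, so the number of root vectors stays equal to the number of letters
  f.\<close>

lemma word_in_phi_span:
  "set w \<subseteq> {e, f} \<Longrightarrow> bas w \<in> fv.span {phi (bas u) * xe ^ i | u i. length u = count_list w f}"
proof (induction w)
  case Nil
  have "1 = phi (bas []) * xe ^ 0" by simp
  then show ?case
    unfolding bas_Nil by (intro fv.span_base CollectI exI[of _ "[]"] exI[of _ 0]) simp
next
  case (Cons l w)
  let ?S = "\<lambda>b. {phi (bas u) * xe ^ i | u i. length u = b}"
  have IH: "bas w \<in> fv.span (?S (count_list w f))"
    using Cons by simp
  have "bas [l] * bas w \<in> fv.span (?S (count_list (l # w) f))"
  proof (rule lin_span_into[OF lin_multL[OF lin_id] _ _ IH])
    fix x assume "x \<in> ?S (count_list w f)"
    then obtain u i where x: "x = phi (bas u) * xe ^ i" "length u = count_list w f" by blast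
    consider "l = f" | "l = e" using Cons.prems by auto
    then show "bas [l] * x \<in> fv.span (?S (count_list (l # w) f))"
    proof cases
      case 1
      have "bas [l] * x = phi (bas (0 # u)) * xe ^ i"
        by (simp add: 1 x mult.assoc)
      moreover have "length (0 # u) = count_list (l # w) f"
        by (simp add: x 1)
      ultimately show ?thesis
        by (intro fv.span_base) blast
    next
      case 2
      have adx: "adx (phi (bas u)) \<in> fv.span {phi (bas v) | v. length v = length u}" for u
      proof (induction u)
        case Nil
        show ?case by (simp add: adx_def fv.span_zero)
      next
        case (Cons j u)
        have "z j * adx (phi (bas u)) \<in> fv.span {phi (bas v) | v. length v = length (j # u)}"
        proof (rule lin_span_into[OF lin_multL[OF lin_id] _ _ Cons])
          fix x assume "x \<in> {phi (bas v) | v. length v = length u}"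
          then obtain v where "x = phi (bas v)" "length v = length u" by blast
          then have "z j * x = phi (bas (j # v))" "length (j # v) = length (j # u)" by simp_all
          then show "z j * x \<in> fv.span {phi (bas v) | v. length v = length (j # u)}"
            by (intro fv.span_base) blast
        qed simp
        moreover have "adx (z j) * phi (bas u) \<in> fv.span {phi (bas v) | v. length v = length (j # u)}"
          by (intro fv.span_base) (auto intro!: exI[of _ "Suc j # u"])
        ultimately show ?case
          by (simp add: adx_mult sg_z fscale_mult fv.span_add fv.span_scale)
      qed
      have "bas [l] * x = adx (phi (bas u)) * xe ^ i + sg e (phi (bas u)) * xe ^ Suc i"
        by (simp add: 2 x adx_def left_diff_distrib mult.assoc)
      moreover have "sg e (phi (bas u)) * xe ^ Suc i \<in> fv.span (?S (count_list (l # w) f))"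
        unfolding sg_phi fscale_mult
        by (intro fv.span_scale fv.span_base CollectI exI[of _ u] exI[of _ "Suc i"]) (use x 2 ef in simp)
      moreover have "adx (phi (bas u)) * xe ^ i \<in> fv.span (?S (count_list (l # w) f))"
        by (rule lin_span_into[OF lin_multR[OF lin_id] _ _ adx[of u]])
          (use x 2 ef in \<open>auto intro!: fv.span_base\<close>)
      ultimately show ?thesis
        by (simp add: fv.span_add)
    qed
  qed simp
  then show ?case by (simp add: bas_mult_list)
qed

end

context cartan_pair
begin

text \<open>A nonvanishing word with b letters f yields a nonvanishing root vector word of length b.
  Its index sum and that of its reflection add up to m b, which is at least 2 b, so one of the two
  words contains at least b letters e; a factor \<open>xe\<close> adds one more.\<close>

lemma grow:
  assumes "m \<ge> 2" "set w \<subseteq> {e, f}" "bas w \<notin> nich"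
  obtains w' where "set w' \<subseteq> {e, f}" "bas w' \<notin> nich" "count_list w' e > count_list w f"
proof -
  let ?b = "count_list w f"
  have "\<exists>u i. length u = ?b \<and> phi (bas u) * xe ^ i \<notin> nich"
  proof (rule ccontr)
    assume "\<not> ?thesis"
    then have "fv.span {phi (bas u) * xe ^ i | u i. length u = ?b} \<subseteq> nich"
      by (intro fv.span_minimal subspace_nich) blast
    then show False
      using word_in_phi_span[OF assms(2)] assms(3) by blast
  qed
  then obtain u where u: "length u = ?b" "phi (bas u) \<notin> nich"
    using nich_mult_right by blast
  have s: "\<forall>j\<in>set u. j \<le> m"
  proof (rule ccontr)
    assume "\<not> ?thesis"
    then obtain j where "j \<in> set u" "j > m" by force
    then obtain u1 u2 where "u = u1 @ j # u2" by (meson split_list)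
    then have "phi (bas u) = phi (bas u1 * (bas [j] * bas u2))"
      by (simp add: bas_mult_list)
    then have "phi (bas u) = phi (bas u1) * (z j * phi (bas u2))"
      by (simp only: phi_mult phi_single)
    then show False
      using u z_nich[OF cz_top \<open>j > m\<close>] nich_mult_left nich_mult_right by metis
  qed
  have sum: "sum_list u + sum_list (rv u) = m * length u"
    using s by (induction u) auto
  obtain v where v: "length v = ?b" "phi (bas v) \<notin> nich" "sum_list v \<ge> ?b"
  proof (cases "sum_list u \<ge> ?b")
    case False
    have "m * length u \<ge> 2 * length u" using assms(1) by simp
    then have "sum_list (rv u) \<ge> ?b" using sum False u by linarith
    moreover have "length (rv u) = ?b" using u by (simp add: rv_def)
    ultimately show ?thesis
      using that reflect[OF s u(2)] by blast
  qed (use u that in blast)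
  \<comment> \<open>\<open>dR e\<close> kills root vector words, so it strips off the final letter
    and returns \<open>phi (bas v)\<close>.\<close>
  have "phi (bas v) * xe \<notin> nich"
  proof
    assume "phi (bas v) * xe \<in> nich"
    then have "dR e (phi (bas v) * xe) \<in> nich" by (rule nich_dR)
    then show False using v by (simp add: dR_mult bas_Nil dR_e_phi)
  qed
  moreover have "phi (bas v) * xe \<in> wdeg (sum_list v + 1) (length v + 0)"
    by (intro wdeg_mult phi_wdeg wdeg_letters)
  ultimately obtain w' where "set w' \<subseteq> {e, f}" "count_list w' e = sum_list v + 1" "bas w' \<notin> nich"
    by (metis wdeg_notin_nich)
  then show ?thesis
    using that v by auto
qed

end

lemma (in diag_braid) cartan_pair_infinite:
  assumes "cartan_pair Q e f m" "cartan_pair Q f e m'" "m \<ge> 2" "m' \<ge> 2"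
  shows "\<exists>w. length w \<ge> n \<and> bas w \<notin> nich"
proof -
  interpret E: cartan_pair Q e f m by fact
  interpret F: cartan_pair Q f e m' by fact
  have "\<exists>w. set w \<subseteq> {e, f} \<and> bas w \<notin> nich \<and> (count_list w e \<ge> k \<or> count_list w f \<ge> k)" for k
  proof (induction k)
    case 0
    show ?case by (rule exI[of _ "[]"]) (simp add: bas_Nil one_notin_nich)
  next
    case (Suc k)
    then obtain w where w: "set w \<subseteq> {e, f}" "bas w \<notin> nich" "count_list w e \<ge> k \<or> count_list w f \<ge> k" by blast
    from w(3) show ?case
    proof
      assume "count_list w e \<ge> k"
      then show ?case
        using F.grow[OF assms(4) _ w(2)] w(1) by (metis Suc_leI insert_commute le_less_trans)
    next
      assume "count_list w f \<ge> k"
      then show ?case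
        using E.grow[OF assms(3) _ w(2)] w(1) by (metis Suc_leI le_less_trans)
    qed
  qed
  then show ?thesis
    by (metis count_le_length le_trans)
qed

section \<open>Root vectors of self-braiding 1\<close>

context letter_pair
begin

text \<open>\<open>sw m [m]\<close> is the self-braiding of \<open>z m\<close>. If it is 1, quantum
  integers become ordinary ones and \<open>opD m\<close> sends the power k + 1 to k + 1 times the
  power k.\<close>

lemma root_vector_infinite:
  assumes "Cz m * qfact m \<noteq> 0" "sw m [m] = 1" "\<And>k. of_nat (Suc k) \<noteq> (0 :: 'k)"
  shows "\<exists>w. length w \<ge> n \<and> bas w \<notin> nich"
proof -
  have D: "Dw m (replicate (Suc k) m) = fscale (of_nat (Suc k)) (bas (replicate k m))" for k
  proof (induction k)
    case 0
    then show ?case by (simp add: sw_def)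
  next
    case (Suc k)
    have "sw m (replicate k m) = 1" for k
      using assms(2) by (induction k) (simp_all add: sw_def)
    moreover have "Q f e ^ m * Q f f * (q ^ m * Q e f) ^ m = 1"
      using assms(2) by (simp add: sw_def)
    ultimately show ?case
      using Suc fv.scale_left_distrib[of 1 1 "bas (m # replicate k m) :: nat list \<Rightarrow>\<^sub>0 'k"]
      by (simp add: fscale_mult bas_mult_list fv.scale_left_distrib distrib_left sw_def)
  qed
  have "phi (bas (replicate k m)) \<notin> nich" for k
  proof (induction k)
    case 0
    show ?case by (simp add: one_notin_nich)
  next
    case (Suc k)
    show ?case
    proof
      assume "phi (bas (replicate (Suc k) m)) \<in> nich"
      then have "DD m (phi (bas (replicate (Suc k) m))) \<in> nich"
        by (rule nich_DD)
      moreover have "DD m (phi (bas (replicate (Suc k) m)))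
          = fscale (Cz m * qfact m * of_nat (Suc k)) (phi (bas (replicate k m)))"
        by (subst phi_opD[symmetric]) (simp_all add: D bas_small del: replicate_Suc of_nat_Suc)
      ultimately have "fscale (inverse (Cz m * qfact m * of_nat (Suc k)) * (Cz m * qfact m * of_nat (Suc k)))
          (phi (bas (replicate k m))) \<in> nich"
        by (metis nich_scale fv.scale_scale)
      moreover have "Cz m * qfact m * of_nat (Suc k) \<noteq> 0"
        using assms(1,3) by simp
      ultimately show False
        using Suc by (metis fv.scale_one left_inverse)
    qed
  qed
  then obtain w where "count_list w f = n" "bas w \<notin> nich"
    using phi_wdeg[of "replicate n m"] by (metis wdeg_notin_nich length_replicate)
  then show ?thesis
    by (metis count_le_length)
qed

end

text \<open>
  Let \<open>M\<close> be the order of \<open>x\<close>. If some \<open>x\<^sup>m l x\<^sup>2\<close> equals \<open>1\<close>, then the pair is of Cartan type with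
  Cartan integer \<open>- m\<close>, where \<open>m \<ge> 2\<close> outside of the excluded cases. Otherwise \<open>l = - 1\<close>, \<open>M\<close> is odd,
  and \<open>z (M - 1)\<close> is a root vector of self-braiding \<open>1\<close>, so that its powers do not vanish in
  characteristic \<open>0\<close>.
\<close>

lemma (in diag_braid) rank2_infinite:
  fixes e f :: 'i
  assumes "e \<noteq> f" and char0: "\<And>k. of_nat (Suc k) \<noteq> (0 :: 'k)"
    and Qe: "Q e e = x" and Qf: "Q f f = x" and p: "Q e f * Q f e = l * x ^ 2" and l: "l = 1 \<or> l = - 1"
    and root: "x ^ K = 1" "K > 0"
    and A1A1: "\<not> (l * x ^ 2 = 1 \<and> x \<noteq> 1)" and A2: "\<not> (l * x ^ 3 = 1 \<and> x \<noteq> 1)"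
  shows "\<exists>w. length w \<ge> n \<and> bas w \<notin> nich"
proof -
  interpret E: letter_pair Q e f by unfold_locales fact
  interpret F: letter_pair Q f e by unfold_locales (use assms in simp)
  define M where "M = (LEAST k. k > 0 \<and> x ^ k = 1)"
  have M: "M > 0" "x ^ M = 1"
    using LeastI[of "\<lambda>k. k > 0 \<and> x ^ k = 1" K] root by (auto simp: M_def)
  have less_M: "x ^ i \<noteq> 1" if "0 < i" "i < M" for i
    using not_less_Least[of i "\<lambda>k. k > 0 \<and> x ^ k = 1"] that by (auto simp: M_def)
  have x0: "x \<noteq> 0" using M by (auto simp: power_0_left)
  have two: "(2 :: 'k) \<noteq> 0" using char0[of 1] by simp
  have qint: "(1 - x) * E.qint i = 1 - x ^ i" "F.qint i = E.qint i" for i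
    unfolding E.qint_def F.qint_def Qe Qf by (simp_all add: one_diff_power_eq)
  have qint_nz: "E.qint i \<noteq> 0" "F.qint i \<noteq> 0" if "0 < i" "i < M" for i
    using qint less_M[OF that] by (metis diff_eq_diff_eq diff_self mult_zero_right)+
  have cz: "E.cz j = E.qint j * (1 - x ^ (j - 1) * (l * x ^ 2))" "F.cz j = E.qint j * (1 - x ^ (j - 1) * (l * x ^ 2))" for j
    unfolding E.cz_def F.cz_def using p by (simp_all add: Qe Qf qint mult.commute)
  have cartan_case: ?thesis if m: "m \<ge> 2" "m < M" "x ^ m * (l * x ^ 2) = 1" "\<And>i. i < m \<Longrightarrow> x ^ i * (l * x ^ 2) \<noteq> 1" for m
  proof (rule cartan_pair_infinite)
    have "E.cz j \<noteq> 0 \<and> F.cz j \<noteq> 0" if "1 \<le> j" "j \<le> m" for j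
      using m(2) that qint_nz[of j] m(4)[of "j - 1"] by (simp add: cz)
    then show "cartan_pair Q e f m" "cartan_pair Q f e m"
      using m p x0 by (unfold_locales; simp add: Qe Qf mult.commute)+
  qed (use m in auto)
  show ?thesis
  proof (cases "x = 1")
    case True
    show ?thesis
      by (rule E.root_vector_infinite[of 0, OF _ _ char0]) (simp_all add: E.Cz_def E.qfact_def E.sw_def Qf True)
  next
    case x1: False
    have "M \<noteq> 1" using M x1 by auto
    \<comment> \<open>The letter f itself, which is \<open>z 0\<close>, already has self-braiding
      1.\<close>
    show ?thesis
      using l
    proof
      assume l: "l = 1"
      have "M \<noteq> 2" using A1A1 l x1 M by auto
      moreover have "M \<noteq> 3" using A2 l x1 M by auto
      ultimately have "M \<ge> 4" using M \<open>M \<noteq> 1\<close> by simp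
      \<comment> \<open>For l = 1 the Cartan condition reads x^(m + 2) = 1, which is first satisfied
        by m = M - 2.\<close>
      show ?thesis
      proof (rule cartan_case[of "M - 2"])
        have e: "x ^ i * (l * x ^ 2) = x ^ (i + 2)" for i by (simp add: l power_add power2_eq_square)
        show "x ^ (M - 2) * (l * x\<^sup>2) = 1"
          unfolding e using M le_add_diff_inverse2[of 2 M] \<open>M \<ge> 4\<close> by (simp del: power_add power_add_numeral2 add_2_eq_Suc')
        show "x ^ i * (l * x\<^sup>2) \<noteq> 1" if "i < M - 2" for i
          unfolding e by (rule less_M) (use that in auto)
      qed (use \<open>M \<ge> 4\<close> in auto)
    next
      assume l: "l = - 1"
      have e: "x ^ i * (l * x ^ 2) = - (x ^ (i + 2))" for i by (simp add: l power_add power2_eq_square)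
      show ?thesis
      proof (cases "even M")
        case True
        then obtain h where h: "M = 2 * h" by blast
        have "(x ^ h) ^ 2 = 1" using M h by (simp add: power_mult[symmetric] mult.commute)
        moreover have "x ^ h \<noteq> 1" using less_M[of h] h M by simp
        ultimately have xh: "x ^ h = - 1" by (simp add: power2_eq_1_iff)
        \<comment> \<open>h = 1 and h = 3 would give l x^3 = 1, and h = 2 would give l x^2 = 1;
          these are the excluded cases.\<close>
        have "h \<noteq> 1" using xh A2 l x1 by auto
        moreover have "h \<noteq> 2" using xh A1A1 l x1 by auto
        moreover have "h \<noteq> 3" using xh A2 l x1 by auto
        ultimately have h4: "h \<ge> 4" using h M by simp
        \<comment> \<open>For l = -1 the Cartan condition reads x^(m + 2) = -1 = x^h, which is first
          satisfied by m = h - 2.\<close>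
        show ?thesis
        proof (rule cartan_case[of "h - 2"])
          show "x ^ (h - 2) * (l * x\<^sup>2) = 1"
            unfolding e using xh le_add_diff_inverse2[of 2 h] h4 by (simp del: power_add power_add_numeral2 add_2_eq_Suc')
          show "x ^ i * (l * x\<^sup>2) \<noteq> 1" if "i < h - 2" for i
          proof
            assume "x ^ i * (l * x\<^sup>2) = 1"
            then have "x ^ (i + 2) = x ^ h" unfolding e by (metis xh minus_minus)
            then have "x ^ (h - (i + 2)) = 1"
              using that x0 by (simp add: power_diff)
            moreover have "0 < h - (i + 2)" "h - (i + 2) < M" using that h h4 by auto
            ultimately show False
              using less_M by blast
          qed
        qed (use h h4 in auto)
      next
        case False
        have neg: "x ^ i \<noteq> - 1" for i
        proof
          assume "x ^ i = - 1"
          then have "(- 1) ^ M = (x ^ M) ^ i" by (metis power_mult mult.commute)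
          then have "(- 1 :: 'k) = 1" using False M by simp
          then show False using two by (metis add.right_inverse one_add_one)
        qed
        define m where "m = M - 1"
        have m: "M = Suc m" "even m" using False M by (auto simp: m_def)
        have "1 - x ^ i * (l * x ^ 2) \<noteq> 0" for i
          unfolding e using neg[of "i + 2"] by (metis diff_minus_eq_add eq_neg_iff_add_eq_0 add.commute)
        then have "E.Cz m \<noteq> 0"
          unfolding E.Cz_def by (simp add: Qe p)
        moreover have "E.qfact m \<noteq> 0"
          unfolding E.qfact_def using qint_nz m by simp
        moreover have "E.sw m [m] = 1"
        proof -
          \<comment> \<open>The edge contributes 2 m to the exponent, the vertex f contributes 1 and
            the vertex e contributes m m, in total (m + 1)^2; the sign of the edge disappears
            because m is even.\<close>
          have "E.sw m [m] = (Q e f * Q f e) ^ m * x * (x ^ m) ^ m"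
            by (simp add: E.sw_def Qe Qf power_mult_distrib mult_ac)
          also have "\<dots> = x ^ (2 * m + 1 + m * m)"
            using m(2) by (simp add: p l power_mult_distrib power_add power_mult power_mult[of x 2 m])
          also have "2 * m + 1 + m * m = M * M" by (simp add: m)
          also have "x ^ (M * M) = 1" using M by (simp add: power_mult)
          finally show ?thesis .
        qed
        ultimately show ?thesis
          by (intro E.root_vector_infinite[of m] char0) simp_all
      qed
    qed
  qed
qed

section \<open>Finite-dimensional Nichols algebras\<close>

context diag_braid
begin

text \<open>The formula of \<open>adx\<close> for an arbitrary letter, since it is applied also to
  letters outside the pair under consideration.\<close>

definition ad :: "'i \<Rightarrow> ('i list \<Rightarrow>\<^sub>0 'k) \<Rightarrow> ('i list \<Rightarrow>\<^sub>0 'k)" where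
  "ad i x = bas [i] * x - sg i x * bas [i]"

lemma ad_mult: "ad i (x * y) = ad i x * y + sg i x * ad i y"
  by (simp add: ad_def sg_mult algebra_simps)

lemma ad_mult_nich: "ad i x \<in> nich \<Longrightarrow> ad i y \<in> nich \<Longrightarrow> ad i (x * y) \<in> nich"
  by (simp add: ad_mult nich_add nich_mult_left nich_mult_right)

lemma ad_power_nich: "ad i x \<in> nich \<Longrightarrow> ad i (x ^ n) \<in> nich"
  by (induction n) (simp_all add: ad_mult_nich, simp add: ad_def nich_0)

lemma ad_letter_nich: "i \<noteq> j \<Longrightarrow> Q i j * Q j i = 1 \<Longrightarrow> ad i (bas [j]) \<in> nich"
proof -
  assume ij: "i \<noteq> j" "Q i j * Q j i = 1"
  interpret letter_pair Q i j by unfold_locales fact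
  have "z (Suc 0) \<in> nich" by (rule z_nich[of 0]) (simp_all add: cz_def ij)
  then show ?thesis by (simp add: adx_def ad_def)
qed

text \<open>\<open>dR i\<close> lowers the k-th power of its letter with the quantum integer of k as
  coefficient, and the other right derivations kill the power.\<close>

lemma letter_power_nich:
  assumes "(\<Sum>k<M. Q i i ^ k) = 0" "M > 0"
  shows "bas [i] ^ M \<in> nich"
proof (rule nichI)
  obtain m where m: "M = Suc m" using assms(2) gr0_conv_Suc by blast
  have other: "dR j (bas [i] ^ k) = 0" if "j \<noteq> i" for j k
    using that by (induction k) (simp_all add: dR_mult)
  have "dR i (bas [i] ^ k) = fscale (\<Sum>k<k. Q i i ^ k) (bas [i] ^ (k - 1))" for k
  proof (induction k)
    case (Suc k)
    have "dR i (bas [i] ^ Suc k) = dR i (bas [i] ^ k * bas [i])"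
      by (simp only: power_Suc2)
    also have "\<dots> = bas [i] ^ k + fscale (Q i i * (\<Sum>k<k. Q i i ^ k)) (bas [i] ^ (k - 1) * bas [i])"
      by (simp only: dR_mult Suc) (simp add: bas_Nil fscale_mult)
    also have "fscale (Q i i * (\<Sum>k<k. Q i i ^ k)) (bas [i] ^ (k - 1) * bas [i])
      = fscale (Q i i * (\<Sum>k<k. Q i i ^ k)) (bas [i] ^ k :: 'i list \<Rightarrow>\<^sub>0 'k)"
      by (cases k) (simp_all add: power_commutes)
    finally show ?case
      unfolding sum.lessThan_Suc_shift by (simp add: fv.scale_left_distrib sum_distrib_left)
  qed simp
  then show "dR j (bas [i] ^ M) \<in> nich" for j
    using other assms(1) by (cases "j = i") (simp_all add: nich_0)
  show "eps (bas [i] ^ M) = 0"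
    by (simp add: m eps_mult eps_bas)
qed

end

text \<open>\<open>M\<close> is any positive number with vanishing quantum integer, possibly a
  multiple of the order of the label. That suffices for finiteness when n = 1, and M = 2 gives the
  exact count when the label is -1.\<close>

locale A2_pair = letter_pair Q e f for Q :: "'i::finite \<Rightarrow> 'i \<Rightarrow> 'k::field" and e f +
  fixes M :: nat
  assumes A2: "Q f f = Q e e" "Q e e * (Q e f * Q f e) = 1" and M: "M > 0" "(\<Sum>k<M. Q e e ^ k) = 0"
begin

abbreviation "zz \<equiv> z (Suc 0)"

lemma zz_eq: "zz = xe * xf - fscale (Q e f) (xf * xe)"
  by (simp add: adx_def fscale_mult)

lemma xe_zz: "ad e zz \<in> nich"
proof -
  have "cz (Suc (Suc 0)) = 0" by (simp add: cz_def A2)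
  then have "z (Suc (Suc 0)) \<in> nich" using z_nich[of 1 2] by (simp add: numeral_2_eq_2)
  then show ?thesis by (simp add: adx_def ad_def)
qed

lemma dL_zz: "dL e zz = fscale (1 - p) xf" "dL f zz = 0"
  by (simp_all only: dL_e_z dL_f_z) (simp_all add: cz_def qint_def)

text \<open>The second quantum Serre relation. Only \<open>dL e\<close> needs an argument: it leaves
  a multiple of 1 - q \<open>Q e f\<close> \<open>Q f e\<close>, which is 0.\<close>

lemma zz_xf: "zz * xf - fscale (q * Q e f) (xf * zz) \<in> nich"
proof (rule nichI_left)
  have k: "q * Q e f * Q f e = 1" using A2 by (simp add: mult_ac)
  fix i
  consider "i = e" | "i = f" | "i \<noteq> e" "i \<noteq> f" by blast
  then show "dL i (zz * xf - fscale (q * Q e f) (xf * zz)) \<in> nich"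
  proof cases
    case 1
    have "dL e (zz * xf - fscale (q * Q e f) (xf * zz)) = fscale (1 - p) (fscale (1 - q * Q e f * Q f e) (xf * xf))"
      using ef by (simp add: dL_mult dL_zz fscale_mult mult_ac fv.scale_left_diff_distrib algebra_simps del: z.simps)
    then show ?thesis by (simp add: 1 k nich_0)
  next
    case 2
    have "dL f (zz * xf - fscale (q * Q e f) (xf * zz)) = 0"
      by (simp add: dL_mult dL_zz tu_f_z fscale_mult bas_Nil A2 mult_ac del: z.simps)
    then show ?thesis by (simp add: 2 nich_0)
  next
    case 3
    then show ?thesis by (simp add: dL_mult dL_other_z nich_0 del: z.simps)
  qed
qed (simp add: eps_mult eps_bas del: z.simps)

end

context diag_braid
begin

lemma sg_power: "sg i x = fscale a x \<Longrightarrow> sg i (x ^ n) = fscale (a ^ n) (x ^ n)"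
  by (induction n) (simp_all add: sg_mult fscale_mult mult_ac)

definition nspan :: "('i list \<Rightarrow>\<^sub>0 'k) set \<Rightarrow> ('i list \<Rightarrow>\<^sub>0 'k) set" where
  "nspan B = fv.span (B \<union> nich)"

lemma subspace_nspan: "fv.subspace (nspan B)" by (simp add: nspan_def)

lemmas nspan_rules = fv.subspace_0[OF subspace_nspan] fv.subspace_add[OF subspace_nspan]
  fv.subspace_scale[OF subspace_nspan] fv.subspace_diff[OF subspace_nspan]

lemma nich_nspan: "x \<in> nich \<Longrightarrow> x \<in> nspan B" and base_nspan: "x \<in> B \<Longrightarrow> x \<in> nspan B"
  by (simp_all add: nspan_def fv.span_base)

lemma lin_nspan:
  assumes "lin g" "\<And>x. x \<in> nich \<Longrightarrow> g x \<in> nspan C" "\<And>x. x \<in> B \<Longrightarrow> g x \<in> nspan C" "x \<in> nspan B"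
  shows "g x \<in> nspan C"
  by (rule lin_span_into[OF assms(1) subspace_nspan _ assms(4)[unfolded nspan_def]]) (use assms in auto)

lemma words_nspan:
  assumes "\<And>i x. i \<in> L \<Longrightarrow> x \<in> nspan B \<Longrightarrow> bas [i] * x \<in> nspan B" "1 \<in> nspan B" "set w \<subseteq> L"
  shows "bas w \<in> nspan B"
  using assms(3)
proof (induction w)
  case (Cons i w)
  then show ?case unfolding bas_Cons[of i w] by (intro assms(1)) auto
qed (simp add: bas_Nil assms(2))

text \<open>This reduces a spanning claim to straightening one letter in front of each
  monomial.\<close>

lemma UNIV_nspan:
  assumes "\<And>i x. x \<in> nspan B \<Longrightarrow> bas [i] * x \<in> nspan B" "1 \<in> nspan B"
  shows "nspan B = UNIV"
proof -
  have "x \<in> nspan B" for x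
    by (rule lin_into_subspace[OF lin_id subspace_nspan]) (rule words_nspan[of UNIV], use assms in auto)
  then show ?thesis by blast
qed

end

section \<open>PBW monomials for type A_1 x A_1\<close>

locale A1A1_pair = letter_pair Q e f for Q :: "'i::finite \<Rightarrow> 'i \<Rightarrow> 'k::field" and e f +
  fixes M :: nat
  assumes A1A1: "Q e f * Q f e = 1"
    and M: "M > 0" "(\<Sum>k<M. Q e e ^ k) = 0" "(\<Sum>k<M. Q f f ^ k) = 0"
begin

definition "A1_basis = (\<lambda>(a, c). xf ^ a * xe ^ c) ` ({..<M} \<times> {..<M})"

lemma A1_monomial: "xf ^ a * xe ^ c \<in> nspan A1_basis"
proof -
  have n: "xe ^ M \<in> nich" "xf ^ M \<in> nich"
    using letter_power_nich M by auto
  have "xf ^ a \<in> nich" if "a \<ge> M"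
    using that n by (metis le_add_diff_inverse nich_mult_right power_add)
  moreover have "xe ^ c \<in> nich" if "c \<ge> M"
    using that n by (metis le_add_diff_inverse nich_mult_right power_add)
  moreover have "xf ^ a * xe ^ c \<in> A1_basis" if "a < M" "c < M"
    using that by (auto simp: A1_basis_def)
  ultimately show ?thesis
    by (metis base_nspan nich_nspan nich_mult_left nich_mult_right not_less)
qed

lemma A1_closed:
  assumes "x \<in> nspan A1_basis" "i \<in> {e, f}"
  shows "bas [i] * x \<in> nspan A1_basis"
proof (rule lin_nspan[OF lin_multL[OF lin_id] _ _ assms(1)])
  fix x assume "x \<in> A1_basis"
  then obtain a c where x: "x = xf ^ a * xe ^ c" by (auto simp: A1_basis_def)
  show "bas [i] * x \<in> nspan A1_basis"
  proof (cases "i = f")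
    case True
    then show ?thesis using A1_monomial[of "Suc a" c] by (simp add: x mult.assoc)
  next
    case False
    then have i: "i = e" using assms by simp
    have "ad e (xf ^ a) * xe ^ c \<in> nich"
      using ef A1A1 by (intro nich_mult_right ad_power_nich ad_letter_nich)
    moreover have "sg e (xf ^ a) = fscale (Q e f ^ a) (xf ^ a)"
      by (rule sg_power) simp
    then have "xe * x = ad e (xf ^ a) * xe ^ c + fscale (Q e f ^ a) (xf ^ a * xe ^ Suc c)"
      by (simp add: x ad_def fscale_mult algebra_simps)
    ultimately show ?thesis
      unfolding i by (simp only: nspan_rules nich_nspan A1_monomial)
  qed
qed (simp add: nich_nspan nich_mult_left)

end

section \<open>PBW monomials for type A_2\<close>

context A2_pair
begin

text \<open>\<open>tu e\<close> contributes q \<open>Q f e\<close> on \<open>zz\<close>, and moving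
  \<open>xf\<close> in front of it contributes q \<open>Q e f\<close>. Their product is q by the A_2
  condition, so a quantum integer builds up as for powers of a letter.\<close>

lemma dL_zz_power: "dL e (zz ^ k) - fscale ((1 - p) * qint k) (xf * zz ^ (k - 1)) \<in> nich"
proof (induction k)
  case (Suc k)
  define r where "r = dL e (zz ^ k) - fscale ((1 - p) * qint k) (xf * zz ^ (k - 1))"
  define t where "t = zz * xf - fscale (q * Q e f) (xf * zz)"
  have r: "r \<in> nich" "dL e (zz ^ k) = r + fscale ((1 - p) * qint k) (xf * zz ^ (k - 1))"
    using Suc by (simp_all add: r_def)
  have t: "t \<in> nich" "zz * xf = t + fscale (q * Q e f) (xf * zz)"
    using zz_xf by (simp_all add: t_def)
  have tu: "tu e zz = fscale (q * Q f e) zz" using tu_z[of 1] by simp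
  have s: "q * Q f e * (q * Q e f) = q" using A2 by (metis mult.assoc mult.commute mult.right_neutral)
  have k: "fscale ((1 - p) * qint k) (xf * zz * zz ^ (k - 1)) = fscale ((1 - p) * qint k) (xf * zz ^ k)"
    by (cases k) (simp_all add: qint_def mult.assoc)
  have "dL e (zz ^ Suc k) = fscale (1 - p) (xf * zz ^ k)
      + fscale (q * Q f e) (zz * r + fscale ((1 - p) * qint k) (zz * xf * zz ^ (k - 1)))"
    by (simp add: dL_mult dL_zz tu r(2) fscale_mult distrib_left fv.scale_right_distrib mult_ac del: z.simps)
  also have "zz * xf * zz ^ (k - 1) = t * zz ^ (k - 1) + fscale (q * Q e f) (xf * zz * zz ^ (k - 1))"
    by (simp add: t(2) distrib_right fscale_mult del: z.simps)
  also have "fscale (1 - p) (xf * zz ^ k) + fscale (q * Q f e) (zz * r + fscale ((1 - p) * qint k)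
        (t * zz ^ (k - 1) + fscale (q * Q e f) (xf * zz * zz ^ (k - 1))))
    = fscale (1 - p) (xf * zz ^ k) + fscale (q * Q f e * (q * Q e f)) (fscale ((1 - p) * qint k) (xf * zz * zz ^ (k - 1)))
      + fscale (q * Q f e) (zz * r + fscale ((1 - p) * qint k) (t * zz ^ (k - 1)))"
    by (simp add: fv.scale_right_distrib mult_ac del: z.simps)
  also have "fscale (1 - p) (xf * zz ^ k) + fscale (q * Q f e * (q * Q e f)) (fscale ((1 - p) * qint k) (xf * zz * zz ^ (k - 1)))
    = fscale ((1 - p) * qint (Suc k)) (xf * zz ^ k)"
    unfolding s k by (simp add: qint_Suc algebra_simps fv.scale_left_distrib fv.scale_left_diff_distrib
        fv.scale_right_diff_distrib del: z.simps)
  finally show ?case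
    using r t by (simp add: nich_add nich_scale nich_mult_left nich_mult_right del: z.simps)
qed (simp add: qint_def nich_0)

lemma zz_power_nich: "zz ^ M \<in> nich"
proof (rule nichI_left)
  have 0: "dL i (zz ^ k) = 0" if "i \<noteq> e" for i k
    using that by (induction k) (simp_all add: dL_mult dL_other_z dL_f_z del: z.simps, metis dL_other_z dL_f_z mult_zero_left nat.distinct(1))
  fix i
  show "dL i (zz ^ M) \<in> nich"
    using dL_zz_power[of M] M 0 by (cases "i = e") (simp_all add: qint_def nich_0 del: z.simps)
next
  have "eps (zz ^ Suc k) = 0" for k by (simp add: eps_mult eps_z del: z.simps)
  then show "eps (zz ^ M) = 0" using M(1) gr0_conv_Suc by metis
qed

definition "A2_basis = (\<lambda>(a, b, c). xf ^ a * zz ^ b * xe ^ c) ` ({..<M} \<times> {..<M} \<times> {..<M})"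

lemma A2_monomial: "xf ^ a * zz ^ b * xe ^ c \<in> nspan A2_basis"
proof -
  have n: "xe ^ M \<in> nich" "xf ^ M \<in> nich"
    using letter_power_nich M A2 by auto
  have "xf ^ a \<in> nich" if "a \<ge> M"
    using that n by (metis le_add_diff_inverse nich_mult_right power_add)
  moreover have "zz ^ b \<in> nich" if "b \<ge> M"
    using that zz_power_nich by (metis le_add_diff_inverse nich_mult_right power_add)
  moreover have "xe ^ c \<in> nich" if "c \<ge> M"
    using that n by (metis le_add_diff_inverse nich_mult_right power_add)
  moreover have "xf ^ a * zz ^ b * xe ^ c \<in> A2_basis" if "a < M" "b < M" "c < M"
    using that by (force simp: A2_basis_def)
  ultimately show ?thesis
    by (metis base_nspan nich_nspan nich_mult_left nich_mult_right not_less)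
qed

text \<open>Only the shape of this straightening rule matters for spanning, so its second
  coefficient stays existential. At a = 0 that coefficient is 0, which makes the truncated exponent
  a - 1 harmless.\<close>

lemma xe_xf_power:
  "\<exists>k. xe * xf ^ a - (fscale (Q e f ^ a) (xf ^ a * xe) + fscale k (xf ^ (a - 1) * zz)) \<in> nich"
proof (induction a)
  case 0
  show ?case by (rule exI[of _ 0]) (simp add: nich_0)
next
  case (Suc a)
  then obtain k where k: "xe * xf ^ a - (fscale (Q e f ^ a) (xf ^ a * xe) + fscale k (xf ^ (a - 1) * zz)) \<in> nich"
    by blast
  define r where "r = xe * xf ^ a - (fscale (Q e f ^ a) (xf ^ a * xe) + fscale k (xf ^ (a - 1) * zz))"
  define t where "t = zz * xf - fscale (q * Q e f) (xf * zz)"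
  have r: "r \<in> nich" "xe * xf ^ a = r + (fscale (Q e f ^ a) (xf ^ a * xe) + fscale k (xf ^ (a - 1) * zz))"
    using k by (simp_all add: r_def)
  have t: "t \<in> nich" "zz * xf = t + fscale (q * Q e f) (xf * zz)"
    using zz_xf by (simp_all add: t_def)
  have "xe * xf ^ Suc a = (xe * xf ^ a) * xf" by (simp only: power_Suc2 mult.assoc)
  also have "\<dots> = r * xf + fscale (Q e f ^ a) (xf ^ a * (xe * xf)) + fscale k (xf ^ (a - 1) * (zz * xf))"
    by (simp only: r(2) distrib_right fscale_mult mult.assoc add.assoc)
  also have "\<dots> = r * xf + fscale (Q e f ^ a) (xf ^ a * (zz + fscale (Q e f) (xf * xe)))
      + fscale k (xf ^ (a - 1) * (t + fscale (q * Q e f) (xf * zz)))"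
    by (simp only: t(2)[symmetric]) (simp add: zz_eq del: z.simps)
  finally have *: "xe * xf ^ Suc a = r * xf + fscale (Q e f ^ a) (xf ^ a * (zz + fscale (Q e f) (xf * xe)))
      + fscale k (xf ^ (a - 1) * (t + fscale (q * Q e f) (xf * zz)))" .
  show ?case
  proof (cases a)
    case 0
    show ?thesis
      by (rule exI[of _ 1]) (simp add: 0 zz_eq nich_0 del: z.simps)
  next
    case (Suc b)
    have "xe * xf ^ Suc a - (fscale (Q e f ^ Suc a) (xf ^ Suc a * xe)
        + fscale (Q e f ^ a + k * (q * Q e f)) (xf ^ a * zz)) = r * xf + fscale k (xf ^ b * t)"
    proof -
      have 1: "xf ^ (a - 1) * (xf * zz) = xf ^ a * zz"
        unfolding Suc diff_Suc_1 power_Suc2 by (simp only: mult.assoc)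
      have 2: "xf ^ a * (xf * xe) = xf ^ Suc a * xe"
        unfolding power_Suc2 by (simp only: mult.assoc)
      have "xe * xf ^ Suc a = r * xf + fscale (Q e f ^ a) (xf ^ a * zz) + fscale (Q e f ^ a * Q e f) (xf ^ a * (xf * xe))
          + fscale k (xf ^ (a - 1) * t) + fscale (k * (q * Q e f)) (xf ^ (a - 1) * (xf * zz))"
        unfolding * by (simp only: distrib_left fscale_mult fv.scale_right_distrib fv.scale_scale add.assoc)
      then show ?thesis
        unfolding 1 2 power_Suc2[of "Q e f" a, symmetric]
        by (simp add: fv.scale_left_distrib Suc del: z.simps power_Suc)
    qed
    moreover have "r * xf + fscale k (xf ^ b * t) \<in> nich"
      by (intro nich_add nich_scale nich_mult_left[OF t(1)] nich_mult_right[OF r(1)])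
    ultimately show ?thesis
      by (intro exI[of _ "Q e f ^ a + k * (q * Q e f)"]) (simp only: diff_Suc_1)
  qed
qed

lemma A2_closed:
  assumes "x \<in> nspan A2_basis" "i \<in> {e, f}"
  shows "bas [i] * x \<in> nspan A2_basis"
proof (rule lin_nspan[OF lin_multL[OF lin_id] _ _ assms(1)])
  fix x assume "x \<in> A2_basis"
  then obtain a b c where x: "x = xf ^ a * zz ^ b * xe ^ c" by (auto simp: A2_basis_def)
  show "bas [i] * x \<in> nspan A2_basis"
  proof (cases "i = f")
    case True
    then show ?thesis using A2_monomial[of "Suc a" b c] by (simp add: x mult.assoc)
  next
    case False
    then have i: "i = e" using assms by simp
    obtain k where k: "xe * xf ^ a - (fscale (Q e f ^ a) (xf ^ a * xe) + fscale k (xf ^ (a - 1) * zz)) \<in> nich"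
      using xe_xf_power by blast
    define r where "r = xe * xf ^ a - (fscale (Q e f ^ a) (xf ^ a * xe) + fscale k (xf ^ (a - 1) * zz))"
    have r: "r \<in> nich" "xe * xf ^ a = r + (fscale (Q e f ^ a) (xf ^ a * xe) + fscale k (xf ^ (a - 1) * zz))"
      using k by (simp_all add: r_def)
    have "sg e zz = fscale (q * Q e f) zz" using sg_z[of 1] by simp
    then have sgz: "sg e (zz ^ b) = fscale ((q * Q e f) ^ b) (zz ^ b)"
      by (rule sg_power)
    have zb: "xe * zz ^ b = ad e (zz ^ b) + fscale ((q * Q e f) ^ b) (zz ^ b * xe)"
      by (simp add: ad_def sgz fscale_mult del: z.simps)
    have "xe * x = (xe * xf ^ a) * zz ^ b * xe ^ c" by (simp add: x mult.assoc)
    also have "\<dots> = r * zz ^ b * xe ^ c + fscale (Q e f ^ a) (xf ^ a * (xe * zz ^ b) * xe ^ c)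
        + fscale k (xf ^ (a - 1) * zz ^ Suc b * xe ^ c)"
      by (simp add: r(2) distrib_right fscale_mult mult.assoc del: z.simps)
    also have "xf ^ a * (xe * zz ^ b) * xe ^ c = xf ^ a * ad e (zz ^ b) * xe ^ c
        + fscale ((q * Q e f) ^ b) (xf ^ a * zz ^ b * xe ^ Suc c)"
      by (simp add: zb distrib_right distrib_left fscale_mult mult.assoc del: z.simps)
    finally have eq: "xe * x = r * zz ^ b * xe ^ c + fscale (Q e f ^ a) (xf ^ a * ad e (zz ^ b) * xe ^ c
        + fscale ((q * Q e f) ^ b) (xf ^ a * zz ^ b * xe ^ Suc c)) + fscale k (xf ^ (a - 1) * zz ^ Suc b * xe ^ c)" .
    have "r * zz ^ b * xe ^ c \<in> nich" "xf ^ a * ad e (zz ^ b) * xe ^ c \<in> nich"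
      using r xe_zz by (simp_all only: nich_mult_left nich_mult_right ad_power_nich)
    then show ?thesis
      unfolding i eq by (intro nspan_rules A2_monomial nich_nspan)
  qed
qed (simp add: nich_nspan nich_mult_left)

end

section \<open>Dimensions of quotients\<close>

lemma quot_dim_le: "finite B \<Longrightarrow> B \<subseteq> P \<Longrightarrow> P \<subseteq> fv.span (B \<union> R) \<Longrightarrow> quot_dim P R \<le> enat (card B)"
  unfolding quot_dim_def by (rule INF_lower) simp

definition indep_mod :: "('s \<Rightarrow>\<^sub>0 'k::field) set \<Rightarrow> 'a set \<Rightarrow> ('a \<Rightarrow> ('s \<Rightarrow>\<^sub>0 'k)) \<Rightarrow> bool" where
  "indep_mod R A g \<longleftrightarrow> (\<forall>c. (\<Sum>x\<in>A. fscale (c x) (g x)) \<in> R \<longrightarrow> (\<forall>x\<in>A. c x = 0))"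

text \<open>Each \<open>g x\<close> is replaced by its component in the span of a competing set B.
  Independence modulo \<open>R\<close> passes to these components, and the exchange lemma compares
  cardinalities.\<close>

lemma quot_dim_ge:
  fixes R P :: "('s \<Rightarrow>\<^sub>0 'k::field) set"
  assumes "fv.subspace R" "finite A" "g ` A \<subseteq> P" "indep_mod R A g"
  shows "enat (card A) \<le> quot_dim P R"
  unfolding quot_dim_def
proof (rule INF_greatest)
  fix B assume "B \<in> {B. finite B \<and> B \<subseteq> P \<and> P \<subseteq> fv.span (B \<union> R)}"
  then have B: "finite B" "P \<subseteq> fv.span (B \<union> R)" by auto
  have "\<exists>b. b \<in> fv.span B \<and> g x - b \<in> R" if "x \<in> A" for x
  proof -
    have "g x \<in> fv.span (B \<union> R)" using B that assms(3) by blast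
    then obtain b r where "b \<in> fv.span B" "r \<in> fv.span R" "g x = b + r"
      unfolding fv.span_Un by blast
    moreover have "fv.span R = R" using assms(1) by (simp add: fv.span_eq_iff)
    ultimately show ?thesis
      by (intro exI[of _ b]) simp
  qed
  then obtain b where b: "\<And>x. x \<in> A \<Longrightarrow> b x \<in> fv.span B" "\<And>x. x \<in> A \<Longrightarrow> g x - b x \<in> R"
    by metis
  have ind: "\<forall>x\<in>A. c x = 0" if "(\<Sum>x\<in>A. fscale (c x) (b x)) = 0" for c
  proof -
    have "(\<Sum>x\<in>A. fscale (c x) (g x)) = (\<Sum>x\<in>A. fscale (c x) (g x - b x))"
      using that by (simp add: fv.scale_right_diff_distrib sum_subtractf)
    also have "\<dots> \<in> R"
      using b assms(1) by (intro fv.subspace_sum fv.subspace_scale) auto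
    finally show ?thesis using assms(4) by (simp add: indep_mod_def)
  qed
  have inj: "inj_on b A"
  proof (rule inj_onI, rule ccontr)
    fix x y assume xy: "x \<in> A" "y \<in> A" "b x = b y" "x \<noteq> y"
    define c where "c = (\<lambda>u. if u = x then 1 else if u = y then - 1 else (0 :: 'k))"
    have "(\<Sum>u\<in>A. fscale (c u) (b u)) = (\<Sum>u\<in>{x, y}. fscale (c u) (b u))"
      using assms(2) xy by (intro sum.mono_neutral_right) (auto simp: c_def)
    also have "\<dots> = 0" using xy by (simp add: c_def)
    finally have "c x = 0" using ind[of c] xy(1) by blast
    then show False by (simp add: c_def)
  qed
  have "fv.independent (b ` A)"
    unfolding fv.dependent_finite[OF finite_imageI[OF assms(2)]]
  proof safe
    fix u x assume u: "(\<Sum>v\<in>b ` A. fscale (u v) v) = 0" "x \<in> A" "u (b x) \<noteq> 0"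
    then show False
      using ind[of "\<lambda>x. u (b x)"] by (simp add: sum.reindex[OF inj])
  qed
  then have "card (b ` A) \<le> card B"
    using fv.independent_span_bound[OF B(1), of "b ` A"] b(1) by blast
  then show "enat (card A) \<le> enat (card B)"
    by (simp add: card_image[OF inj])
qed

lemma enat_eq_infinityI: "(\<And>n. enat n \<le> x) \<Longrightarrow> x = \<infinity>"
proof (cases x)
  case (enat m)
  assume "\<And>n. enat n \<le> x"
  from this[of "Suc m"] show ?thesis using enat by simp
qed simp

context diag_braid
begin

lemma dR_in_homog: "x \<in> homog n \<Longrightarrow> dR i x \<in> homog (n - 1)"
  by (rule lin_into_homog[OF lin_dR _ _ subspace_homog], assumption) (use dRw_in_homog in force)

lemma eps_dRs_homog: "x \<in> homog n \<Longrightarrow> eps (dRs w x) \<noteq> 0 \<Longrightarrow> length w = n"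
proof (induction w arbitrary: x n)
  case Nil
  then show ?case by (auto simp: homog_def eps_def simp flip: in_keys_iff)
next
  case (Cons i w)
  show ?case
  proof (cases n)
    case 0
    have "dR i x = 0"
      by (rule lin_eqI_keys[OF lin_dR lin_zero]) (use Cons.prems 0 in \<open>auto simp: homog_def\<close>)
    then show ?thesis using Cons.prems by (simp add: lin_0[OF lin_dRs])
  next
    case (Suc m)
    then show ?thesis
      using Cons.IH[of "dR i x" m] dR_in_homog[OF Cons.prems(1), of i] Cons.prems(2) by simp
  qed
qed

text \<open>The words have distinct lengths, so an iterated derivation that detects one of them
  kills the others for reasons of degree.\<close>

lemma indep_words:
  assumes "finite L" "\<And>l. l \<in> L \<Longrightarrow> length (h l) = l \<and> bas (h l) \<notin> nich"
  shows "indep_mod nich L (\<lambda>l. bas (h l))"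
  unfolding indep_mod_def
proof (intro allI impI ballI)
  fix c l assume s: "(\<Sum>x\<in>L. fscale (c x) (bas (h x))) \<in> nich" and l: "l \<in> L"
  obtain v where v: "eps (dRs v (bas (h l))) \<noteq> 0"
    using assms(2)[OF l] by (auto simp: nich_def)
  have other: "eps (dRs v (bas (h x))) = 0" if "x \<in> L" "x \<noteq> l" for x
    using eps_dRs_homog[OF bas_in_homog[OF refl], of v] v assms(2) that l by metis
  have e: "eps (\<Sum>x\<in>L. k x) = (\<Sum>x\<in>L. eps (k x))" for k
    by (simp add: eps_def lookup_sum)
  have "0 = eps (dRs v (\<Sum>x\<in>L. fscale (c x) (bas (h x))))"
    using s by (simp add: nich_def)
  also have "\<dots> = (\<Sum>x\<in>L. c x * eps (dRs v (bas (h x))))"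
    by (simp add: lin_sum[OF lin_dRs] lin_scale[OF lin_dRs] e)
  also have "\<dots> = (\<Sum>x\<in>{l}. c x * eps (dRs v (bas (h x))))"
    using assms(1) l other by (intro sum.mono_neutral_right) auto
  finally show "c l = 0" using v by simp
qed

lemma infinite_indep:
  assumes "\<And>n. \<exists>w. length w \<ge> n \<and> bas w \<notin> nich"
  obtains L h where "finite L" "card L = n" "indep_mod nich L (\<lambda>l::nat. bas (h l))"
proof -
  define S where "S = {l. \<exists>w. length w = l \<and> bas w \<notin> nich}"
  have "infinite S"
    unfolding infinite_nat_iff_unbounded_le S_def using assms by blast
  then obtain L where L: "finite L" "card L = n" "L \<subseteq> S"
    using infinite_arbitrarily_large by blast
  then have "\<forall>l\<in>L. \<exists>w. length w = l \<and> bas w \<notin> nich" by (auto simp: S_def)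
  then obtain h where "\<And>l. l \<in> L \<Longrightarrow> length (h l) = l \<and> bas (h l) \<notin> nich" by metis
  then show ?thesis using that L indep_words by blast
qed

end

section \<open>Diagonal bases of braided vector spaces\<close>

definition null2 :: "('s \<Rightarrow>\<^sub>0 'k::field) set \<Rightarrow> ('s \<times> 's \<Rightarrow>\<^sub>0 'k) set" where
  "null2 U = fv.span ({tens u x | u x. u \<in> U} \<union> {tens x u | u x. u \<in> U})"

lemma subspace_null2: "fv.subspace (null2 U)" by (simp add: null2_def)

lemma null2_left: "u \<in> U \<Longrightarrow> tens u x \<in> null2 U" and null2_right: "u \<in> U \<Longrightarrow> tens x u \<in> null2 U"
  unfolding null2_def by (blast intro: fv.span_base)+

text \<open>The part of degree n of the ideal generated by \<open>U\<close>. The degree is fixed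
  because \<open>braid_at c i\<close> is meaningful only on words with at least i + 2
  letters.\<close>

definition null_deg :: "('s \<Rightarrow>\<^sub>0 'k::field) set \<Rightarrow> nat \<Rightarrow> ('s list \<Rightarrow>\<^sub>0 'k) set" where
  "null_deg U n = fv.span {bas w * deg1 u * bas r | w u r. u \<in> U \<and> length w + 1 + length r = n}"

lemma subspace_null_deg: "fv.subspace (null_deg U n)" by (simp add: null_deg_def)

lemma null_degI:
  assumes "x \<in> homog a" "u \<in> U" "y \<in> homog b" "a + 1 + b = n"
  shows "x * deg1 u * y \<in> null_deg U n"
proof -
  have "bas w * deg1 u * y \<in> null_deg U n" if "length w = a" for w
    by (rule lin_into_homog[OF lin_multL[OF lin_id] assms(3) _ subspace_null_deg])
      (use that assms in \<open>auto simp: null_deg_def intro!: fv.span_base\<close>)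
  then show ?thesis
    using lin_into_homog[OF lin_multR[OF lin_multR[OF lin_id]] assms(1) _ subspace_null_deg] by blast
qed

lemma null_deg_two:
  assumes "x \<in> homog a" "t \<in> null2 U" "y \<in> homog b" "a + 2 + b = n"
  shows "x * two t * y \<in> null_deg U n"
proof (rule lin_span_into[where f = "\<lambda>t. x * two t * y", OF _ subspace_null_deg _ assms(2)[unfolded null2_def]])
  show "lin (\<lambda>t. x * two t * y)" by (intro lin_intros lin_two)
  fix t assume "t \<in> {tens u x |u x. u \<in> U} \<union> {tens x u |u x. u \<in> U}"
  then consider u x' where "t = tens u x'" "u \<in> U" | u x' where "t = tens x' u" "u \<in> U" by blast
  then show "x * two t * y \<in> null_deg U n"
  proof cases
    case 1
    have "x * deg1 u * (deg1 x' * y) \<in> null_deg U n"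
      by (rule null_degI[OF assms(1) 1(2) homog_mult[OF deg1_in_homog assms(3)]]) (use assms(4) in simp)
    then show ?thesis by (simp add: 1 two_tens mult.assoc)
  next
    case 2
    have "x * deg1 x' * deg1 u * y \<in> null_deg U n"
      by (rule null_degI[OF homog_mult[OF assms(1) deg1_in_homog] 2(2) assms(3)]) (use assms(4) in simp)
    then show ?thesis by (simp add: 2 two_tens mult.assoc)
  qed
qed

lemma null_deg_ideal: "null_deg U n \<subseteq> ideal_gen (deg1 ` U)"
  unfolding null_deg_def ideal_gen_def by (rule fv.span_mono) blast

text \<open>The factor from \<open>U\<close> lies behind the braided pair, is its second or its
  first member, or lies before the pair. Only the two middle cases use that the braiding preserves
  \<open>null2 U\<close>.\<close>

lemma braid_at_null_deg:
  assumes c: "\<And>x. x \<in> null2 U \<Longrightarrow> lext c x \<in> null2 U" and "x \<in> null_deg U n" "Suc i < n"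
  shows "braid_at c i x \<in> null_deg U n"
proof (rule lin_span_into[OF lin_braid_at subspace_null_deg _ assms(2)[unfolded null_deg_def]])
  fix x assume "x \<in> {bas w * deg1 u * bas r | w u r. u \<in> U \<and> length w + 1 + length r = n}"
  then obtain w u r where x: "x = bas w * deg1 u * bas r" "u \<in> U" "length w + 1 + length r = n" by blast
  consider "Suc i < length w" | "Suc i = length w" | "i = length w" | "i > length w" by linarith
  then show "braid_at c i x \<in> null_deg U n"
  proof cases
    case 1
    then obtain w1 s t w2 where w: "w = w1 @ [s, t] @ w2" "length w1 = i" using split_word_at by metis
    have "x = bas w1 * two (bas (s, t)) * (bas w2 * deg1 u * bas r)"
      by (simp add: x w bas_mult_list flip: mult.assoc)
    then have "braid_at c i x = bas w1 * two (c (s, t)) * bas w2 * deg1 u * bas r"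
      using braid_at_mid_homog[OF bas_in_homog[OF w(2)], of c "bas (s, t)" "bas w2 * deg1 u * bas r"]
      by (simp only: mult.assoc lext_bas)
    also have "\<dots> \<in> null_deg U n"
      by (rule null_degI[OF homog_mult[OF homog_mult[OF bas_in_homog[OF refl] two_in_homog] bas_in_homog[OF refl]]
          x(2) bas_in_homog[OF refl]]) (use w x in simp)
    finally show ?thesis .
  next
    case 2
    then obtain w1 s where w: "w = w1 @ [s]" "length w1 = i"
      by (metis append_butlast_last_id length_butlast diff_Suc_1 list.size(3) nat.distinct(1))
    have "x = bas w1 * two (tens (bas s) u) * bas r"
      by (simp add: x w two_tens bas_mult_list flip: mult.assoc)
    then have "braid_at c i x = bas w1 * two (lext c (tens (bas s) u)) * bas r"
      using braid_at_mid_homog[OF bas_in_homog[OF w(2)]] by simp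
    also have "\<dots> \<in> null_deg U n"
      by (rule null_deg_two[OF bas_in_homog[OF refl] c bas_in_homog[OF refl]]) (use w x null2_right in auto)
    finally show ?thesis .
  next
    case 3
    then have "length r \<noteq> 0" using x assms(3) by linarith
    then obtain t r1 where r: "r = t # r1" by (cases r) auto
    have "x = bas w * two (tens u (bas t)) * bas r1"
      by (simp add: x r two_tens bas_Cons[of t r1] mult.assoc)
    then have "braid_at c i x = bas w * two (lext c (tens u (bas t))) * bas r1"
      using braid_at_mid_homog[OF bas_in_homog[OF 3[symmetric]]] by simp
    also have "\<dots> \<in> null_deg U n"
      by (rule null_deg_two[OF bas_in_homog[OF refl] c bas_in_homog[OF refl]]) (use r x null2_left in auto)
    finally show ?thesis .
  next
    case 4
    then have "Suc (i - length w - 1) < length r" using x assms(3) by simp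
    then obtain r1 s t r2 where r: "r = r1 @ [s, t] @ r2" "length r1 = i - length w - 1"
      using split_word_at by metis
    have "x = (bas w * deg1 u * bas r1) * two (bas (s, t)) * bas r2"
      by (simp add: x r bas_mult_list mult.assoc)
    moreover have "bas w * deg1 u * bas r1 \<in> homog i"
      using homog_mult[OF homog_mult[OF bas_in_homog[OF refl] deg1_in_homog] bas_in_homog[OF refl], of w u r1] r 4 by simp
    ultimately have "braid_at c i x = bas w * deg1 u * (bas r1 * two (c (s, t)) * bas r2)"
      using braid_at_mid_homog[of "bas w * deg1 u * bas r1" i c "bas (s, t)" "bas r2"] by (simp only: mult.assoc lext_bas)
    also have "\<dots> \<in> null_deg U n"
      by (rule null_degI[OF bas_in_homog[OF refl] x(2)
          homog_mult[OF homog_mult[OF bas_in_homog[OF refl] two_in_homog] bas_in_homog[OF refl]]]) (use r x 4 in simp)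
    finally show ?thesis .
  qed
qed

text \<open>
  The retraction \<open>ret\<close> witnesses that the \<open>v i\<close> are linearly independent modulo \<open>U\<close>.
\<close>

locale braided_basis = diag_braid Q for Q :: "'i::finite \<Rightarrow> 'i \<Rightarrow> 'k::field" +
  fixes c :: "'s \<times> 's \<Rightarrow> ('s \<times> 's \<Rightarrow>\<^sub>0 'k)" and U W :: "('s \<Rightarrow>\<^sub>0 'k) set"
    and v :: "'i \<Rightarrow> ('s \<Rightarrow>\<^sub>0 'k)" and ret :: "('s \<Rightarrow>\<^sub>0 'k) \<Rightarrow> ('i \<Rightarrow>\<^sub>0 'k)"
  assumes c_null: "\<And>x. x \<in> null2 U \<Longrightarrow> lext c x \<in> null2 U"
    and v_W: "\<And>i. v i \<in> W"
    and c_v: "\<And>i j. lext c (tens (v i) (v j)) - fscale (Q i j) (tens (v j) (v i)) \<in> null2 U"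
    and ret: "lin ret" "\<And>u. u \<in> U \<Longrightarrow> ret u = 0" "\<And>i. ret (v i) = bas i"
begin

definition Phi :: "('i list \<Rightarrow>\<^sub>0 'k) \<Rightarrow> ('s list \<Rightarrow>\<^sub>0 'k)" where "Phi = freehom (\<lambda>i. deg1 (v i))"
definition Ret :: "('s list \<Rightarrow>\<^sub>0 'k) \<Rightarrow> ('i list \<Rightarrow>\<^sub>0 'k)" where "Ret = freehom (\<lambda>s. deg1 (ret (bas s)))"

lemma lin_Phi: "lin Phi" by (simp add: Phi_def lin_freehom)
lemma Phi_mult: "Phi (x * y) = Phi x * Phi y" by (simp add: Phi_def freehom_mult)

lemma Ret_deg1: "Ret (deg1 x) = deg1 (ret x)"
  by (rule lin_eqI[where f = "\<lambda>x. Ret (deg1 x)" and g = "\<lambda>x. deg1 (ret x)"])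
    (simp_all add: Ret_def lin_freehom_comp lin_deg1 lin_deg1_comp ret freehom_bas)

lemma Ret_Phi: "Ret (Phi x) = x"
  using freehom_comp[of "\<lambda>s. deg1 (ret (bas s))" "\<lambda>i. deg1 (v i)" x]
  unfolding Ret_def[symmetric] Phi_def[symmetric] by (simp add: Ret_deg1 ret freehom_bas_singletons)

lemma Ret_ideal: "x \<in> ideal_gen (deg1 ` U) \<Longrightarrow> Ret x = 0"
proof -
  assume x: "x \<in> ideal_gen (deg1 ` U)"
  have "Ret x \<in> {0}"
  proof (rule lin_span_into[OF _ _ _ x[unfolded ideal_gen_def]])
    show "lin Ret" by (simp add: Ret_def lin_freehom)
    show "fv.subspace {0 :: 'i list \<Rightarrow>\<^sub>0 'k}" by (simp add: fv.subspace_def)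
    fix y assume "y \<in> {a * r * b | a r b. r \<in> deg1 ` U}"
    then obtain a u b where "y = a * deg1 u * b" "u \<in> U" by blast
    then show "Ret y \<in> {0}"
      using Ret_deg1[of u] by (simp add: Ret_def freehom_mult ret lin_0[OF lin_deg1])
  qed
  then show ?thesis by simp
qed

lemma Phi_in_homog: "x \<in> homog n \<Longrightarrow> Phi x \<in> homog n"
proof (rule lin_into_homog[OF lin_Phi _ _ subspace_homog])
  fix w :: "'i list" assume "length w = n"
  then show "Phi (bas w) \<in> homog n"
  proof (induction w arbitrary: n)
    case Nil
    then show ?case by (simp add: Phi_def freehom_bas bas_Nil[symmetric] bas_in_homog)
  next
    case (Cons i w)
    have "deg1 (v i) * Phi (bas w) \<in> homog (1 + length w)"
      by (intro homog_mult deg1_in_homog Cons.IH refl)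
    then show ?case using Cons.prems by (simp add: Phi_def freehom_bas)
  qed
qed

definition lift_deg :: "nat \<Rightarrow> ('s list \<Rightarrow>\<^sub>0 'k) \<Rightarrow> ('i list \<Rightarrow>\<^sub>0 'k) \<Rightarrow> bool" where
  "lift_deg n x t \<longleftrightarrow> t \<in> homog n \<and> x - Phi t \<in> null_deg U n"

lemma Phi_braid_at:
  assumes "t \<in> homog n" "Suc i < n"
  shows "braid_at c i (Phi t) - Phi (braid_at dbr i t) \<in> null_deg U n"
proof (rule lin_into_homog[where f = "\<lambda>t. braid_at c i (Phi t) - Phi (braid_at dbr i t)", OF _ assms(1) _ subspace_null_deg])
  fix w :: "'i list" assume w: "length w = n"
  then obtain u a b r where wu: "w = u @ [a, b] @ r" "length u = i"
    using split_word_at assms(2) by metis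
  have P: "Phi (bas (u @ [a, b] @ r)) = Phi (bas u) * two (tens (v a) (v b)) * Phi (bas r)" for a b
    by (simp add: Phi_def freehom_bas two_tens mult.assoc)
  have hu: "Phi (bas u) \<in> homog i" using wu by (intro Phi_in_homog bas_in_homog)
  have "braid_at dbr i (bas w) = fscale (Q a b) (bas (u @ [b, a] @ r))"
    using wu by (simp only: braid_at_word) (simp add: dbr_def lin_scale[OF lin_two] fscale_mult bas_mult_list)
  then have "braid_at c i (Phi (bas w)) - Phi (braid_at dbr i (bas w))
    = Phi (bas u) * two (lext c (tens (v a) (v b)) - fscale (Q a b) (tens (v b) (v a))) * Phi (bas r)"
    unfolding wu(1) P braid_at_mid_homog[OF hu]
    using P[of b a] by (simp add: lin_scale[OF lin_Phi] lin_scale[OF lin_two] lin_diff[OF lin_two] fscale_mult algebra_simps)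
  also have "\<dots> \<in> null_deg U n"
    by (rule null_deg_two[OF hu c_v Phi_in_homog[OF bas_in_homog[OF refl]]]) (use w wu in simp)
  finally show "braid_at c i (Phi (bas w)) - Phi (braid_at dbr i (bas w)) \<in> null_deg U n" .
qed (intro lin_sub lin_comp[OF lin_braid_at] lin_comp[OF lin_Phi] lin_Phi lin_braid_at)

lemma lift_braid_at: "lift_deg n x t \<Longrightarrow> Suc i < n \<Longrightarrow> lift_deg n (braid_at c i x) (braid_at dbr i t)"
proof -
  assume l: "lift_deg n x t" and i: "Suc i < n"
  have "braid_at c i (x - Phi t) + (braid_at c i (Phi t) - Phi (braid_at dbr i t)) \<in> null_deg U n"
    using l i by (intro fv.subspace_add[OF subspace_null_deg] braid_at_null_deg Phi_braid_at c_null) (auto simp: lift_deg_def)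
  then show ?thesis
    using l i by (simp add: lift_deg_def lin_diff[OF lin_braid_at] braid_at_in_homog)
qed

lemma lift_braid_sum: "lift_deg n x t \<Longrightarrow> m < n \<Longrightarrow> lift_deg n (braid_sum c m x) (braid_sum dbr m t)"
proof (induction m)
  case (Suc m)
  have "lift_deg n (braid_at c m (braid_sum c m x)) (braid_at dbr m (braid_sum dbr m t))"
    using Suc by (intro lift_braid_at) auto
  then have "(x - Phi t) + (braid_at c m (braid_sum c m x) - Phi (braid_at dbr m (braid_sum dbr m t))) \<in> null_deg U n"
    "t + braid_at dbr m (braid_sum dbr m t) \<in> homog n"
    using Suc.prems by (auto simp: lift_deg_def intro!: fv.subspace_add[OF subspace_null_deg] fv.subspace_add[OF subspace_homog])
  then show ?case
    by (simp add: lift_deg_def lin_add[OF lin_Phi] algebra_simps)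
qed simp

lemma lift_qsymm: "lift_deg n x t \<Longrightarrow> m \<le> n \<Longrightarrow> lift_deg n (qsymm c m x) (qsymm dbr m t)"
  by (induction m arbitrary: x t) (simp_all add: lift_braid_sum)

lemma quantum_symmetrizer_Phi:
  "quantum_symmetrizer c (Phi t) - Phi (quantum_symmetrizer dbr t) \<in> ideal_gen (deg1 ` U)"
proof (rule lin_into_subspace[where f = "\<lambda>t. quantum_symmetrizer c (Phi t) - Phi (quantum_symmetrizer dbr t)"])
  fix w :: "'i list"
  have h: "bas w \<in> homog (length w)" by (simp add: bas_in_homog)
  then have "lift_deg (length w) (Phi (bas w)) (bas w)"
    by (simp add: lift_deg_def fv.subspace_0[OF subspace_null_deg])
  from lift_qsymm[OF this order_refl]
  show "quantum_symmetrizer c (Phi (bas w)) - Phi (quantum_symmetrizer dbr (bas w)) \<in> ideal_gen (deg1 ` U)"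
    using null_deg_ideal by (auto simp: quantum_symmetrizer_homog[OF h] quantum_symmetrizer_homog[OF Phi_in_homog[OF h]] lift_deg_def)
qed (auto intro!: lin_sub lin_comp[OF lin_quantum_symmetrizer] lin_comp[OF lin_Phi] lin_Phi lin_quantum_symmetrizer
    simp: ideal_gen_def)

lemma Phi_tensor_alg: "Phi t \<in> tensor_alg W"
proof (rule lin_into_subspace[OF lin_Phi])
  show "Phi (bas w) \<in> tensor_alg W" for w
    unfolding tensor_alg_def subalg_gen_def Phi_def freehom_bas by (rule fv.span_base) (use v_W in \<open>auto intro!: exI[of _ "map (\<lambda>i. deg1 (v i)) w"]\<close>)
qed (simp add: tensor_alg_def subalg_gen_def)

lemma subspace_ideal_gen: "fv.subspace (ideal_gen R)" by (simp add: ideal_gen_def)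

text \<open>The two symmetrizers correspond under \<open>Phi\<close> modulo the ideal of
  \<open>U\<close>, and \<open>Phi\<close> is injective modulo that ideal because \<open>Ret\<close>
  kills it and inverts \<open>Phi\<close>.\<close>

theorem Phi_nichols_ideal: "Phi t \<in> nichols_ideal c W U \<longleftrightarrow> t \<in> nich"
proof -
  let ?a = "quantum_symmetrizer c (Phi t)" and ?b = "Phi (quantum_symmetrizer dbr t)"
  have "?a - (?a - ?b) \<in> ideal_gen (deg1 ` U)" if "?a \<in> ideal_gen (deg1 ` U)"
    by (rule fv.subspace_diff[OF subspace_ideal_gen that quantum_symmetrizer_Phi])
  moreover have "?b + (?a - ?b) \<in> ideal_gen (deg1 ` U)" if "?b \<in> ideal_gen (deg1 ` U)"
    by (rule fv.subspace_add[OF subspace_ideal_gen that quantum_symmetrizer_Phi])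
  ultimately have "?a \<in> ideal_gen (deg1 ` U) \<longleftrightarrow> ?b \<in> ideal_gen (deg1 ` U)"
    by auto
  also have "\<dots> \<longleftrightarrow> quantum_symmetrizer dbr t = 0"
  proof
    assume "?b \<in> ideal_gen (deg1 ` U)"
    from Ret_ideal[OF this] show "quantum_symmetrizer dbr t = 0" by (simp only: Ret_Phi)
  next
    assume "quantum_symmetrizer dbr t = 0"
    then show "?b \<in> ideal_gen (deg1 ` U)"
      by (simp only: lin_0[OF lin_Phi] fv.subspace_0[OF subspace_ideal_gen])
  qed
  finally show ?thesis
    using Phi_tensor_alg by (simp add: nichols_ideal_def nich_iff_quantum_symmetrizer)
qed

lemma subspace_nichols_ideal: "fv.subspace (nichols_ideal c W U)"
proof (rule fv.subspaceI)
  have s: "fv.subspace (tensor_alg W)" by (simp add: tensor_alg_def subalg_gen_def)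
  show "0 \<in> nichols_ideal c W U"
    using s by (simp add: nichols_ideal_def fv.subspace_0 lin_0[OF lin_quantum_symmetrizer] subspace_ideal_gen)
  show "x + y \<in> nichols_ideal c W U" if "x \<in> nichols_ideal c W U" "y \<in> nichols_ideal c W U" for x y
    using that s by (simp add: nichols_ideal_def fv.subspace_add lin_add[OF lin_quantum_symmetrizer] subspace_ideal_gen)
  show "fscale a x \<in> nichols_ideal c W U" if "x \<in> nichols_ideal c W U" for a x
    using that s by (simp add: nichols_ideal_def fv.subspace_scale lin_scale[OF lin_quantum_symmetrizer] subspace_ideal_gen)
qed

text \<open>The vectors \<open>v i\<close> may span a proper subspace of \<open>W\<close>; a braided
  subspace bounds the dimension from below. This is how n = 2 with \<lambda> = -1 is
  treated.\<close>

lemma nichols_dim_ge: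
  assumes "finite A" "indep_mod nich A g"
  shows "enat (card A) \<le> nichols_dim c W U"
  unfolding nichols_dim_def
proof (rule quot_dim_ge[OF subspace_nichols_ideal assms(1)])
  show "(\<lambda>x. Phi (g x)) ` A \<subseteq> tensor_alg W" using Phi_tensor_alg by blast
  show "indep_mod (nichols_ideal c W U) A (\<lambda>x. Phi (g x))"
    using assms(2)
    by (simp add: indep_mod_def lin_scale[OF lin_Phi, symmetric] lin_sum[OF lin_Phi, symmetric] Phi_nichols_ideal)
qed

lemma nichols_dim_infinite:
  assumes "\<And>n. \<exists>w. length w \<ge> n \<and> bas w \<notin> nich"
  shows "nichols_dim c W U = \<infinity>"
proof (rule enat_eq_infinityI)
  fix n
  obtain L h where "finite L" "card L = n" "indep_mod nich L (\<lambda>l::nat. bas (h l))"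
    using infinite_indep[OF assms] by metis
  then show "enat n \<le> nichols_dim c W U" using nichols_dim_ge by blast
qed

lemma tensor_alg_Phi:
  assumes "W \<subseteq> fv.span (range v)"
  shows "tensor_alg W \<subseteq> range Phi"
proof -
  have sub: "fv.subspace (range Phi)"
  proof (rule fv.subspaceI)
    show "0 \<in> range Phi" using lin_0[OF lin_Phi] by (metis rangeI)
  qed (auto simp flip: lin_add[OF lin_Phi] lin_scale[OF lin_Phi])
  have d: "deg1 x \<in> range Phi" if "x \<in> W" for x
  proof (rule lin_span_into[OF lin_deg1 sub])
    show "x \<in> fv.span (range v)" using assms that by blast
    show "deg1 y \<in> range Phi" if "y \<in> range v" for y
    proof -
      obtain i where "y = v i" using \<open>y \<in> range v\<close> by blast
      then have "deg1 y = Phi (bas [i])" by (simp add: Phi_def freehom_bas)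
      then show ?thesis by blast
    qed
  qed
  have "prod_list rs \<in> range Phi" if "set rs \<subseteq> deg1 ` W" for rs
    using that
  proof (induction rs)
    case Nil
    have "Phi 1 = 1" by (simp add: Phi_def freehom_1)
    then show ?case by (metis prod_list.Nil rangeI)
  next
    case (Cons r rs)
    then obtain a b where "r = Phi a" "prod_list rs = Phi b" using d by fastforce
    then have "prod_list (r # rs) = Phi (a * b)" by (simp add: Phi_mult)
    then show ?case by blast
  qed
  then show ?thesis
    unfolding tensor_alg_def subalg_gen_def by (intro fv.span_minimal sub) blast
qed

lemma nichols_dim_le:
  assumes "W \<subseteq> fv.span (range v)" "finite B" "nspan B = UNIV"
  shows "nichols_dim c W U \<le> enat (card B)"
proof -
  have "tensor_alg W \<subseteq> fv.span (Phi ` B \<union> nichols_ideal c W U)"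
  proof
    fix x assume "x \<in> tensor_alg W"
    then obtain t where x: "x = Phi t" using tensor_alg_Phi[OF assms(1)] by blast
    have "t \<in> nspan B" using assms(3) by simp
    then show "x \<in> fv.span (Phi ` B \<union> nichols_ideal c W U)"
      unfolding x nspan_def
      by (rule lin_span_into[OF lin_Phi fv.subspace_span, rotated]) (auto intro!: fv.span_base simp: Phi_nichols_ideal)
  qed
  then have "nichols_dim c W U \<le> enat (card (Phi ` B))"
    unfolding nichols_dim_def using assms(2) Phi_tensor_alg by (intro quot_dim_le) auto
  also have "\<dots> \<le> enat (card B)"
    using card_image_le[OF assms(2)] by simp
  finally show ?thesis .
qed

end

section \<open>Two commuting blocks of type \<open>A\<^sub>2\<close> at \<open>-1\<close>\<close>

context diag_braid
begin

definition killed :: "'i \<Rightarrow> 'a set \<Rightarrow> ('a \<Rightarrow> ('i list \<Rightarrow>\<^sub>0 'k)) \<Rightarrow> bool" where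
  "killed i A g \<longleftrightarrow> (\<forall>x\<in>A. dR i (g x) = 0)"

definition ext :: "('i list \<Rightarrow>\<^sub>0 'k) \<Rightarrow> ('a \<Rightarrow> ('i list \<Rightarrow>\<^sub>0 'k)) \<Rightarrow> 'a \<times> bool \<Rightarrow> ('i list \<Rightarrow>\<^sub>0 'k)" where
  "ext y g = (\<lambda>(x, b). if b then g x * y else g x)"

lemma killed_ext: "killed i A g \<Longrightarrow> dR i y = 0 \<Longrightarrow> killed i (A \<times> UNIV) (ext y g)"
  by (auto simp: killed_def ext_def dR_mult)

text \<open>
  Right multiplication by \<open>y\<close> doubles an independent family if some operator preserving the Nichols
  ideal kills the family and strips off the factor \<open>y\<close>.
\<close>

lemma indep_ext:
  assumes A: "finite A" "indep_mod nich A g" and P: "lin P" "\<And>x. x \<in> nich \<Longrightarrow> P x \<in> nich"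
    and g: "\<And>x. x \<in> A \<Longrightarrow> P (g x) = 0" "\<And>x. x \<in> A \<Longrightarrow> P (g x * y) = fscale a (g x)" and "a \<noteq> 0"
  shows "indep_mod nich (A \<times> UNIV) (ext y g)"
  unfolding indep_mod_def
proof (intro allI impI)
  fix c :: "'a \<times> bool \<Rightarrow> 'k"
  assume s: "(\<Sum>xb\<in>A \<times> UNIV. fscale (c xb) (ext y g xb)) \<in> nich"
  have sum: "(\<Sum>xb\<in>A \<times> UNIV. fscale (c xb) (ext y g xb))
    = (\<Sum>x\<in>A. fscale (c (x, True)) (g x * y) + fscale (c (x, False)) (g x))"
    by (subst sum.cartesian_product[symmetric, of "\<lambda>x b. fscale (c (x, b)) (ext y g (x, b))", simplified])
      (simp add: UNIV_bool ext_def add.commute)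
  have "P (\<Sum>x\<in>A. fscale (c (x, True)) (g x * y) + fscale (c (x, False)) (g x)) \<in> nich"
    using s P(2) unfolding sum by blast
  also have "P (\<Sum>x\<in>A. fscale (c (x, True)) (g x * y) + fscale (c (x, False)) (g x))
    = (\<Sum>x\<in>A. fscale (c (x, True) * a) (g x))"
    by (simp add: lin_sum[OF P(1)] lin_add[OF P(1)] lin_scale[OF P(1)] g)
  finally have "\<forall>x\<in>A. c (x, True) * a = 0"
    using A(2)[unfolded indep_mod_def, rule_format, of "\<lambda>x. c (x, True) * a"] by blast
  then have t: "\<forall>x\<in>A. c (x, True) = 0" using \<open>a \<noteq> 0\<close> by simp
  then have "(\<Sum>x\<in>A. fscale (c (x, False)) (g x)) \<in> nich"
    using s unfolding sum by simp
  then have "\<forall>x\<in>A. c (x, False) = 0"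
    using A(2)[unfolded indep_mod_def, rule_format, of "\<lambda>x. c (x, False)"] by blast
  with t show "\<forall>xb\<in>A \<times> UNIV. c xb = 0"
    by (auto simp: all_bool_eq split: prod.splits)
qed

lemma indep_ext_letter:
  assumes "finite A" "indep_mod nich A g" "killed i A g"
  shows "indep_mod nich (A \<times> UNIV) (ext (bas [i]) g)"
  by (rule indep_ext[where P = "dR i" and a = 1, OF assms(1,2) lin_dR nich_dR])
    (use assms(3) in \<open>simp_all add: killed_def dR_mult bas_Nil\<close>)

end

context letter_pair
begin

text \<open>The stripping operator is \<open>dR e\<close> after \<open>dR f\<close>, which turns the
  new factor into the scalar 1 - p.\<close>

lemma indep_ext_root:
  assumes "finite A" "indep_mod nich A g" "killed e A g" "\<And>x. x \<in> A \<Longrightarrow> dR e (dR f (g x)) = 0" "p \<noteq> 1"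
  shows "indep_mod nich (A \<times> UNIV) (ext (z (Suc 0)) g)"
proof (rule indep_ext[OF assms(1,2), of "\<lambda>x. dR e (dR f x)" _ "1 - p"])
  fix x assume x: "x \<in> A"
  have "dR f (z (Suc 0)) = fscale (1 - p) xe"
    using dR_f_z[of "Suc 0"] by (simp add: Cz_def)
  moreover have "sg f (z (Suc 0)) = fscale (Q f e * Q f f) (z (Suc 0))"
    using sg_f_z[of "Suc 0"] by simp
  ultimately show "dR e (dR f (g x * z (Suc 0))) = fscale (1 - p) (g x)"
    using assms(3,4) x by (simp add: dR_mult killed_def bas_Nil fscale_mult dR_e_z del: z.simps)
qed (use assms lin_comp[OF lin_dR lin_dR] nich_dR in auto)

text \<open>The factors are appended in the order xf, root vector, xe. At each stage the operator
  that strips the new factor has to kill what is already there, and \<open>dR e\<close> kills both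
  xf and the root vector.\<close>

definition block :: "('a \<Rightarrow> ('i list \<Rightarrow>\<^sub>0 'k)) \<Rightarrow> (('a \<times> bool) \<times> bool) \<times> bool \<Rightarrow> ('i list \<Rightarrow>\<^sub>0 'k)" where
  "block g = ext xe (ext (z (Suc 0)) (ext xf g))"

lemma indep_block:
  assumes "finite A" "indep_mod nich A g" "killed e A g" "killed f A g" "p \<noteq> 1"
  shows "indep_mod nich (((A \<times> UNIV) \<times> UNIV) \<times> UNIV) (block g)"
  unfolding block_def
proof (intro indep_ext_letter indep_ext_root)
  show "killed e (A \<times> UNIV) (ext xf g)"
    using assms ef by (intro killed_ext) auto
  then show "killed e ((A \<times> UNIV) \<times> UNIV) (ext (z (Suc 0)) (ext xf g))"
    by (rule killed_ext) (rule dR_e_z)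
  show "dR e (dR f (ext xf g x)) = 0" if "x \<in> A \<times> UNIV" for x
    using that assms(3,4) by (auto simp: ext_def killed_def dR_mult bas_Nil)
qed (use assms in auto)

lemma killed_block:
  assumes "killed i A g" "i \<noteq> e" "i \<noteq> f"
  shows "killed i (((A \<times> UNIV) \<times> UNIV) \<times> UNIV) (block g)"
  unfolding block_def by (intro killed_ext assms) (use assms dR_other_z[of i "Suc 0"] in \<open>auto simp del: z.simps\<close>)

end

lemma (in diag_braid) ad_other_block:
  assumes "\<And>x. x \<in> {a, b} \<Longrightarrow> i \<noteq> x \<and> Q i x * Q x i = 1" "y \<in> {a, b}" "z \<in> {a, b}"
  shows "ad i (bas [y] * bas [z]) \<in> nich"
  using assms by (intro ad_mult_nich ad_letter_nich) auto

text \<open>\<open>ad i\<close> sends both letters of the pair into the ideal. Being a skew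
  derivation, it does the same with the root vector and with every monomial, and on a monomial
  \<open>sg i\<close> is a scalar.\<close>

lemma (in A2_pair) other_letter_A2_basis:
  assumes "\<And>x. x \<in> {e, f} \<Longrightarrow> i \<noteq> x \<and> Q i x * Q x i = 1" "y \<in> A2_basis"
  shows "\<exists>s. bas [i] * y - fscale s (y * bas [i]) \<in> nich"
proof -
  obtain a b c where y: "y = xf ^ a * zz ^ b * xe ^ c"
    using assms(2) by (auto simp: A2_basis_def)
  have "ad i zz = ad i (xe * xf) - fscale (Q e f) (ad i (xf * xe))"
    unfolding zz_eq by (simp add: ad_def fscale_mult algebra_simps fv.scale_right_diff_distrib)
  moreover have "ad i (xe * xf) \<in> nich" "ad i (xf * xe) \<in> nich"
    by (rule ad_other_block[of e f]; use assms(1) in auto)+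
  ultimately have "ad i zz \<in> nich"
    by (simp add: nich_diff nich_scale del: z.simps)
  then have "ad i y \<in> nich"
    unfolding y using assms(1) by (intro ad_mult_nich ad_power_nich ad_letter_nich) auto
  moreover have "sg i zz = fscale (Q i e * Q i f) zz"
    unfolding zz_eq by (simp add: sg_mult fscale_mult fv.scale_right_diff_distrib mult.commute)
  from sg_power[OF this, of b] have "sg i y = fscale (Q i f ^ a * (Q i e * Q i f) ^ b * Q i e ^ c) y"
    unfolding y sg_mult sg_power[OF sg_bas[of i "[f]"]] sg_power[OF sg_bas[of i "[e]"]]
    by (simp add: fscale_mult mult_ac del: z.simps)
  ultimately show ?thesis
    by (auto simp: ad_def fscale_mult)
qed

section \<open>The four-letter diagram with two A_2 components\<close>

locale two_blocks = diag_braid Q for Q :: "'i::finite \<Rightarrow> 'i \<Rightarrow> 'k::field" +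
  fixes e1 f1 e2 f2 :: 'i
  assumes distinct: "distinct [e1, f1, e2, f2]" and all: "UNIV = {e1, f1, e2, f2}"
    and diag: "\<And>i. Q i i = - 1" and A2s: "Q e1 f1 * Q f1 e1 = - 1" "Q e2 f2 * Q f2 e2 = - 1"
    and cross: "\<And>x y. x \<in> {e1, f1} \<Longrightarrow> y \<in> {e2, f2} \<Longrightarrow> Q x y * Q y x = 1"
    and two: "(2 :: 'k) \<noteq> 0"
begin

sublocale L1: A2_pair Q e1 f1 2
  by unfold_locales (use distinct diag A2s in \<open>auto simp: numeral_2_eq_2\<close>)
sublocale L2: A2_pair Q e2 f2 2
  by unfold_locales (use distinct diag A2s in \<open>auto simp: numeral_2_eq_2\<close>)

definition "basis64 = (\<lambda>(x, y). x * y) ` (L1.A2_basis \<times> L2.A2_basis)"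

lemma finite_basis64: "finite basis64" "card basis64 \<le> 64"
proof -
  have 1: "finite L1.A2_basis" "card L1.A2_basis \<le> 8"
    unfolding L1.A2_basis_def by (simp, rule order_trans[OF card_image_le]) simp_all
  have 2: "finite L2.A2_basis" "card L2.A2_basis \<le> 8"
    unfolding L2.A2_basis_def by (simp, rule order_trans[OF card_image_le]) simp_all
  show "finite basis64" using 1 2 by (simp add: basis64_def)
  have "card basis64 \<le> card (L1.A2_basis \<times> L2.A2_basis)"
    unfolding basis64_def using 1 2 by (intro card_image_le) simp
  also have "\<dots> \<le> 8 * 8"
    unfolding card_cartesian_product using 1 2 by (intro mult_le_mono) auto
  finally show "card basis64 \<le> 64" by simp
qed

lemma mult_basis64:
  assumes "x \<in> nspan L1.A2_basis" "y \<in> nspan L2.A2_basis"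
  shows "x * y \<in> nspan basis64"
proof -
  have "b * y \<in> nspan basis64" if "b \<in> L1.A2_basis" for b
    by (rule lin_nspan[OF lin_multL[OF lin_id] _ _ assms(2)])
      (use that in \<open>auto simp: nich_mult_left nich_nspan basis64_def intro!: base_nspan\<close>)
  then show ?thesis
    by - (rule lin_nspan[OF lin_multR[OF lin_id] _ _ assms(1)], auto simp: nich_mult_right nich_nspan)
qed

lemma nspan_basis64: "nspan basis64 = UNIV"
proof (rule UNIV_nspan)
  have "xx ^ 0 * yy ^ 0 * zz ^ 0 = 1" for xx yy zz :: "'i list \<Rightarrow>\<^sub>0 'k" by simp
  then have "1 \<in> nspan L1.A2_basis" "1 \<in> nspan L2.A2_basis"
    using L1.A2_monomial[of 0 0 0] L2.A2_monomial[of 0 0 0] by simp_all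
  then show "1 \<in> nspan basis64" using mult_basis64[of 1 1] by simp
  fix i x assume x: "x \<in> nspan basis64"
  show "bas [i] * x \<in> nspan basis64"
  proof (rule lin_nspan[OF lin_multL[OF lin_id] _ _ x])
    fix x assume "x \<in> basis64"
    then obtain a b where ab: "x = a * b" "a \<in> L1.A2_basis" "b \<in> L2.A2_basis"
      by (auto simp: basis64_def)
    consider "i \<in> {e1, f1}" | "i \<in> {e2, f2}" using all by blast
    then show "bas [i] * x \<in> nspan basis64"
    proof cases
      case 1
      then show ?thesis
        using mult_basis64[OF L1.A2_closed[OF base_nspan[OF ab(2)] 1] base_nspan[OF ab(3)]] ab(1) by (simp add: mult.assoc)
    next
      case 2
      have "i \<noteq> x \<and> Q i x * Q x i = 1" if "x \<in> {e1, f1}" for x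
        using cross[OF that 2] distinct that 2 by (auto simp: mult.commute)
      then obtain s where s: "bas [i] * a - fscale s (a * bas [i]) \<in> nich"
        using L1.other_letter_A2_basis ab(2) by blast
      \<comment> \<open>A letter of the second block is moved past the first factor at the cost of a
        scalar, and is then absorbed by the second factor.\<close>
      have "bas [i] * x = (bas [i] * a - fscale s (a * bas [i])) * b + fscale s (a * (bas [i] * b))"
        by (simp add: ab(1) algebra_simps fscale_mult)
      moreover have "a * (bas [i] * b) \<in> nspan basis64"
        by (rule mult_basis64[OF base_nspan[OF ab(2)] L2.A2_closed[OF base_nspan[OF ab(3)] 2]])
      ultimately show ?thesis
        using s by (simp add: nspan_rules nich_nspan nich_mult_right)
    qed
  qed (simp add: nich_nspan nich_mult_left)
qed

text \<open>Six doublings of the family {1} give 2^6 = 64 elements, which the nested type encodes.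
  The second block is built first because the derivations for e1 and f1 kill it.\<close>

lemma indep64: "\<exists>(A :: (((((((unit \<times> bool) \<times> bool) \<times> bool) \<times> bool) \<times> bool) \<times> bool)) set) g.
  finite A \<and> card A = 64 \<and> indep_mod nich A g"
proof -
  have p: "Q e1 f1 * Q f1 e1 \<noteq> 1" "Q e2 f2 * Q f2 e2 \<noteq> 1"
    using A2s two by (metis add.right_inverse one_add_one)+
  have 0: "indep_mod nich {()} (\<lambda>_. 1)"
  proof (unfold indep_mod_def, intro allI impI ballI)
    fix c :: "unit \<Rightarrow> 'k" and x
    assume "(\<Sum>x\<in>{()}. fscale (c x) 1) \<in> nich"
    then have "eps (fscale (c ()) 1) = 0" by (intro nich_eps) simp
    then show "c x = 0" by simp
  qed
  have k: "killed i {()} (\<lambda>_. 1)" for i by (simp add: killed_def)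
  have 2: "indep_mod nich ((({()} \<times> UNIV) \<times> UNIV) \<times> UNIV) (L2.block (\<lambda>_. 1))"
    by (rule L2.indep_block[OF _ 0 k k p(2)]) simp
  have "indep_mod nich (((((({()} \<times> UNIV) \<times> UNIV) \<times> UNIV) \<times> UNIV) \<times> UNIV) \<times> UNIV) (L1.block (L2.block (\<lambda>_. 1)))"
    by (rule L1.indep_block[OF _ 2 _ _ p(1)]) (use distinct in \<open>auto intro!: L2.killed_block k\<close>)
  then show ?thesis
    by (intro exI conjI) (simp_all add: card_cartesian_product)
qed

end

lemma (in braided_basis) nichols_dim_64:
  assumes "two_blocks Q e1 f1 e2 f2" "W \<subseteq> fv.span (range v)"
  shows "nichols_dim c W U = 64"
proof (rule antisym)
  interpret B: two_blocks Q e1 f1 e2 f2 by fact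
  have "nichols_dim c W U \<le> enat (card B.basis64)"
    by (rule nichols_dim_le[OF assms(2) B.finite_basis64(1) B.nspan_basis64])
  also have "\<dots> \<le> enat 64" using B.finite_basis64(2) by simp
  finally show "nichols_dim c W U \<le> 64" by (simp add: numeral_eq_enat)
  show "64 \<le> nichols_dim c W U"
    using B.indep64 nichols_dim_ge by (metis numeral_eq_enat)
qed

section \<open>The Suzuki algebra as a Hopf algebra quotient\<close>

lemma comult_append: "comult (u @ v) = (comult u * comult v :: _ \<Rightarrow>\<^sub>0 'k::field)"
  by (induction u rule: comult.induct) (simp_all add: mult.assoc)

definition Delta :: "'k::field free_alg \<Rightarrow> (word \<times> word \<Rightarrow>\<^sub>0 'k)" where "Delta = lext comult"

lemma lin_Delta: "lin Delta" by (simp add: Delta_def lin_lext)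

lemma Delta_mult: "Delta (x * y) = Delta x * Delta y"
  by (rule bilin_eqI[where f = "\<lambda>x y. Delta (x * y)" and g = "\<lambda>x y. Delta x * Delta y"])
    (intro lin_intros lin_comp[OF lin_Delta] lin_Delta | simp add: bas_mult_list Delta_def comult_append)+

lemma Delta_simps: "Delta (x + y) = Delta x + Delta y" "Delta (x - y) = Delta x - Delta y"
  "Delta (fscale a x) = fscale a (Delta x)"
  by (simp_all add: lin_add lin_diff lin_scale lin_Delta)

lemma UNIV_ind: "UNIV = {I1, I2}" using ind.exhaust by auto

lemma Delta_1: "Delta 1 = 1"
  by (simp add: Delta_def flip: bas_Nil)

lemma Delta_xg: "Delta (xg i j) = tens (xg i I1) (xg I1 j) + tens (xg i I2) (xg I2 j)"
  by (simp add: Delta_def xg_def)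

definition ant :: "nat \<Rightarrow> 'k::field free_alg \<Rightarrow> 'k free_alg" where "ant N = lext (antipode N)"

lemma lin_ant: "lin (ant N)" by (simp add: ant_def lin_lext)

lemma antipode_append: "antipode N (u @ v) = (antipode N v * antipode N u :: 'k::field free_alg)"
  by (induction N u rule: antipode.induct) (simp_all add: mult.assoc)

lemma ant_mult: "ant N (x * y) = ant N y * ant N x"
  by (rule bilin_eqI[where f = "\<lambda>x y. ant N (x * y)" and g = "\<lambda>x y. ant N y * ant N x"])
    (intro lin_intros lin_comp[OF lin_ant] lin_ant | simp add: bas_mult_list ant_def antipode_append)+

lemma ant_1: "ant N 1 = 1"
  by (simp add: ant_def flip: bas_Nil)

lemma ant_xg: "ant N (xg i j) = xg j i ^ (4 * N - 1)"
  by (simp add: ant_def xg_def)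

lemma ant_power: "ant N (x ^ m) = ant N x ^ m"
  by (induction m) (simp_all add: ant_1 ant_mult power_commutes)

lemma alt_prod_even: "alt_prod a b (2 * m) = (a * b) ^ m"
  by (induction m) (simp_all add: mult.assoc)

lemma ideal_gen_mult:
  assumes "x \<in> ideal_gen R"
  shows "y * x \<in> ideal_gen R" "x * y \<in> ideal_gen R"
proof -
  have s: "fv.subspace (ideal_gen R)" by (simp add: ideal_gen_def)
  show "y * x \<in> ideal_gen R"
  proof (rule lin_span_into[OF lin_multL[OF lin_id] s _ assms[unfolded ideal_gen_def]])
    fix x assume "x \<in> {a * r * b | a r b. r \<in> R}"
    then obtain a r b where "x = a * r * b" "r \<in> R" by blast
    then have "y * x = (y * a) * r * b" "r \<in> R" by (simp_all add: mult.assoc)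
    then show "y * x \<in> ideal_gen R" unfolding ideal_gen_def by (intro fv.span_base) blast
  qed
  show "x * y \<in> ideal_gen R"
  proof (rule lin_span_into[OF lin_multR[OF lin_id] s _ assms[unfolded ideal_gen_def]])
    fix x assume "x \<in> {a * r * b | a r b. r \<in> R}"
    then obtain a r b where "x = a * r * b" "r \<in> R" by blast
    then have "x * y = a * r * (b * y)" "r \<in> R" by (simp_all add: mult.assoc)
    then show "x * y \<in> ideal_gen R" unfolding ideal_gen_def by (intro fv.span_base) blast
  qed
qed

lemma ideal_gen_base: "r \<in> R \<Longrightarrow> r \<in> ideal_gen R"
proof -
  assume "r \<in> R"
  then have "1 * r * 1 \<in> {a * r * b | a r b. r \<in> R}" by blast
  then show ?thesis unfolding ideal_gen_def by (intro fv.span_base) simp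
qed

lemma lin_ideal_gen:
  assumes "lin g" "fv.subspace V" "x \<in> ideal_gen R" "\<And>a r b. r \<in> R \<Longrightarrow> g (a * r * b) \<in> V"
  shows "g x \<in> V"
  by (rule lin_span_into[OF assms(1,2) _ assms(3)[unfolded ideal_gen_def]]) (use assms(4) in blast)

locale suzuki =
  fixes N n :: nat and \<mu> lam :: "'k::field"
  assumes N: "N \<ge> 1" and n: "n \<ge> 1" and mu: "\<mu> * \<mu> = 1" and lam: "lam * lam = 1"
begin

abbreviation "P \<equiv> xg I1 I1 :: 'k free_alg"
abbreviation "R \<equiv> xg I2 I2 :: 'k free_alg"
abbreviation "S \<equiv> xg I1 I2 :: 'k free_alg"
abbreviation "T \<equiv> xg I2 I1 :: 'k free_alg"
abbreviation "I \<equiv> suzuki_ideal N n \<mu> lam"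

lemma subspace_I: "fv.subspace I" by (simp add: suzuki_ideal_def ideal_gen_def)

lemmas I_rules = fv.subspace_0[OF subspace_I] fv.subspace_add[OF subspace_I] fv.subspace_diff[OF subspace_I]
  fv.subspace_scale[OF subspace_I]

lemma I_mult: "x \<in> I \<Longrightarrow> y * x \<in> I" "x \<in> I \<Longrightarrow> x * y \<in> I"
  by (simp_all add: suzuki_ideal_def ideal_gen_mult)

lemma rel_I: "r \<in> suzuki_relations N n \<mu> lam \<Longrightarrow> r \<in> I"
  by (simp add: suzuki_ideal_def ideal_gen_base)

definition cg :: "'k free_alg \<Rightarrow> 'k free_alg \<Rightarrow> bool" (infix "\<sim>" 50) where "x \<sim> y \<longleftrightarrow> x - y \<in> I"

lemma cg_refl [simp, intro]: "x \<sim> x" by (simp add: cg_def I_rules)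
lemma cg_sym: "x \<sim> y \<Longrightarrow> y \<sim> x" using I_rules(3)[OF I_rules(1), of "x - y"] by (simp add: cg_def)
lemma cg_trans [trans]: "x \<sim> y \<Longrightarrow> y \<sim> z \<Longrightarrow> x \<sim> z"
  using I_rules(2)[of "x - y" "y - z"] by (simp add: cg_def)
lemma cg_eq_trans [trans]: "x \<sim> y \<Longrightarrow> y = z \<Longrightarrow> x \<sim> z" "x = y \<Longrightarrow> y \<sim> z \<Longrightarrow> x \<sim> z"
  by simp_all
lemma cg_add: "x \<sim> x' \<Longrightarrow> y \<sim> y' \<Longrightarrow> x + y \<sim> x' + y'"
  using I_rules(2)[of "x - x'" "y - y'"] by (simp add: cg_def algebra_simps)
lemma cg_scale: "x \<sim> x' \<Longrightarrow> fscale a x \<sim> fscale a x'"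
  using I_rules(4)[of "x - x'" a] by (simp add: cg_def fv.scale_right_diff_distrib)
lemma cg_mult: "x \<sim> x' \<Longrightarrow> y \<sim> y' \<Longrightarrow> x * y \<sim> x' * y'"
  using I_rules(2)[OF I_mult(2)[of "x - x'" y] I_mult(1)[of "y - y'" x']] by (simp add: cg_def algebra_simps)
lemma cg_power: "x \<sim> x' \<Longrightarrow> x ^ m \<sim> x' ^ m"
  by (induction m) (simp_all add: cg_mult)
lemma cg_0: "x \<sim> 0 \<longleftrightarrow> x \<in> I" by (simp add: cg_def)

lemma rels: "P ^ 2 \<sim> R ^ 2" "S ^ 2 \<sim> T ^ 2" "(T * S) ^ n \<sim> fscale lam ((S * T) ^ n)" "(P * R) ^ n \<sim> (R * P) ^ n"
  "P ^ (2 * N) + fscale \<mu> (S ^ (2 * N)) \<sim> 1"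
  unfolding cg_def alt_prod_even[symmetric] by (rule rel_I; simp add: suzuki_relations_def)+

lemma odd_rel: "(i = j) \<noteq> (k = l) \<Longrightarrow> xg i j * xg k l \<in> I"
proof -
  assume "(i = j) \<noteq> (k = l)"
  then have "odd (ind_val i + ind_val j + ind_val k + ind_val l)"
    by (cases i; cases j; cases k; cases l) simp_all
  then show ?thesis by (intro rel_I) (auto simp: suzuki_relations_def)
qed

text \<open>Between a diagonal and an off-diagonal generator some two neighbours are of different
  kinds, and their product is a relation.\<close>

lemma mixed_word: "(i = j) \<noteq> (k = l) \<Longrightarrow> xg i j * bas w * xg k l \<in> I"
proof (induction w arbitrary: i j)
  case Nil
  then show ?case by (simp add: bas_Nil odd_rel)
next
  case (Cons g w)
  obtain i' j' where g: "g = (i', j')" by force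
  have eq: "xg i j * bas (g # w) * xg k l = xg i j * xg i' j' * (bas w * xg k l)"
    "xg i j * bas (g # w) * xg k l = xg i j * (xg i' j' * bas w * xg k l)"
    by (simp_all add: g xg_def bas_mult_list mult.assoc)
  show ?case
  proof (cases "(i = j) = (i' = j')")
    case True
    have "xg i' j' * bas w * xg k l \<in> I"
      by (rule Cons.IH) (use True Cons.prems in simp)
    then show ?thesis unfolding eq(2) by (rule I_mult(1))
  next
    case False
    then show ?thesis unfolding eq(1) by (intro I_mult(2) odd_rel)
  qed
qed

lemma mixed: "(i = j) \<noteq> (k = l) \<Longrightarrow> xg i j * u * xg k l \<in> I"
  by (rule lin_into_subspace[where f = "\<lambda>u. xg i j * u * xg k l", OF _ subspace_I])
    (intro lin_intros | rule mixed_word; assumption)+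

subsection \<open>Central elements and normal forms\<close>

definition "A = P ^ 2"
definition "B = S ^ 2"

lemma R2: "R ^ 2 \<sim> A" and T2: "T ^ 2 \<sim> B"
  unfolding A_def B_def by (rule cg_sym, rule rels)+

text \<open>Products of x_11, x_22 and products of x_12, x_21 annihilate each other. The two kinds
  are encoded by annihilation conditions, so closure under multiplication follows without describing
  their elements.\<close>

definition Dia :: "'k free_alg set" where "Dia = {x. x * S \<in> I \<and> x * T \<in> I \<and> S * x \<in> I \<and> T * x \<in> I}"
definition Off :: "'k free_alg set" where "Off = {y. \<forall>x\<in>Dia. x * y \<in> I \<and> y * x \<in> I}"

lemma Dia_mult: "x \<in> Dia \<Longrightarrow> y \<in> Dia \<Longrightarrow> x * y \<in> Dia"
  using I_mult(1)[of "y * S" x] I_mult(1)[of "y * T" x] I_mult(2)[of "S * x" y] I_mult(2)[of "T * x" y]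
  by (simp add: Dia_def mult.assoc)

lemma Dia_gen: "P \<in> Dia" "R \<in> Dia"
  by (simp_all add: Dia_def odd_rel)

lemma Off_gen: "S \<in> Off" "T \<in> Off"
  by (auto simp: Off_def Dia_def)

lemma Off_mult: "x \<in> Off \<Longrightarrow> y \<in> Off \<Longrightarrow> x * y \<in> Off"
  using I_mult(2)[of "z * x" y for z] I_mult(1)[of "y * z" x for z]
  by (simp add: Off_def mult.assoc)

lemma Dia_Off: "x \<in> Dia \<Longrightarrow> y \<in> Off \<Longrightarrow> x * y \<in> I" "x \<in> Dia \<Longrightarrow> y \<in> Off \<Longrightarrow> y * x \<in> I"
  by (auto simp: Off_def)

lemma Dia_power: "m \<ge> 1 \<Longrightarrow> x \<in> Dia \<Longrightarrow> x ^ m \<in> Dia"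
  by (induction m rule: nat_induct_at_least) (simp_all add: Dia_mult)

lemma Off_power: "m \<ge> 1 \<Longrightarrow> x \<in> Off \<Longrightarrow> x ^ m \<in> Off"
  by (induction m rule: nat_induct_at_least) (simp_all add: Off_mult)

lemma A_Dia: "A \<in> Dia" and B_Off: "B \<in> Off"
  by (simp_all add: A_def B_def power2_eq_square Dia_mult Dia_gen Off_mult Off_gen)

text \<open>\<open>A\<close> is the square of \<open>P\<close> and congruent to the square of
  \<open>R\<close>, hence commutes with both; with \<open>S\<close> and \<open>T\<close> both
  products vanish. The same holds for \<open>B\<close> with the roles exchanged.\<close>

lemma central_letter: "A * xg i j \<sim> xg i j * A" "B * xg i j \<sim> xg i j * B"
proof -
  have A0: "A * y \<sim> y * A" if "y \<in> Off" for y
    using Dia_Off[OF A_Dia that] I_rules(3) by (simp add: cg_def)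
  have B0: "B * x \<sim> x * B" if "x \<in> Dia" for x
    using Dia_Off[OF that B_Off] I_rules(3) by (simp add: cg_def)
  have sq: "x ^ 2 * x = x * x ^ 2" for x :: "'k free_alg"
    by (simp add: power2_eq_square mult.assoc)
  have AR: "A * R \<sim> R * A"
    using cg_trans[OF cg_mult[OF cg_sym[OF R2] cg_refl] cg_trans[OF _ cg_mult[OF cg_refl R2]]] sq[of R] cg_refl by metis
  have BT: "B * T \<sim> T * B"
    using cg_trans[OF cg_mult[OF cg_sym[OF T2] cg_refl] cg_trans[OF _ cg_mult[OF cg_refl T2]]] sq[of T] cg_refl by metis
  show "A * xg i j \<sim> xg i j * A"
    by (cases i; cases j) (simp_all add: AR A0 Off_gen, simp add: A_def sq)
  show "B * xg i j \<sim> xg i j * B"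
    by (cases i; cases j) (simp_all add: BT B0 Dia_gen, simp add: B_def sq)
qed

lemma central: "A * u \<sim> u * A" "B * u \<sim> u * B"
proof -
  have *: "C * u - u * C \<in> I" if C: "\<And>i j. C * xg i j \<sim> xg i j * C" for C
  proof (rule lin_into_subspace[where f = "\<lambda>u. C * u - u * C", OF _ subspace_I])
    fix w :: word
    show "C * bas w - bas w * C \<in> I"
    proof (induction w)
      case Nil
      then show ?case by (simp add: bas_Nil I_rules)
    next
      case (Cons g w)
      obtain i j where g: "g = (i, j)" by force
      have b: "bas (g # w) = xg i j * bas w" by (simp add: g xg_def bas_mult_list)
      have "C * xg i j * bas w \<sim> xg i j * C * bas w" by (intro cg_mult C) simp
      also have "xg i j * C * bas w = xg i j * (C * bas w)" by (simp add: mult.assoc)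
      also have "\<dots> \<sim> xg i j * (bas w * C)" by (rule cg_mult[OF cg_refl]) (use Cons in \<open>simp add: cg_def\<close>)
      finally show ?case by (simp add: b cg_def mult.assoc)
    qed
  qed (intro lin_intros)
  show "A * u \<sim> u * A" "B * u \<sim> u * B"
    unfolding cg_def by (rule *; rule central_letter)+
qed

lemma central_power: "A ^ i * u \<sim> u * A ^ i" "B ^ i * u \<sim> u * B ^ i"
proof -
  have *: "C ^ i * u \<sim> u * C ^ i" if C: "\<And>u. C * u \<sim> u * C" for C u
  proof (induction i)
    case (Suc i)
    have "C ^ Suc i * u = C ^ i * (C * u)" by (simp only: power_Suc2 mult.assoc)
    also have "\<dots> \<sim> C ^ i * (u * C)" by (intro cg_mult C) simp
    also have "C ^ i * (u * C) = (C ^ i * u) * C" by (simp only: mult.assoc)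
    also have "\<dots> \<sim> (u * C ^ i) * C" by (intro cg_mult Suc) simp
    also have "(u * C ^ i) * C = u * C ^ Suc i" by (simp only: power_Suc2 mult.assoc)
    finally show ?case .
  qed simp
  show "A ^ i * u \<sim> u * A ^ i" "B ^ i * u \<sim> u * B ^ i"
    by (rule *, rule central)+
qed

text \<open>Multiplying A^N + \<mu> B^N ~ 1 by A^i or by B^i kills the other summand as soon as i is
  positive.\<close>

lemma A_period: "i \<ge> 1 \<Longrightarrow> A ^ (i + N) \<sim> A ^ i" and B_period: "i \<ge> 1 \<Longrightarrow> B ^ (i + N) \<sim> fscale \<mu> (B ^ i)"
proof -
  assume i: "i \<ge> 1"
  have e: "A ^ N + fscale \<mu> (B ^ N) \<sim> 1"
    using rels(5) by (simp add: A_def B_def power_mult)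
  have AB: "A ^ i * B ^ N \<sim> 0" "B ^ i * A ^ N \<sim> 0"
    unfolding cg_0 using i N by (simp_all add: Dia_Off Dia_power Off_power A_Dia B_Off)
  have "A ^ (i + N) = A ^ i * A ^ N + fscale \<mu> 0" by (simp add: power_add)
  also have "\<dots> \<sim> A ^ i * A ^ N + fscale \<mu> (A ^ i * B ^ N)"
    by (intro cg_add cg_refl cg_scale cg_sym[OF AB(1)])
  also have "\<dots> = A ^ i * (A ^ N + fscale \<mu> (B ^ N))" by (simp add: distrib_left fscale_mult)
  also have "\<dots> \<sim> A ^ i * 1" by (intro cg_mult cg_refl e)
  finally show "A ^ (i + N) \<sim> A ^ i" by simp
  have "B ^ (i + N) = fscale \<mu> (0 + fscale \<mu> (B ^ i * B ^ N))" by (simp add: power_add mu)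
  also have "\<dots> \<sim> fscale \<mu> (B ^ i * A ^ N + fscale \<mu> (B ^ i * B ^ N))"
    by (intro cg_add cg_refl cg_scale cg_sym[OF AB(2)])
  also have "\<dots> = fscale \<mu> (B ^ i * (A ^ N + fscale \<mu> (B ^ N)))" by (simp add: distrib_left fscale_mult)
  also have "\<dots> \<sim> fscale \<mu> (B ^ i * 1)" by (intro cg_mult cg_refl e cg_scale)
  finally show "B ^ (i + N) \<sim> fscale \<mu> (B ^ i)" by simp
qed

lemma A_period_mult: "i \<ge> 1 \<Longrightarrow> A ^ (i + N * m) \<sim> A ^ i"
proof (induction m)
  case (Suc m)
  have "A ^ (i + N * Suc m) = A ^ ((i + N * m) + N)" by (simp add: algebra_simps)
  also have "\<dots> \<sim> A ^ (i + N * m)" using Suc.prems by (intro A_period) simp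
  also have "\<dots> \<sim> A ^ i" using Suc by simp
  finally show ?case .
qed simp

lemma B_period_mult: "i \<ge> 1 \<Longrightarrow> B ^ (i + N * m) \<sim> fscale (\<mu> ^ m) (B ^ i)"
proof (induction m)
  case (Suc m)
  have "B ^ (i + N * Suc m) = B ^ ((i + N * m) + N)" by (simp add: algebra_simps)
  also have "\<dots> \<sim> fscale \<mu> (B ^ (i + N * m))" using Suc.prems by (intro B_period) simp
  also have "\<dots> \<sim> fscale \<mu> (fscale (\<mu> ^ m) (B ^ i))" using Suc by (intro cg_scale) simp
  finally show ?case by simp
qed simp

lemma mu_even: "even m \<Longrightarrow> \<mu> ^ m = 1"
  by (elim evenE) (simp add: power_mult power2_eq_square mu)

subsection \<open>The ideal is a Hopf ideal\<close>

definition I2' :: "(word \<times> word \<Rightarrow>\<^sub>0 'k) set" where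
  "I2' = fv.span ({tens a b | a b. a \<in> I} \<union> {tens a b | a b. b \<in> I})"

lemma subspace_I2': "fv.subspace I2'" by (simp add: I2'_def)

lemmas I2'_rules = fv.subspace_0[OF subspace_I2'] fv.subspace_add[OF subspace_I2'] fv.subspace_diff[OF subspace_I2']
  fv.subspace_scale[OF subspace_I2']

lemma tens_I2': "a \<in> I \<or> b \<in> I \<Longrightarrow> tens a b \<in> I2'"
  unfolding I2'_def by (rule fv.span_base) blast

lemma lin_I2':
  assumes "lin g" "fv.subspace V" "x \<in> I2'" "\<And>a b. a \<in> I \<Longrightarrow> g (tens a b) \<in> V" "\<And>a b. b \<in> I \<Longrightarrow> g (tens a b) \<in> V"
  shows "g x \<in> V"
  by (rule lin_span_into[OF assms(1,2) _ assms(3)[unfolded I2'_def]]) (use assms(4,5) in blast)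

lemma I2'_mult:
  assumes "x \<in> I2'"
  shows "y * x \<in> I2'" "x * y \<in> I2'"
proof -
  have t: "tens a b * x \<in> I2'" "x * tens a b \<in> I2'" for a b
    by (rule lin_I2'[OF _ subspace_I2' assms]; (intro lin_intros)?; simp add: tens_mult tens_I2' I_mult)+
  show "y * x \<in> I2'"
    by (rule lin_span_into[OF lin_multR[OF lin_id] subspace_I2' _ range_tens_span[of y]]) (auto simp: t)
  show "x * y \<in> I2'"
    by (rule lin_span_into[OF lin_multL[OF lin_id] subspace_I2' _ range_tens_span[of y]]) (auto simp: t)
qed

definition cg2 :: "(word \<times> word \<Rightarrow>\<^sub>0 'k) \<Rightarrow> (word \<times> word \<Rightarrow>\<^sub>0 'k) \<Rightarrow> bool" (infix "\<approx>" 50) where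
  "x \<approx> y \<longleftrightarrow> x - y \<in> I2'"

lemma cg2_refl [simp, intro]: "x \<approx> x" by (simp add: cg2_def I2'_rules)
lemma cg2_sym: "x \<approx> y \<Longrightarrow> y \<approx> x" using I2'_rules(3)[OF I2'_rules(1), of "x - y"] by (simp add: cg2_def)
lemma cg2_trans [trans]: "x \<approx> y \<Longrightarrow> y \<approx> z \<Longrightarrow> x \<approx> z"
  using I2'_rules(2)[of "x - y" "y - z"] by (simp add: cg2_def)
lemma cg2_eq_trans [trans]: "x \<approx> y \<Longrightarrow> y = z \<Longrightarrow> x \<approx> z" "x = y \<Longrightarrow> y \<approx> z \<Longrightarrow> x \<approx> z"
  by simp_all
lemma cg2_add: "x \<approx> x' \<Longrightarrow> y \<approx> y' \<Longrightarrow> x + y \<approx> x' + y'"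
  using I2'_rules(2)[of "x - x'" "y - y'"] by (simp add: cg2_def algebra_simps)
lemma cg2_scale: "x \<approx> x' \<Longrightarrow> fscale a x \<approx> fscale a x'"
  using I2'_rules(4)[of "x - x'" a] by (simp add: cg2_def fv.scale_right_diff_distrib)
lemma cg2_mult: "x \<approx> x' \<Longrightarrow> y \<approx> y' \<Longrightarrow> x * y \<approx> x' * y'"
  using I2'_rules(2)[OF I2'_mult(2)[of "x - x'" y] I2'_mult(1)[of "y - y'" x']] by (simp add: cg2_def algebra_simps)
lemma cg2_tens: "x \<sim> x' \<Longrightarrow> y \<sim> y' \<Longrightarrow> tens x y \<approx> tens x' y'"
proof -
  assume "x \<sim> x'" "y \<sim> y'"
  then have "tens (x - x') y + tens x' (y - y') \<in> I2'"
    by (intro I2'_rules(2) tens_I2') (auto simp: cg_def)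
  then show ?thesis by (simp add: cg2_def tens_simps)
qed

text \<open>
  Products of diagonal generators \<open>x\<^sub>i\<^sub>i\<close> and of off-diagonal ones \<open>x\<^sub>1\<^sub>2, x\<^sub>2\<^sub>1\<close> with matching indices
  behave under \<open>\<Delta>\<close> like the rows of the matrix coalgebra, because the mixed products vanish.
\<close>

definition dcop :: "'k free_alg \<Rightarrow> 'k free_alg \<Rightarrow> 'k free_alg \<Rightarrow> bool" where
  "dcop x y z \<longleftrightarrow> Delta x \<approx> tens x x + tens y z \<and> x \<in> Dia \<and> y \<in> Off"
definition ocop :: "'k free_alg \<Rightarrow> 'k free_alg \<Rightarrow> 'k free_alg \<Rightarrow> bool" where
  "ocop y x z \<longleftrightarrow> Delta y \<approx> tens x y + tens y z \<and> x \<in> Dia \<and> y \<in> Off"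

lemma dcop_mult:
  assumes "dcop x y z" "dcop x' y' z'"
  shows "dcop (x * x') (y * y') (z * z')"
proof -
  have "Delta (x * x') \<approx> (tens x x + tens y z) * (tens x' x' + tens y' z')"
    unfolding Delta_mult using assms by (intro cg2_mult) (auto simp: dcop_def)
  also have "\<dots> = (tens (x * x') (x * x') + tens (y * y') (z * z')) + (tens (x * y') (x * z') + tens (y * x') (z * x'))"
    by (simp add: algebra_simps tens_mult)
  also have "\<dots> \<approx> (tens (x * x') (x * x') + tens (y * y') (z * z')) + (0 + 0)"
    using assms by (intro cg2_add cg2_refl) (simp_all add: cg2_def dcop_def tens_I2' Dia_Off)
  finally show ?thesis
    using assms by (simp add: dcop_def Dia_mult Off_mult)
qed

lemma ocop_mult:
  assumes "ocop y x z" "ocop y' x' z'"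
  shows "ocop (y * y') (x * x') (z * z')"
proof -
  have "Delta (y * y') \<approx> (tens x y + tens y z) * (tens x' y' + tens y' z')"
    unfolding Delta_mult using assms by (intro cg2_mult) (auto simp: ocop_def)
  also have "\<dots> = (tens (x * x') (y * y') + tens (y * y') (z * z')) + (tens (x * y') (y * z') + tens (y * x') (z * y'))"
    by (simp add: algebra_simps tens_mult)
  also have "\<dots> \<approx> (tens (x * x') (y * y') + tens (y * y') (z * z')) + (0 + 0)"
    using assms by (intro cg2_add cg2_refl) (simp_all add: cg2_def ocop_def tens_I2' Dia_Off)
  finally show ?thesis
    using assms by (simp add: ocop_def Dia_mult Off_mult)
qed

lemma dcop_power: "m \<ge> 1 \<Longrightarrow> dcop x y z \<Longrightarrow> dcop (x ^ m) (y ^ m) (z ^ m)"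
  by (induction m rule: nat_induct_at_least) (simp_all add: dcop_mult)

lemma ocop_power: "m \<ge> 1 \<Longrightarrow> ocop x y z \<Longrightarrow> ocop (x ^ m) (y ^ m) (z ^ m)"
  by (induction m rule: nat_induct_at_least) (simp_all add: ocop_mult)

lemma dcop_cg: "dcop x y z \<Longrightarrow> z \<sim> z' \<Longrightarrow> dcop x y z'"
  and ocop_cg: "ocop y x z \<Longrightarrow> z \<sim> z' \<Longrightarrow> ocop y x z'"
  unfolding dcop_def ocop_def by (blast intro: cg2_trans cg2_add cg2_tens cg2_refl cg_refl)+

lemma cop_gen: "dcop P S T" "dcop R T S" "ocop S P R" "ocop T R P"
  by (simp_all add: dcop_def ocop_def Delta_xg Dia_gen Off_gen add.commute)

lemma dcop_A: "dcop A B B" and ocop_B: "ocop B A A"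
proof -
  have "dcop A B (T ^ 2)" "ocop B A (R ^ 2)"
    unfolding A_def B_def by (rule dcop_power ocop_power; simp add: cop_gen)+
  then show "dcop A B B" "ocop B A A"
    using dcop_cg ocop_cg R2 T2 by blast+
qed

lemma Delta_I: "x \<in> I \<Longrightarrow> Delta x \<in> I2'"
proof -
  assume x: "x \<in> I"
  have "Delta (a * r * b) \<in> I2'" if "r \<in> suzuki_relations N n \<mu> lam" for a r b
  proof -
    have d: "Delta (x - y) \<in> I2'" if "Delta x \<approx> u" "Delta y \<approx> v" "u \<approx> v" for x y u v
      using cg2_trans[OF that(1) cg2_trans[OF that(3) cg2_sym[OF that(2)]]] by (simp add: Delta_simps cg2_def)
    have dd: "Delta (x - y) \<in> I2'" if "dcop x x1 x2" "dcop y y1 y2" "x \<sim> y" "x1 \<sim> y1" "x2 \<sim> y2" for x y x1 x2 y1 y2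
      by (rule d[of x "tens x x + tens x1 x2" y "tens y y + tens y1 y2"])
        (use that in \<open>auto simp: dcop_def intro!: cg2_add cg2_tens\<close>)
    have r1: "Delta (P ^ 2 - R ^ 2) \<in> I2'"
      using rels by (intro dd[OF dcop_power[OF _ cop_gen(1)] dcop_power[OF _ cop_gen(2)]]) (auto intro: cg_sym)
    have r2: "Delta (S ^ 2 - T ^ 2) \<in> I2'"
    proof (rule d)
      show "Delta (S ^ 2) \<approx> tens (P ^ 2) (S ^ 2) + tens (S ^ 2) (R ^ 2)"
        using ocop_power[OF _ cop_gen(3), of 2] by (simp add: ocop_def)
      show "Delta (T ^ 2) \<approx> tens (R ^ 2) (T ^ 2) + tens (T ^ 2) (P ^ 2)"
        using ocop_power[OF _ cop_gen(4), of 2] by (simp add: ocop_def)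
      show "tens (P ^ 2) (S ^ 2) + tens (S ^ 2) (R ^ 2) \<approx> tens (R ^ 2) (T ^ 2) + tens (T ^ 2) (P ^ 2)"
        using rels by (intro cg2_add cg2_tens) (auto intro: cg_sym)
    qed
    have r3: "Delta ((T * S) ^ n - fscale lam ((S * T) ^ n)) \<in> I2'"
    proof (rule d)
      show "Delta ((T * S) ^ n) \<approx> tens ((R * P) ^ n) ((T * S) ^ n) + tens ((T * S) ^ n) ((P * R) ^ n)"
        using ocop_power[OF n ocop_mult[OF cop_gen(4,3)]] by (simp add: ocop_def)
      show "Delta (fscale lam ((S * T) ^ n))
          \<approx> fscale lam (tens ((P * R) ^ n) ((S * T) ^ n) + tens ((S * T) ^ n) ((R * P) ^ n))"
        using ocop_power[OF n ocop_mult[OF cop_gen(3,4)]] by (simp add: ocop_def Delta_simps cg2_scale)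
      have "tens ((R * P) ^ n) ((T * S) ^ n) + tens ((T * S) ^ n) ((P * R) ^ n)
        \<approx> tens ((P * R) ^ n) (fscale lam ((S * T) ^ n)) + tens (fscale lam ((S * T) ^ n)) ((R * P) ^ n)"
        using rels by (intro cg2_add cg2_tens) (auto intro: cg_sym)
      then show "tens ((R * P) ^ n) ((T * S) ^ n) + tens ((T * S) ^ n) ((P * R) ^ n)
        \<approx> fscale lam (tens ((P * R) ^ n) ((S * T) ^ n) + tens ((S * T) ^ n) ((R * P) ^ n))"
        by (simp add: tens_simps fv.scale_right_distrib)
    qed
    have r4: "Delta ((P * R) ^ n - (R * P) ^ n) \<in> I2'"
    proof (rule d)
      show "Delta ((P * R) ^ n) \<approx> tens ((P * R) ^ n) ((P * R) ^ n) + tens ((S * T) ^ n) ((T * S) ^ n)"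
        using dcop_power[OF n dcop_mult[OF cop_gen(1,2)]] by (simp add: dcop_def)
      show "Delta ((R * P) ^ n) \<approx> tens ((R * P) ^ n) ((R * P) ^ n) + tens ((T * S) ^ n) ((S * T) ^ n)"
        using dcop_power[OF n dcop_mult[OF cop_gen(2,1)]] by (simp add: dcop_def)
      have "tens ((S * T) ^ n) ((T * S) ^ n) \<approx> tens ((S * T) ^ n) (fscale lam ((S * T) ^ n))"
        by (intro cg2_tens rels cg_refl)
      also have "\<dots> = tens (fscale lam ((S * T) ^ n)) ((S * T) ^ n)"
        by (simp add: tens_simps)
      also have "\<dots> \<approx> tens ((T * S) ^ n) ((S * T) ^ n)"
        by (intro cg2_tens cg_sym[OF rels(3)] cg_refl)
      finally show "tens ((P * R) ^ n) ((P * R) ^ n) + tens ((S * T) ^ n) ((T * S) ^ n)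
          \<approx> tens ((R * P) ^ n) ((R * P) ^ n) + tens ((T * S) ^ n) ((S * T) ^ n)"
        using rels(4) by (intro cg2_add[OF cg2_tens])
    qed
    have r5: "Delta (P ^ (2 * N) + fscale \<mu> (S ^ (2 * N)) - 1) \<in> I2'"
    proof (rule d)
      \<comment> \<open>The nonconstant part of this relation is group-like modulo the ideal, and so
        is 1.\<close>
      let ?e = "A ^ N + fscale \<mu> (B ^ N)"
      have "Delta (A ^ N) \<approx> tens (A ^ N) (A ^ N) + tens (B ^ N) (B ^ N)"
        "Delta (B ^ N) \<approx> tens (A ^ N) (B ^ N) + tens (B ^ N) (A ^ N)"
        using dcop_power[OF N dcop_A] ocop_power[OF N ocop_B] by (simp_all add: dcop_def ocop_def)
      then have "Delta ?e \<approx> (tens (A ^ N) (A ^ N) + tens (B ^ N) (B ^ N))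
          + fscale \<mu> (tens (A ^ N) (B ^ N) + tens (B ^ N) (A ^ N))"
        unfolding Delta_simps by (intro cg2_add cg2_scale)
      also have "\<dots> = tens ?e ?e"
        by (simp add: tens_simps fv.scale_right_distrib mu)
      finally show "Delta (P ^ (2 * N) + fscale \<mu> (S ^ (2 * N))) \<approx> tens ?e ?e"
        by (simp add: A_def B_def power_mult)
      show "Delta 1 \<approx> tens 1 1" by (simp add: Delta_1 tens_1_1)
      show "tens ?e ?e \<approx> tens 1 1"
        using rels(5) by (intro cg2_tens) (simp_all add: A_def B_def power_mult)
    qed
    have r6: "Delta (xg i j * xg k l) \<in> I2'" if o: "odd (ind_val i + ind_val j + ind_val k + ind_val l)" for i j k l
    proof -
      have "(i = j) \<noteq> (k = l)" using o by (cases i; cases j; cases k; cases l) simp_all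
      \<comment> \<open>The index sums of the two tensor factors add up to an odd number modulo 2,
        so one of the factors is again a relation.\<close>
      then have "tens (xg i a * xg k b) (xg a j * xg b l) \<in> I2'" for a b
        by (cases "(i = a) = (k = b)"; cases i; cases j; cases k; cases l; cases a; cases b)
          (auto intro!: tens_I2' odd_rel)
      then show ?thesis
        by (simp add: Delta_mult Delta_xg algebra_simps tens_mult I2'_rules)
    qed
    have "Delta r \<in> I2'"
      using that r1 r2 r3 r4 r5 r6 unfolding suzuki_relations_def alt_prod_even by blast
    then show ?thesis by (simp add: Delta_mult I2'_mult)
  qed
  then show ?thesis
    using lin_ideal_gen[OF lin_Delta subspace_I2' x[unfolded suzuki_ideal_def]] by blast
qed

end

section \<open>The antipode preserves the ideal\<close>

context suzuki
begin

abbreviation "M \<equiv> 4 * N - 1"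

text \<open>The exponent of the antipode is odd, so an M-th power of a generator is that generator
  times a power of the central element \<open>A\<close> or \<open>B\<close>.\<close>

lemma M_eq: "M = Suc (2 * (2 * N - 1))"
  using N by simp

lemma pow_M: "P ^ M = P * A ^ (2 * N - 1)" "S ^ M = S * B ^ (2 * N - 1)"
  "R ^ M \<sim> R * A ^ (2 * N - 1)" "T ^ M \<sim> T * B ^ (2 * N - 1)"
  unfolding M_eq power_Suc power_mult A_def[symmetric] B_def[symmetric]
  by (auto intro: cg_mult cg_power R2 T2)

lemma ant_gen: "ant N P = P ^ M" "ant N R = R ^ M" "ant N S = T ^ M" "ant N T = S ^ M"
  by (simp_all add: ant_xg)

lemma mult_B_pow: "(x * B ^ i) * (y * B ^ j) \<sim> x * y * B ^ (i + j)" and mult_A_pow: "(x * A ^ i) * (y * A ^ j) \<sim> x * y * A ^ (i + j)"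
proof -
  have "x * (B ^ i * y) * B ^ j \<sim> x * (y * B ^ i) * B ^ j" "x * (A ^ i * y) * A ^ j \<sim> x * (y * A ^ i) * A ^ j"
    by (intro cg_mult cg_refl central_power)+
  then show "(x * B ^ i) * (y * B ^ j) \<sim> x * y * B ^ (i + j)" "(x * A ^ i) * (y * A ^ j) \<sim> x * y * A ^ (i + j)"
    by (simp_all add: mult.assoc power_add)
qed

lemma power_mult_B: "(x * B ^ i) ^ m \<sim> x ^ m * B ^ (i * m)" and power_mult_A: "(x * A ^ i) ^ m \<sim> x ^ m * A ^ (i * m)"
proof -
  show "(x * B ^ i) ^ m \<sim> x ^ m * B ^ (i * m)"
  proof (induction m)
    case (Suc m)
    have "(x * B ^ i) ^ Suc m \<sim> (x * B ^ i) * (x ^ m * B ^ (i * m))"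
      by (simp only: power_Suc) (rule cg_mult[OF cg_refl Suc])
    also have "\<dots> \<sim> x * x ^ m * B ^ (i + i * m)" by (rule mult_B_pow)
    finally show ?case by simp
  qed simp
  show "(x * A ^ i) ^ m \<sim> x ^ m * A ^ (i * m)"
  proof (induction m)
    case (Suc m)
    have "(x * A ^ i) ^ Suc m \<sim> (x * A ^ i) * (x ^ m * A ^ (i * m))"
      by (simp only: power_Suc) (rule cg_mult[OF cg_refl Suc])
    also have "\<dots> \<sim> x * x ^ m * A ^ (i + i * m)" by (rule mult_A_pow)
    finally show ?case by simp
  qed simp
qed

lemma ant_I: "x \<in> I \<Longrightarrow> ant N x \<in> I"
proof -
  assume x: "x \<in> I"
  have "ant N (a * r * b) \<in> I" if "r \<in> suzuki_relations N n \<mu> lam" for a r b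
  proof -
    have d: "ant N (x - y) \<in> I" if "ant N x \<sim> u" "ant N y \<sim> v" "u \<sim> v" for x y u v
      using cg_trans[OF that(1) cg_trans[OF that(3) cg_sym[OF that(2)]]] by (simp add: lin_diff[OF lin_ant] cg_def)
    have pw: "(x ^ M) ^ 2 = (x ^ 2) ^ M" for x :: "'k free_alg" by (simp add: power_mult[symmetric] mult.commute)
    have r1: "ant N (P ^ 2 - R ^ 2) \<in> I" "ant N (S ^ 2 - T ^ 2) \<in> I"
      by (rule d[OF cg_refl cg_refl]; simp only: ant_power ant_gen pw; intro cg_power rels cg_sym[OF rels(2)])+
    let ?k = "(2 * N - 1 + (2 * N - 1)) * n"
    have TS: "T ^ M * S ^ M \<sim> T * S * B ^ (2 * N - 1 + (2 * N - 1))" "S ^ M * T ^ M \<sim> S * T * B ^ (2 * N - 1 + (2 * N - 1))"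
      using cg_trans[OF cg_mult[OF pow_M(4) cg_refl] mult_B_pow] cg_trans[OF cg_mult[OF cg_refl pow_M(4)] mult_B_pow]
      by (simp_all only: pow_M(2))
    have RP: "R ^ M * P ^ M \<sim> R * P * A ^ (2 * N - 1 + (2 * N - 1))" "P ^ M * R ^ M \<sim> P * R * A ^ (2 * N - 1 + (2 * N - 1))"
      using cg_trans[OF cg_mult[OF pow_M(3) cg_refl] mult_A_pow] cg_trans[OF cg_mult[OF cg_refl pow_M(3)] mult_A_pow]
      by (simp_all only: pow_M(1))
    have r3: "ant N ((T * S) ^ n - fscale lam ((S * T) ^ n)) \<in> I"
    proof (rule d)
      show "ant N ((T * S) ^ n) \<sim> (T * S) ^ n * B ^ ?k"
        unfolding ant_power ant_mult ant_gen by (rule cg_trans[OF cg_power[OF TS(1)] power_mult_B])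
      show "ant N (fscale lam ((S * T) ^ n)) \<sim> fscale lam ((S * T) ^ n * B ^ ?k)"
        unfolding lin_scale[OF lin_ant] ant_power ant_mult ant_gen
        by (rule cg_scale[OF cg_trans[OF cg_power[OF TS(2)] power_mult_B]])
      show "(T * S) ^ n * B ^ ?k \<sim> fscale lam ((S * T) ^ n * B ^ ?k)"
        unfolding fscale_mult_left[symmetric] by (intro cg_mult rels cg_refl)
    qed
    have r4: "ant N ((P * R) ^ n - (R * P) ^ n) \<in> I"
    proof (rule d)
      show "ant N ((P * R) ^ n) \<sim> (R * P) ^ n * A ^ ?k"
        unfolding ant_power ant_mult ant_gen by (rule cg_trans[OF cg_power[OF RP(1)] power_mult_A])
      show "ant N ((R * P) ^ n) \<sim> (P * R) ^ n * A ^ ?k"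
        unfolding ant_power ant_mult ant_gen by (rule cg_trans[OF cg_power[OF RP(2)] power_mult_A])
      show "(R * P) ^ n * A ^ ?k \<sim> (P * R) ^ n * A ^ ?k"
        by (intro cg_mult cg_sym[OF rels(4)] cg_refl)
    qed
    have r5: "ant N (P ^ (2 * N) + fscale \<mu> (S ^ (2 * N)) - 1) \<in> I"
    proof (rule d)
      \<comment> \<open>N M exceeds N by an even number of periods, so no factor \<mu>
        survives.\<close>
      have "even (M - 1)" "M = Suc (M - 1)" using N by auto
      then have NM: "N * M = N + N * (M - 1)" "\<mu> ^ (M - 1) = 1"
        by (metis mult_Suc_right, simp add: mu_even)
      have "ant N (P ^ (2 * N)) = A ^ (N * M)"
        unfolding ant_power ant_gen A_def power_mult[symmetric] by (simp add: mult_ac)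
      also have "\<dots> \<sim> A ^ N" unfolding NM(1) by (rule A_period_mult[OF N])
      finally have 1: "ant N (P ^ (2 * N)) \<sim> A ^ N" .
      have "ant N (S ^ (2 * N)) = (T ^ 2) ^ (N * M)"
        unfolding ant_power ant_gen power_mult[symmetric] by (simp add: mult_ac)
      also have "\<dots> \<sim> B ^ (N * M)" by (rule cg_power[OF T2])
      also have "\<dots> \<sim> B ^ N" unfolding NM(1) using B_period_mult[OF N, of "M - 1"] NM(2) by simp
      finally have 2: "ant N (S ^ (2 * N)) \<sim> B ^ N" .
      show "ant N (P ^ (2 * N) + fscale \<mu> (S ^ (2 * N))) \<sim> A ^ N + fscale \<mu> (B ^ N)"
        unfolding lin_add[OF lin_ant] lin_scale[OF lin_ant] by (intro cg_add cg_scale 1 2)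
      show "ant N 1 \<sim> 1" by (simp add: ant_1)
      show "A ^ N + fscale \<mu> (B ^ N) \<sim> 1" using rels(5) by (simp add: A_def B_def power_mult)
    qed
    have r6: "ant N (xg i j * xg k l) \<in> I" if o: "odd (ind_val i + ind_val j + ind_val k + ind_val l)" for i j k l
    proof -
      have "(l = k) \<noteq> (j = i)" using o by (cases i; cases j; cases k; cases l) simp_all
      \<comment> \<open>At the seam of the two M-th powers a diagonal and an off-diagonal generator
        meet.\<close>
      then have "xg l k ^ (M - 1) * (xg l k * xg j i) * xg j i ^ (M - 1) \<in> I"
        by (intro I_mult odd_rel)
      moreover have "x ^ M = x ^ (M - 1) * x" "x ^ M = x * x ^ (M - 1)" for x :: "'k free_alg"
        unfolding M_eq diff_Suc_1 by (rule power_Suc2, rule power_Suc)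
      ultimately show ?thesis
        unfolding ant_mult ant_xg by (metis mult.assoc)
    qed
    have "ant N r \<in> I"
      using that r1 r3 r4 r5 r6 unfolding suzuki_relations_def alt_prod_even by blast
    then show ?thesis by (simp add: ant_mult I_mult)
  qed
  then show ?thesis
    using lin_ideal_gen[OF lin_ant subspace_I x[unfolded suzuki_ideal_def]] by blast
qed

end

section \<open>The module and its Yetter-Drinfeld structure\<close>

lemma lin_lext_arg: "(\<And>w. lin (F w)) \<Longrightarrow> lin (\<lambda>x. lext (\<lambda>w. F w x) h)"
  unfolding lext_def by (intro lin_sumI lin_smul)

lemma lin_mod_act: "lin (mod_act a w)"
  by (induction w) (simp_all add: lin_def lin_add[OF lin_lext] lin_scale[OF lin_lext])

lemma mod_act_append: "mod_act a (u @ w) v = mod_act a u (mod_act a w v)"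
  by (induction u) simp_all

definition Vact :: "(ind \<times> ind \<Rightarrow> 'b \<Rightarrow> ('b \<Rightarrow>\<^sub>0 'k)) \<Rightarrow> 'k free_alg \<Rightarrow> ('b \<Rightarrow>\<^sub>0 'k) \<Rightarrow> ('b \<Rightarrow>\<^sub>0 'k::field)" where
  "Vact a h v = lext (\<lambda>w. mod_act a w v) h"

lemma lin_Vact_left: "lin (\<lambda>h. Vact a h v)" by (simp add: Vact_def lin_lext)
lemma lin_Vact: "lin (Vact a h)"
  unfolding Vact_def[abs_def] by (rule lin_lext_arg) (rule lin_mod_act)

lemma Vact_bas: "Vact a (bas w) v = mod_act a w v" by (simp add: Vact_def)

lemma Vact_xg: "Vact a (xg i j) v = lext (a (i, j)) v" by (simp add: xg_def Vact_bas)

lemma Vact_mult: "Vact a (x * y) v = Vact a x (Vact a y v)"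
  by (rule bilin_eqI[where f = "\<lambda>x y. Vact a (x * y) v" and g = "\<lambda>x y. Vact a x (Vact a y v)"])
    (intro lin_intros lin_comp[OF lin_Vact_left] lin_comp[OF lin_Vact] lin_Vact_left
      | simp add: bas_mult_list Vact_bas mod_act_append)+

lemma Vact_1: "Vact a 1 v = v"
  using Vact_bas[of a "[]"] by (simp add: bas_Nil)

lemma Vact_simps: "Vact a (x + y) v = Vact a x v + Vact a y v" "Vact a (x - y) v = Vact a x v - Vact a y v"
  "Vact a (fscale s x) v = fscale s (Vact a x v)" "Vact a x (v + w) = Vact a x v + Vact a x w"
  "Vact a x (fscale s v) = fscale s (Vact a x v)" "Vact a x 0 = 0"
  by (simp_all add: lin_add[OF lin_Vact_left] lin_diff[OF lin_Vact_left] lin_scale[OF lin_Vact_left]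
      lin_add[OF lin_Vact] lin_scale[OF lin_Vact] lin_0[OF lin_Vact])

text \<open>The action of an arbitrary element of the threefold tensor product, through which the
  action of h factors. Multiplicativity can be checked here on pure tensors, without any
  coproduct.\<close>

definition Psi :: "nat \<Rightarrow> (ind \<times> ind \<Rightarrow> 'b \<Rightarrow> ('b \<Rightarrow>\<^sub>0 'k)) \<Rightarrow> (word \<times> word \<times> word \<Rightarrow>\<^sub>0 'k) \<Rightarrow> ('b \<times> word \<Rightarrow>\<^sub>0 'k)
    \<Rightarrow> ('b \<times> word \<Rightarrow>\<^sub>0 'k::field)" where
  "Psi N a H x = lext (\<lambda>(h1, h2, h3). lext (\<lambda>(l, g). tens (mod_act a h2 (bas l)) (bas h1 * bas g * antipode N h3)) x) H"

lemma lin_Psi_left: "lin (\<lambda>H. Psi N a H x)" by (simp add: Psi_def lin_lext)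
lemma lin_Psi: "lin (Psi N a H)"
proof -
  have "lin (\<lambda>x. lext (\<lambda>h. (case h of (h1, h2, h3) \<Rightarrow> lext (\<lambda>(l, g). tens (mod_act a h2 (bas l)) (bas h1 * bas g * antipode N h3))) x) H)"
    by (rule lin_lext_arg) (auto simp: lin_lext split: prod.splits)
  then show ?thesis by (simp add: Psi_def[abs_def] case_prod_unfold)
qed

lemma Psi_tens: "Psi N a (tens x (tens y z)) (tens l u) = tens (Vact a y l) (x * u * ant N z)"
proof -
  note L = lin_intros lin_comp[OF lin_Psi_left] lin_comp[OF lin_Psi] lin_Psi lin_comp[OF lin_Vact] lin_comp[OF lin_Vact_left]
    lin_comp[OF lin_ant] lin_Vact lin_Vact_left lin_ant
  have 1: "Psi N a (tens (bas h1) (tens (bas h2) (bas h3))) (tens (bas l) (bas g))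
    = tens (Vact a (bas h2) (bas l)) (bas h1 * bas g * ant N (bas h3))" for h1 h2 h3 l g
    by (simp add: Psi_def Vact_bas ant_def)
  have 2: "Psi N a (tens (bas h1) (tens (bas h2) (bas h3))) (tens l u)
    = tens (Vact a (bas h2) l) (bas h1 * u * ant N (bas h3))" for h1 h2 h3 l u
    by (rule bilin_eqI[where f = "\<lambda>l u. Psi N a (tens (bas h1) (tens (bas h2) (bas h3))) (tens l u)"
          and g = "\<lambda>l u. tens (Vact a (bas h2) l) (bas h1 * u * ant N (bas h3))"]; (intro L)?; rule 1)
  have 3: "Psi N a (tens (bas h1) (tens y z)) (tens l u) = tens (Vact a y l) (bas h1 * u * ant N z)" for h1 y z
    by (rule bilin_eqI[where f = "\<lambda>y z. Psi N a (tens (bas h1) (tens y z)) (tens l u)"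
          and g = "\<lambda>y z. tens (Vact a y l) (bas h1 * u * ant N z)"]; (intro L)?; rule 2)
  show ?thesis
    by (rule lin_eqI[where f = "\<lambda>x. Psi N a (tens x (tens y z)) (tens l u)"
          and g = "\<lambda>x. tens (Vact a y l) (x * u * ant N z)"]; (intro L)?; rule 3)
qed

lemma Psi_mult: "Psi N a (H * H') x = Psi N a H (Psi N a H' x)"
proof -
  note L = lin_intros lin_comp[OF lin_Psi_left] lin_comp[OF lin_Psi] lin_Psi lin_Psi_left
  have 1: "Psi N a (bas h * bas h') (bas lg) = Psi N a (bas h) (Psi N a (bas h') (bas lg))" for h h' lg
  proof -
    obtain h1 h2 h3 h1' h2' h3' l g where e: "h = (h1, h2, h3)" "h' = (h1', h2', h3')" "lg = (l, g)"
      by (metis surj_pair)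
    have b: "bas h = tens (bas h1) (tens (bas h2) (bas h3))" "bas h' = tens (bas h1') (tens (bas h2') (bas h3'))"
      "bas lg = tens (bas l) (bas g)" by (simp_all add: e)
    show ?thesis
      unfolding b tens_mult Psi_tens by (simp only: Vact_mult ant_mult mult.assoc)
  qed
  have 2: "Psi N a (bas h * bas h') x = Psi N a (bas h) (Psi N a (bas h') x)" for h h'
    by (rule lin_eqI[where f = "\<lambda>x. Psi N a (bas h * bas h') x" and g = "\<lambda>x. Psi N a (bas h) (Psi N a (bas h') x)"];
        (intro L)?; rule 1)
  show ?thesis
    by (rule bilin_eqI[where f = "\<lambda>H H'. Psi N a (H * H') x" and g = "\<lambda>H H'. Psi N a H (Psi N a H' x)"];
        (intro L)?; rule 2)
qed

definition idD :: "(word \<times> word \<Rightarrow>\<^sub>0 'k) \<Rightarrow> (word \<times> word \<times> word \<Rightarrow>\<^sub>0 'k::field)" where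
  "idD = lext (\<lambda>(u, v). tens (bas u) (comult v))"

lemma lin_idD: "lin idD" by (simp add: idD_def lin_lext)

lemma idD_tens: "idD (tens x y) = tens x (Delta y)"
  by (rule bilin_eqI[where f = "\<lambda>x y. idD (tens x y)" and g = "\<lambda>x y. tens x (Delta y)"];
      (intro lin_intros lin_comp[OF lin_idD] lin_comp[OF lin_Delta] lin_Delta)?; simp add: idD_def Delta_def)

lemma idD_mult: "idD (x * y) = idD x * idD y"
proof (rule bilin_eqI[where f = "\<lambda>x y. idD (x * y)" and g = "\<lambda>x y. idD x * idD y"];
    (intro lin_intros lin_comp[OF lin_idD] lin_idD)?)
  fix s t :: "word \<times> word"
  obtain s1 s2 t1 t2 where e: "s = (s1, s2)" "t = (t1, t2)" by force
  have b: "bas s = tens (bas s1) (bas s2)" "bas t = tens (bas t1) (bas t2)" by (simp_all add: e)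
  show "idD (bas s * bas t) = idD (bas s) * (idD (bas t) :: _ \<Rightarrow>\<^sub>0 'a)"
    unfolding b tens_mult idD_tens by (simp only: Delta_mult)
qed

definition act :: "nat \<Rightarrow> (ind \<times> ind \<Rightarrow> 'b \<Rightarrow> ('b \<Rightarrow>\<^sub>0 'k)) \<Rightarrow> 'k free_alg \<Rightarrow> ('b \<times> word \<Rightarrow>\<^sub>0 'k) \<Rightarrow> ('b \<times> word \<Rightarrow>\<^sub>0 'k::field)" where
  "act N a h x = Psi N a (idD (Delta h)) x"

lemma lin_act: "lin (act N a h)" by (simp add: act_def[abs_def] lin_Psi)
lemma lin_act_left: "lin (\<lambda>h. act N a h x)"
  unfolding act_def by (intro lin_comp[OF lin_Psi_left] lin_comp[OF lin_idD] lin_Delta)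

lemma act_mult: "act N a (h * h') x = act N a h (act N a h' x)"
  by (simp add: act_def Delta_mult idD_mult Psi_mult)

lemma act_1: "act N a 1 x = x"
proof -
  have "Psi N a (idD 1) (bas lg) = bas lg" for lg
  proof -
    obtain l g where lg: "lg = (l, g)" by force
    have "Psi N a (idD (tens 1 1)) (tens (bas l) (bas g)) = tens (bas l) (bas g)"
      unfolding idD_tens Delta_1 tens_1_1[symmetric] Psi_tens by (simp add: Vact_1 ant_1)
    then show ?thesis by (simp add: lg tens_1_1)
  qed
  then show ?thesis
    unfolding act_def Delta_1 by - (rule lin_eqI[where f = "Psi N a (idD 1)" and g = "\<lambda>x. x"], simp_all add: lin_Psi lin_id)
qed

lemma box_mult_eq_act: "box_mult N a h x = act N a h x"
proof -
  have 1: "lext (box_act N a w) x = act N a (bas w) x" for w x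
  proof (rule lin_eqI[where f = "lext (box_act N a w)" and g = "act N a (bas w)"])
    fix lg :: "'a \<times> word"
    obtain l g where lg: "lg = (l, g)" by force
    show "lext (box_act N a w) (bas lg) = act N a (bas w) (bas lg)"
      unfolding lg lext_bas act_def Delta_def Psi_def box_act_def idD_def by (simp add: comult2_def)
  qed (simp_all add: lin_lext lin_act)
  show ?thesis
    unfolding box_mult_def 1
    by (rule lin_eqI[where f = "lext (\<lambda>w. act N a (bas w) x)" and g = "\<lambda>h. act N a h x"])
      (simp_all add: lin_lext lin_act_left)
qed

text \<open>The braiding of the tensor of l and u with y, as a linear function of
  \<open>Delta u\<close>, so that congruences of coproducts modulo \<open>I2'\<close> carry over to
  the braiding.\<close>

definition Ups :: "nat \<Rightarrow> (ind \<times> ind \<Rightarrow> 'b \<Rightarrow> ('b \<Rightarrow>\<^sub>0 'k)) \<Rightarrow> ('b \<Rightarrow>\<^sub>0 'k) \<Rightarrow> ('b \<times> word \<Rightarrow>\<^sub>0 'k)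
    \<Rightarrow> (word \<times> word \<Rightarrow>\<^sub>0 'k) \<Rightarrow> (('b \<times> word) \<times> ('b \<times> word) \<Rightarrow>\<^sub>0 'k::field)" where
  "Ups N a l y = lext (\<lambda>(u1, u2). tens (act N a (bas u1) y) (tens l (bas u2)))"

lemma lin_Ups: "lin (Ups N a l y)" by (simp add: Ups_def lin_lext)

lemma Ups_tens: "Ups N a l y (tens u1 u2) = tens (act N a u1 y) (tens l u2)"
  by (rule bilin_eqI[where f = "\<lambda>u1 u2. Ups N a l y (tens u1 u2)" and g = "\<lambda>u1 u2. tens (act N a u1 y) (tens l u2)"];
      (intro lin_intros lin_comp[OF lin_Ups] lin_comp[OF lin_act_left] lin_act_left)?; simp add: Ups_def)

lemma box_braiding_tens: "lext (box_braiding N a) (tens (tens l u) y) = Ups N a l y (Delta u)"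
proof -
  have Ul: "lin (\<lambda>l. Ups N a l y D)" for y D
  proof -
    have "lin (\<lambda>l. lext (\<lambda>w. (case w of (u1, u2) \<Rightarrow> \<lambda>l. tens (act N a (bas u1) y) (tens l (bas u2))) l) D)"
      by (rule lin_lext_arg) (auto split: prod.splits intro!: lin_intros)
    then show ?thesis by (simp add: Ups_def case_prod_unfold)
  qed
  have Uy: "lin (\<lambda>y. Ups N a l y D)" for l D
  proof -
    have "lin (\<lambda>y. lext (\<lambda>w. (case w of (u1, u2) \<Rightarrow> \<lambda>y. tens (act N a (bas u1) y) (tens l (bas u2))) y) D)"
      by (rule lin_lext_arg) (auto split: prod.splits intro!: lin_intros lin_act)
    then show ?thesis by (simp add: Ups_def case_prod_unfold)
  qed
  have 0: "lext (\<lambda>(h, x0). tens (act N a (bas h) (bas y)) (bas x0)) (lext (\<lambda>(g1, g2). bas (g1, (l, g2))) D)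
      = Ups N a (bas l) (bas y) D" for l y D
    by (rule lin_eqI[where f = "\<lambda>D. lext (\<lambda>(h, x0). tens (act N a (bas h) (bas y)) (bas x0)) (lext (\<lambda>(g1, g2). bas (g1, (l, g2))) D)"
          and g = "Ups N a (bas l) (bas y)"]; (intro lin_intros lin_Ups)?; auto simp: Ups_def)
  have 1: "lext (box_braiding N a) (tens (tens (bas l) (bas u)) (bas y)) = Ups N a (bas l) (bas y) (Delta (bas u))" for l u y
  proof -
    have b: "box_act N a h y = act N a (bas h) (bas y)" for h
      using box_mult_eq_act[of N a "bas h" "bas y"] by (simp add: box_mult_def)
    show ?thesis
      by (simp add: box_braiding_def box_coact_def b 0 Delta_def)
  qed
  have 2: "lext (box_braiding N a) (tens (tens (bas l) u) y) = Ups N a (bas l) y (Delta u)" for l u y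
    by (rule bilin_eqI[where f = "\<lambda>u y. lext (box_braiding N a) (tens (tens (bas l) u) y)"
          and g = "\<lambda>u y. Ups N a (bas l) y (Delta u)"];
        (intro lin_intros lin_comp[OF lin_Ups] lin_Delta Uy)?; rule 1)
  show ?thesis
    by (rule lin_eqI[where f = "\<lambda>l. lext (box_braiding N a) (tens (tens l u) y)" and g = "\<lambda>l. Ups N a l y (Delta u)"];
        (intro lin_intros Ul)?; rule 2)
qed

text \<open>
  In terms of \<open>\<beta> = \<mu>\<^sub>b\<^sub>a\<^sub>r \<omega>\<^sup>8\<^sup>k\<^sup>n\<close> and \<open>c = \<omega>\<^sup>2\<^sup>j\<^sup>N\<close> the module \<open>V'\<^sub>j\<^sub>k\<close> depends only on \<open>c\<^sup>2\<^sup>n = \<lambda>\<close> and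
  \<open>\<beta>\<^sup>N = \<mu>\<close>.
\<close>

definition Vg :: "'k::field \<Rightarrow> 'k \<Rightarrow> ind \<times> ind \<Rightarrow> ind \<Rightarrow> (ind \<Rightarrow>\<^sub>0 'k)" where
  "Vg \<beta> c g b = (case (g, b) of
      ((I2, I1), I1) \<Rightarrow> fscale c (bas I2)
    | ((I2, I1), I2) \<Rightarrow> fscale (\<beta> / c) (bas I1)
    | ((I1, I2), I1) \<Rightarrow> bas I2
    | ((I1, I2), I2) \<Rightarrow> fscale \<beta> (bas I1)
    | _ \<Rightarrow> 0)"

locale suzuki_module = suzuki N n \<mu> lam for N n :: nat and \<mu> lam :: "'k::field" +
  fixes \<beta> c :: 'k
  assumes c_pow: "c ^ (2 * n) = lam" and \<beta>_pow: "\<beta> ^ N = \<mu>"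
begin

lemma nz: "c \<noteq> 0" "\<beta> \<noteq> 0" "lam \<noteq> 0" "\<mu> \<noteq> 0"
proof -
  show 1: "lam \<noteq> 0" "\<mu> \<noteq> 0" using lam mu by auto
  show "c \<noteq> 0" using c_pow 1 n by (auto simp: power_0_left)
  show "\<beta> \<noteq> 0" using \<beta>_pow 1 N by (auto simp: power_0_left)
qed

abbreviation "V \<equiv> Vact (Vg \<beta> c)"
abbreviation "ac \<equiv> act N (Vg \<beta> c)"
abbreviation "U \<equiv> box_null I :: (ind \<times> word \<Rightarrow>\<^sub>0 'k) set"
abbreviation "v1 \<equiv> bas I1 :: ind \<Rightarrow>\<^sub>0 'k"
abbreviation "v2 \<equiv> bas I2 :: ind \<Rightarrow>\<^sub>0 'k"

lemma V_gen_bas: "V P v1 = 0" "V P v2 = 0" "V R v1 = 0" "V R v2 = 0" "V S v1 = v2" "V S v2 = fscale \<beta> v1"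
  "V T v1 = fscale c v2" "V T v2 = fscale (\<beta> / c) v1"
  by (simp_all add: Vact_xg Vg_def)

lemma ind_ext:
  assumes "lin f" "lin g" "f v1 = g v1" "f v2 = g v2"
  shows "f v = g v"
  by (rule lin_eqI[OF assms(1,2)]) (metis assms(3,4) ind.exhaust)

lemma V_diag: "V P v = 0" "V R v = 0"
  by (rule ind_ext[OF lin_Vact lin_zero]; simp add: V_gen_bas)+

lemma V_power: "V x v = fscale a v \<Longrightarrow> V (x ^ m) v = fscale (a ^ m) v"
  by (induction m) (simp_all add: Vact_1 Vact_mult Vact_simps mult.commute)

lemma V_ST: "V (S * T) v1 = fscale (\<beta> * c) v1" "V (S * T) v2 = fscale (\<beta> / c) v2"
  "V (T * S) v1 = fscale (\<beta> / c) v1" "V (T * S) v2 = fscale (\<beta> * c) v2"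
  "V (S ^ 2) v1 = fscale \<beta> v1" "V (S ^ 2) v2 = fscale \<beta> v2"
  "V (T ^ 2) v1 = fscale \<beta> v1" "V (T ^ 2) v2 = fscale \<beta> v2"
  using nz by (simp_all add: Vact_mult V_gen_bas Vact_simps power2_eq_square mult.commute)

text \<open>c^(2n) = \<lambda> gives the relation between the products of x_12 and x_21, and
  \<beta>^N = \<mu> the one between the 2N-th powers. The others hold because x_11, x_22 act by 0
  and the squares of x_12, x_21 both act by \<beta>.\<close>

lemma V_I: "x \<in> I \<Longrightarrow> V x v = 0"
proof -
  assume x: "x \<in> I"
  have "V (a * r * b) v = 0" if r: "r \<in> suzuki_relations N n \<mu> lam" for a r b
  proof -
    have ncase: "(a * P) ^ n = (a * P) ^ (n - 1) * a * P" "(a * R) ^ n = (a * R) ^ (n - 1) * a * R" for a :: "'k free_alg"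
      using n by (cases n; simp add: power_commutes mult.assoc)+
    have cn: "\<beta> ^ n / c ^ n = lam * (\<beta> ^ n * c ^ n)" "\<beta> ^ n * c ^ n = lam * (\<beta> ^ n / c ^ n)"
    proof -
      have cc: "c ^ n * c ^ n = lam" using c_pow by (simp add: power_add[symmetric] mult_2)
      then have "lam * (c ^ n * c ^ n) = 1" using lam by simp
      then show "\<beta> ^ n / c ^ n = lam * (\<beta> ^ n * c ^ n)"
        using nz by (simp add: field_simps)
      show "\<beta> ^ n * c ^ n = lam * (\<beta> ^ n / c ^ n)"
        using nz cc by (simp add: field_simps)
    qed
    have "V r w = 0" for w
    proof (rule ind_ext[OF lin_Vact lin_zero])
      have V0: "V (a * P) w = 0" "V (a * R) w = 0" "V 0 w = 0" for a w
        by (simp_all add: Vact_mult V_diag Vact_simps lin_0[OF lin_Vact_left])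
      have d: "V (x - y) v1 = 0 \<and> V (x - y) v2 = 0" if "V x v1 = V y v1" "V x v2 = V y v2" for x y
        using that by (simp add: Vact_simps)
      have r1: "V (P ^ 2 - R ^ 2) v1 = 0 \<and> V (P ^ 2 - R ^ 2) v2 = 0"
        by (rule d) (simp_all add: power2_eq_square V0)
      have r2: "V (S ^ 2 - T ^ 2) v1 = 0 \<and> V (S ^ 2 - T ^ 2) v2 = 0"
        by (rule d) (simp_all add: V_ST)
      have r3: "V ((T * S) ^ n - fscale lam ((S * T) ^ n)) v1 = 0 \<and> V ((T * S) ^ n - fscale lam ((S * T) ^ n)) v2 = 0"
        by (rule d; use cn in \<open>simp add: V_power[OF V_ST(1)] V_power[OF V_ST(2)] V_power[OF V_ST(3)] V_power[OF V_ST(4)]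
            Vact_simps power_divide power_mult_distrib\<close>)
      have r4: "V ((P * R) ^ n - (R * P) ^ n) v1 = 0 \<and> V ((P * R) ^ n - (R * P) ^ n) v2 = 0"
        by (rule d) (simp_all only: ncase V0)
      have r5: "V (P ^ (2 * N) + fscale \<mu> (S ^ (2 * N)) - 1) v1 = 0 \<and> V (P ^ (2 * N) + fscale \<mu> (S ^ (2 * N)) - 1) v2 = 0"
      proof (rule d)
        have P: "V (P ^ (2 * N)) w = 0" for w
        proof -
          have "P ^ (2 * N) = P ^ (2 * N - 1) * P" using N power_minus_mult[of "2 * N" P] by simp
          then show ?thesis by (simp only: V0)
        qed
        show "V (P ^ (2 * N) + fscale \<mu> (S ^ (2 * N))) v1 = V 1 v1" "V (P ^ (2 * N) + fscale \<mu> (S ^ (2 * N))) v2 = V 1 v2"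
          unfolding power_mult[of S] Vact_simps P V_power[OF V_ST(5)] V_power[OF V_ST(6)] \<beta>_pow Vact_1
          by (simp_all add: mu)
      qed
      have r6: "V (xg i j * xg k l) w = 0" if o: "odd (ind_val i + ind_val j + ind_val k + ind_val l)" for i j k l w
        using o by (cases i; cases j; cases k; cases l) (simp_all add: Vact_mult V_diag Vact_simps)
      show "V r v1 = 0" "V r v2 = 0"
        using r r1 r2 r3 r4 r5 r6 unfolding suzuki_relations_def alt_prod_even by blast+
    qed
    then show ?thesis by (simp add: Vact_mult Vact_simps)
  qed
  then have "V x v \<in> {0}"
    by (intro lin_ideal_gen[OF lin_Vact_left _ x[unfolded suzuki_ideal_def], of "{0}"]) (auto simp: fv.subspace_def)
  then show ?thesis by simp
qed

lemma subspace_U: "fv.subspace U" by (simp add: box_null_def)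

lemmas U_rules = fv.subspace_0[OF subspace_U] fv.subspace_add[OF subspace_U] fv.subspace_diff[OF subspace_U]
  fv.subspace_scale[OF subspace_U]

lemma tens_U: "g \<in> I \<Longrightarrow> tens l g \<in> U"
  unfolding box_null_def by (rule fv.span_base) blast

lemma lin_U:
  assumes "lin f" "fv.subspace W" "x \<in> U" "\<And>l g. g \<in> I \<Longrightarrow> f (tens l g) \<in> W"
  shows "f x \<in> W"
  by (rule lin_span_into[OF assms(1,2) _ assms(3)[unfolded box_null_def]]) (use assms(4) in blast)

lemma triple_bas: "bas h = tens (bas (fst h)) (tens (bas (fst (snd h))) (bas (snd (snd h))))"
  by simp

lemma ac_U: "x \<in> U \<Longrightarrow> ac h x \<in> U"
  unfolding act_def
proof (rule lin_U[OF lin_Psi subspace_U])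
  fix l and g :: "'k free_alg" assume g: "g \<in> I"
  show "Psi N (Vg \<beta> c) (idD (Delta h)) (tens l g) \<in> U"
    by (rule lin_into_subspace[OF lin_Psi_left subspace_U])
      (simp only: triple_bas Psi_tens, intro tens_U I_mult g)
qed

lemma Psi_into_U:
  assumes "\<And>l u. Psi N (Vg \<beta> c) H (tens l u) \<in> U"
  shows "Psi N (Vg \<beta> c) H x \<in> U"
proof (rule lin_into_subspace[OF lin_Psi subspace_U])
  fix lg :: "ind \<times> word"
  show "Psi N (Vg \<beta> c) H (bas lg) \<in> U"
    using assms[of "bas (fst lg)" "bas (snd lg)"] by simp
qed

text \<open>Applying \<open>Delta_I\<close> twice puts one leg of the iterated coproduct into the
  ideal. An outer leg multiplies into the algebra factor, the third one through the antipode; the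
  middle leg acts on V' by 0.\<close>

lemma ac_I: "h \<in> I \<Longrightarrow> ac h x \<in> U"
proof -
  assume h: "h \<in> I"
  have 1: "Psi N (Vg \<beta> c) (tens a E) x \<in> U" if a: "a \<in> I" for a E x
  proof (rule Psi_into_U)
    fix l u
    show "Psi N (Vg \<beta> c) (tens a E) (tens l u) \<in> U"
    proof (rule lin_into_subspace[where f = "\<lambda>E. Psi N (Vg \<beta> c) (tens a E) (tens l u)", OF _ subspace_U])
      fix bd :: "word \<times> word"
      have b: "bas bd = tens (bas (fst bd)) (bas (snd bd))" by simp
      show "Psi N (Vg \<beta> c) (tens a (bas bd)) (tens l u) \<in> U"
        unfolding b Psi_tens by (intro tens_U I_mult a)
    qed (intro lin_comp[OF lin_Psi_left] lin_intros)
  qed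
  have 2: "Psi N (Vg \<beta> c) (tens a E) x \<in> U" if E: "E \<in> I2'" for a E x
  proof (rule Psi_into_U)
    fix l u
    show "Psi N (Vg \<beta> c) (tens a E) (tens l u) \<in> U"
    proof (rule lin_I2'[where g = "\<lambda>E. Psi N (Vg \<beta> c) (tens a E) (tens l u)", OF _ subspace_U E])
      show "Psi N (Vg \<beta> c) (tens a (tens b d)) (tens l u) \<in> U" if "b \<in> I" for b d
        by (simp add: Psi_tens V_I that tens_simps U_rules)
      show "Psi N (Vg \<beta> c) (tens a (tens b d)) (tens l u) \<in> U" if "d \<in> I" for b d
        unfolding Psi_tens by (intro tens_U I_mult(1) ant_I that)
    qed (intro lin_comp[OF lin_Psi_left] lin_intros)
  qed
  show ?thesis
    unfolding act_def
    by (rule lin_I2'[where g = "\<lambda>D. Psi N (Vg \<beta> c) (idD D) x", OF _ subspace_U Delta_I[OF h]])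
      (intro lin_comp[OF lin_Psi_left] lin_idD | simp only: idD_tens, (rule 1, assumption | rule 2, rule Delta_I, assumption))+
qed

definition eqU :: "(ind \<times> word \<Rightarrow>\<^sub>0 'k) \<Rightarrow> (ind \<times> word \<Rightarrow>\<^sub>0 'k) \<Rightarrow> bool" (infix "\<simeq>" 50) where
  "x \<simeq> y \<longleftrightarrow> x - y \<in> U"

lemma eqU_refl [simp, intro]: "x \<simeq> x" by (simp add: eqU_def U_rules)
lemma eqU_sym: "x \<simeq> y \<Longrightarrow> y \<simeq> x" using U_rules(3)[OF U_rules(1), of "x - y"] by (simp add: eqU_def)
lemma eqU_trans [trans]: "x \<simeq> y \<Longrightarrow> y \<simeq> z \<Longrightarrow> x \<simeq> z"
  using U_rules(2)[of "x - y" "y - z"] by (simp add: eqU_def)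
lemma eqU_eq_trans [trans]: "x \<simeq> y \<Longrightarrow> y = z \<Longrightarrow> x \<simeq> z" "x = y \<Longrightarrow> y \<simeq> z \<Longrightarrow> x \<simeq> z"
  by simp_all
lemma eqU_add: "x \<simeq> x' \<Longrightarrow> y \<simeq> y' \<Longrightarrow> x + y \<simeq> x' + y'"
  using U_rules(2)[of "x - x'" "y - y'"] by (simp add: eqU_def algebra_simps)
lemma eqU_scale: "x \<simeq> x' \<Longrightarrow> fscale a x \<simeq> fscale a x'"
  using U_rules(4)[of "x - x'" a] by (simp add: eqU_def fv.scale_right_diff_distrib)
lemma eqU_ac: "x \<simeq> x' \<Longrightarrow> ac h x \<simeq> ac h x'"
  using ac_U[of "x - x'" h] by (simp add: eqU_def lin_diff[OF lin_act])
lemma eqU_ac_left: "h \<sim> h' \<Longrightarrow> ac h x \<simeq> ac h' x"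
  using ac_I[of "h - h'" x] by (simp add: eqU_def cg_def lin_diff[OF lin_act_left])
lemma eqU_tens: "u \<sim> u' \<Longrightarrow> tens l u \<simeq> tens l u'"
  using tens_U[of "u - u'" l] by (simp add: eqU_def cg_def tens_simps)
lemma eqU_0: "x \<simeq> 0 \<longleftrightarrow> x \<in> U" by (simp add: eqU_def)

lemma ac_simps: "ac h (x + y) = ac h x + ac h y" "ac h (fscale a x) = fscale a (ac h x)"
  by (simp_all add: lin_add[OF lin_act] lin_scale[OF lin_act])

subsection \<open>The action of the generators\<close>

lemma ac_xg: "ac (xg i j) (tens l u)
  = tens (V (xg I1 I1) l) (xg i I1 * u * ant N (xg I1 j)) + tens (V (xg I1 I2) l) (xg i I1 * u * ant N (xg I2 j))
    + tens (V (xg I2 I1) l) (xg i I2 * u * ant N (xg I1 j)) + tens (V (xg I2 I2) l) (xg i I2 * u * ant N (xg I2 j))"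
  by (simp add: act_def Delta_xg lin_add[OF lin_idD] idD_tens tens_simps lin_add[OF lin_Psi_left] Psi_tens)

text \<open>Since x_11 and x_22 act on V' by 0, only the off-diagonal middle legs of the coproduct
  survive. \<open>Fo\<close> and \<open>Go\<close> are what then happens to the algebra factor under
  x_12 and x_21, up to a scalar.\<close>

definition Fo :: "'k \<Rightarrow> 'k free_alg \<Rightarrow> 'k free_alg" where "Fo e u = P * u * R ^ M + fscale e (S * u * T ^ M)"
definition Go :: "'k \<Rightarrow> 'k free_alg \<Rightarrow> 'k free_alg" where "Go e u = R * u * P ^ M + fscale e (T * u * S ^ M)"

lemma ac_S: "ac S (tens v1 u) = tens v2 (Fo c u)" "ac S (tens v2 u) = fscale \<beta> (tens v1 (Fo (1 / c) u))"
  and ac_T: "ac T (tens v1 u) = fscale c (tens v2 (Go (1 / c) u))" "ac T (tens v2 u) = fscale (\<beta> / c) (tens v1 (Go c u))"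
  using nz by (simp_all add: ac_xg V_diag V_gen_bas ant_gen tens_simps Fo_def Go_def fv.scale_right_distrib add.commute)

lemma mixed_power: "(i = j) \<noteq> (k = l) \<Longrightarrow> xg i j * u * xg k l ^ M \<in> I"
  unfolding M_eq power_Suc mult.assoc[symmetric] by (rule I_mult(2), rule mixed)

text \<open>In the surviving terms \<open>u\<close> is enclosed by a diagonal generator and an
  off-diagonal power, in either order, so \<open>mixed_power\<close> applies or its mirror image
  does.\<close>

lemma ac_diag: "ac P x \<in> U" "ac R x \<in> U"
proof -
  have "ac P (bas lg) \<in> U \<and> ac R (bas lg) \<in> U" for lg
  proof -
    have b: "bas lg = tens (bas (fst lg)) (bas (snd lg))" by simp
    show ?thesis
      unfolding b ac_xg V_diag tens_simps ant_xg by (auto intro!: U_rules tens_U mixed_power[unfolded One_nat_def])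
  qed
  then show "ac P x \<in> U" "ac R x \<in> U"
    by (auto intro: lin_into_subspace[OF lin_act subspace_U])
qed

lemma conj_A: "x * (A ^ i * X) * (y * A ^ m) \<sim> A ^ (i + m) * (x * X * y)"
  and conj_B: "x * (B ^ i * X) * (y * B ^ m) \<sim> B ^ (i + m) * (x * X * y)"
proof -
  have "x * A ^ i * X * (y * A ^ m) \<sim> A ^ i * x * X * (A ^ m * y)"
    by (intro cg_mult cg_refl cg_sym[OF central_power(1)])
  also have "A ^ i * x * X * (A ^ m * y) = A ^ i * (x * X * A ^ m) * y" by (simp only: mult.assoc)
  also have "\<dots> \<sim> A ^ i * (A ^ m * (x * X)) * y" by (intro cg_mult cg_refl cg_sym[OF central_power(1)])
  finally show "x * (A ^ i * X) * (y * A ^ m) \<sim> A ^ (i + m) * (x * X * y)" by (simp only: mult.assoc power_add)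
  have "x * B ^ i * X * (y * B ^ m) \<sim> B ^ i * x * X * (B ^ m * y)"
    by (intro cg_mult cg_refl cg_sym[OF central_power(2)])
  also have "B ^ i * x * X * (B ^ m * y) = B ^ i * (x * X * B ^ m) * y" by (simp only: mult.assoc)
  also have "\<dots> \<sim> B ^ i * (B ^ m * (x * X)) * y" by (intro cg_mult cg_refl cg_sym[OF central_power(2)])
  finally show "x * (B ^ i * X) * (y * B ^ m) \<sim> B ^ (i + m) * (x * X * y)" by (simp only: mult.assoc power_add)
qed

text \<open>The unmixed terms are A^(4N) u and B^(4N) u, where 4N = M + 1, and A^(4N) + B^(4N) ~ A^N
  + \<mu> B^N ~ 1. Hence x_12^2 acts as a scalar.\<close>

lemma Fo_Fo: "e * e' = 1 \<Longrightarrow> Fo e' (Fo e u) \<sim> u"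
proof -
  assume e: "e * e' = 1"
  let ?m = "2 * N - 1"
  have PR: "P * (P * u * R ^ M) * R ^ M \<sim> A ^ (4 * N) * u"
  proof -
    have "P * (P * u * R ^ M) * R ^ M = A * u * (R ^ 2) ^ M"
    proof -
      have "R ^ M * R ^ M = (R ^ 2) ^ M" by (simp only: power_mult[symmetric] power_add[symmetric] mult_2)
      then show ?thesis by (simp only: A_def power2_eq_square[of P] mult.assoc)
    qed
    also have "\<dots> \<sim> A * u * A ^ M" by (intro cg_mult cg_refl cg_power R2)
    also have "A * u * A ^ M = A * (u * A ^ M)" by (rule mult.assoc)
    also have "\<dots> \<sim> A * (A ^ M * u)" by (intro cg_mult cg_refl cg_sym[OF central_power(1)])
    also have "A * (A ^ M * u) = A ^ (4 * N) * u"
      using N by (simp add: mult.assoc[symmetric] power_Suc[symmetric] del: power_Suc)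
    finally show ?thesis .
  qed
  have ST: "S * (S * u * T ^ M) * T ^ M \<sim> B ^ (4 * N) * u"
  proof -
    have "S * (S * u * T ^ M) * T ^ M = B * u * (T ^ 2) ^ M"
    proof -
      have "T ^ M * T ^ M = (T ^ 2) ^ M" by (simp only: power_mult[symmetric] power_add[symmetric] mult_2)
      then show ?thesis by (simp only: B_def power2_eq_square[of S] mult.assoc)
    qed
    also have "\<dots> \<sim> B * u * B ^ M" by (intro cg_mult cg_refl cg_power T2)
    also have "B * u * B ^ M = B * (u * B ^ M)" by (rule mult.assoc)
    also have "\<dots> \<sim> B * (B ^ M * u)" by (intro cg_mult cg_refl cg_sym[OF central_power(2)])
    also have "B * (B ^ M * u) = B ^ (4 * N) * u"
      using N by (simp add: mult.assoc[symmetric] power_Suc[symmetric] del: power_Suc)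
    finally show ?thesis .
  qed
  have m0: "P * (S * u * T ^ M) * R ^ M \<sim> 0" "S * (P * u * R ^ M) * T ^ M \<sim> 0"
    unfolding cg_0 mult.assoc[of S] mult.assoc[of P] mult.assoc[of _ _ "_ ^ M"]
    unfolding mult.assoc[of P S, symmetric] mult.assoc[of S P, symmetric]
    by (intro I_mult(2) odd_rel; simp)+
  have e4: "A ^ (4 * N) + B ^ (4 * N) \<sim> 1"
  proof -
    have a: "A ^ (4 * N) \<sim> A ^ N" using A_period_mult[OF N, of 3] N by (simp add: mult.commute)
    have b: "B ^ (4 * N) \<sim> fscale \<mu> (B ^ N)"
      using B_period_mult[OF N, of 3] N mu by (simp add: mult.commute power3_eq_cube)
    show ?thesis
      using cg_trans[OF cg_add[OF a b]] rels(5) by (simp add: A_def B_def power_mult)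
  qed
  have "Fo e' (Fo e u) = P * (P * u * R ^ M) * R ^ M + fscale (e * e') (S * (S * u * T ^ M) * T ^ M)
      + (fscale e (P * (S * u * T ^ M) * R ^ M) + fscale e' (S * (P * u * R ^ M) * T ^ M))"
    by (simp add: Fo_def distrib_left distrib_right fscale_mult fv.scale_right_distrib mult.commute[of e'] algebra_simps)
  also have "\<dots> \<sim> A ^ (4 * N) * u + fscale (e * e') (B ^ (4 * N) * u) + (fscale e 0 + fscale e' 0)"
    by (intro cg_add cg_scale PR ST m0)
  also have "\<dots> = (A ^ (4 * N) + B ^ (4 * N)) * u" by (simp add: e distrib_right)
  also have "\<dots> \<sim> 1 * u" by (intro cg_mult e4 cg_refl)
  finally show ?thesis by simp
qed

lemma ac_SS: "ac S (ac S x) \<simeq> fscale \<beta> x"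
proof -
  have "ac S (ac S (bas lg)) - fscale \<beta> (bas lg) \<in> U" for lg
  proof -
    have b: "bas lg = tens (bas (fst lg)) (bas (snd lg))" by simp
    have "ac S (ac S (tens l u)) \<simeq> fscale \<beta> (tens l u)" if "l \<in> {v1, v2}" for l u
      using that nz by (auto simp: ac_S ac_simps intro!: eqU_scale eqU_tens Fo_Fo)
    moreover have "bas (fst lg) \<in> {v1, v2}" by (cases "fst lg") auto
    ultimately show ?thesis unfolding b by (simp only: eqU_def)
  qed
  then show ?thesis
    unfolding eqU_def
    by - (rule lin_into_subspace[where f = "\<lambda>x. ac S (ac S x) - fscale \<beta> x", OF _ subspace_U],
        (intro lin_intros lin_comp[OF lin_act] lin_act | assumption)+)
qed

lemma ac_TT: "ac T (ac T x) \<simeq> fscale \<beta> x"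
proof -
  have "ac T (ac T x) = ac (T ^ 2) x" by (simp add: act_mult power2_eq_square)
  also have "\<dots> \<simeq> ac (S ^ 2) x" by (rule eqU_ac_left, rule cg_sym, rule rels)
  also have "ac (S ^ 2) x = ac S (ac S x)" by (simp add: act_mult power2_eq_square)
  also have "\<dots> \<simeq> fscale \<beta> x" by (rule ac_SS)
  finally show ?thesis .
qed

text \<open>Together with \<open>ac_A\<close> this makes a braiding keep only the terms of a
  coproduct whose left leg contains a power of \<open>B\<close>, which contributes a power of
  \<beta>.\<close>

lemma ac_B: "ac (B ^ i * y) x \<simeq> fscale (\<beta> ^ i) (ac y x)"
proof -
  have "ac (B ^ i) x \<simeq> fscale (\<beta> ^ i) x" for x
  proof (induction i)
    case (Suc i)
    have "ac (B ^ Suc i) x = ac S (ac S (ac (B ^ i) x))" by (simp add: act_mult B_def power2_eq_square)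
    also have "\<dots> \<simeq> fscale \<beta> (ac (B ^ i) x)" by (rule ac_SS)
    also have "\<dots> \<simeq> fscale \<beta> (fscale (\<beta> ^ i) x)" by (rule eqU_scale[OF Suc])
    finally show ?case by simp
  qed (simp add: act_1)
  then show ?thesis by (simp add: act_mult)
qed

lemma ac_A: "i \<ge> 1 \<Longrightarrow> ac (A ^ i * y) x \<in> U"
proof -
  assume "i \<ge> 1"
  then obtain m where "i = Suc m" by (cases i) auto
  then have "ac (A ^ i * y) x = ac P (ac P (ac (A ^ m) (ac y x)))"
    by (simp add: act_mult A_def power2_eq_square)
  then show ?thesis by (simp add: ac_diag)
qed

subsection \<open>Normal forms of the vectors\<close>

text \<open>
  Modulo the ideal, every \<open>w\<^sub>r\<close> is a multiple of some \<open>v'\<^sub>i \<otimes> HH \<dots>\<close> or \<open>v'\<^sub>i \<otimes> HH' \<dots>\<close>.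
\<close>

definition HH :: "nat \<Rightarrow> nat \<Rightarrow> 'k \<Rightarrow> 'k free_alg" where
  "HH i k d = A ^ i * (R * P) ^ k + fscale d (B ^ i * (T * S) ^ k)"
definition HH' :: "nat \<Rightarrow> nat \<Rightarrow> 'k \<Rightarrow> 'k free_alg" where
  "HH' i k d = A ^ i * (P * R) ^ k + fscale d (B ^ i * (S * T) ^ k)"

lemma HH_0: "HH i 0 d = HH' i 0 d" by (simp add: HH_def HH'_def)

lemma alt_power: "x * (y * x) ^ k * y = (x * y) ^ Suc k" for x y :: "'k free_alg"
proof (induction k)
  case (Suc k)
  have "x * (y * x) ^ Suc k * y = x * y * (x * (y * x) ^ k * y)" by (simp add: mult.assoc)
  then show ?case by (simp add: Suc)
qed simp

lemma cross_0: "i \<ge> 1 \<Longrightarrow> x \<in> Dia \<Longrightarrow> x * (B ^ i * y) * w \<sim> 0" "i \<ge> 1 \<Longrightarrow> z \<in> Off \<Longrightarrow> z * (A ^ i * y) * w \<sim> 0"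
proof -
  show "x * (B ^ i * y) * w \<sim> 0" if "i \<ge> 1" "x \<in> Dia"
    using Dia_Off(1)[OF that(2) Off_power[OF that(1) B_Off]] by (simp add: cg_0 mult.assoc[symmetric] I_mult(2))
  show "z * (A ^ i * y) * w \<sim> 0" if "i \<ge> 1" "z \<in> Off"
    using Dia_Off(2)[OF Dia_power[OF that(1) A_Dia] that(2)] by (simp add: cg_0 mult.assoc[symmetric] I_mult(2))
qed

text \<open>The outer generators prolong the alternating product by one step, and the central part
  of the M-th power adds 2N - 1 to the exponent i. The cross terms vanish because i is
  positive.\<close>

lemma Fo_HH: "i \<ge> 1 \<Longrightarrow> Fo e (HH i k d) \<sim> HH' (i + (2 * N - 1)) (Suc k) (e * d)"
  and Go_HH: "i \<ge> 1 \<Longrightarrow> Go e (HH' i k d) \<sim> HH (i + (2 * N - 1)) (Suc k) (e * d)"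
proof -
  assume i: "i \<ge> 1"
  let ?m = "2 * N - 1"
  have 1: "P * (A ^ i * (R * P) ^ k) * R ^ M \<sim> A ^ (i + ?m) * (P * R) ^ Suc k"
    using cg_trans[OF cg_mult[OF cg_refl pow_M(3)] conj_A[of P i "(R * P) ^ k" R ?m]] by (simp only: alt_power)
  have 2: "S * (B ^ i * (T * S) ^ k) * T ^ M \<sim> B ^ (i + ?m) * (S * T) ^ Suc k"
    using cg_trans[OF cg_mult[OF cg_refl pow_M(4)] conj_B[of S i "(T * S) ^ k" T ?m]] by (simp only: alt_power)
  have "Fo e (HH i k d) = P * (A ^ i * (R * P) ^ k) * R ^ M + fscale (e * d) (S * (B ^ i * (T * S) ^ k) * T ^ M)
      + (fscale d (P * (B ^ i * (T * S) ^ k) * R ^ M) + fscale e (S * (A ^ i * (R * P) ^ k) * T ^ M))"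
    by (simp add: Fo_def HH_def distrib_left distrib_right fscale_mult fv.scale_right_distrib add_ac)
  also have "\<dots> \<sim> A ^ (i + ?m) * (P * R) ^ Suc k + fscale (e * d) (B ^ (i + ?m) * (S * T) ^ Suc k) + (fscale d 0 + fscale e 0)"
    by (intro cg_add cg_scale 1 2 cross_0 i Dia_gen Off_gen)
  finally show "Fo e (HH i k d) \<sim> HH' (i + ?m) (Suc k) (e * d)" by (simp add: HH'_def)
  have 1: "R * (A ^ i * (P * R) ^ k) * P ^ M \<sim> A ^ (i + ?m) * (R * P) ^ Suc k"
    using conj_A[of R i "(P * R) ^ k" P ?m] by (simp only: alt_power pow_M)
  have 2: "T * (B ^ i * (S * T) ^ k) * S ^ M \<sim> B ^ (i + ?m) * (T * S) ^ Suc k"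
    using conj_B[of T i "(S * T) ^ k" S ?m] by (simp only: alt_power pow_M)
  have "Go e (HH' i k d) = R * (A ^ i * (P * R) ^ k) * P ^ M + fscale (e * d) (T * (B ^ i * (S * T) ^ k) * S ^ M)
      + (fscale d (R * (B ^ i * (S * T) ^ k) * P ^ M) + fscale e (T * (A ^ i * (P * R) ^ k) * S ^ M))"
    by (simp add: Go_def HH'_def distrib_left distrib_right fscale_mult fv.scale_right_distrib add_ac)
  also have "\<dots> \<sim> A ^ (i + ?m) * (R * P) ^ Suc k + fscale (e * d) (B ^ (i + ?m) * (T * S) ^ Suc k) + (fscale d 0 + fscale e 0)"
    by (intro cg_add cg_scale 1 2 cross_0 i Dia_gen Off_gen)
  finally show "Go e (HH' i k d) \<sim> HH (i + ?m) (Suc k) (e * d)" by (simp add: HH_def)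
qed

text \<open>At full length the relations of the algebra exchange the two orders of the alternating
  products, at the cost of \<lambda> on the off-diagonal part.\<close>

lemma HH_n: "HH i n d \<sim> HH' i n (lam * d)"
proof -
  have "HH i n d \<sim> A ^ i * (P * R) ^ n + fscale d (B ^ i * fscale lam ((S * T) ^ n))"
    unfolding HH_def by (intro cg_add cg_scale cg_mult cg_refl rels cg_sym[OF rels(4)])
  then show ?thesis by (simp add: HH'_def fscale_mult mult.commute)
qed

text \<open>The product telescopes from the middle outwards: each pair of adjacent equal generators
  is a central square.\<close>

lemma alt_cancel: "(P * R) ^ k * (R * P) ^ k \<sim> A ^ (2 * k)" "(S * T) ^ k * (T * S) ^ k \<sim> B ^ (2 * k)"
proof -
  show "(P * R) ^ k * (R * P) ^ k \<sim> A ^ (2 * k)"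
  proof (induction k)
    case (Suc k)
    have "(P * R) ^ Suc k * (R * P) ^ Suc k = (P * R) ^ k * (P * R ^ 2 * P) * (R * P) ^ k"
      by (simp only: power_Suc2[of "P * R"] power_Suc[of "R * P"] power2_eq_square mult.assoc)
    also have "\<dots> \<sim> (P * R) ^ k * (P * A * P) * (R * P) ^ k" by (intro cg_mult cg_refl R2)
    also have "\<dots> \<sim> (P * R) ^ k * (A * P * P) * (R * P) ^ k" by (intro cg_mult cg_refl cg_sym[OF central(1)])
    also have "(P * R) ^ k * (A * P * P) * (R * P) ^ k = (P * R) ^ k * A ^ 2 * (R * P) ^ k"
      by (simp add: A_def power2_eq_square mult.assoc)
    also have "\<dots> \<sim> A ^ 2 * (P * R) ^ k * (R * P) ^ k" by (intro cg_mult cg_refl cg_sym[OF central_power(1)])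
    also have "A ^ 2 * (P * R) ^ k * (R * P) ^ k = A ^ 2 * ((P * R) ^ k * (R * P) ^ k)" by (rule mult.assoc)
    also have "\<dots> \<sim> A ^ 2 * A ^ (2 * k)" by (intro cg_mult cg_refl Suc)
    finally show ?case by (simp add: power_add power2_eq_square mult.assoc)
  qed simp
  show "(S * T) ^ k * (T * S) ^ k \<sim> B ^ (2 * k)"
  proof (induction k)
    case (Suc k)
    have "(S * T) ^ Suc k * (T * S) ^ Suc k = (S * T) ^ k * (S * T ^ 2 * S) * (T * S) ^ k"
      by (simp only: power_Suc2[of "S * T"] power_Suc[of "T * S"] power2_eq_square mult.assoc)
    also have "\<dots> \<sim> (S * T) ^ k * (S * B * S) * (T * S) ^ k" by (intro cg_mult cg_refl T2)
    also have "\<dots> \<sim> (S * T) ^ k * (B * S * S) * (T * S) ^ k" by (intro cg_mult cg_refl cg_sym[OF central(2)])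
    also have "(S * T) ^ k * (B * S * S) * (T * S) ^ k = (S * T) ^ k * B ^ 2 * (T * S) ^ k"
      by (simp add: B_def power2_eq_square mult.assoc)
    also have "\<dots> \<sim> B ^ 2 * (S * T) ^ k * (T * S) ^ k" by (intro cg_mult cg_refl cg_sym[OF central_power(2)])
    also have "B ^ 2 * (S * T) ^ k * (T * S) ^ k = B ^ 2 * ((S * T) ^ k * (T * S) ^ k)" by (rule mult.assoc)
    also have "\<dots> \<sim> B ^ 2 * B ^ (2 * k)" by (intro cg_mult cg_refl Suc)
    finally show ?case by (simp add: power_add power2_eq_square mult.assoc)
  qed simp
qed

lemma HH_2n: "HH i (2 * n) d \<sim> HH (i + 2 * n) 0 (lam * d)"
proof -
  have sp: "x ^ (2 * n) = x ^ n * x ^ n" for x :: "'k free_alg" by (simp add: mult_2 power_add)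
  have 1: "(R * P) ^ (2 * n) \<sim> A ^ (2 * n)"
    unfolding sp[of "R * P"] by (rule cg_trans[OF cg_mult[OF cg_sym[OF rels(4)] cg_refl] alt_cancel(1)])
  have "(T * S) ^ (2 * n) \<sim> fscale lam ((S * T) ^ n) * (T * S) ^ n"
    unfolding sp[of "T * S"] by (intro cg_mult rels cg_refl)
  also have "\<dots> = fscale lam ((S * T) ^ n * (T * S) ^ n)" by (simp add: fscale_mult)
  also have "\<dots> \<sim> fscale lam (B ^ (2 * n))" by (rule cg_scale[OF alt_cancel(2)])
  finally have 2: "(T * S) ^ (2 * n) \<sim> fscale lam (B ^ (2 * n))" .
  have "HH i (2 * n) d \<sim> A ^ i * A ^ (2 * n) + fscale d (B ^ i * fscale lam (B ^ (2 * n)))"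
    unfolding HH_def by (intro cg_add cg_scale cg_mult cg_refl 1 2)
  then show ?thesis by (simp add: HH_def fscale_mult mult.commute power_add)
qed

lemma HH'_Suc_n: "HH' i (Suc n) d \<sim> HH (i + 2) (n - 1) (lam * d)"
proof -
  obtain m where m: "n = Suc m" using n by (cases n) auto
  have c: "P * R * (R * P) \<sim> A ^ 2" "S * T * (T * S) \<sim> B ^ 2"
    using alt_cancel[of 1] by simp_all
  have "(P * R) ^ Suc n \<sim> P * R * (R * P) ^ n" unfolding power_Suc by (intro cg_mult cg_refl rels)
  also have "\<dots> = P * R * (R * P) * (R * P) ^ m" by (simp add: m mult.assoc)
  also have "\<dots> \<sim> A ^ 2 * (R * P) ^ m" by (intro cg_mult cg_refl c)
  finally have 1: "(P * R) ^ Suc n \<sim> A ^ 2 * (R * P) ^ m" .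
  have "fscale lam (fscale lam ((S * T) ^ n)) \<sim> fscale lam ((T * S) ^ n)"
    by (intro cg_scale cg_sym[OF rels(3)])
  then have st: "(S * T) ^ n \<sim> fscale lam ((T * S) ^ n)" by (simp add: lam)
  have "(S * T) ^ Suc n \<sim> S * T * fscale lam ((T * S) ^ n)" unfolding power_Suc by (intro cg_mult cg_refl st)
  also have "\<dots> = fscale lam (S * T * (T * S) * (T * S) ^ m)" by (simp add: m mult.assoc fscale_mult)
  also have "\<dots> \<sim> fscale lam (B ^ 2 * (T * S) ^ m)" by (intro cg_scale cg_mult cg_refl c)
  finally have 2: "(S * T) ^ Suc n \<sim> fscale lam (B ^ 2 * (T * S) ^ m)" .
  have "HH' i (Suc n) d \<sim> A ^ i * (A ^ 2 * (R * P) ^ m) + fscale d (B ^ i * fscale lam (B ^ 2 * (T * S) ^ m))"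
    unfolding HH'_def by (intro cg_add cg_scale cg_mult cg_refl 1 2)
  also have "\<dots> = HH (i + 2) (n - 1) (lam * d)"
    unfolding HH_def power_add by (simp add: fscale_mult mult.commute[of d] mult.assoc m)
  finally show ?thesis .
qed

text \<open>The period is 2N and not N, because B^N contributes \<mu>, whose square is 1.\<close>

lemma HH_period: "i \<ge> 1 \<Longrightarrow> HH (i + 2 * N * m) k d \<sim> HH i k d" "i \<ge> 1 \<Longrightarrow> HH' (i + 2 * N * m) k d \<sim> HH' i k d"
proof -
  assume i: "i \<ge> 1"
  have "A ^ (i + N * (2 * m)) \<sim> A ^ i" "B ^ (i + N * (2 * m)) \<sim> B ^ i"
    using A_period_mult[OF i, of "2 * m"] B_period_mult[OF i, of "2 * m"] mu_even[of "2 * m"] by simp_all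
  then have "A ^ (i + 2 * N * m) \<sim> A ^ i" "B ^ (i + 2 * N * m) \<sim> B ^ i"
    by (simp_all add: mult_ac)
  then show "HH (i + 2 * N * m) k d \<sim> HH i k d" "HH' (i + 2 * N * m) k d \<sim> HH' i k d"
    unfolding HH_def HH'_def by (auto intro!: cg_add cg_scale cg_mult)
qed

lemma V_HH: "i \<ge> 1 \<Longrightarrow> V (HH i k d) v1 = fscale (d * \<beta> ^ i * (\<beta> / c) ^ k) v1"
  "i \<ge> 1 \<Longrightarrow> V (HH' i k d) v1 = fscale (d * \<beta> ^ i * (\<beta> * c) ^ k) v1"
proof -
  assume "i \<ge> 1"
  then obtain m where m: "i = Suc m" by (cases i) auto
  have "A ^ i * y = P * (P * A ^ m * y)" for y by (simp add: m A_def power2_eq_square mult.assoc)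
  then have 0: "V (A ^ i * y) v1 = 0" for y by (simp only: Vact_mult V_diag)
  show "V (HH i k d) v1 = fscale (d * \<beta> ^ i * (\<beta> / c) ^ k) v1" "V (HH' i k d) v1 = fscale (d * \<beta> ^ i * (\<beta> * c) ^ k) v1"
    by (simp_all add: HH_def HH'_def Vact_simps 0) (simp_all add: Vact_mult V_power[OF V_ST(3)] V_power[OF V_ST(1)] Vact_simps
        B_def V_power[OF V_ST(5)] mult_ac)
qed

end

instance ind :: finite
proof
  have "finite {I1, I2}" by simp
  then show "finite (UNIV :: ind set)" by (simp only: UNIV_ind)
qed

section \<open>The braiding\<close>

context suzuki_module
begin

abbreviation "br \<equiv> box_braiding N (Vg \<beta> c)"
abbreviation "cb x y \<equiv> lext br (tens x y)"

lemma br_null2: "x \<in> null2 U \<Longrightarrow> lext br x \<in> null2 U"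
proof (rule lin_span_into[OF lin_lext subspace_null2])
  show "x \<in> null2 U \<Longrightarrow> x \<in> fv.span ({tens u x | u x. u \<in> U} \<union> {tens x u | u x. u \<in> U})"
    by (simp add: null2_def)
  have 1: "cb u x \<in> null2 U" if u: "u \<in> U" for u x
  proof (rule lin_U[where f = "\<lambda>u. cb u x", OF _ subspace_null2 u])
    fix l and g :: "'k free_alg" assume g: "g \<in> I"
    show "cb (tens l g) x \<in> null2 U"
      unfolding box_braiding_tens
      by (rule lin_I2'[OF lin_Ups subspace_null2 Delta_I[OF g]])
        (simp_all add: Ups_tens null2_left null2_right ac_I tens_U)
  qed (intro lin_intros)
  have 2: "cb x u \<in> null2 U" if u: "u \<in> U" for u x
  proof (rule lin_into_subspace[where f = "\<lambda>x. cb x u", OF _ subspace_null2])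
    fix lg :: "ind \<times> word"
    have b: "bas lg = tens (bas (fst lg)) (bas (snd lg))" by simp
    have "Ups N (Vg \<beta> c) (bas (fst lg)) u D \<in> null2 U" for D
    proof (rule lin_into_subspace[OF lin_Ups subspace_null2])
      fix st :: "word \<times> word"
      have "bas st = tens (bas (fst st)) (bas (snd st))" by simp
      then show "Ups N (Vg \<beta> c) (bas (fst lg)) u (bas st) \<in> null2 U"
        using Ups_tens null2_left ac_U[OF u] by metis
    qed
    then show "cb (bas lg) u \<in> null2 U"
      unfolding b box_braiding_tens .
  qed (intro lin_intros)
  show "lext br y \<in> null2 U" if "y \<in> {tens u x | u x. u \<in> U} \<union> {tens x u | u x. u \<in> U}" for y
    using that 1 2 by blast
qed

definition eq2 :: "((ind \<times> word) \<times> (ind \<times> word) \<Rightarrow>\<^sub>0 'k) \<Rightarrow> ((ind \<times> word) \<times> (ind \<times> word) \<Rightarrow>\<^sub>0 'k) \<Rightarrow> bool" (infix "\<cong>" 50) where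
  "x \<cong> y \<longleftrightarrow> x - y \<in> null2 U"

lemmas null2_rules = fv.subspace_0[OF subspace_null2] fv.subspace_add[OF subspace_null2]
  fv.subspace_diff[OF subspace_null2] fv.subspace_scale[OF subspace_null2]

lemma eq2_trans [trans]: "x \<cong> y \<Longrightarrow> y \<cong> z \<Longrightarrow> x \<cong> z"
  using null2_rules(2)[of "x - y" U "y - z"] by (simp add: eq2_def)
lemma eq2_eq_trans [trans]: "x \<cong> y \<Longrightarrow> y = z \<Longrightarrow> x \<cong> z" "x = y \<Longrightarrow> y \<cong> z \<Longrightarrow> x \<cong> z"
  by simp_all
lemma eq2_add: "x \<cong> x' \<Longrightarrow> y \<cong> y' \<Longrightarrow> x + y \<cong> x' + y'"
  using null2_rules(2)[of "x - x'" U "y - y'"] by (simp add: eq2_def algebra_simps)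
lemma eq2_scale: "x \<cong> x' \<Longrightarrow> fscale a x \<cong> fscale a x'"
  using null2_rules(4)[of "x - x'" U a] by (simp add: eq2_def fv.scale_right_diff_distrib)
lemma eq2_tens: "x \<simeq> x' \<Longrightarrow> y \<simeq> y' \<Longrightarrow> tens x y \<cong> tens x' y'"
proof -
  assume "x \<simeq> x'" "y \<simeq> y'"
  then have "tens (x - x') y + tens x' (y - y') \<in> null2 U"
    by (intro null2_rules null2_left null2_right) (simp_all add: eqU_def)
  then show ?thesis by (simp add: eq2_def tens_simps)
qed
lemma eq2_cb: "x \<simeq> x' \<Longrightarrow> cb x y \<cong> cb x' y"
  using br_null2[OF null2_left[of "x - x'" U y]] by (simp add: eq2_def eqU_def tens_simps lin_diff[OF lin_lext])

text \<open>The coproduct of x + d y is x \<otimes> (x + d y) + y \<otimes> (z + d z') modulo the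
  ideal. As x acts by 0, the braiding reduces to a single term.\<close>

lemma br_cop:
  assumes "dcop x y z" "ocop y x z'" "\<And>w. ac x w \<in> U"
  shows "cb (tens l (x + fscale d y)) w \<cong> tens (ac y w) (tens l (z + fscale d z'))"
proof -
  have "Delta (x + fscale d y) \<approx> (tens x x + tens y z) + fscale d (tens x y + tens y z')"
    using assms unfolding Delta_simps by (intro cg2_add cg2_scale) (simp_all add: dcop_def ocop_def)
  then have D: "Delta (x + fscale d y) - (tens x (x + fscale d y) + tens y (z + fscale d z')) \<in> I2'"
    by (simp add: cg2_def tens_simps fv.scale_right_distrib algebra_simps)
  have "Ups N (Vg \<beta> c) l w (Delta (x + fscale d y) - (tens x (x + fscale d y) + tens y (z + fscale d z'))) \<in> null2 U"
    by (rule lin_I2'[OF lin_Ups subspace_null2 D]) (simp_all add: Ups_tens null2_left null2_right ac_I tens_U)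
  then have "cb (tens l (x + fscale d y)) w
      \<cong> tens (ac x w) (tens l (x + fscale d y)) + tens (ac y w) (tens l (z + fscale d z'))"
    by (simp add: eq2_def box_braiding_tens lin_diff[OF lin_Ups] lin_add[OF lin_Ups] Ups_tens)
  also have "\<dots> \<cong> tens 0 (tens l (x + fscale d y)) + tens (ac y w) (tens l (z + fscale d z'))"
    by (intro eq2_add eq2_tens) (simp_all add: eqU_0 assms(3))
  finally show ?thesis by (simp add: tens_simps)
qed

lemma cop_normal:
  assumes "i \<ge> 1"
  shows "dcop (A ^ i * (R * P) ^ k) (B ^ i * (T * S) ^ k) (B ^ i * (S * T) ^ k)"
    "ocop (B ^ i * (T * S) ^ k) (A ^ i * (R * P) ^ k) (A ^ i * (P * R) ^ k)"
    "dcop (A ^ i * (P * R) ^ k) (B ^ i * (S * T) ^ k) (B ^ i * (T * S) ^ k)"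
    "ocop (B ^ i * (S * T) ^ k) (A ^ i * (P * R) ^ k) (A ^ i * (R * P) ^ k)"
proof -
  have s: "x ^ i * y ^ Suc k = (x ^ i * y ^ k) * y" for x y :: "'k free_alg" and k
    unfolding power_Suc2 by (rule mult.assoc[symmetric])
  have 0: "dcop (A ^ i) (B ^ i) (B ^ i)" "ocop (B ^ i) (A ^ i) (A ^ i)"
    using dcop_power[OF assms dcop_A] ocop_power[OF assms ocop_B] .
  show "dcop (A ^ i * (R * P) ^ k) (B ^ i * (T * S) ^ k) (B ^ i * (S * T) ^ k)"
    by (induction k) (simp add: 0, simp only: s dcop_mult dcop_mult[OF cop_gen(2,1)])
  show "ocop (B ^ i * (T * S) ^ k) (A ^ i * (R * P) ^ k) (A ^ i * (P * R) ^ k)"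
    by (induction k) (simp add: 0, simp only: s ocop_mult ocop_mult[OF cop_gen(4,3)])
  show "dcop (A ^ i * (P * R) ^ k) (B ^ i * (S * T) ^ k) (B ^ i * (T * S) ^ k)"
    by (induction k) (simp add: 0, simp only: s dcop_mult dcop_mult[OF cop_gen(1,2)])
  show "ocop (B ^ i * (S * T) ^ k) (A ^ i * (P * R) ^ k) (A ^ i * (R * P) ^ k)"
    by (induction k) (simp add: 0, simp only: s ocop_mult ocop_mult[OF cop_gen(3,4)])
qed

lemma br_HH:
  assumes "i \<ge> 1" "d \<noteq> 0"
  shows "cb (tens l (HH i k d)) w \<cong> fscale (d * \<beta> ^ i) (tens (ac ((T * S) ^ k) w) (tens l (HH' i k (1 / d))))"
    and "cb (tens l (HH' i k d)) w \<cong> fscale (d * \<beta> ^ i) (tens (ac ((S * T) ^ k) w) (tens l (HH i k (1 / d))))"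
proof -
  have e: "B ^ i * (S * T) ^ k + fscale d (A ^ i * (P * R) ^ k) = fscale d (HH' i k (1 / d))"
    "B ^ i * (T * S) ^ k + fscale d (A ^ i * (R * P) ^ k) = fscale d (HH i k (1 / d))"
    using assms(2) by (simp_all add: HH_def HH'_def fv.scale_right_distrib add.commute)
  have "cb (tens l (HH i k d)) w \<cong> tens (ac (B ^ i * (T * S) ^ k) w) (tens l (fscale d (HH' i k (1 / d))))"
    unfolding HH_def e[symmetric] by (intro br_cop cop_normal ac_A assms(1))
  also have "\<dots> \<cong> tens (fscale (\<beta> ^ i) (ac ((T * S) ^ k) w)) (tens l (fscale d (HH' i k (1 / d))))"
    by (intro eq2_tens ac_B eqU_refl)
  finally show "cb (tens l (HH i k d)) w \<cong> fscale (d * \<beta> ^ i) (tens (ac ((T * S) ^ k) w) (tens l (HH' i k (1 / d))))"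
    by (simp add: tens_simps mult.commute)
  have "cb (tens l (HH' i k d)) w \<cong> tens (ac (B ^ i * (S * T) ^ k) w) (tens l (fscale d (HH i k (1 / d))))"
    unfolding HH'_def e[symmetric] by (intro br_cop cop_normal ac_A assms(1))
  also have "\<dots> \<cong> tens (fscale (\<beta> ^ i) (ac ((S * T) ^ k) w)) (tens l (fscale d (HH i k (1 / d))))"
    by (intro eq2_tens ac_B eqU_refl)
  finally show "cb (tens l (HH' i k d)) w \<cong> fscale (d * \<beta> ^ i) (tens (ac ((S * T) ^ k) w) (tens l (HH i k (1 / d))))"
    by (simp add: tens_simps mult.commute)
qed

text \<open>
  The functional \<open>u \<mapsto>\<close> coefficient of \<open>v'\<^sub>1\<close> in \<open>u \<cdot> v'\<^sub>1\<close> on the algebra vanishes on the ideal and is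
  used to separate vectors modulo \<open>U\<close>.
\<close>

definition coef :: "(ind \<times> word \<Rightarrow>\<^sub>0 'k) \<Rightarrow> (ind \<Rightarrow>\<^sub>0 'k)" where
  "coef = lext (\<lambda>(l, g). fscale (Poly_Mapping.lookup (V (bas g) v1) I1) (bas l))"

lemma lin_coef: "lin coef" by (simp add: coef_def lin_lext)

lemma coef_tens: "coef (tens l u) = fscale (Poly_Mapping.lookup (V u v1) I1) l"
proof (rule bilin_eqI[where f = "\<lambda>l u. coef (tens l u)" and g = "\<lambda>l u. fscale (Poly_Mapping.lookup (V u v1) I1) l"])
  show "lin (\<lambda>u. fscale (Poly_Mapping.lookup (V u v1) I1) l)" for l :: "ind \<Rightarrow>\<^sub>0 'k"
    by (simp add: lin_def Vact_simps lookup_add fv.scale_left_distrib)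
qed (intro lin_intros lin_comp[OF lin_coef] | simp add: coef_def)+

lemma coef_U: "x \<in> U \<Longrightarrow> coef x = 0"
proof -
  assume x: "x \<in> U"
  have "coef x \<in> {0}"
    by (rule lin_U[OF lin_coef _ x]) (simp_all add: fv.subspace_def coef_tens V_I)
  then show ?thesis by simp
qed

lemma coef_eqU: "x \<simeq> y \<Longrightarrow> coef x = coef y"
  using coef_U[of "x - y"] by (simp add: eqU_def lin_diff[OF lin_coef])

lemma coef_HH: "i \<ge> 1 \<Longrightarrow> coef (tens l (HH i k d)) = fscale (d * \<beta> ^ i * (\<beta> / c) ^ k) l"
  "i \<ge> 1 \<Longrightarrow> coef (tens l (HH' i k d)) = fscale (d * \<beta> ^ i * (\<beta> * c) ^ k) l"
  by (simp_all add: coef_tens V_HH)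

lemma \<beta>_2N: "\<beta> ^ (2 * N) = 1"
  unfolding mult.commute[of 2] power_mult by (simp add: \<beta>_pow power2_eq_square mu)

lemma \<beta>_shift: "\<beta> ^ (i + (2 * N - 1)) = \<beta> ^ i / \<beta>"
proof -
  have "\<beta> ^ (i + (2 * N - 1)) * \<beta> = \<beta> ^ i * \<beta> ^ (2 * N)"
    using N power_Suc2[of \<beta> "i + (2 * N - 1)"] by (simp add: power_add[symmetric] del: power_Suc)
  then have "\<beta> ^ (i + (2 * N - 1)) * \<beta> = \<beta> ^ i" by (simp only: \<beta>_2N mult_1_right)
  then show ?thesis by (rule nonzero_eq_divide_eq[OF nz(2), THEN iffD2])
qed

end

locale suzuki_vector = suzuki_module N n \<mu> lam \<beta> c for N n :: nat and \<mu> lam \<beta> c :: "'k::field" +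
  fixes s :: nat and \<epsilon> :: 'k
  assumes s: "s \<ge> 1" and eps: "\<epsilon> * \<epsilon> = 1"
begin

definition "q = \<epsilon> * \<beta> ^ s"
definition "w1 = tens v1 (HH s 0 \<epsilon>)"
definition "w2 = ac S w1"
definition "w3 = ac T w2"
definition "w4 = ac S w3"

abbreviation "s1 \<equiv> s + (2 * N - 1)"

lemma eps_nz: "\<epsilon> \<noteq> 0" "1 / \<epsilon> = \<epsilon>"
proof -
  show "\<epsilon> \<noteq> 0" using eps by auto
  then show "1 / \<epsilon> = \<epsilon>" using eps by (simp add: field_simps)
qed

lemma q_nz: "q \<noteq> 0" using eps_nz nz by (simp add: q_def)

lemma s1: "s1 \<ge> 1" using s by simp

lemma br_w1: "cb w1 y \<cong> fscale q (tens y w1)"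
  using br_HH(1)[OF s eps_nz(1), of v1 0 y] by (simp add: act_1 eps_nz w1_def q_def flip: HH_0)

lemma w2_eq: "w2 \<simeq> tens v2 (HH' s1 1 (c * \<epsilon>))"
  unfolding w2_def w1_def ac_S using Fo_HH[OF s, of c 0 \<epsilon>] by (intro eqU_tens) simp

lemma T_w1: "ac T w1 \<simeq> fscale c (tens v2 (HH s1 1 (\<epsilon> / c)))"
  unfolding w1_def ac_T HH_0 using Go_HH[OF s, of "1 / c" 0 \<epsilon>] by (intro eqU_tens eqU_scale) simp

lemma w3_eq: "w3 \<simeq> fscale (\<beta> / c) (tens v1 (HH (s1 + (2 * N - 1)) 2 (c ^ 2 * \<epsilon>)))"
proof -
  have "w3 \<simeq> ac T (tens v2 (HH' s1 1 (c * \<epsilon>)))" unfolding w3_def by (rule eqU_ac[OF w2_eq])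
  also have "\<dots> \<simeq> fscale (\<beta> / c) (tens v1 (HH (s1 + (2 * N - 1)) 2 (c ^ 2 * \<epsilon>)))"
    unfolding ac_T using Go_HH[OF s1, of c 1 "c * \<epsilon>"]
    by (intro eqU_tens eqU_scale) (simp add: power2_eq_square mult.assoc numeral_2_eq_2)
  finally show ?thesis .
qed

lemma coef_w1: "coef w1 = fscale q v1"
  using s by (simp add: w1_def coef_HH q_def)

subsection \<open>The case \<open>n = 1\<close>\<close>

context
  assumes n1: "n = 1"
begin

lemma c_sq: "c ^ 2 = lam" using c_pow n1 by simp

lemma lam_div: "lam / c = c" "lam * (\<epsilon> / c) = c * \<epsilon>"
proof -
  show "lam / c = c" using c_sq nz by (simp add: field_simps power2_eq_square)
  then show "lam * (\<epsilon> / c) = c * \<epsilon>" by (metis times_divide_eq_left times_divide_eq_right mult.commute)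
qed

lemma w2_eq': "w2 \<simeq> tens v2 (HH s1 1 (\<epsilon> / c))"
proof -
  have "tens v2 (HH s1 1 (\<epsilon> / c)) \<simeq> tens v2 (HH' s1 1 (c * \<epsilon>))"
  proof (rule eqU_tens)
    have "HH s1 k (\<epsilon> / c) \<sim> HH' s1 k (lam * (\<epsilon> / c))" if "k = n" for k
      unfolding that by (rule HH_n)
    from this[OF n1[symmetric]] show "HH s1 1 (\<epsilon> / c) \<sim> HH' s1 1 (c * \<epsilon>)"
      by (simp only: lam_div)
  qed
  then show ?thesis using w2_eq eqU_sym eqU_trans by blast
qed

lemma n1_T: "ac T w1 \<simeq> fscale c w2" "ac T w2 \<simeq> fscale (\<beta> / c) w1"
proof -
  show "ac T w1 \<simeq> fscale c w2"
    using T_w1 eqU_scale[OF eqU_sym[OF w2_eq'], of c] by (rule eqU_trans)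
  have "HH (s1 + (2 * N - 1)) 2 (c ^ 2 * \<epsilon>) \<sim> HH (s1 + (2 * N - 1) + 2) 0 (lam * (c ^ 2 * \<epsilon>))"
    using HH_2n[of "s1 + (2 * N - 1)" "c ^ 2 * \<epsilon>"] by (simp add: n1)
  \<comment> \<open>Two shifts by 2N - 1 together with the 2 = 2n from \<open>HH_2n\<close> are
    exactly two periods of length 2N.\<close>
  also have "s1 + (2 * N - 1) + 2 = s + 2 * N * 2" using N by simp
  also have "lam * (c ^ 2 * \<epsilon>) = \<epsilon>" using lam by (simp add: c_sq flip: mult.assoc)
  also have "HH (s + 2 * N * 2) 0 \<epsilon> \<sim> HH s 0 \<epsilon>" by (rule HH_period(1)[OF s])
  finally have "HH (s1 + (2 * N - 1)) 2 (c ^ 2 * \<epsilon>) \<sim> HH s 0 \<epsilon>" .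
  then have "fscale (\<beta> / c) (tens v1 (HH (s1 + (2 * N - 1)) 2 (c ^ 2 * \<epsilon>))) \<simeq> fscale (\<beta> / c) w1"
    unfolding w1_def by (intro eqU_scale eqU_tens)
  then show "ac T w2 \<simeq> fscale (\<beta> / c) w1"
    using w3_eq unfolding w3_def by (blast intro: eqU_trans)
qed

lemma n1_ST: "ac (S * T) w1 \<simeq> fscale (\<beta> * c) w1" "ac (S * T) w2 \<simeq> fscale (\<beta> / c) w2"
proof -
  have "ac (S * T) w1 \<simeq> fscale c (ac S w2)" using eqU_ac[OF n1_T(1), of S] by (simp add: act_mult ac_simps)
  also have "\<dots> \<simeq> fscale c (fscale \<beta> w1)" unfolding w2_def by (intro eqU_scale ac_SS)
  finally show "ac (S * T) w1 \<simeq> fscale (\<beta> * c) w1" by (simp add: mult.commute)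
  show "ac (S * T) w2 \<simeq> fscale (\<beta> / c) w2"
    using eqU_ac[OF n1_T(2), of S] by (simp add: act_mult ac_simps w2_def)
qed

lemma br_w2: "cb w2 y \<cong> fscale (q * c / \<beta>) (tens (ac (S * T) y) w2)"
proof -
  have d: "c * \<epsilon> \<noteq> 0" "1 / (c * \<epsilon>) = \<epsilon> / c" using eps_nz nz eps by (simp_all add: field_simps)
  have "cb w2 y \<cong> cb (tens v2 (HH' s1 1 (c * \<epsilon>))) y" by (rule eq2_cb[OF w2_eq])
  also have "\<dots> \<cong> fscale (c * \<epsilon> * \<beta> ^ s1) (tens (ac ((S * T) ^ 1) y) (tens v2 (HH s1 1 (1 / (c * \<epsilon>)))))"
    by (rule br_HH(2)[OF s1 d(1)])
  also have "\<dots> \<cong> fscale (c * \<epsilon> * \<beta> ^ s1) (tens (ac ((S * T) ^ 1) y) w2)"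
    unfolding d(2) by (intro eq2_scale eq2_tens eqU_refl eqU_sym[OF w2_eq'])
  also have "c * \<epsilon> * \<beta> ^ s1 = q * c / \<beta>" unfolding \<beta>_shift q_def by simp
  finally show ?thesis by simp
qed

text \<open>\<open>w2\<close> braids through x_12 x_21, whose eigenvalues are \<beta> c on
  \<open>w1\<close> and \<beta> / c on \<open>w2\<close>. With c^2 = \<lambda> this makes the edge
  \<lambda> q^2.\<close>

definition "Q1 = (\<lambda>i j. if i = I2 \<and> j = I1 then lam * q else q)"
definition "vec1 = (\<lambda>i. if i = I1 then w1 else w2)"
definition "ret1 x = lext (\<lambda>i. fscale (if i = I1 then 1 / q else 1 / (lam * q)) (bas i)) (coef x)"

lemma coef_w2: "coef w2 = fscale (lam * q) v2"
proof -
  have "c * \<epsilon> * \<beta> ^ s1 * (\<beta> * c) ^ 1 = lam * q"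
    unfolding \<beta>_shift q_def c_sq[symmetric] using nz by (simp add: power2_eq_square)
  then show ?thesis using coef_eqU[OF w2_eq] coef_HH(2)[OF s1, of v2 1 "c * \<epsilon>"] by simp
qed

lemma braided_basis_1: "w1 \<in> W \<Longrightarrow> w2 \<in> W \<Longrightarrow> braided_basis Q1 br U W vec1 ret1"
proof unfold_locales
  fix i j
  show "cb (vec1 i) (vec1 j) - fscale (Q1 i j) (tens (vec1 j) (vec1 i)) \<in> null2 U"
  proof (cases i)
    case I1
    then show ?thesis using br_w1[of "vec1 j"] by (simp add: vec1_def Q1_def eq2_def)
  next
    case I2
    have "cb w2 (vec1 j) \<cong> fscale (q * c / \<beta>) (tens (fscale (if j = I1 then \<beta> * c else \<beta> / c) (vec1 j)) w2)"
      using n1_ST by (intro eq2_trans[OF br_w2] eq2_scale eq2_tens) (auto simp: vec1_def)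
    also have "\<dots> = fscale (Q1 I2 j) (tens (vec1 j) w2)"
    proof -
      have "q * c / \<beta> * (\<beta> * c) = q * c ^ 2" "q * c / \<beta> * (\<beta> / c) = q"
        using nz by (simp_all add: power2_eq_square)
      then show ?thesis by (simp add: tens_simps Q1_def c_sq mult.commute)
    qed
    finally show ?thesis using I2 by (simp add: eq2_def vec1_def)
  qed
next
  show "lin ret1" unfolding ret1_def[abs_def] by (intro lin_lext_comp lin_coef)
  show "ret1 u = 0" if "u \<in> U" for u using that by (simp add: ret1_def coef_U lin_0[OF lin_lext])
  show "ret1 (vec1 i) = bas i" for i
    using q_nz nz by (cases i) (simp_all add: ret1_def vec1_def coef_w1 coef_w2 lin_scale[OF lin_lext])
qed (auto simp: br_null2 vec1_def)

end

end

locale suzuki_vector2 = suzuki_vector N n \<mu> lam \<beta> c s \<epsilon>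
  for N n :: nat and \<mu> lam \<beta> c :: "'k::field" and s \<epsilon> +
  fixes \<iota> :: 'k
  assumes n2: "n = 2" and \<iota>: "\<iota> * \<iota> = - 1" and two: "(2 :: 'k) \<noteq> 0"
begin

lemma c4: "c ^ 4 = lam" using c_pow n2 by simp

lemma \<iota>_nz: "\<iota> \<noteq> 0" "1 / \<iota> = - \<iota>"
proof -
  show "\<iota> \<noteq> 0" using \<iota> by auto
  then show "1 / \<iota> = - \<iota>" using \<iota> by (simp add: field_simps)
qed

text \<open>
  The module with \<open>c\<close> replaced by \<open>\<iota> c\<close> provides a second functional, which is needed to separate
  \<open>w\<^sub>1\<close> from \<open>w\<^sub>3\<close> and \<open>w\<^sub>2\<close> from \<open>w\<^sub>4\<close>.
\<close>

definition "coefM = suzuki_module.coef \<beta> (\<iota> * c)"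

lemma coefM: "lin coefM" "x \<simeq> y \<Longrightarrow> coefM x = coefM y" "x \<in> U \<Longrightarrow> coefM x = 0"
  "i \<ge> 1 \<Longrightarrow> coefM (tens l (HH i k d)) = fscale (d * \<beta> ^ i * (\<beta> / (\<iota> * c)) ^ k) l"
  "i \<ge> 1 \<Longrightarrow> coefM (tens l (HH' i k d)) = fscale (d * \<beta> ^ i * (\<beta> * (\<iota> * c)) ^ k) l"
proof -
  interpret M: suzuki_module N n \<mu> lam \<beta> "\<iota> * c"
  proof unfold_locales
    have "\<iota> ^ 4 = (\<iota> * \<iota>) * (\<iota> * \<iota>)" by (simp add: power4_eq_xxxx mult.assoc)
    then have "\<iota> ^ 4 = 1" by (simp add: \<iota>)
    then show "(\<iota> * c) ^ (2 * n) = lam" using c4 by (simp add: n2 power_mult_distrib)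
  qed (rule \<beta>_pow)
  show "lin coefM" unfolding coefM_def by (rule M.lin_coef)
  show "eqU x y \<Longrightarrow> coefM x = coefM y" unfolding coefM_def by (rule M.coef_eqU)
  show "x \<in> U \<Longrightarrow> coefM x = 0" unfolding coefM_def by (rule M.coef_U)
  show "i \<ge> 1 \<Longrightarrow> coefM (tens l (HH i k d)) = fscale (d * \<beta> ^ i * (\<beta> / (\<iota> * c)) ^ k) l"
    unfolding coefM_def by (rule M.coef_HH)
  show "i \<ge> 1 \<Longrightarrow> coefM (tens l (HH' i k d)) = fscale (d * \<beta> ^ i * (\<beta> * (\<iota> * c)) ^ k) l"
    unfolding coefM_def by (rule M.coef_HH)
qed

abbreviation "s2 \<equiv> s1 + (2 * N - 1)"
abbreviation "s3 \<equiv> s2 + (2 * N - 1)"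

text \<open>With this scaling x_12 x_21 and x_21 x_12 swap \<open>w1\<close> with \<open>A2\<close>,
  and \<open>w2\<close> with \<open>B2\<close>, by the same scalar in both directions.\<close>

definition "A2 = fscale (c / \<beta>) w3"
definition "B2 = fscale (c / \<beta>) w4"

lemma s23: "s2 \<ge> 1" "s3 \<ge> 1" using s by simp_all

lemma w34: "w3 = fscale (\<beta> / c) A2" "w4 = fscale (\<beta> / c) B2"
  using nz by (simp_all add: A2_def B2_def)

lemma A2_eq: "A2 \<simeq> tens v1 (HH s2 2 (c ^ 2 * \<epsilon>))"
  using eqU_scale[OF w3_eq, of "c / \<beta>"] nz by (simp add: A2_def)

text \<open>\<open>br_HH\<close> returns the primed form with the inverse coefficient. That this is
  \<open>A2\<close> again rests on c^8 = \<lambda>^2 = 1.\<close>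

lemma A2_eq': "A2 \<simeq> tens v1 (HH' s2 2 (1 / (c ^ 2 * \<epsilon>)))"
proof -
  have "c ^ 4 * (c ^ 2 * \<epsilon>) = 1 / (c ^ 2 * \<epsilon>)"
  proof -
    have "(c ^ 4 * (c ^ 2 * \<epsilon>)) * (c ^ 2 * \<epsilon>) = c ^ 4 * (c ^ 2 * c ^ 2) * (\<epsilon> * \<epsilon>)" by (simp only: mult_ac)
    also have "c ^ 2 * c ^ 2 = c ^ 4" by (simp add: power_add[symmetric])
    also have "c ^ 4 * c ^ 4 * (\<epsilon> * \<epsilon>) = 1" by (simp add: c4 lam eps)
    finally show ?thesis using eps_nz nz by (simp add: eq_divide_eq)
  qed
  moreover have "HH s2 2 (c ^ 2 * \<epsilon>) \<sim> HH' s2 2 (lam * (c ^ 2 * \<epsilon>))"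
    using HH_n[of s2 "c ^ 2 * \<epsilon>"] by (simp only: n2)
  ultimately show ?thesis
    using eqU_trans[OF A2_eq eqU_tens] by (simp only: c4)
qed

lemma w4_eq: "B2 \<simeq> tens v2 (HH' s3 3 (c ^ 3 * \<epsilon>))"
proof -
  have "B2 = fscale (c / \<beta>) (ac S w3)" by (simp add: B2_def w4_def)
  also have "\<dots> \<simeq> fscale (c / \<beta>) (ac S (fscale (\<beta> / c) (tens v1 (HH s2 2 (c ^ 2 * \<epsilon>)))))"
    by (intro eqU_scale eqU_ac w3_eq)
  also have "\<dots> = tens v2 (Fo c (HH s2 2 (c ^ 2 * \<epsilon>)))"
    using nz by (simp add: ac_simps ac_S)
  also have "\<dots> \<simeq> tens v2 (HH' s3 3 (c ^ 3 * \<epsilon>))"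
    using Fo_HH[OF s23(1), of c 2 "c ^ 2 * \<epsilon>"]
    by (intro eqU_tens) (simp add: power3_eq_cube power2_eq_square mult.assoc numeral_3_eq_3 numeral_2_eq_2)
  finally show ?thesis .
qed

text \<open>An alternating product of 2n + 2 = 6 factors shortens to one of two factors. The
  shortened form is what the braiding of \<open>w2\<close> produces, so braiding interchanges
  \<open>w2\<close> and \<open>B2\<close> up to scalars.\<close>

lemma B2_eq: "B2 \<simeq> tens v2 (HH s1 1 (\<epsilon> / c))"
proof -
  have "lam * (c ^ 3 * \<epsilon>) = \<epsilon> / c"
  proof -
    have "lam * (c ^ 3 * \<epsilon>) * c = lam * c ^ 4 * \<epsilon>" by (simp add: power4_eq_xxxx power3_eq_cube mult_ac)
    then show ?thesis using nz by (simp add: c4 lam eq_divide_eq)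
  qed
  note l = this
  have "HH' s3 3 (c ^ 3 * \<epsilon>) \<sim> HH (s3 + 2) 1 (lam * (c ^ 3 * \<epsilon>))"
    using HH'_Suc_n[of s3 "c ^ 3 * \<epsilon>"] by (simp add: n2 numeral_3_eq_3 numeral_2_eq_2)
  also have "s3 + 2 = s1 + 2 * N * 2" using N by simp
  also have "HH (s1 + 2 * N * 2) 1 (lam * (c ^ 3 * \<epsilon>)) \<sim> HH s1 1 (\<epsilon> / c)"
    unfolding l by (rule HH_period(1)[OF s1])
  finally have "HH' s3 3 (c ^ 3 * \<epsilon>) \<sim> HH s1 1 (\<epsilon> / c)" .
  then show ?thesis by (rule eqU_trans[OF w4_eq eqU_tens])
qed

lemma T_B2: "ac T B2 \<simeq> fscale (\<beta> / c) w1"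
proof -
  let ?s4 = "s3 + (2 * N - 1)"
  have "ac T B2 \<simeq> ac T (tens v2 (HH' s3 3 (c ^ 3 * \<epsilon>)))" by (rule eqU_ac[OF w4_eq])
  also have "\<dots> \<simeq> fscale (\<beta> / c) (tens v1 (HH ?s4 4 (c ^ 4 * \<epsilon>)))"
    unfolding ac_T using Go_HH[OF s23(2), of c 3 "c ^ 3 * \<epsilon>"]
    by (intro eqU_scale eqU_tens) (simp add: power4_eq_xxxx power3_eq_cube mult.assoc eval_nat_numeral)
  also have "\<dots> \<simeq> fscale (\<beta> / c) (tens v1 (HH s 0 \<epsilon>))"
  proof (intro eqU_scale eqU_tens)
    have "HH ?s4 4 (c ^ 4 * \<epsilon>) \<sim> HH (?s4 + 4) 0 (lam * (c ^ 4 * \<epsilon>))"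
      using HH_2n[of ?s4 "c ^ 4 * \<epsilon>"] by (simp add: n2)
    also have "?s4 + 4 = s + 2 * N * 4" using N by simp
    also have "lam * (c ^ 4 * \<epsilon>) = \<epsilon>" using lam by (simp add: c4 flip: mult.assoc)
    also have "HH (s + 2 * N * 4) 0 \<epsilon> \<sim> HH s 0 \<epsilon>" by (rule HH_period(1)[OF s])
    finally show "HH ?s4 4 (c ^ 4 * \<epsilon>) \<sim> HH s 0 \<epsilon>" .
  qed
  finally show ?thesis by (simp add: w1_def)
qed

lemma T_A1: "ac T w1 \<simeq> fscale c B2"
  using eqU_trans[OF T_w1 eqU_scale[OF eqU_sym[OF B2_eq]]] .

lemma S_A2: "ac S A2 = B2" by (simp add: A2_def B2_def ac_simps w4_def)

lemma T_A2: "ac T A2 \<simeq> fscale c w2"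
proof -
  have "ac T A2 = fscale (c / \<beta>) (ac T (ac T w2))" by (simp add: A2_def ac_simps w3_def)
  also have "\<dots> \<simeq> fscale (c / \<beta>) (fscale \<beta> w2)" by (intro eqU_scale ac_TT)
  finally show ?thesis using nz by simp
qed

lemma S_B1: "ac S w2 \<simeq> fscale \<beta> w1" unfolding w2_def by (rule ac_SS)

lemma T_B1: "ac T w2 = fscale (\<beta> / c) A2" by (simp add: w34(1)[symmetric] w3_def)

lemma S_B2: "ac S B2 \<simeq> fscale \<beta> A2"
proof -
  have "ac S B2 = fscale (c / \<beta>) (ac S (ac S w3))" by (simp add: B2_def w4_def ac_simps)
  also have "\<dots> \<simeq> fscale (c / \<beta>) (fscale \<beta> w3)" by (intro eqU_scale ac_SS)
  finally show ?thesis using nz by (simp add: w34(1))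
qed

lemma br_A2: "cb A2 y \<cong> fscale (q * c ^ 2 / \<beta> ^ 2) (tens (ac ((T * S) ^ 2) y) A2)"
proof -
  have "cb A2 y \<cong> cb (tens v1 (HH s2 2 (c ^ 2 * \<epsilon>))) y" by (rule eq2_cb[OF A2_eq])
  also have "\<dots> \<cong> fscale (c ^ 2 * \<epsilon> * \<beta> ^ s2)
      (tens (ac ((T * S) ^ 2) y) (tens v1 (HH' s2 2 (1 / (c ^ 2 * \<epsilon>)))))"
    using eps_nz nz by (intro br_HH(1) s23) simp
  also have "\<dots> \<cong> fscale (c ^ 2 * \<epsilon> * \<beta> ^ s2) (tens (ac ((T * S) ^ 2) y) A2)"
    by (intro eq2_scale eq2_tens eqU_refl eqU_sym[OF A2_eq'])
  also have "c ^ 2 * \<epsilon> * \<beta> ^ s2 = q * c ^ 2 / \<beta> ^ 2"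
    unfolding \<beta>_shift q_def by (simp add: power2_eq_square)
  finally show ?thesis .
qed

lemma br_B1: "cb w2 y \<cong> fscale (q * c / \<beta>) (tens (ac (S * T) y) B2)"
proof -
  have d: "c * \<epsilon> \<noteq> 0" "1 / (c * \<epsilon>) = \<epsilon> / c" using eps_nz nz eps by (simp_all add: field_simps)
  have "cb w2 y \<cong> cb (tens v2 (HH' s1 1 (c * \<epsilon>))) y" by (rule eq2_cb[OF w2_eq])
  also have "\<dots> \<cong> fscale (c * \<epsilon> * \<beta> ^ s1) (tens (ac ((S * T) ^ 1) y) (tens v2 (HH s1 1 (1 / (c * \<epsilon>)))))"
    by (rule br_HH(2)[OF s1 d(1)])
  also have "\<dots> \<cong> fscale (c * \<epsilon> * \<beta> ^ s1) (tens (ac ((S * T) ^ 1) y) B2)"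
    unfolding d(2) by (intro eq2_scale eq2_tens eqU_refl eqU_sym[OF B2_eq])
  also have "c * \<epsilon> * \<beta> ^ s1 = q * c / \<beta>" unfolding \<beta>_shift q_def by simp
  finally show ?thesis by simp
qed

lemma br_B2: "cb B2 y \<cong> fscale (q / (c * \<beta>)) (tens (ac (T * S) y) w2)"
proof -
  have d: "\<epsilon> / c \<noteq> 0" "1 / (\<epsilon> / c) = c * \<epsilon>" using eps_nz nz eps by (simp_all add: field_simps)
  have "cb B2 y \<cong> cb (tens v2 (HH s1 1 (\<epsilon> / c))) y" by (rule eq2_cb[OF B2_eq])
  also have "\<dots> \<cong> fscale (\<epsilon> / c * \<beta> ^ s1) (tens (ac ((T * S) ^ 1) y) (tens v2 (HH' s1 1 (1 / (\<epsilon> / c)))))"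
    by (rule br_HH(1)[OF s1 d(1)])
  also have "\<dots> \<cong> fscale (\<epsilon> / c * \<beta> ^ s1) (tens (ac ((T * S) ^ 1) y) w2)"
    unfolding d(2) by (intro eq2_scale eq2_tens eqU_refl eqU_sym[OF w2_eq])
  also have "\<epsilon> / c * \<beta> ^ s1 = q / (c * \<beta>)" unfolding \<beta>_shift q_def by simp
  finally show ?thesis by simp
qed

text \<open>
  The braiding acts through \<open>x\<^sub>1\<^sub>2 x\<^sub>2\<^sub>1\<close> and \<open>x\<^sub>2\<^sub>1 x\<^sub>1\<^sub>2\<close>, which swap \<open>w\<^sub>1\<close> with \<open>A2\<close> and \<open>w\<^sub>2\<close> with \<open>B2\<close> up to
  scalars; their eigenvectors diagonalize it.
\<close>

fun sgi :: "ind \<Rightarrow> 'k" where "sgi I1 = 1" | "sgi I2 = - 1"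

lemma sgi_sq: "sgi i * sgi i = 1" by (cases i) simp_all

definition "vA i = w1 + fscale (sgi i) A2"
definition "vB i = w2 + fscale (sgi i) B2"

lemma swap_eigen:
  assumes "ac h x \<simeq> fscale a y" "ac h y \<simeq> fscale a x"
  shows "ac h (x + fscale (sgi i) y) \<simeq> fscale (a * sgi i) (x + fscale (sgi i) y)"
proof -
  have "ac h (x + fscale (sgi i) y) \<simeq> fscale a y + fscale (sgi i) (fscale a x)"
    unfolding ac_simps by (intro eqU_add eqU_scale assms)
  also have "\<dots> = fscale (a * sgi i) (x + fscale (sgi i) y)"
    by (simp add: fv.scale_right_distrib mult.assoc sgi_sq mult.commute add.commute)
  finally show ?thesis .
qed

lemma ST_vA: "ac (S * T) (vA i) \<simeq> fscale (\<beta> * c * sgi i) (vA i)"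
proof -
  have "ac (S * T) w1 \<simeq> fscale c (ac S B2)" using eqU_ac[OF T_A1, of S] by (simp add: act_mult ac_simps)
  also have "\<dots> \<simeq> fscale c (fscale \<beta> A2)" by (intro eqU_scale S_B2)
  finally have 1: "ac (S * T) w1 \<simeq> fscale (\<beta> * c) A2" by (simp add: mult.commute)
  have "ac (S * T) A2 \<simeq> fscale c (ac S w2)" using eqU_ac[OF T_A2, of S] by (simp add: act_mult ac_simps)
  also have "\<dots> \<simeq> fscale c (fscale \<beta> w1)" by (intro eqU_scale S_B1)
  finally have 2: "ac (S * T) A2 \<simeq> fscale (\<beta> * c) w1" by (simp add: mult.commute)
  show ?thesis unfolding vA_def by (rule swap_eigen[OF 1 2])
qed

lemma TS_vA: "ac (T * S) (vA i) \<simeq> fscale (\<beta> / c * sgi i) (vA i)"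
proof -
  have 1: "ac (T * S) w1 \<simeq> fscale (\<beta> / c) A2" by (simp add: act_mult T_B1 flip: w2_def)
  have 2: "ac (T * S) A2 \<simeq> fscale (\<beta> / c) w1" by (simp add: act_mult S_A2 T_B2)
  show ?thesis unfolding vA_def by (rule swap_eigen[OF 1 2])
qed

lemma ST_vB: "ac (S * T) (vB i) \<simeq> fscale (\<beta> / c * sgi i) (vB i)"
proof -
  have 1: "ac (S * T) w2 \<simeq> fscale (\<beta> / c) B2" by (simp add: act_mult T_B1 ac_simps S_A2)
  have 2: "ac (S * T) B2 \<simeq> fscale (\<beta> / c) w2"
    using eqU_ac[OF T_B2, of S] by (simp add: act_mult ac_simps flip: w2_def)
  show ?thesis unfolding vB_def by (rule swap_eigen[OF 1 2])
qed

lemma TS_vB: "ac (T * S) (vB i) \<simeq> fscale (\<beta> * c * sgi i) (vB i)"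
proof -
  have "ac (T * S) w2 \<simeq> fscale \<beta> (ac T w1)" using eqU_ac[OF S_B1, of T] by (simp add: act_mult ac_simps)
  also have "\<dots> \<simeq> fscale \<beta> (fscale c B2)" by (intro eqU_scale T_A1)
  finally have 1: "ac (T * S) w2 \<simeq> fscale (\<beta> * c) B2" by simp
  have "ac (T * S) B2 \<simeq> fscale \<beta> (ac T A2)" using eqU_ac[OF S_B2, of T] by (simp add: act_mult ac_simps)
  also have "\<dots> \<simeq> fscale \<beta> (fscale c w2)" by (intro eqU_scale T_A2)
  finally have 2: "ac (T * S) B2 \<simeq> fscale (\<beta> * c) w2" by simp
  show ?thesis unfolding vB_def by (rule swap_eigen[OF 1 2])
qed

lemma eigen_sq:
  assumes "ac h x \<simeq> fscale (a * sgi i) x"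
  shows "ac (h ^ 2) x \<simeq> fscale (a ^ 2) x"
proof -
  have "ac (h ^ 2) x \<simeq> fscale (a * sgi i) (ac h x)"
    using eqU_ac[OF assms, of h] by (simp add: act_mult power2_eq_square ac_simps)
  also have "\<dots> \<simeq> fscale (a * sgi i) (fscale (a * sgi i) x)" by (intro eqU_scale assms)
  also have "\<dots> = fscale (a ^ 2 * (sgi i * sgi i)) x" by (simp add: power2_eq_square mult_ac)
  finally show ?thesis by (simp add: sgi_sq)
qed

text \<open>\<open>vA j\<close> satisfies the hypothesis for every \<lambda>, whereas for
  \<open>vB j\<close> the eigenvalue is (\<beta> c)^2, which agrees only if c^4 = 1. This is where
  \<lambda> = 1 enters.\<close>

lemma br_vA:
  assumes "ac ((T * S) ^ 2) y \<simeq> fscale (\<beta> ^ 2 / c ^ 2) y"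
  shows "cb (vA i) y \<cong> fscale q (tens y (vA i))"
proof -
  have "cb (vA i) y = cb w1 y + fscale (sgi i) (cb A2 y)"
    by (simp add: vA_def tens_simps lin_add[OF lin_lext] lin_scale[OF lin_lext])
  also have "\<dots> \<cong> fscale q (tens y w1)
      + fscale (sgi i) (fscale (q * c ^ 2 / \<beta> ^ 2) (tens (fscale (\<beta> ^ 2 / c ^ 2) y) A2))"
    by (intro eq2_add eq2_scale br_w1 eq2_trans[OF br_A2] eq2_tens assms eqU_refl)
  also have "\<dots> = fscale q (tens y (vA i))"
    using nz by (simp add: vA_def tens_simps fv.scale_right_distrib mult.commute)
  finally show ?thesis .
qed

text \<open>Because \<open>w2\<close> and \<open>B2\<close> are interchanged, \<open>vB i\<close>
  comes back only if the eigenvalues a and b are the same multiple t of \<beta> / c and of c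
  \<beta>.\<close>

lemma br_vB:
  assumes "ac (S * T) y \<simeq> fscale a y" "ac (T * S) y \<simeq> fscale b y" "c * a = t * \<beta>" "b = t * (c * \<beta>)"
  shows "cb (vB i) y \<cong> fscale (q * sgi i * t) (tens y (vB i))"
proof -
  have "cb (vB i) y = cb w2 y + fscale (sgi i) (cb B2 y)"
    by (simp add: vB_def tens_simps lin_add[OF lin_lext] lin_scale[OF lin_lext])
  also have "\<dots> \<cong> fscale (q * c / \<beta>) (tens (fscale a y) B2)
      + fscale (sgi i) (fscale (q / (c * \<beta>)) (tens (fscale b y) w2))"
    by (intro eq2_add eq2_scale eq2_trans[OF br_B1] eq2_trans[OF br_B2] eq2_tens assms eqU_refl)
  also have "\<dots> = fscale (q * (c * a) / \<beta>) (tens y B2) + fscale (sgi i * q * t) (tens y w2)"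
    using nz by (simp add: tens_simps assms(4) mult_ac)
  also have "q * (c * a) / \<beta> = q * t" using nz assms(3) by simp
  also have "fscale (q * t) (tens y B2) + fscale (sgi i * q * t) (tens y w2)
    = fscale (q * sgi i * t) (tens y w2) + fscale (q * (sgi i * sgi i) * t) (tens y B2)"
    by (simp add: sgi_sq mult_ac)
  also have "\<dots> = fscale (q * sgi i * t) (tens y (vB i))"
    by (simp add: vB_def tens_simps fv.scale_right_distrib mult_ac)
  finally show ?thesis .
qed

lemma br_vA_vA: "cb (vA i) (vA j) \<cong> fscale q (tens (vA j) (vA i))"
  by (rule br_vA) (use eigen_sq[OF TS_vA, of j] in \<open>simp add: power_divide\<close>)

lemma coefs: "coef w1 = fscale q v1" "coef A2 = fscale q v1" "coef w2 = fscale (q * c ^ 2) v2" "coef B2 = fscale (q / c ^ 2) v2"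
  "coefM w1 = fscale q v1" "coefM A2 = fscale (- q) v1" "coefM w2 = fscale (\<iota> * q * c ^ 2) v2"
  "coefM B2 = fscale (- \<iota> * q / c ^ 2) v2"
proof -
  have e: "c ^ 2 * \<epsilon> * \<beta> ^ s2 * (\<beta> / x) ^ 2 = q * (c / x) ^ 2" "c * \<epsilon> * \<beta> ^ s1 * (\<beta> * x) ^ 1 = q * c * x"
    "\<epsilon> / c * \<beta> ^ s1 * (\<beta> / x) ^ 1 = q / (c * x)" for x
    unfolding \<beta>_shift q_def using nz by (simp_all add: power2_eq_square)
  show "coef w1 = fscale q v1" by (rule coef_w1)
  show "coef A2 = fscale q v1"
    unfolding coef_eqU[OF A2_eq] coef_HH(1)[OF s23(1)] e using nz by simp
  show "coef w2 = fscale (q * c ^ 2) v2"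
    unfolding coef_eqU[OF w2_eq] coef_HH(2)[OF s1] e by (simp add: power2_eq_square mult.assoc)
  show "coef B2 = fscale (q / c ^ 2) v2"
    unfolding coef_eqU[OF B2_eq] coef_HH(1)[OF s1] e by (simp add: power2_eq_square)
  show "coefM w1 = fscale q v1"
    using s by (simp add: w1_def coefM q_def)
  have i2: "(c / (\<iota> * c)) ^ 2 = - 1"
    using nz \<iota>_nz \<iota> by (simp add: power2_eq_square)
  show "coefM A2 = fscale (- q) v1"
    unfolding coefM(2)[OF A2_eq] coefM(4)[OF s23(1)] e i2 by simp
  show "coefM w2 = fscale (\<iota> * q * c ^ 2) v2"
    unfolding coefM(2)[OF w2_eq] coefM(5)[OF s1] e by (simp add: power2_eq_square mult_ac)
  have "q / (c * (\<iota> * c)) = (1 / \<iota>) * q / c ^ 2" by (simp add: power2_eq_square)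
  then show "coefM B2 = fscale (- \<iota> * q / c ^ 2) v2"
    unfolding coefM(2)[OF B2_eq] coefM(4)[OF s1] e \<iota>_nz(2) by simp
qed

lemma coef_simps: "coef (x + y) = coef x + coef y" "coef (fscale a x) = fscale a (coef x)"
  "coefM (x + y) = coefM x + coefM y" "coefM (fscale a x) = fscale a (coefM x)"
  by (simp_all add: lin_add lin_scale lin_coef coefM(1))

lemma coef_vA: "coef (vA d) = fscale (q * (1 + sgi d)) v1" "coefM (vA d) = fscale (q * (1 - sgi d)) v1"
  by (simp_all add: vA_def coef_simps coefs algebra_simps fv.scale_left_distrib fv.scale_left_diff_distrib)

text \<open>\<open>coef\<close> sees only \<open>vA I1\<close> and \<open>coefM\<close> only
  \<open>vA I2\<close>, each with the scalar 2 q.\<close>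

definition "ret2 x = lext (\<lambda>i. fscale (1 / (2 * q)) (bas I1)) (lext (\<lambda>i. if i = I1 then bas I1 else 0) (coef x))
  + lext (\<lambda>i. fscale (1 / (2 * q)) (bas I2)) (lext (\<lambda>i. if i = I1 then bas I1 else 0) (coefM x))"

lemma braided_basis_2: "range vA \<subseteq> W \<Longrightarrow> braided_basis (\<lambda>_ _. q) br U W vA ret2"
proof unfold_locales
  show "cb (vA i) (vA j) - fscale q (tens (vA j) (vA i)) \<in> null2 U" for i j
    using br_vA_vA by (simp add: eq2_def)
  show "lin ret2" unfolding ret2_def[abs_def] by (intro lin_plus lin_lext_comp lin_coef coefM(1))
  show "ret2 u = 0" if "u \<in> U" for u
    using that by (simp add: ret2_def coef_U coefM(3) lin_0[OF lin_lext])
  show "ret2 (vA i) = bas i" for i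
    using q_nz two
    by (cases i) (simp_all add: ret2_def coef_vA lin_scale[OF lin_lext] lin_0[OF lin_lext])
qed (auto simp: br_null2)

context
  assumes lam1: "lam = 1"
begin

definition "vec4 ti = (if fst ti = I1 then vA (snd ti) else vB (snd ti))"
definition "Q4 x y = (if fst x = I1 then q else q * sgi (snd x) * (sgi (snd y) * (if fst y = I1 then c ^ 2 else 1)))"

lemma c2: "c ^ 2 * c ^ 2 = 1" "1 / c ^ 2 = c ^ 2"
proof -
  show "c ^ 2 * c ^ 2 = 1" using c4 by (simp add: lam1 power_add[symmetric])
  then show "1 / c ^ 2 = c ^ 2" using nz by (simp add: field_simps)
qed

lemma br_vec4: "cb (vec4 x) (vec4 y) \<cong> fscale (Q4 x y) (tens (vec4 y) (vec4 x))"
proof -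
  have b: "\<beta> / c = c ^ 2 * (c * \<beta>)" "\<beta> / c = c ^ 2 * \<beta> * c" "\<beta> * c = 1 * (c * \<beta>)" "c * (\<beta> / c) = 1 * \<beta>" "c * (\<beta> * c) = c ^ 2 * \<beta>"
    using c4 nz by (simp_all add: lam1 field_simps power2_eq_square power4_eq_xxxx)
  obtain t i t' i' where xy: "x = (t, i)" "y = (t', i')" by force
  consider "t = I1" "t' = I1" | "t = I1" "t' = I2" | "t = I2" "t' = I1" | "t = I2" "t' = I2"
    by (cases t; cases t') auto
  then show ?thesis
  proof cases
    case 1
    then show ?thesis using br_vA_vA by (simp add: xy vec4_def Q4_def)
  next
    case 2
    have "(\<beta> * c) ^ 2 = \<beta> ^ 2 / c ^ 2" using c2(2) by (simp add: power_mult_distrib divide_inverse)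
    then show ?thesis using 2 br_vA[of "vB i'" i] eigen_sq[OF TS_vB, of i'] by (simp add: xy vec4_def Q4_def)
  next
    case 3
    have "cb (vB i) (vA i') \<cong> fscale (q * sgi i * (sgi i' * c ^ 2)) (tens (vA i') (vB i))"
      by (rule br_vB[OF ST_vA TS_vA]) (simp_all only: b(1) mult.assoc[symmetric] mult.commute[of "sgi i'"], simp_all add: power2_eq_square mult_ac)
    then show ?thesis using 3 by (simp add: xy vec4_def Q4_def)
  next
    case 4
    have "cb (vB i) (vB i') \<cong> fscale (q * sgi i * sgi i') (tens (vB i') (vB i))"
      by (rule br_vB[OF ST_vB TS_vB]) (use nz in \<open>simp_all add: mult_ac\<close>)
    then show ?thesis using 4 by (simp add: xy vec4_def Q4_def)
  qed
qed

lemma coef_vB: "coef (vB d) = fscale (q * c ^ 2 * (1 + sgi d)) v2"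
  "coefM (vB d) = fscale (\<iota> * q * c ^ 2 * (1 - sgi d)) v2"
proof -
  have qc: "q / c ^ 2 = q * c ^ 2" "\<iota> * q / c ^ 2 = \<iota> * q * c ^ 2" using c2(2) by (simp_all add: divide_inverse)
  show "coef (vB d) = fscale (q * c ^ 2 * (1 + sgi d)) v2"
    "coefM (vB d) = fscale (\<iota> * q * c ^ 2 * (1 - sgi d)) v2"
    by (simp_all add: vB_def coef_simps coefs qc algebra_simps fv.scale_left_distrib fv.scale_left_diff_distrib)
qed

definition "ret4 x = lext (\<lambda>i. if i = I1 then fscale (1 / (2 * q)) (bas (I1, I1)) else fscale (1 / (2 * q * c ^ 2)) (bas (I2, I1))) (coef x)
  + lext (\<lambda>i. if i = I1 then fscale (1 / (2 * q)) (bas (I1, I2)) else fscale (1 / (2 * \<iota> * q * c ^ 2)) (bas (I2, I2))) (coefM x)"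

lemma braided_basis_4: "range vec4 \<subseteq> W \<Longrightarrow> braided_basis Q4 br U W vec4 ret4"
proof unfold_locales
  show "cb (vec4 i) (vec4 j) - fscale (Q4 i j) (tens (vec4 j) (vec4 i)) \<in> null2 U" for i j
    using br_vec4 by (simp add: eq2_def)
  show "lin ret4" unfolding ret4_def[abs_def] by (intro lin_plus lin_lext_comp lin_coef coefM(1))
  show "ret4 u = 0" if "u \<in> U" for u
    using that by (simp add: ret4_def coef_U coefM(3) lin_0[OF lin_lext])
  show "ret4 (vec4 i) = bas i" for i
  proof -
    obtain t d where i: "i = (t, d)" by force
    show ?thesis
      using q_nz two nz \<iota>_nz(1)
      by (cases t; cases d) (simp_all add: i vec4_def ret4_def coef_vA coef_vB lin_scale[OF lin_lext] lin_0[OF lin_lext])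
  qed
qed (auto simp: br_null2)

end

end

section \<open>The Nichols algebras of the modules\<close>

lemma (in braided_basis) diagonal_braiding:
  assumes W: "W \<subseteq> fv.span (range v)" and e: "bij_betw e {..<d} UNIV" and Q: "\<And>i j. Q i j \<noteq> 0"
    and U: "0 \<in> U"
  shows "diagonal_braiding c W U d (\<lambda>i. v (e i)) (\<lambda>i j. Q (e i) (e j))"
  unfolding diagonal_braiding_def
proof (intro conjI allI impI ballI)
  fix x assume "x \<in> W"
  have "x - lext v (ret x) \<in> {0}"
  proof (rule lin_span_into[where f = "\<lambda>x. x - lext v (ret x)"])
    show "x \<in> fv.span (range v)" using W \<open>x \<in> W\<close> by blast
  qed (auto intro!: lin_intros ret simp: ret(3) fv.subspace_def)
  moreover have "lext v (ret x) = (\<Sum>i\<in>UNIV. fscale (Poly_Mapping.lookup (ret x) i) (v i))"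
    by (rule lext_eq_sum) simp_all
  moreover have "\<dots> = (\<Sum>i<d. fscale (Poly_Mapping.lookup (ret x) (e i)) (v (e i)))"
    using e by (rule sum.reindex_bij_betw[symmetric])
  ultimately have x: "x = (\<Sum>i<d. fscale (Poly_Mapping.lookup (ret x) (e i)) (v (e i)))" by simp
  let ?a = "\<lambda>i. if i < d then Poly_Mapping.lookup (ret x) (e i) else 0"
  show "\<exists>!a. (\<forall>i\<ge>d. a i = 0) \<and> x - (\<Sum>i<d. fscale (a i) (v (e i))) \<in> U"
  proof (rule ex1I[of _ ?a])
    show "(\<forall>i\<ge>d. ?a i = 0) \<and> x - (\<Sum>i<d. fscale (?a i) (v (e i))) \<in> U"
      using x U by simp
    fix a assume a: "(\<forall>i\<ge>d. a i = 0) \<and> x - (\<Sum>i<d. fscale (a i) (v (e i))) \<in> U"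
    then have "ret (x - (\<Sum>i<d. fscale (a i) (v (e i)))) = 0" using ret(2) by blast
    then have r: "ret x = (\<Sum>i<d. fscale (a i) (bas (e i)))"
      by (simp add: lin_diff lin_sum lin_scale ret(1,3))
    have "a i = ?a i" for i
    proof (cases "i < d")
      case True
      have "Poly_Mapping.lookup (ret x) (e i) = (\<Sum>j<d. if j = i then a j else 0)"
        unfolding r lookup_sum using e True
        by (intro sum.cong) (auto simp: lookup_single when_def bij_betw_def inj_on_eq_iff)
      then show ?thesis using True by simp
    qed (use a in auto)
    then show "a = ?a" by blast
  qed
qed (use v_W Q c_v in \<open>auto simp: null2_def\<close>)

lemma geometric_sum_0:
  fixes x :: "'k::field"
  assumes "x ^ K = 1" "x \<noteq> 1"
  shows "(\<Sum>k<K. x ^ k) = 0"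
  using one_diff_power_eq[of x K] assms by simp

context suzuki_vector
begin

lemma lam_pm: "lam = 1 \<or> lam = - 1"
  using lam by (simp add: square_eq_1_iff)

context
  fixes K :: nat
  assumes char0: "\<And>k. of_nat (Suc k) \<noteq> (0 :: 'k)" and root: "q ^ K = 1" "K > 0"
begin

lemma dim_n1:
  assumes n1: "n = 1" and W: "W = fv.span {w1, w2}"
  shows "nichols_dim br W U < \<infinity> \<longleftrightarrow> lam * q ^ 2 = 1 \<and> q \<noteq> 1 \<or> lam * q ^ 3 = 1 \<and> q \<noteq> 1"
    and "lam * q ^ 2 = 1 \<Longrightarrow> cartan_type_A1xA1 br W U"
    and "lam * q ^ 3 = 1 \<Longrightarrow> q \<noteq> 1 \<Longrightarrow> cartan_type_A2 br W U"
proof -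
  have W': "w1 \<in> W" "w2 \<in> W" by (simp_all add: W fv.span_base)
  interpret D: braided_basis Q1 br U W vec1 ret1
    using n1 W' by (rule braided_basis_1)
  have Q: "Q1 I1 I1 = q" "Q1 I2 I2 = q" "Q1 I1 I2 = q" "Q1 I2 I1 = lam * q"
    by (simp_all add: Q1_def[OF n1])
  have Wv: "W \<subseteq> fv.span (range vec1)"
    unfolding W by (intro fv.span_mono) (auto simp: vec1_def[OF n1] image_iff intro: exI[of _ I1] exI[of _ I2])
  have sum0: "(\<Sum>k<K. q ^ k) = 0" if "q \<noteq> 1" using geometric_sum_0[OF root(1) that] .
  have diag: "diagonal_braiding br W U 2 (\<lambda>i. vec1 (if i = 0 then I1 else I2))
      (\<lambda>i j. Q1 (if i = 0 then I1 else I2) (if j = 0 then I1 else I2))"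
  proof (rule D.diagonal_braiding[OF Wv])
    show "bij_betw (\<lambda>i::nat. if i = 0 then I1 else I2) {..<2} UNIV"
      by (auto simp: bij_betw_def inj_on_def UNIV_ind numeral_2_eq_2 lessThan_Suc)
    show "Q1 i j \<noteq> 0" for i j using q_nz nz by (simp add: Q1_def[OF n1])
  qed (rule U_rules(1))
  show "cartan_type_A1xA1 br W U" if "lam * q ^ 2 = 1"
    unfolding cartan_type_A1xA1_def
    by (intro exI conjI, rule diag) (use that in \<open>simp add: Q power2_eq_square mult_ac\<close>)
  show "cartan_type_A2 br W U" if "lam * q ^ 3 = 1" "q \<noteq> 1"
    unfolding cartan_type_A2_def
  proof (intro exI conjI, rule diag)
    have 3: "lam * q ^ 2 * q = 1" using that(1) by (simp add: power3_eq_cube power2_eq_square mult.assoc)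
    then show "Q1 (if (0::nat) = 0 then I1 else I2) (if (1::nat) = 0 then I1 else I2)
        * Q1 (if (1::nat) = 0 then I1 else I2) (if (0::nat) = 0 then I1 else I2) = inverse q"
      using q_nz by (simp add: Q field_simps power2_eq_square)
    show "Q1 (if (0::nat) = 0 then I1 else I2) (if (1::nat) = 0 then I1 else I2)
        * Q1 (if (1::nat) = 0 then I1 else I2) (if (0::nat) = 0 then I1 else I2) \<noteq> 1"
      using 3 that(2) unfolding Q by (auto simp: Q power2_eq_square mult.left_commute[of q lam])
  qed (simp_all add: Q)
  show "nichols_dim br W U < \<infinity> \<longleftrightarrow> lam * q ^ 2 = 1 \<and> q \<noteq> 1 \<or> lam * q ^ 3 = 1 \<and> q \<noteq> 1" (is "?L = ?R")
  proof
    assume ?L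
    show ?R
    proof (rule ccontr)
      assume "\<not> ?R"
      then have "\<exists>w. length w \<ge> m \<and> bas w \<notin> D.nich" for m
        using lam_pm by (intro D.rank2_infinite[of I1 I2 q lam K] char0)
          (auto simp: Q root power2_eq_square mult_ac)
      then have "nichols_dim br W U = \<infinity>" by (rule D.nichols_dim_infinite)
      then show False using \<open>?L\<close> by simp
    qed
  next
    have finite: ?L if "finite B" "D.nspan B = UNIV" for B
      using D.nichols_dim_le[OF Wv that] by (metis enat_ord_simps(4) le_less_trans enat_ord_code(4))
    assume ?R
    then consider "lam * q ^ 2 = 1" "q \<noteq> 1" | "lam * q ^ 3 = 1" "q \<noteq> 1" by blast
    then show ?L
    proof cases
      case 1
      interpret A: A1A1_pair Q1 I1 I2 K
        by unfold_locales (use 1 root sum0 in \<open>auto simp: Q power2_eq_square mult_ac\<close>)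
      show ?L
      proof (rule finite[of A.A1_basis])
        show "D.nspan A.A1_basis = UNIV"
        proof (rule D.UNIV_nspan)
          show "1 \<in> D.nspan A.A1_basis" using A.A1_monomial[of 0 0] by simp
          show "bas [i] * x \<in> D.nspan A.A1_basis" if "x \<in> D.nspan A.A1_basis" for i x
            using that by (rule A.A1_closed) (cases i; simp)
        qed
      qed (simp add: A.A1_basis_def)
    next
      case 2
      interpret A: A2_pair Q1 I1 I2 K
        by unfold_locales (use 2 root sum0 in \<open>auto simp: Q power3_eq_cube mult_ac\<close>)
      show ?L
      proof (rule finite[of A.A2_basis])
        show "D.nspan A.A2_basis = UNIV"
        proof (rule D.UNIV_nspan)
          show "1 \<in> D.nspan A.A2_basis" using A.A2_monomial[of 0 0 0] by simp
          show "bas [i] * x \<in> D.nspan A.A2_basis" if "x \<in> D.nspan A.A2_basis" for i x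
            using that by (rule A.A2_closed) (cases i; simp)
        qed
      qed (simp add: A.A2_basis_def)
    qed
  qed
qed

end

end

context suzuki_vector2
begin

context
  fixes K :: nat
  assumes char0: "\<And>k. of_nat (Suc k) \<noteq> (0 :: 'k)" and root: "q ^ K = 1" "K > 0"
begin

lemma dim_n2:
  assumes W: "W = fv.span {w1, w2, w3, w4}" and fin: "nichols_dim br W U < \<infinity>"
  shows "q = - 1 \<or> q ^ 3 = 1 \<and> q \<noteq> 1"
proof (rule ccontr)
  assume no: "\<not> ?thesis"
  have A2: "A2 \<in> W" unfolding A2_def W by (intro fv.span_scale fv.span_base) simp
  have "range vA \<subseteq> W"
    using A2 unfolding vA_def W by (auto intro!: fv.span_add fv.span_scale intro: fv.span_base)
  then interpret D: braided_basis "\<lambda>_ _. q" br U W vA ret2 by (rule braided_basis_2)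
  have "\<exists>w. length w \<ge> m \<and> bas w \<notin> D.nich" for m
    using no by (intro D.rank2_infinite[of I1 I2 q 1 K] char0)
      (auto simp: root power2_eq_square square_eq_1_iff)
  then show False using D.nichols_dim_infinite fin by simp
qed

lemma dim_n2_lam1:
  assumes W: "W = fv.span {w1, w2, w3, w4}" and lam1: "lam = 1"
  shows "q = - 1 \<Longrightarrow> nichols_dim br W U = 64" and "q \<noteq> - 1 \<Longrightarrow> nichols_dim br W U = \<infinity>"
proof -
  have AB: "A2 \<in> W" "B2 \<in> W" unfolding A2_def B2_def W by (auto intro!: fv.span_scale intro: fv.span_base)
  have vAB: "vA i \<in> W" "vB i \<in> W" for i
    using AB unfolding vA_def vB_def W by (auto intro!: fv.span_add fv.span_scale intro: fv.span_base)
  interpret D: braided_basis Q4 br U W vec4 ret4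
    by (rule braided_basis_4[OF lam1]) (use vAB in \<open>auto simp: vec4_def[OF lam1]\<close>)
  note Q4 = Q4_def[OF lam1]
  have c2: "c ^ 2 = 1 \<or> c ^ 2 = - 1"
    using c2(1)[OF lam1] unfolding square_eq_1_iff .
  have half: "x = fscale (1 / 2) (x + fscale 1 y + (x + fscale (- 1) y))" "y = fscale (1 / 2) (x + fscale 1 y - (x + fscale (- 1) y))"
    for x y :: "ind \<times> word \<Rightarrow>\<^sub>0 'k"
  proof -
    have "x + fscale 1 y + (x + fscale (- 1) y) = fscale 2 x" "x + fscale 1 y - (x + fscale (- 1) y) = fscale 2 y"
      by (rule poly_mapping_eqI, simp add: lookup_add lookup_minus)+
    then show "x = fscale (1 / 2) (x + fscale 1 y + (x + fscale (- 1) y))"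
      "y = fscale (1 / 2) (x + fscale 1 y - (x + fscale (- 1) y))" using two by simp_all
  qed
  have Wv: "W \<subseteq> fv.span (range vec4)"
  proof -
    have "vec4 (I1, i) = vA i" "vec4 (I2, i) = vB i" for i by (simp_all add: vec4_def[OF lam1])
    then have v: "vA i \<in> fv.span (range vec4)" "vB i \<in> fv.span (range vec4)" for i
      by (metis fv.span_base rangeI)+
    have "w1 = fscale (1 / 2) (vA I1 + vA I2)" "A2 = fscale (1 / 2) (vA I1 - vA I2)"
      "w2 = fscale (1 / 2) (vB I1 + vB I2)" "B2 = fscale (1 / 2) (vB I1 - vB I2)"
      unfolding vA_def vB_def sgi.simps by (rule half)+
    then have "w1 \<in> fv.span (range vec4)" "A2 \<in> fv.span (range vec4)" "w2 \<in> fv.span (range vec4)" "B2 \<in> fv.span (range vec4)"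
      by (simp_all only:) (intro fv.span_scale fv.span_add fv.span_diff v)+
    then show ?thesis unfolding W w34 by (intro fv.span_minimal) (auto intro: fv.span_scale)
  qed
  \<comment> \<open>Since c^2 is a sign, \<delta> can be chosen so that \<open>vA I1\<close> and
    \<open>vB \<delta>\<close> have edge - q^2; with the other sign \<delta>' the edge is q^2. For q
    = -1 this separates the two A_2 components.\<close>
  define \<delta> where "\<delta> = (if c ^ 2 = 1 then I2 else I1)"
  define \<delta>' where "\<delta>' = (if c ^ 2 = 1 then I1 else I2)"
  have \<delta>: "sgi \<delta> * c ^ 2 = - 1" "sgi \<delta>' * c ^ 2 = 1" "sgi \<delta>' = - sgi \<delta>"
    using c2 by (auto simp: \<delta>_def \<delta>'_def)
  show "nichols_dim br W U = 64" if q: "q = - 1"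
  proof (rule D.nichols_dim_64[OF _ Wv])
    show "two_blocks Q4 (I1, I1) (I2, \<delta>) (I1, I2) (I2, \<delta>')"
    proof unfold_locales
      show "UNIV = {(I1, I1), (I2, \<delta>), (I1, I2), (I2, \<delta>')}"
        unfolding \<delta>_def \<delta>'_def by (auto, (metis ind.exhaust)+)
      show "distinct [(I1, I1), (I2, \<delta>), (I1, I2), (I2, \<delta>')]" by (auto simp: \<delta>_def \<delta>'_def)
      show "Q4 i i = - 1" for i
        using q sgi_sq[of "snd i"] by (simp add: Q4)
    qed (use q \<delta> c2 two in \<open>auto simp: Q4 sgi_sq\<close>)
  qed
  show "nichols_dim br W U = \<infinity>" if q: "q \<noteq> - 1"
  proof (rule D.nichols_dim_infinite)
    fix m
    show "\<exists>w. length w \<ge> m \<and> bas w \<notin> D.nich"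
    proof (cases "q ^ 3 = 1 \<and> q \<noteq> 1")
      case False
      then show ?thesis
        using q by (intro D.rank2_infinite[of "(I1, I1)" "(I1, I2)" q 1 K] char0)
          (auto simp: root power2_eq_square square_eq_1_iff Q4)
    next
      case True
      \<comment> \<open>For a primitive cube root of unity the pair \<open>vA I1\<close>,
        \<open>vA I2\<close> is of type A_2 and gives no obstruction; the pair with edge - q^2
        does.\<close>
      have "- (q ^ 2) \<noteq> 1"
      proof
        assume "- (q ^ 2) = 1"
        then have "q ^ 2 = - 1" by (metis minus_minus)
        then have "q ^ 3 = - q" by (simp add: power3_eq_cube flip: power2_eq_square)
        then show False using True q by (metis minus_minus)
      qed
      moreover have "- (q ^ 3) \<noteq> 1" using True two by (metis add_eq_0_iff2 one_add_one)
      ultimately show ?thesis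
        using \<delta> by (intro D.rank2_infinite[of "(I1, I1)" "(I2, \<delta>)" q "- 1" K] char0)
          (auto simp: root power2_eq_square[of q] Q4 mult.assoc sgi_sq)
    qed
  qed
qed

end

end

lemma V_gen_Vg:
  assumes "\<omega> \<noteq> 0"
  shows "V_gen N n \<mu> \<omega> j k = Vg (mu_bar n \<mu> \<omega> * \<omega> ^ (8 * k * n)) (\<omega> ^ (2 * j * N))"
proof -
  have "2 * (4 * int k * int n - int j * int N) = int (8 * k * n) - int (2 * j * N)" by simp
  then have "\<omega> powi (2 * (4 * int k * int n - int j * int N)) = \<omega> ^ (8 * k * n) / \<omega> ^ (2 * j * N)"
    using assms by (simp only: power_int_diff power_int_of_nat simp_thms)
  then show ?thesis by (intro ext) (simp add: V_gen_def Vg_def split: prod.split ind.split)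
qed

context suzuki_vector
begin

lemma K_vec_w:
  assumes V: "V_gen N n \<mu>' \<omega> j k = Vg \<beta> c" and p: "\<epsilon> = (- 1) ^ p"
  shows "K_vec N n \<mu>' \<omega> j k p s (Suc 0) = w1" "K_vec N n \<mu>' \<omega> j k p s 2 = w2"
    "K_vec N n \<mu>' \<omega> j k p s 3 = w3" "K_vec N n \<mu>' \<omega> j k p s 4 = w4"
proof -
  have "K_vec N n \<mu>' \<omega> j k p s r = ac (if even r then chi12 (r - 1) else chi21 (r - 1)) w1" for r
    by (simp add: K_vec_def V box_mult_eq_act w1_def HH_def A_def B_def power_mult flip: p)
  note r = this
  have alt: "alt_prod x y 2 = x * y" "alt_prod x y 3 = x * (y * x)" for x y :: "'k free_alg"
    by (simp_all add: eval_nat_numeral)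
  show "K_vec N n \<mu>' \<omega> j k p s (Suc 0) = w1" "K_vec N n \<mu>' \<omega> j k p s 2 = w2"
    "K_vec N n \<mu>' \<omega> j k p s 3 = w3" "K_vec N n \<mu>' \<omega> j k p s 4 = w4"
    by (simp_all add: r alt act_1 act_mult w2_def w3_def w4_def)
qed

lemma q_root: "q ^ (2 * N) = 1"
proof -
  have "q ^ (2 * N) = (\<epsilon> ^ 2) ^ N * (\<beta> ^ (2 * N)) ^ s"
    by (simp add: q_def power_mult_distrib power_mult[symmetric] mult.commute)
  then show ?thesis by (simp only: \<beta>_2N) (simp add: power2_eq_square eps)
qed

end

theorem lemma4p23:
  fixes \<mu> lam \<omega> q :: "'k :: {alg_closed_field, field_char_0}"
    and N n j k s p :: nat
  assumes "N \<ge> 1" and "n \<ge> 1"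
    and "\<mu> \<in> {1, - 1}" and "lam \<in> {1, - 1}"
    and "primitive_root_of_one (8 * n * N) \<omega>"
    and "lam = 1 \<Longrightarrow> j \<in> {2, 4}" and "lam = - 1 \<Longrightarrow> j \<in> {1, 3}"
    and "p \<in> {0, 1}" and "1 \<le> s" and "s \<le> N" and "0 \<le> k" and "k \<le> N - 1"
    and "q = (- 1) ^ p * mu_bar n \<mu> \<omega> ^ s * \<omega> ^ (8 * k * n * s)"
  defines "c \<equiv> K_braiding N n \<mu> \<omega> j k"
    and "K \<equiv> K_space N n \<mu> \<omega> j k p s"
    and "U \<equiv> K_null N n \<mu> lam"
  shows "(n = 1 \<longrightarrow>
            (nichols_dim c K U < \<infinity> \<longleftrightarrow>
               (lam * q ^ 2 = 1 \<and> q \<noteq> 1) \<or> (lam * q ^ 3 = 1 \<and> q \<noteq> 1)) \<and>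
            (lam * q ^ 2 = 1 \<and> q \<noteq> 1 \<longrightarrow> cartan_type_A1xA1 c K U) \<and>
            (lam * q ^ 3 = 1 \<and> q \<noteq> 1 \<longrightarrow> cartan_type_A2 c K U)) \<and>
         (n = 2 \<longrightarrow>
            (nichols_dim c K U < \<infinity> \<longrightarrow> q = - 1 \<or> (q ^ 3 = 1 \<and> q \<noteq> 1)) \<and>
            (lam = 1 \<longrightarrow>
               (q = - 1 \<longrightarrow> nichols_dim c K U = 64) \<and>
               (q \<noteq> - 1 \<longrightarrow> nichols_dim c K U = \<infinity>)))"
proof -
  let ?\<beta> = "mu_bar n \<mu> \<omega> * \<omega> ^ (8 * k * n)" and ?c = "\<omega> ^ (2 * j * N)"
  have \<omega>: "\<omega> ^ (8 * n * N) = 1" and prim: "\<And>i. 0 < i \<Longrightarrow> i < 8 * n * N \<Longrightarrow> \<omega> ^ i \<noteq> 1"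
    using assms(5) by (auto simp: primitive_root_of_one_def)
  have "\<omega> \<noteq> 0" using \<omega> assms(1,2) by (auto simp: power_0_left)
  then have V: "V_gen N n \<mu> \<omega> j k = Vg ?\<beta> ?c" by (rule V_gen_Vg)
  have "(\<omega> ^ (4 * n * N)) ^ 2 = 1" using \<omega> by (simp add: mult_ac flip: power_mult)
  then have half: "\<omega> ^ (4 * n * N) = - 1"
    using prim[of "4 * n * N"] assms(1,2) by (auto simp: power2_eq_1_iff)
  interpret X: suzuki_vector N n \<mu> lam ?\<beta> ?c s "(- 1) ^ p"
  proof unfold_locales
    \<comment> \<open>This is (-1)^j, so the parity required of j is exactly what produces
      \<lambda>.\<close>
    have "?c ^ (2 * n) = (\<omega> ^ (4 * n * N)) ^ j" by (simp add: mult_ac flip: power_mult)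
    then show "?c ^ (2 * n) = lam" unfolding half using assms(4,6,7) by auto
    have "(\<omega> ^ (8 * k * n)) ^ N = (\<omega> ^ (8 * n * N)) ^ k" by (simp add: mult_ac flip: power_mult)
    then have "?\<beta> ^ N = mu_bar n \<mu> \<omega> ^ N" by (simp add: power_mult_distrib \<omega>)
    also have "\<dots> = \<mu>" using half assms(3) by (auto simp: mu_bar_def simp flip: power_mult)
    finally show "?\<beta> ^ N = \<mu>" .
    show "(- 1 :: 'k) ^ p * (- 1) ^ p = 1" by (simp flip: power_mult_distrib)
  qed (use assms in auto)
  have q: "q = X.q" unfolding X.q_def assms(13) by (simp add: power_mult_distrib power_mult mult.assoc)
  have c: "c = X.br" unfolding c_def V ..
  have char0: "of_nat (Suc i) \<noteq> (0 :: 'k)" for i by (rule of_nat_neq_0)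
  have K0: "2 * N > 0" using assms(1) by simp
  note w = X.K_vec_w[OF V refl]
  show ?thesis
  proof (intro conjI impI)
    assume n1: "n = 1"
    have K: "K = fv.span {X.w1, X.w2}"
    proof -
      have "{1..2 * n} = {Suc 0, 2}" using n1 by auto
      then show ?thesis unfolding K_def K_space_def by (simp add: w)
    qed
    note D = X.dim_n1[OF char0 X.q_root K0 n1 K, folded q c U_def]
    show "nichols_dim c K U < \<infinity> \<longleftrightarrow> lam * q ^ 2 = 1 \<and> q \<noteq> 1 \<or> lam * q ^ 3 = 1 \<and> q \<noteq> 1"
      by (rule D(1))
    show "cartan_type_A1xA1 c K U" if "lam * q ^ 2 = 1 \<and> q \<noteq> 1" using D(2) that by blast
    show "cartan_type_A2 c K U" if "lam * q ^ 3 = 1 \<and> q \<noteq> 1" using D(3) that by blast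
  next
    assume n2: "n = 2"
    have K: "K = fv.span {X.w1, X.w2, X.w3, X.w4}"
    proof -
      have "{1..2 * n} = {Suc 0, 2, 3, 4}" using n2 by auto
      then show ?thesis unfolding K_def K_space_def by (simp add: w)
    qed
    interpret Y: suzuki_vector2 N n \<mu> lam ?\<beta> ?c s "(- 1) ^ p" "\<omega> ^ (4 * N)"
    proof unfold_locales
      show "\<omega> ^ (4 * N) * \<omega> ^ (4 * N) = - 1" using half by (simp add: n2 flip: power_add)
    qed (use n2 in simp_all)
    show "q = - 1 \<or> (q ^ 3 = 1 \<and> q \<noteq> 1)" if "nichols_dim c K U < \<infinity>"
      using Y.dim_n2[OF char0 X.q_root K0 K, folded q c U_def] that by blast
    note D = Y.dim_n2_lam1[OF char0 X.q_root K0 K, folded q c U_def]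
    show "nichols_dim c K U = 64" if "lam = 1" "q = - 1" using D(1) that by blast
    show "nichols_dim c K U = \<infinity>" if "lam = 1" "q \<noteq> - 1" using D(2) that by blast
  qed
qed

end
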